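(* For $\vec\alpha=(\alpha_1,\dots,\alpha_n)\in I_{k,n}$ write $$W(R,\vec\alpha)(w)=(-w)^{\frac{\alpha_1+1}{k}-1}\prod_{t=2}^n(w-r_t)^{-\alpha_t/k}.$$ Then the period lattice $\Lambda\subset\mathbb{C}^{I_{k,n}}$ of $C_{k,n}$ (with respect to the basis $\{\theta_{\vec\alpha}\}_{\vec\alpha\in I_{k,n}}$ of holomorphic $1$-forms) is generated by the period vectors $$\left(\zeta_k^{\sum_{d=1}^n g_dM_d}\,\frac{(1-\zeta_k^{M_j})(1-\zeta_k^{M_l})}{k}\int_{r_j}^{r_l}W(R,\vec\alpha)\,dw\right)_{\vec\alpha\in I_{k,n}},$$ one for each generator $\rho[\phi_j,\phi_l]\rho^{-1}$ of $H_1(C_{k,n},\mathbb{Z})$ with $\rho=\prod_{d=1}^n\phi_d^{g_d}$, $1\le j<l\le n$ and $0\le g_d\le k-1$ for $1\le d\le n$. Here $M_1=\alpha_1+1$ and $M_i=-\alpha_i$ for $2\le i\le n$ (so the $M_i$ depend on $\vec\alpha$).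
   Context: Let $k,n\ge 2$ be integers, $\zeta_k=e^{2\pi i/k}$, and let $\lambda_1,\dots,\lambda_{n-2}\in\mathbb{C}\setminus\{0,1\}$ be pairwise distinct. Put $r_1=0$, $r_2=1$, $r_i=\lambda_{i-2}$ for $3\le i\le n$, and $R=\{r_1,\dots,r_n\}$. The generalized Fermat curve $C_{k,n}\subset\mathbb{P}^n\mathbb{C}$ is the smooth projective curve (compact Riemann surface) defined by the $n-1$ equations $r_i x_0^k+x_1^k+x_i^k=0$, $2\le i\le n$. Let $\pi:C_{k,n}\to\hat{\mathbb{C}}$, $\pi([x_0,\dots,x_n])=-(x_1/x_0)^k$; its branch points are $R\cup\{\infty\}$. Put $C_{k,n}'=C_{k,n}\setminus\pi^{-1}(R\cup\{\infty\})$. Forms. Let $y_j=x_j/x_0$ on $C_{k,n}$, and let $I_{k,n}$ be the set of $(\alpha_1,\dots,\alpha_n)\in\mathbb{Z}^n$ with $0\le\alpha_2,\dots,\alpha_n\le k-1$ and $0\le\alpha_1\le\sum_{i=2}^n\alpha_i-2$. For $\vec\alpha\in I_{k,n}$ let $\theta_{\vec\alpha}=\dfrac{y_1^{\alpha_1}dy_1}{y_2^{\alpha_2}\cdots y_n^{\alpha_n}}$. It is known that these forms are holomorphic on $C_{k,n}$ and form a basis of the space of holomorphic $1$-forms. The period lattice is $\Lambda=\{(\int_\gamma\theta_{\vec\alpha})_{\vec\alpha\in I_{k,n}}:\gamma\in H_1(C_{k,n},\mathbb{Z})\}$. Coverings. Let $p:U\to\mathbb{C}\setminus R$ be a holomorphic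 universal covering with group of covering transformations $\mathrm{Deck}(p)$; put $p_1=-p$, $p_i=p-r_i$ ($2\le i\le n$), fix holomorphic logarithms $\log p_i$ on $U$, and let $\hat{x}_i=\exp(\frac1k\log p_i)$. The map $q:U\to C_{k,n}'$, $q(u)=[1,\hat{x}_1(u),\dots,\hat{x}_n(u)]$, is a universal covering with $\mathrm{Deck}(q)\le\mathrm{Deck}(p)$. Fix $u\in U$ and $z_0=p(u)$. For $\phi\in\mathrm{Deck}(q)$ the associated class in $H_1(C_{k,n},\mathbb{Z})$ is that of the image under $q$ of a path in $U$ from $u$ to $\phi(u)$. Generators and integrals. $\mathrm{Deck}(p)\cong\pi_1(\mathbb{C}\setminus R,z_0)$ is free of rank $n$; $\phi_1,\dots,\phi_n$ are free generators such that a path from $u$ to $\phi_i(u)$ projects under $p$ to a loop $\gamma_i$ of the following form: $\beta_i$ is a piecewise smooth path from $z_0$ to $r_i$, lying in $\mathbb{C}\setminus R$ except for its endpoint and being a straight segment near $r_i$; $\gamma_i$ follows $\beta_i$ up to a small circle centred at $r_i$, traverses this circle once counterclockwise, and returns along $\beta_i$. The integral $\int_{z_0}^{r_i}W(R,\vec\alpha)\,dw$ is the (convergent improper) integral along $\beta_i$, where the branch is determined by $u$: along $\beta_i$, lifted to $U$ starting at $u$, $(-w)^{1/k}$ is read as $\hat{x}_1$ and $(w-r_t)^{1/k}$ as $\hat{x}_t$, i.e. $W(R,\vec\alpha)=\hat{x}_1^{\alpha_1+1-k}\prod_{t=2}^n\hat{x}_t^{-\alpha_t}$. Then $\int_{r_j}^{r_l}W\,dw:=\int_{z_0}^{r_l}W\,dw-\int_{z_0}^{r_j}W\,dw$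 (the integral from $r_j$ to $r_l$ through $z_0$). Products $\prod_{d=1}^n\phi_d^{g_d}$ are in the order $d=1,\dots,n$, and $[a,b]=aba^{-1}b^{-1}$. *)

theory Defs
  imports "HOL-Complex_Analysis.Complex_Analysis" "HOL-Homology.Homology" "HOL-Algebra.Bij"
begin

section \<open>Complex projective space and generalized Fermat curves\<close>

text \<open>Coordinate vectors \<open>(x 0, \<dots>, x n)\<close> are functions that are \<^const>\<open>undefined\<close> outside \<open>{0..n}\<close>.\<close>

definition coord_space :: "nat \<Rightarrow> (nat \<Rightarrow> complex) topology" where
  "coord_space n =
     subtopology (product_topology (\<lambda>_. euclidean) {0..n}) {x. \<exists>i\<in>{0..n}. x i \<noteq> 0}"

text \<open>The point \<open>[v 0, \<dots>, v n]\<close>, as the set of its coordinate vectors; only the values of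
  \<open>v\<close> on \<open>{0..n}\<close> matter.\<close>

definition proj_point :: "nat \<Rightarrow> (nat \<Rightarrow> complex) \<Rightarrow> (nat \<Rightarrow> complex) set" where
  "proj_point n v =
     {w \<in> {0..n} \<rightarrow>\<^sub>E UNIV. \<exists>t. t \<noteq> 0 \<and> (\<forall>i\<in>{0..n}. w i = t * v i)}"

definition proj_space :: "nat \<Rightarrow> (nat \<Rightarrow> complex) set topology" where
  "proj_space n = topology (\<lambda>W. W \<subseteq> proj_point n ` topspace (coord_space n) \<and>
      openin (coord_space n) {x \<in> topspace (coord_space n). proj_point n x \<in> W})"

lemma openin_proj_space:
  "openin (proj_space n) W \<longleftrightarrow>
     W \<subseteq> proj_point n ` topspace (coord_space n) \<and>
     openin (coord_space n) {x \<in> topspace (coord_space n). proj_point n x \<in> W}"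
proof -
  let ?X = "coord_space n" and ?f = "proj_point n"
  let ?L = "\<lambda>W. W \<subseteq> ?f ` topspace ?X \<and> openin ?X {x \<in> topspace ?X. ?f x \<in> W}"
  have "istopology ?L"
    unfolding istopology_def
  proof (intro conjI allI impI)
    fix S T assume S: "?L S" and T: "?L T"
    show "S \<inter> T \<subseteq> ?f ` topspace ?X" using S by blast
    have "{x \<in> topspace ?X. ?f x \<in> S \<inter> T} =
        {x \<in> topspace ?X. ?f x \<in> S} \<inter> {x \<in> topspace ?X. ?f x \<in> T}" by blast
    then show "openin ?X {x \<in> topspace ?X. ?f x \<in> S \<inter> T}" using S T by auto
  next
    fix \<K> assume K: "\<forall>K\<in>\<K>. ?L K"
    then show "\<Union> \<K> \<subseteq> ?f ` topspace ?X" by blast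
    have "{x \<in> topspace ?X. ?f x \<in> \<Union> \<K>} = (\<Union>K\<in>\<K>. {x \<in> topspace ?X. ?f x \<in> K})" by blast
    then show "openin ?X {x \<in> topspace ?X. ?f x \<in> \<Union> \<K>}" using K by auto
  qed
  then show ?thesis by (simp add: proj_space_def)
qed

lemma topspace_proj_space: "topspace (proj_space n) = proj_point n ` topspace (coord_space n)"
proof -
  have "openin (proj_space n) (proj_point n ` topspace (coord_space n))"
    unfolding openin_proj_space
    by (smt (verit, best) Collect_cong Collect_mem_eq image_eqI openin_topspace subset_refl)
  then show ?thesis
    by (metis openin_proj_space openin_subset openin_topspace subset_antisym)
qed

lemma quotient_map_proj_point: "quotient_map (coord_space n) (proj_space n) (proj_point n)"
  by (auto simp: quotient_map_def topspace_proj_space openin_proj_space)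

definition branch_pt :: "(nat \<Rightarrow> complex) \<Rightarrow> nat \<Rightarrow> complex" where
  "branch_pt lam i = (if i = 1 then 0 else if i = 2 then 1 else lam (i - 2))"

definition fermat_curve :: "nat \<Rightarrow> nat \<Rightarrow> (nat \<Rightarrow> complex) \<Rightarrow> (nat \<Rightarrow> complex) set topology" where
  "fermat_curve k n r = subtopology (proj_space n)
     {proj_point n x | x. x \<in> topspace (coord_space n) \<and>
        (\<forall>i\<in>{2..n}. r i * x 0 ^ k + x 1 ^ k + x i ^ k = 0)}"


section \<open>Holomorphic 1-forms and their integrals\<close>

text \<open>A local holomorphic parametrization of a smooth curve \<open>X\<close> in projective space, given by
  holomorphic homogeneous coordinates \<open>h 0, \<dots>, h n\<close>.  An injective holomorphic map between
  Riemann surfaces is biholomorphic onto its open image, so these are exactly the inverses of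
  holomorphic charts of \<open>X\<close>.\<close>

definition local_param ::
    "nat \<Rightarrow> (nat \<Rightarrow> complex) set topology \<Rightarrow> complex set \<Rightarrow> (nat \<Rightarrow> complex \<Rightarrow> complex) \<Rightarrow> bool" where
  "local_param n X D h \<longleftrightarrow>
     open D \<and> (\<forall>i\<in>{0..n}. h i holomorphic_on D) \<and>
     (\<forall>s\<in>D. \<exists>i\<in>{0..n}. h i s \<noteq> 0) \<and>
     (\<forall>s\<in>D. proj_point n (\<lambda>i. h i s) \<in> topspace X) \<and>
     inj_on (\<lambda>s. proj_point n (\<lambda>i. h i s)) D"

text \<open>A 1-form is represented by the map that sends a parametrization \<open>h\<close> to the coefficient
  \<open>f\<close> of its pullback \<open>f(s) ds\<close>.\<close>

type_synonym one_form = "(nat \<Rightarrow> complex \<Rightarrow> complex) \<Rightarrow> complex \<Rightarrow> complex"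

definition form_index :: "nat \<Rightarrow> nat \<Rightarrow> (nat \<Rightarrow> int) set" where
  "form_index k n = {\<alpha> \<in> {1..n} \<rightarrow>\<^sub>E UNIV.
     (\<forall>i\<in>{2..n}. 0 \<le> \<alpha> i \<and> \<alpha> i \<le> int k - 1) \<and> 0 \<le> \<alpha> 1 \<and> \<alpha> 1 \<le> (\<Sum>i=2..n. \<alpha> i) - 2}"

text \<open>The form \<open>y\<^sub>1\<^sup>\<alpha>\<^sup>1 dy\<^sub>1 / (y\<^sub>2\<^sup>\<alpha>\<^sup>2 \<cdots> y\<^sub>n\<^sup>\<alpha>\<^sup>n)\<close> with \<open>y\<^sub>j = x\<^sub>j / x\<^sub>0\<close>.  The expression is
  evaluated where no coordinate vanishes; \<^const>\<open>remove_sings\<close> yields the coefficient of the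
  holomorphic extension at the remaining (isolated) points.\<close>

definition theta :: "nat \<Rightarrow> (nat \<Rightarrow> int) \<Rightarrow> one_form" where
  "theta n \<alpha> h = remove_sings (\<lambda>s.
     (h 1 s / h 0 s) powi \<alpha> 1 * deriv (\<lambda>z. h 1 z / h 0 z) s /
     (\<Prod>j=2..n. (h j s / h 0 s) powi \<alpha> j))"

text \<open>The integral of a holomorphic form along a continuous path: on a piece \<open>\<gamma>\<close> restricted to
  \<open>{a..b}\<close> that lies in the image of a parametrization, it is the increment of a primitive of the
  pulled-back form; in general one subdivides.\<close>

definition has_local_integral ::
    "nat \<Rightarrow> (nat \<Rightarrow> complex) set topology \<Rightarrow> one_form \<Rightarrow> (real \<Rightarrow> (nat \<Rightarrow> complex) set)
      \<Rightarrow> real \<Rightarrow> real \<Rightarrow> complex \<Rightarrow> bool" where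
  "has_local_integral n X \<omega> \<gamma> a b I \<longleftrightarrow>
     (\<exists>D h c F. local_param n X D h \<and>
        continuous_on {a..b} c \<and> c ` {a..b} \<subseteq> D \<and>
        (\<forall>t\<in>{a..b}. \<gamma> t = proj_point n (\<lambda>i. h i (c t))) \<and>
        (\<forall>s\<in>D. (F has_field_derivative \<omega> h s) (at s)) \<and>
        I = F (c b) - F (c a))"

definition has_path_integral ::
    "nat \<Rightarrow> (nat \<Rightarrow> complex) set topology \<Rightarrow> one_form \<Rightarrow> (real \<Rightarrow> (nat \<Rightarrow> complex) set)
      \<Rightarrow> complex \<Rightarrow> bool" where
  "has_path_integral n X \<omega> \<gamma> I \<longleftrightarrow>
     (\<exists>m T J. T 0 = 0 \<and> T m = 1 \<and>
        (\<forall>i<m. T i < T (Suc i) \<and> has_local_integral n X \<omega> \<gamma> (T i) (T (Suc i)) (J i)) \<and>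
        I = (\<Sum>i<m. J i))"

definition path_integral ::
    "nat \<Rightarrow> (nat \<Rightarrow> complex) set topology \<Rightarrow> one_form \<Rightarrow> (real \<Rightarrow> (nat \<Rightarrow> complex) set)
      \<Rightarrow> complex" where
  "path_integral n X \<omega> \<gamma> = (THE I. has_path_integral n X \<omega> \<gamma> I)"


section \<open>First homology and periods\<close>

text \<open>A singular 1-simplex lives on \<^term>\<open>standard_simplex 1\<close>, with vertices \<open>e\<^sub>0\<close>, \<open>e\<^sub>1\<close> and
  boundary \<open>\<sigma> e\<^sub>1 - \<sigma> e\<^sub>0\<close>; it is read as the path from \<open>\<sigma> e\<^sub>0\<close> to \<open>\<sigma> e\<^sub>1\<close>.\<close>

definition path_of_simplex :: "((nat \<Rightarrow> real) \<Rightarrow> 'a) \<Rightarrow> real \<Rightarrow> 'a" where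
  "path_of_simplex \<sigma> t = \<sigma> (\<lambda>i. if i = 0 then 1 - t else if i = 1 then t else 0)"

definition simplex_of_path :: "(real \<Rightarrow> 'a) \<Rightarrow> (nat \<Rightarrow> real) \<Rightarrow> 'a" where
  "simplex_of_path \<gamma> = restrict (\<lambda>x. \<gamma> (x 1)) (standard_simplex 1)"

definition chain_integral ::
    "nat \<Rightarrow> (nat \<Rightarrow> complex) set topology \<Rightarrow> one_form \<Rightarrow> (nat \<Rightarrow> complex) set chain \<Rightarrow> complex" where
  "chain_integral n X \<omega> c = (\<Sum>\<sigma>\<in>Poly_Mapping.keys c.
     of_int (Poly_Mapping.lookup c \<sigma>) * path_integral n X \<omega> (path_of_simplex \<sigma>))"

text \<open>Elements of \<^term>\<open>homology_group 1 X\<close> are sets of homologous 1-cycles.\<close>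

definition class_integral ::
    "nat \<Rightarrow> (nat \<Rightarrow> complex) set topology \<Rightarrow> one_form \<Rightarrow> (nat \<Rightarrow> complex) set chain set \<Rightarrow> complex" where
  "class_integral n X \<omega> \<Gamma> = (THE I. \<forall>c\<in>\<Gamma>. chain_integral n X \<omega> c = I)"

definition period_vector ::
    "nat \<Rightarrow> nat \<Rightarrow> (nat \<Rightarrow> complex) set topology \<Rightarrow> (nat \<Rightarrow> complex) set chain set
      \<Rightarrow> (nat \<Rightarrow> int) \<Rightarrow> complex" where
  "period_vector k n X \<Gamma> = (\<lambda>\<alpha>\<in>form_index k n. class_integral n X (theta n \<alpha>) \<Gamma>)"

definition period_lattice ::
    "nat \<Rightarrow> nat \<Rightarrow> (nat \<Rightarrow> complex) set topology \<Rightarrow> ((nat \<Rightarrow> int) \<Rightarrow> complex) set" where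
  "period_lattice k n X = period_vector k n X ` carrier (homology_group 1 X)"

definition complex_add_group :: "complex monoid" where
  "complex_add_group = \<lparr>carrier = UNIV, monoid.mult = (+), one = 0\<rparr>"

definition period_space :: "nat \<Rightarrow> nat \<Rightarrow> ((nat \<Rightarrow> int) \<Rightarrow> complex) monoid" where
  "period_space k n = product_group (form_index k n) (\<lambda>_. complex_add_group)"


section \<open>Universal coverings and covering transformations\<close>

text \<open>The complex structure of the covering surface is the one for which \<open>p\<close> is locally
  biholomorphic, so it is determined by the topological covering, and a continuous logarithm on
  \<open>U\<close> of a function of the form \<open>p - r\<close> is automatically holomorphic.  Taking \<open>U\<close> inside a real
  normed space is no restriction, as every Riemann surface embeds in one.\<close>

definition universal_covering ::
    "'u::real_normed_vector set \<Rightarrow> ('u \<Rightarrow> complex) \<Rightarrow> complex set \<Rightarrow> bool" where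
  "universal_covering U p S \<longleftrightarrow> covering_space U p S \<and> simply_connected U"

definition deck_group :: "'u::topological_space set \<Rightarrow> ('u \<Rightarrow> 'b) \<Rightarrow> ('u \<Rightarrow> 'u) monoid" where
  "deck_group U f = (BijGroup U)
     \<lparr>carrier := {\<phi> \<in> Bij U. (\<exists>\<psi>. homeomorphism U U \<phi> \<psi>) \<and> (\<forall>v\<in>U. f (\<phi> v) = f v)}\<rparr>"

text \<open>A word is a list of letters \<open>(i, e)\<close>, standing for \<open>\<phi> i\<close> if \<open>e\<close> holds and for its
  inverse otherwise.\<close>

definition word_value ::
    "('g, 'm) monoid_scheme \<Rightarrow> ('i \<Rightarrow> 'g) \<Rightarrow> ('i \<times> bool) list \<Rightarrow> 'g" where
  "word_value G \<phi> w = foldr (\<lambda>(i, e) x.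
     (if e then \<phi> i else inv\<^bsub>G\<^esub> (\<phi> i)) \<otimes>\<^bsub>G\<^esub> x) w \<one>\<^bsub>G\<^esub>"

definition reduced_word :: "('i \<times> bool) list \<Rightarrow> bool" where
  "reduced_word w \<longleftrightarrow> successively (\<lambda>a b. \<not> (fst a = fst b \<and> snd a \<noteq> snd b)) w"

definition free_generators ::
    "('g, 'm) monoid_scheme \<Rightarrow> 'i set \<Rightarrow> ('i \<Rightarrow> 'g) \<Rightarrow> bool" where
  "free_generators G A \<phi> \<longleftrightarrow>
     \<phi> ` A \<subseteq> carrier G \<and> generate G (\<phi> ` A) = carrier G \<and>
     (\<forall>w. w \<noteq> [] \<longrightarrow> fst ` set w \<subseteq> A \<longrightarrow> reduced_word w \<longrightarrow> word_value G \<phi> w \<noteq> \<one>\<^bsub>G\<^esub>)"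

text \<open>\<open>\<rho> [\<phi>\<^sub>j, \<phi>\<^sub>l] \<rho>\<^sup>-\<^sup>1\<close> with \<open>\<rho> = \<phi>\<^sub>1\<^bsup>g 1\<^esup> \<cdots> \<phi>\<^sub>n\<^bsup>g n\<^esup>\<close> and \<open>[a, b] = a b a\<^sup>-\<^sup>1 b\<^sup>-\<^sup>1\<close>.\<close>

definition ordered_power_product ::
    "('g, 'm) monoid_scheme \<Rightarrow> nat \<Rightarrow> (nat \<Rightarrow> 'g) \<Rightarrow> (nat \<Rightarrow> nat) \<Rightarrow> 'g" where
  "ordered_power_product G n \<phi> g =
     foldr (\<lambda>d x. (\<phi> d [^]\<^bsub>G\<^esub> g d) \<otimes>\<^bsub>G\<^esub> x) [1..<Suc n] \<one>\<^bsub>G\<^esub>"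

definition conj_commutator ::
    "('g, 'm) monoid_scheme \<Rightarrow> nat \<Rightarrow> (nat \<Rightarrow> 'g) \<Rightarrow> nat \<times> nat \<times> (nat \<Rightarrow> nat) \<Rightarrow> 'g" where
  "conj_commutator G n \<phi> = (\<lambda>(j, l, g).
     ordered_power_product G n \<phi> g
       \<otimes>\<^bsub>G\<^esub> (\<phi> j \<otimes>\<^bsub>G\<^esub> \<phi> l \<otimes>\<^bsub>G\<^esub> inv\<^bsub>G\<^esub> (\<phi> j) \<otimes>\<^bsub>G\<^esub> inv\<^bsub>G\<^esub> (\<phi> l))
       \<otimes>\<^bsub>G\<^esub> inv\<^bsub>G\<^esub> (ordered_power_product G n \<phi> g))"

definition gen_index :: "nat \<Rightarrow> nat \<Rightarrow> (nat \<times> nat \<times> (nat \<Rightarrow> nat)) set" where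
  "gen_index k n =
     {(j, l, g). 1 \<le> j \<and> j < l \<and> l \<le> n \<and> (\<forall>d\<in>{1..n}. g d \<le> k - 1)}"

text \<open>\<open>p\<^sub>1 = -p\<close> and \<open>p\<^sub>i = p - r\<^sub>i\<close> for \<open>i \<ge> 2\<close>.\<close>

definition shifted :: "(nat \<Rightarrow> complex) \<Rightarrow> ('u \<Rightarrow> complex) \<Rightarrow> nat \<Rightarrow> 'u \<Rightarrow> complex" where
  "shifted r p i v = (if i = 1 then - p v else p v - r i)"

definition root_coord :: "nat \<Rightarrow> (nat \<Rightarrow> 'u \<Rightarrow> complex) \<Rightarrow> nat \<Rightarrow> 'u \<Rightarrow> complex" where
  "root_coord k L i v = exp (L i v / of_nat k)"

definition curve_map ::
    "nat \<Rightarrow> nat \<Rightarrow> (nat \<Rightarrow> 'u \<Rightarrow> complex) \<Rightarrow> 'u \<Rightarrow> (nat \<Rightarrow> complex) set" where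
  "curve_map k n L v = proj_point n (\<lambda>i. if i = 0 then 1 else root_coord k L i v)"

text \<open>Since \<open>U\<close> is simply connected, the class does not depend on the path chosen here.\<close>

definition deck_class ::
    "'a topology \<Rightarrow> 'u::real_normed_vector set \<Rightarrow> ('u \<Rightarrow> 'a) \<Rightarrow> 'u \<Rightarrow> ('u \<Rightarrow> 'u) \<Rightarrow> 'a chain set" where
  "deck_class X U q u \<phi> = homologous_rel_set 1 X {} (frag_of (simplex_of_path (q \<circ>
     (SOME c. path c \<and> path_image c \<subseteq> U \<and> pathstart c = u \<and> pathfinish c = \<phi> u))))"


section \<open>Loops around the branch points and the integrals of \<open>W\<close>\<close>

definition branch_arc :: "complex set \<Rightarrow> complex \<Rightarrow> complex \<Rightarrow> (real \<Rightarrow> complex) \<Rightarrow> bool" where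
  "branch_arc R z a \<beta> \<longleftrightarrow> valid_path \<beta> \<and> pathstart \<beta> = z \<and> pathfinish \<beta> = a \<and>
     (\<forall>t\<in>{0..<1}. \<beta> t \<notin> R)"

text \<open>From parameter \<open>\<tau>\<close> on, \<open>\<beta>\<close> runs along a segment without turning back; the
  parametrization need not be affine.\<close>

definition straight_from :: "real \<Rightarrow> (real \<Rightarrow> complex) \<Rightarrow> bool" where
  "straight_from \<tau> \<beta> \<longleftrightarrow> 0 \<le> \<tau> \<and> \<tau> < 1 \<and> inj_on \<beta> {\<tau>..1} \<and>
     \<beta> ` {\<tau>..1} = closed_segment (\<beta> \<tau>) (\<beta> 1)"

definition branch_loop :: "(real \<Rightarrow> complex) \<Rightarrow> real \<Rightarrow> real \<Rightarrow> complex" where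
  "branch_loop \<beta> \<sigma> = subpath 0 \<sigma> \<beta> +++
     (\<lambda>t. \<beta> 1 + (\<beta> \<sigma> - \<beta> 1) * cis (2 * pi * t)) +++ reversepath (subpath 0 \<sigma> \<beta>)"

text \<open>A path from \<open>u\<close> to \<open>\<phi> u\<close> projects to the loop that follows \<open>\<beta>\<close> up to a small circle
  about its endpoint, turns once counterclockwise, and returns.\<close>

definition deck_of_arc ::
    "complex set \<Rightarrow> 'u::real_normed_vector set \<Rightarrow> ('u \<Rightarrow> complex) \<Rightarrow> 'u \<Rightarrow> (real \<Rightarrow> complex)
      \<Rightarrow> ('u \<Rightarrow> 'u) \<Rightarrow> bool" where
  "deck_of_arc R U p u \<beta> \<phi> \<longleftrightarrow>
     (\<exists>\<tau> \<sigma> c. straight_from \<tau> \<beta> \<and> \<tau> \<le> \<sigma> \<and> \<sigma> < 1 \<and>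
        cball (\<beta> 1) (dist (\<beta> \<sigma>) (\<beta> 1)) \<inter> R = {\<beta> 1} \<and>
        path c \<and> path_image c \<subseteq> U \<and> pathstart c = u \<and> pathfinish c = \<phi> u \<and>
        (\<forall>t\<in>{0..1}. p (c t) = branch_loop \<beta> \<sigma> t))"

definition arc_lift ::
    "'u::real_normed_vector set \<Rightarrow> ('u \<Rightarrow> complex) \<Rightarrow> 'u \<Rightarrow> (real \<Rightarrow> complex) \<Rightarrow> (real \<Rightarrow> 'u) \<Rightarrow> bool" where
  "arc_lift U p u \<beta> b \<longleftrightarrow> continuous_on {0..<1} b \<and> b ` {0..<1} \<subseteq> U \<and> b 0 = u \<and>
     (\<forall>t\<in>{0..<1}. p (b t) = \<beta> t)"

definition W_fun ::
    "nat \<Rightarrow> nat \<Rightarrow> (nat \<Rightarrow> 'u \<Rightarrow> complex) \<Rightarrow> (nat \<Rightarrow> int) \<Rightarrow> 'u \<Rightarrow> complex" where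
  "W_fun k n L \<alpha> v = root_coord k L 1 v powi (\<alpha> 1 + 1 - int k) *
     (\<Prod>t=2..n. root_coord k L t v powi (- \<alpha> t))"

text \<open>The improper integral of \<open>W\<close> along \<open>\<beta>\<close>, with the branch given by the lift \<open>b\<close> of \<open>\<beta>\<close>.\<close>

definition W_integral ::
    "nat \<Rightarrow> nat \<Rightarrow> (nat \<Rightarrow> 'u \<Rightarrow> complex) \<Rightarrow> (real \<Rightarrow> complex) \<Rightarrow> (real \<Rightarrow> 'u) \<Rightarrow> (nat \<Rightarrow> int)
      \<Rightarrow> complex" where
  "W_integral k n L \<beta> b \<alpha> = Lim (at_left 1) (\<lambda>s.
     integral {0..s} (\<lambda>t. W_fun k n L \<alpha> (b t) * vector_derivative \<beta> (at t)))"

definition zeta_root :: "nat \<Rightarrow> complex" where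
  "zeta_root k = exp (2 * of_real pi * \<i> / of_nat k)"

definition M_exp :: "(nat \<Rightarrow> int) \<Rightarrow> nat \<Rightarrow> int" where
  "M_exp \<alpha> i = (if i = 1 then \<alpha> 1 + 1 else - \<alpha> i)"

text \<open>Here \<open>J i \<alpha>\<close> is the integral of \<open>W\<close> from the base point to \<open>r\<^sub>i\<close>, so that the last factor
  is the integral from \<open>r\<^sub>j\<close> to \<open>r\<^sub>l\<close> through the base point.\<close>

definition explicit_period ::
    "nat \<Rightarrow> nat \<Rightarrow> (nat \<Rightarrow> (nat \<Rightarrow> int) \<Rightarrow> complex) \<Rightarrow> nat \<times> nat \<times> (nat \<Rightarrow> nat)
      \<Rightarrow> (nat \<Rightarrow> int) \<Rightarrow> complex" where
  "explicit_period k n J = (\<lambda>(j, l, g). \<lambda>\<alpha>\<in>form_index k n.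
     zeta_root k powi (\<Sum>d=1..n. int (g d) * M_exp \<alpha> d) *
     ((1 - zeta_root k powi M_exp \<alpha> j) * (1 - zeta_root k powi M_exp \<alpha> l) / of_nat k) *
     (J l \<alpha> - J j \<alpha>))"

end

theory Submission
  imports Defs
begin

text \<open>Let \<open>\<Gamma>\<close> be a primitive on \<open>U\<close> of the pullback of \<open>\<theta>\<close> by \<open>q\<close>; along sections of \<open>p\<close> its
  derivative is \<open>- W / k\<close>. A deck transformation \<open>\<psi>\<close> of \<open>p\<close> multiplies \<open>W\<close> by the root of unity
  \<open>\<omega> \<psi>\<close>, so \<open>\<psi> \<mapsto> \<Gamma> (\<psi> u) - \<Gamma> u\<close> is a crossed homomorphism, whose values on deck transformations of
  \<open>q\<close> are periods. Since \<open>\<phi> i\<close> fixes the limit of \<open>\<Gamma>\<close> at the end of the lifted arc to \<open>r i\<close>, its value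
  on \<open>\<phi> i\<close> is \<open>- (1 - \<omega> (\<phi> i)) / k\<close> times the integral of \<open>W\<close> along that arc; the cocycle rule
  then gives conjugated commutators.

  For the homology, pushing paths off the finitely many ramification points shows that every class of
  the curve comes from a deck transformation of \<open>q\<close>. Those whose conjugates all have class in the
  subgroup \<open>H\<close> generated by the conjugated commutators form a normal subgroup \<open>N\<close> of the deck group
  of \<open>p\<close>. It contains the commutators, and also each \<open>\<phi> i ^ k\<close>, which corresponds to a loop in a disc
  of the curve. Hence an element of \<open>Deck(q)\<close> is, modulo \<open>N\<close>, a product of powers
  \<open>\<phi> d ^ g d\<close> with \<open>0 \<le> g d < k\<close>; its monodromy is divisible by \<open>k\<close>, so all \<open>g d\<close> vanish.\<close>

section \<open>Primitives along maps\<close>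

text \<open>Let y1 be the first affine coordinate and z the value of \<open>p\<close>. The relation
  y1^k = -z gives dy1 = -(1/k) y1^(1-k) dz, the origin of the factor -1/k and of the exponent
  \<alpha> 1 + 1 - k in W. A singular simplex is only continuous and U carries no charts, so
  integrals over chains cannot be computed from a velocity. They are increments of functions that
  locally differ from a chart primitive by a constant (\<open>prim\<close>). Existence of such
  functions on squares yields path integrals, homotopy invariance, vanishing on boundaries and the
  primitive on U. The bound g d < k for the conjugators has this reason: conjugators with equal
  monodromy modulo k differ by an element of Deck(q), and conjugation by that element is invisible
  in the abelian group H_1. On the commutator of \<phi> j and \<phi> l, with \<omega> i short for
  \<omega> (\<phi> i), the cocycle rule gives (1 - \<omega> l) per j - (1 - \<omega> j) per l. Since
  per i itself carries the factor 1 - \<omega> i, the product of both factors splits off and a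
  difference of two arc integrals remains.\<close>

lemma eventually_in_openin:
  assumes "continuous_map (top_of_set Y) X f" "openin X V" "y \<in> Y" "f y \<in> V"
  shows "\<forall>\<^sub>F y' in at y within Y. f y' \<in> V"
proof -
  have "openin (top_of_set Y) {x \<in> Y. f x \<in> V}"
    using openin_continuous_map_preimage[OF assms(1,2)] by simp
  then obtain T where "open T" "{x \<in> Y. f x \<in> V} = Y \<inter> T"
    by (auto simp: openin_open)
  then show ?thesis
    unfolding eventually_at_topological using assms(3,4)
    by (intro exI[of _ T]) blast
qed

text \<open>An axiomatic closed 1-form on \<open>X\<close>: primitives on a cover by open sets, any
  two of them differing by a locally constant function. Paths in singular chains are merely
  continuous, so integration is derived from this datum, which the curve with a fixed form later
  instantiates.\<close>

locale local_primitives =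
  fixes X :: "'a topology" and LP :: "'a set \<Rightarrow> ('a \<Rightarrow> complex) \<Rightarrow> bool"
  assumes LP_open: "LP V F \<Longrightarrow> openin X V"
    and LP_cover: "x \<in> topspace X \<Longrightarrow> \<exists>V F. LP V F \<and> x \<in> V"
    and LP_compat: "LP V F \<Longrightarrow> LP V' F' \<Longrightarrow> x \<in> V \<Longrightarrow> x \<in> V' \<Longrightarrow>
      \<exists>W. openin X W \<and> x \<in> W \<and> (\<forall>y\<in>W. F' y - F y = F' x - F x)"
begin

text \<open>\<open>g\<close> is a primitive of the pullback of the form by \<open>f\<close>; the
  integral along a path \<open>f\<close> is the increment of \<open>g\<close>. The filter is
  relative to \<open>Y\<close>, so that intervals, squares and \<open>U\<close> are treated
  alike.\<close>

definition prim :: "'y::topological_space set \<Rightarrow> ('y \<Rightarrow> 'a) \<Rightarrow> ('y \<Rightarrow> complex) \<Rightarrow> bool" where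
  "prim Y f g \<longleftrightarrow> (\<forall>y\<in>Y. \<exists>V F. LP V F \<and> f y \<in> V \<and>
     (\<forall>\<^sub>F y' in at y within Y. g y' - F (f y') = g y - F (f y)))"

text \<open>The definition gives some local primitive at each point; since two of them differ by a
  constant near \<open>f y\<close>, any other one serves as well.\<close>

lemma prim_any:
  assumes f: "continuous_map (top_of_set Y) X f" and g: "prim Y f g"
    and y: "y \<in> Y" and V: "LP V F" "f y \<in> V"
  shows "\<forall>\<^sub>F y' in at y within Y. g y' - F (f y') = g y - F (f y)"
proof -
  obtain V' F' where V': "LP V' F'" "f y \<in> V'"
    and ev: "\<forall>\<^sub>F y' in at y within Y. g y' - F' (f y') = g y - F' (f y)"
    using g y unfolding prim_def by blast
  obtain W where W: "openin X W" "f y \<in> W" "\<forall>x\<in>W. F' x - F x = F' (f y) - F (f y)"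
    using LP_compat[OF V(1) V'(1) V(2) V'(2)] by blast
  have "\<forall>\<^sub>F y' in at y within Y. f y' \<in> W"
    using eventually_in_openin[OF f W(1) y W(2)] .
  with ev show ?thesis
  proof eventually_elim
    case (elim y')
    have "F' (f y') - F (f y') = F' (f y) - F (f y)" using W(3) elim(2) by blast
    then have "(g y' - F' (f y')) + (F' (f y') - F (f y')) = (g y - F' (f y)) + (F' (f y) - F (f y))"
      using elim(1) by metis
    then show ?case by simp
  qed
qed

lemma prim_unique:
  fixes f :: "'y::topological_space \<Rightarrow> 'a"
  assumes f: "continuous_map (top_of_set Y) X f" and g: "prim Y f g" "prim Y f g'"
    and Y: "connected Y" and ab: "a \<in> Y" "b \<in> Y"
  shows "g' b - g' a = g b - g a"
proof -
  have "\<forall>\<^sub>F y' in at y within Y. g' y - g y = g' y' - g y'" if y: "y \<in> Y" for y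
  proof -
    obtain V F where V: "LP V F" "f y \<in> V"
      using g y unfolding prim_def by blast
    show ?thesis
      using prim_any[OF f g(1) y V] prim_any[OF f g(2) y V]
    proof eventually_elim
      case (elim y')
      then have "(g' y - F (f y)) - (g y - F (f y)) = (g' y' - F (f y')) - (g y' - F (f y'))"
        by metis
      then show ?case by simp
    qed
  qed
  then have "g' a - g a = g' b - g b"
    using connected_local_const[OF Y ab, of "\<lambda>y. g' y - g y"] by blast
  then show ?thesis by (simp add: algebra_simps)
qed

lemma prim_add_const: "prim Y f g \<Longrightarrow> prim Y f (\<lambda>y. g y + c)"
  unfolding prim_def by (simp add: algebra_simps)

lemma prim_subset: "prim Y f g \<Longrightarrow> Z \<subseteq> Y \<Longrightarrow> prim Z f g"
  unfolding prim_def by (meson at_le filter_leD subsetD)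

lemma prim_cong:
  assumes "prim Y f g" "\<And>y. y \<in> Y \<Longrightarrow> f y = f' y" "\<And>y. y \<in> Y \<Longrightarrow> g y = g' y"
  shows "prim Y f' g'"
  unfolding prim_def
proof
  fix y assume y: "y \<in> Y"
  then obtain V F where V: "LP V F" "f y \<in> V"
      "\<forall>\<^sub>F y' in at y within Y. g y' - F (f y') = g y - F (f y)"
    using assms(1) unfolding prim_def by blast
  have "\<forall>\<^sub>F y' in at y within Y. y' \<in> Y"
    by (simp add: eventually_at_filter)
  with V(3) have "\<forall>\<^sub>F y' in at y within Y. g' y' - F (f' y') = g' y - F (f' y)"
    by eventually_elim (use assms(2,3) y in auto)
  then show "\<exists>V F. LP V F \<and> f' y \<in> V \<and>
     (\<forall>\<^sub>F y' in at y within Y. g' y' - F (f' y') = g' y - F (f' y))"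
    using V assms(2) y by metis
qed

lemma prim_compose:
  assumes g: "prim Y f g" and c: "continuous_on Z c" "c ` Z \<subseteq> Y"
  shows "prim Z (f \<circ> c) (g \<circ> c)"
  unfolding prim_def
proof
  fix z assume z: "z \<in> Z"
  then obtain V F where V: "LP V F" "f (c z) \<in> V"
      and ev: "\<forall>\<^sub>F y' in at (c z) within Y. g y' - F (f y') = g (c z) - F (f (c z))"
  proof -
    have "c z \<in> Y" using z c(2) by blast
    then show ?thesis using that g unfolding prim_def by blast
  qed
  obtain S where S: "open S" "c z \<in> S"
     "\<And>y. y \<in> S \<Longrightarrow> y \<noteq> c z \<Longrightarrow> y \<in> Y \<Longrightarrow> g y - F (f y) = g (c z) - F (f (c z))"
    using ev unfolding eventually_at_topological by blast
  have "(c \<longlongrightarrow> c z) (at z within Z)" using c(1) z by (simp add: continuous_on_def)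
  then have "\<forall>\<^sub>F y' in at z within Z. c y' \<in> S"
    using S by (simp add: tendsto_def)
  moreover have "\<forall>\<^sub>F y' in at z within Z. y' \<in> Z"
    by (simp add: eventually_at_filter)
  ultimately have "\<forall>\<^sub>F y' in at z within Z. g (c y') - F (f (c y')) = g (c z) - F (f (c z))"
    by eventually_elim (use S(3) c(2) in force)
  then show "\<exists>V F. LP V F \<and> (f \<circ> c) z \<in> V \<and>
     (\<forall>\<^sub>F y' in at z within Z. (g \<circ> c) y' - F ((f \<circ> c) y') = (g \<circ> c) z - F ((f \<circ> c) z))"
    using V by auto
qed

lemma prim_in_chart:
  assumes "LP V F" "f ` Y \<subseteq> V"
  shows "prim Y f (F \<circ> f)"
  unfolding prim_def using assms by (intro ballI exI[of _ V] exI[of _ F]) auto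

text \<open>Adding a constant makes the two primitives agree at one point of the intersection.
  Connectedness of the intersection extends the agreement to all of it, so the function on the union
  restricts to a primitive on both parts.\<close>

lemma prim_glue:
  fixes f :: "'y::topological_space \<Rightarrow> 'a"
  assumes f: "continuous_map (top_of_set (A \<union> B)) X f"
    and g: "prim A f gA" "prim B f gB"
    and cl: "closed A" "closed B" and conn: "connected (A \<inter> B)" "A \<inter> B \<noteq> {}"
  shows "\<exists>g. prim (A \<union> B) f g"
proof -
  have fA: "continuous_map (top_of_set A) X f" and fB: "continuous_map (top_of_set B) X f"
    and fAB: "continuous_map (top_of_set (A \<inter> B)) X f"
    using f by (meson continuous_map_from_subtopology_mono inf_le1 le_supI1 sup_ge1 sup_ge2)+
  obtain w where w: "w \<in> A" "w \<in> B" using conn by blast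
  define g where "g y = (if y \<in> A then gA y else gB y + (gA w - gB w))" for y
  have eqA: "g y = gA y" if "y \<in> A" for y using that by (simp add: g_def)
  have eqB: "g y = gB y + (gA w - gB w)" if "y \<in> B" for y
  proof (cases "y \<in> A")
    case True
    have "gA y - gA w = gB y - gB w"
      using prim_unique[OF fAB _ _ conn(1), of gB gA w y] g prim_subset w that True
      by (metis IntI inf_le1 inf_le2)
    then show ?thesis using True by (simp add: g_def algebra_simps)
  qed (simp add: g_def)
  have pA: "prim A f g" using prim_cong[OF g(1)] eqA by metis
  have pB: "prim B f g" using prim_cong[OF prim_add_const[OF g(2)]] eqB by metis
  have "prim (A \<union> B) f g"
    unfolding prim_def
  proof
    fix y assume y: "y \<in> A \<union> B"
    have "f y \<in> topspace X" using f y by (auto simp: continuous_map_def)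
    then obtain V F where V: "LP V F" "f y \<in> V" using LP_cover by blast
    have *: "\<forall>\<^sub>F y' in at y within S. g y' - F (f y') = g y - F (f y)"
      if "S = A \<or> S = B" for S
    proof (cases "y \<in> S")
      case True
      then show ?thesis using that prim_any[OF fA pA _ V] prim_any[OF fB pB _ V] by blast
    next
      case False
      \<comment> \<open>Off the closed set \<open>S\<close> there is a neighbourhood that misses
        \<open>S\<close>, so the condition along \<open>S\<close> is vacuous.\<close>
      have "closed S" using cl that by blast
      then have "open (- S)" "y \<in> - S" using False by (simp_all add: open_Compl)
      then show ?thesis
        unfolding eventually_at_topological by blast
    qed
    show "\<exists>V F. LP V F \<and> f y \<in> V \<and>
        (\<forall>\<^sub>F y' in at y within A \<union> B. g y' - F (f y') = g y - F (f y))"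
      using V *[of A] *[of B] by (auto simp: at_within_union eventually_sup)
  qed
  then show ?thesis by blast
qed

text \<open>A Lebesgue number makes every small rectangle map into the domain of one local
  primitive. Bisection then glues rectangles to strips of height 1 and strips to the square, always
  along a segment, which is connected.\<close>

lemma prim_exists_square:
  fixes f :: "real \<times> real \<Rightarrow> 'a"
  assumes f: "continuous_map (top_of_set ({0..1} \<times> {0..1})) X f"
  shows "\<exists>g. prim ({0..1} \<times> {0..1}) f g"
proof -
  let ?Q = "{0..1::real} \<times> {0..1::real}"
  have cont: "continuous_map (top_of_set S) X f" if "S \<subseteq> ?Q" for S
    using f that by (meson continuous_map_from_subtopology_mono)
  have loc: "\<exists>T. open T \<and> y \<in> T \<and> (\<exists>V F. LP V F \<and> f ` (?Q \<inter> T) \<subseteq> V)" if "y \<in> ?Q" for y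
  proof -
    have "f y \<in> topspace X" using f that by (auto simp: continuous_map_def)
    then obtain V F where V: "LP V F" "f y \<in> V" using LP_cover by blast
    have "openin (top_of_set ?Q) {x \<in> ?Q. f x \<in> V}"
      using openin_continuous_map_preimage[OF f LP_open[OF V(1)]] by simp
    then obtain T where "open T" "{x \<in> ?Q. f x \<in> V} = ?Q \<inter> T" by (auto simp: openin_open)
    then show ?thesis using V that by (intro exI[of _ T]) blast
  qed
  have sub: "?Q \<subseteq> \<Union>{T. open T \<and> (\<exists>V F. LP V F \<and> f ` (?Q \<inter> T) \<subseteq> V)}"
  proof (intro subsetI)
    fix y assume "y \<in> ?Q"
    from loc[OF this] obtain T V F where T: "open T" "y \<in> T" "LP V F" "f ` (?Q \<inter> T) \<subseteq> V"
      by (elim exE conjE)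
    then have "T \<in> {T. open T \<and> (\<exists>V F. LP V F \<and> f ` (?Q \<inter> T) \<subseteq> V)}" by (intro CollectI conjI exI)
    then show "y \<in> \<Union>{T. open T \<and> (\<exists>V F. LP V F \<and> f ` (?Q \<inter> T) \<subseteq> V)}" using T(2) by (rule UnionI)
  qed
  have cpt: "compact ?Q" by (intro compact_Times compact_Icc)
  have "\<exists>e>0. \<forall>x\<in>?Q. \<exists>G\<in>{T. open T \<and> (\<exists>V F. LP V F \<and> f ` (?Q \<inter> T) \<subseteq> V)}. ball x e \<subseteq> G"
    by (rule Heine_Borel_lemma[OF cpt sub]) (simp, blast)
  then obtain e where e: "e > 0"
    "\<And>x. x \<in> ?Q \<Longrightarrow> \<exists>G\<in>{T. open T \<and> (\<exists>V F. LP V F \<and> f ` (?Q \<inter> T) \<subseteq> V)}. ball x e \<subseteq> G"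
    by blast
  \<comment> \<open>Sides below \<open>e/2\<close> suffice because the distance in the plane is at
    most the sum of the distances in the coordinates.\<close>
  have small: "\<exists>g. prim ({a..b} \<times> {c..d}) f g"
    if "0 \<le> a" "a \<le> b" "b \<le> 1" "0 \<le> c" "c \<le> d" "d \<le> 1" "b - a < e/2" "d - c < e/2" for a b c d
  proof -
    have "(a, c) \<in> ?Q" using that by auto
    then obtain V F T where V: "LP V F" "f ` (?Q \<inter> T) \<subseteq> V" "ball (a,c) e \<subseteq> T" using e(2) by blast
    have "{a..b} \<times> {c..d} \<subseteq> ball (a,c) e"
    proof clarify
      fix x y assume "x \<in> {a..b}" "y \<in> {c..d}"
      then have "\<bar>x - a\<bar> < e/2" "\<bar>y - c\<bar> < e/2" using that by auto
      moreover have "dist (a,c) (x,y) \<le> dist a x + dist c y"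
        unfolding dist_Pair_Pair by (rule sqrt_sum_squares_le_sum) auto
      ultimately have "dist (a,c) (x,y) < e" unfolding dist_real_def by linarith
      then show "(x,y) \<in> ball (a,c) e" by simp
    qed
    moreover have "{a..b} \<times> {c..d} \<subseteq> ?Q" using that by auto
    ultimately have "f ` ({a..b} \<times> {c..d}) \<subseteq> V" using V by blast
    then show ?thesis using prim_in_chart V(1) by blast
  qed
  have strip: "\<exists>g. prim ({a..b} \<times> {0..1}) f g"
    if ab: "0 \<le> a" "a \<le> b" "b \<le> 1" "b - a < e/2" for a b
  proof -
    have "0 \<le> (0::real) \<and> (1::real) \<le> 1 \<longrightarrow> (\<exists>g. prim ({a..b} \<times> {0..1}) f g)"
    proof (rule Bolzano[where P = "\<lambda>c d. 0 \<le> c \<and> d \<le> 1 \<longrightarrow> (\<exists>g. prim ({a..b} \<times> {c..d}) f g)"])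
      fix c d h :: real
      assume trans: "0 \<le> c \<and> d \<le> 1 \<longrightarrow> (\<exists>g. prim ({a..b} \<times> {c..d}) f g)"
        "0 \<le> d \<and> h \<le> 1 \<longrightarrow> (\<exists>g. prim ({a..b} \<times> {d..h}) f g)" "c \<le> d" "d \<le> h"
      show "0 \<le> c \<and> h \<le> 1 \<longrightarrow> (\<exists>g. prim ({a..b} \<times> {c..h}) f g)"
      proof
        assume ch: "0 \<le> c \<and> h \<le> 1"
        then obtain g1 g2 where g: "prim ({a..b} \<times> {c..d}) f g1" "prim ({a..b} \<times> {d..h}) f g2"
          using trans by auto
        have un: "{a..b} \<times> {c..h} = {a..b} \<times> {c..d} \<union> {a..b} \<times> {d..h}" using trans by auto
        have int: "({a..b} \<times> {c..d}) \<inter> ({a..b} \<times> {d..h}) = {a..b} \<times> {d}" using trans by auto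
        show "\<exists>g. prim ({a..b} \<times> {c..h}) f g"
          unfolding un
        proof (rule prim_glue[OF _ g])
          show "continuous_map (top_of_set ({a..b} \<times> {c..d} \<union> {a..b} \<times> {d..h})) X f"
            using trans ch ab by (intro cont) auto
          show "connected (({a..b} \<times> {c..d}) \<inter> ({a..b} \<times> {d..h}))"
            unfolding int by (intro connected_Times) auto
        qed (use ab in \<open>auto intro!: closed_Times simp: int\<close>)
      qed
    next
      fix x :: real
      show "\<exists>\<delta>>0. \<forall>c d. c \<le> x \<and> x \<le> d \<and> d - c < \<delta> \<longrightarrow>
          0 \<le> c \<and> d \<le> 1 \<longrightarrow> (\<exists>g. prim ({a..b} \<times> {c..d}) f g)"
        using e(1) small ab by (intro exI[of _ "e/2"]) auto
    qed auto
    then show ?thesis by auto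
  qed
  have "0 \<le> (0::real) \<and> (1::real) \<le> 1 \<longrightarrow> (\<exists>g. prim ({0..1} \<times> {0..1}) f g)"
  proof (rule Bolzano[where P = "\<lambda>c d. 0 \<le> c \<and> d \<le> 1 \<longrightarrow> (\<exists>g. prim ({c..d} \<times> {0..1}) f g)"])
    fix c d h :: real
    assume trans: "0 \<le> c \<and> d \<le> 1 \<longrightarrow> (\<exists>g. prim ({c..d} \<times> {0..1}) f g)"
      "0 \<le> d \<and> h \<le> 1 \<longrightarrow> (\<exists>g. prim ({d..h} \<times> {0..1}) f g)" "c \<le> d" "d \<le> h"
    show "0 \<le> c \<and> h \<le> 1 \<longrightarrow> (\<exists>g. prim ({c..h} \<times> {0..1}) f g)"
    proof
      assume ch: "0 \<le> c \<and> h \<le> 1"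
      then obtain g1 g2 where g: "prim ({c..d} \<times> {0..1}) f g1" "prim ({d..h} \<times> {0..1}) f g2"
        using trans by auto
      have un: "{c..h} \<times> {0..1} = {c..d} \<times> {0..1} \<union> {d..h} \<times> {0..1}" using trans by auto
      have int: "({c..d} \<times> {0..1}) \<inter> ({d..h} \<times> {0..1}) = {d} \<times> {0..1::real}" using trans by auto
      show "\<exists>g. prim ({c..h} \<times> {0..1}) f g"
        unfolding un
      proof (rule prim_glue[OF _ g])
        show "continuous_map (top_of_set ({c..d} \<times> {0..1} \<union> {d..h} \<times> {0..1})) X f"
          using trans ch by (intro cont) auto
        show "connected (({c..d} \<times> {0..1}) \<inter> ({d..h} \<times> {0..1::real}))"
          unfolding int by (intro connected_Times) auto
      qed (auto intro!: closed_Times simp: int)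
    qed
  next
    fix x :: real
    show "\<exists>\<delta>>0. \<forall>c d. c \<le> x \<and> x \<le> d \<and> d - c < \<delta> \<longrightarrow>
        0 \<le> c \<and> d \<le> 1 \<longrightarrow> (\<exists>g. prim ({c..d} \<times> {0..1}) f g)"
      using e(1) strip by (intro exI[of _ "e/2"]) auto
  qed auto
  then show ?thesis by auto
qed

text \<open>A path is a square that ignores its second coordinate, so the primitive on the square
  restricts to one along the bottom edge.\<close>

lemma prim_exists_path:
  fixes f :: "real \<Rightarrow> 'a"
  assumes f: "continuous_map (top_of_set {0..1}) X f"
  shows "\<exists>g. prim {0..1} f g"
proof -
  have "continuous_map (top_of_set ({0..1} \<times> {0..1})) X (f \<circ> (fst :: real \<times> real \<Rightarrow> real))"
    by (rule continuous_map_compose[OF _ f]) (auto intro!: continuous_intros)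
  then obtain g where g: "prim ({0..1} \<times> {0..1}) (f \<circ> (fst :: real \<times> real \<Rightarrow> real)) g"
    using prim_exists_square by blast
  have "prim {0..1} ((f \<circ> fst) \<circ> (\<lambda>t. (t, 0::real))) (g \<circ> (\<lambda>t. (t,0)))"
    by (rule prim_compose[OF g]) (auto intro!: continuous_intros)
  then show ?thesis by (auto simp: o_def)
qed

text \<open>A primitive on the whole square has the same increment along both ways from (0,0) to
  (1,1). This takes the place of Stokes' theorem: it gives homotopy invariance and, for a collapsed
  square, vanishing on boundaries of 2-simplices.\<close>

lemma prim_square_edges:
  fixes f :: "real \<times> real \<Rightarrow> 'a"
  assumes f: "continuous_map (top_of_set ({0..1} \<times> {0..1})) X f"
    and "prim {0..1} (\<lambda>t. f (t, 0)) b" "prim {0..1} (\<lambda>t. f (1, t)) r"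
    and "prim {0..1} (\<lambda>t. f (0, t)) l" "prim {0..1} (\<lambda>t. f (t, 1)) t"
  shows "(b 1 - b 0) + (r 1 - r 0) = (l 1 - l 0) + (t 1 - t 0)"
proof -
  obtain g where g: "prim ({0..1} \<times> {0..1}) f g" using prim_exists_square[OF f] by blast
  have *: "h 1 - h 0 = g (e 1) - g (e 0)"
    if e: "continuous_on {0..1} e" "e ` {0..1} \<subseteq> {0..1} \<times> {0..1}" and h: "prim {0..1} (\<lambda>t. f (e t)) h" for e :: "real \<Rightarrow> real \<times> real" and h
  proof -
    have 1: "continuous_map (top_of_set {0..1}) X (f \<circ> e)"
      by (rule continuous_map_compose[OF _ f]) (use e in \<open>auto simp: image_subset_iff_funcset\<close>)
    have "prim {0..1} (f \<circ> e) (g \<circ> e)" using prim_compose[OF g e] .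
    moreover have "prim {0..1} (f \<circ> e) h" using h by (simp add: o_def)
    ultimately have "h 1 - h 0 = (g \<circ> e) 1 - (g \<circ> e) 0"
      using prim_unique[OF 1 _ _ connected_Icc, of "g \<circ> e" h 0 1] by simp
    then show ?thesis by simp
  qed
  have "b 1 - b 0 = g (1, 0) - g (0, 0)" by (rule *[of "\<lambda>t. (t,0)"]) (use assms in \<open>auto intro!: continuous_intros\<close>)
  moreover have "r 1 - r 0 = g (1, 1) - g (1, 0)" by (rule *[of "\<lambda>t. (1,t)"]) (use assms in \<open>auto intro!: continuous_intros\<close>)
  moreover have "l 1 - l 0 = g (0, 1) - g (0, 0)" by (rule *[of "\<lambda>t. (0,t)"]) (use assms in \<open>auto intro!: continuous_intros\<close>)
  moreover have "t 1 - t 0 = g (1, 1) - g (0, 1)" by (rule *[of "\<lambda>t. (t,1)"]) (use assms in \<open>auto intro!: continuous_intros\<close>)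
  ultimately show ?thesis by simp
qed

lemma prim_const_path:
  assumes "prim {0..1::real} (\<lambda>t. x) g"
  shows "g 1 = g 0"
proof -
  have x: "x \<in> topspace X"
  proof -
    obtain V F where "LP V F" "x \<in> V" using assms unfolding prim_def by fastforce
    then show ?thesis using LP_open openin_subset by blast
  qed
  then obtain V F where V: "LP V F" "x \<in> V" using LP_cover by blast
  have "prim {0..1::real} (\<lambda>t. x) (F \<circ> (\<lambda>t. x))"
    by (rule prim_in_chart[OF V(1)]) (use V in auto)
  then have "g 1 - g 0 = (F \<circ> (\<lambda>t. x)) 1 - (F \<circ> (\<lambda>t. x)) (0::real)"
    using prim_unique[OF _ _ assms connected_Icc, of "F \<circ> (\<lambda>t. x)" 0 1] x by simp
  then show ?thesis by simp
qed

text \<open>The value at \<open>v\<close> is the increment along any path from a base point: a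
  homotopy between two paths is a square with two constant edges, so the choice does not matter.
  Local path connectedness then supplies paths inside one chart.\<close>

lemma prim_exists_simply_connected:
  fixes Y :: "'y::real_normed_vector set"
  assumes f: "continuous_map (top_of_set Y) X f"
    and Y: "simply_connected Y" "locally path_connected Y"
  shows "\<exists>g. prim Y f g"
proof (cases "Y = {}")
  case True
  then show ?thesis by (auto simp: prim_def)
next
  case False
  then obtain u where u: "u \<in> Y" by blast
  have fc: "continuous_map (top_of_set {0..1}) X (f \<circ> c)" if "path c" "path_image c \<subseteq> Y" for c
    by (rule continuous_map_compose[OF _ f]) (use that in \<open>auto simp: path_def path_image_def\<close>)
  define I where "I c = (let g = (SOME g. prim {0..1} (f \<circ> c) g) in g 1 - g 0)" for c :: "real \<Rightarrow> 'y"
  have I: "I c = g 1 - g 0" if "path c" "path_image c \<subseteq> Y" "prim {0..1} (f \<circ> c) g" for c g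
  proof -
    have "prim {0..1} (f \<circ> c) (SOME g. prim {0..1} (f \<circ> c) g)"
      using that(3) by (rule someI[of "\<lambda>g. prim {0..1} (f \<circ> c) g"])
    then show ?thesis
      unfolding I_def Let_def using prim_unique[OF fc[OF that(1,2)] that(3), of _ 0 1] by auto
  qed
  have hom: "I c = I c'" if c: "path c" "path_image c \<subseteq> Y" "path c'" "path_image c' \<subseteq> Y"
     "pathstart c' = pathstart c" "pathfinish c' = pathfinish c" for c c'
  proof -
    have "homotopic_paths Y c c'" using Y(1) c unfolding simply_connected_eq_homotopic_paths by blast
    then obtain h where h: "continuous_on ({0..1} \<times> {0..1}) h" "h \<in> ({0..1} \<times> {0..1}) \<rightarrow> Y"
      "\<And>x. x \<in> {0..1} \<Longrightarrow> h (0,x) = c x" "\<And>x. x \<in> {0..1} \<Longrightarrow> h (1,x) = c' x"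
      "\<And>t::real. t \<in> {0..1} \<Longrightarrow> h (t, 0) = c 0 \<and> h (t,1) = c 1"
      unfolding homotopic_paths by (auto simp: pathstart_def pathfinish_def)
    have fh: "continuous_map (top_of_set ({0..1} \<times> {0..1})) X (f \<circ> h)"
      by (rule continuous_map_compose[OF _ f]) (use h in auto)
    obtain gl gr where g: "prim {0..1} (f \<circ> c) gl" "prim {0..1} (f \<circ> c') gr"
      using prim_exists_path fc c by metis
    have "c 0 \<in> Y" "c 1 \<in> Y" using c(2) by (auto simp: path_image_def)
    then have pt: "f (c 0) \<in> topspace X" "f (c 1) \<in> topspace X"
      using f by (auto simp: continuous_map_def)
    have "\<exists>e. prim {0..1} (\<lambda>t::real. f (c s)) e" if "f (c s) \<in> topspace X" for s
      by (rule prim_exists_path) (use that in auto)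
    then obtain e0 e1 where e: "prim {0..1} (\<lambda>t::real. f (c 0)) e0" "prim {0..1} (\<lambda>t::real. f (c 1)) e1"
      using pt by metis
    have "prim {0..1} (\<lambda>t. (f \<circ> h) (t, 0)) e0"
      by (rule prim_cong[OF e(1)]) (use h(5) in auto)
    moreover have "prim {0..1} (\<lambda>t. (f \<circ> h) (t, 1)) e1"
      by (rule prim_cong[OF e(2)]) (use h(5) in auto)
    moreover have "prim {0..1} (\<lambda>t. (f \<circ> h) (0, t)) gl"
      by (rule prim_cong[OF g(1)]) (use h(3) in auto)
    moreover have "prim {0..1} (\<lambda>t. (f \<circ> h) (1, t)) gr"
      by (rule prim_cong[OF g(2)]) (use h(4) in auto)
    ultimately have "(e0 1 - e0 0) + (gr 1 - gr 0) = (gl 1 - gl 0) + (e1 1 - e1 0)"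
      using prim_square_edges[OF fh] by blast
    then show ?thesis using I[OF c(1,2) g(1)] I[OF c(3,4) g(2)] prim_const_path[OF e(1)] prim_const_path[OF e(2)] by simp
  qed
  \<comment> \<open>Appending a path that stays in the domain of a local primitive \<open>F\<close>
    adds the increment of \<open>F\<close>; this is what makes \<open>G\<close> a primitive.\<close>
  have join: "I (c +++ c') = I c + (F (f (pathfinish c')) - F (f (pathfinish c)))"
    if c: "path c" "path_image c \<subseteq> Y" "path c'" "path_image c' \<subseteq> Y"
     "pathstart c' = pathfinish c" and V: "LP V F" "f ` path_image c' \<subseteq> V" for c c' V F
  proof -
    have p: "path (c +++ c')" "path_image (c +++ c') \<subseteq> Y"
      using c by (auto simp: path_image_join)
    obtain g where g: "prim {0..1} (f \<circ> (c +++ c')) g" using prim_exists_path fc[OF p] by blast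
    have "prim {0..1} ((f \<circ> (c +++ c')) \<circ> (\<lambda>t. t/2)) (g \<circ> (\<lambda>t. t/2))"
      by (rule prim_compose[OF g]) (auto intro!: continuous_intros)
    then have "prim {0..1} (f \<circ> c) (g \<circ> (\<lambda>t. t/2))"
      by (rule prim_cong) (auto simp: joinpaths_def)
    then have 1: "I c = g (1/2) - g 0" using I c by fastforce
    have "prim {0..1} ((f \<circ> (c +++ c')) \<circ> (\<lambda>t. 1/2 + t/2)) (g \<circ> (\<lambda>t. 1/2 + t/2))"
      by (rule prim_compose[OF g]) (auto intro!: continuous_intros)
    then have "prim {0..1} (f \<circ> c') (g \<circ> (\<lambda>t. 1/2 + t/2))"
    proof (rule prim_cong)
      fix t :: real assume t: "t \<in> {0..1}"
      show "((f \<circ> (c +++ c')) \<circ> (\<lambda>t. 1/2 + t/2)) t = (f \<circ> c') t"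
        using c(5) t by (cases "t = 0") (auto simp: joinpaths_def pathstart_def pathfinish_def)
    qed auto
    moreover have "prim {0..1} (f \<circ> c') (F \<circ> (f \<circ> c'))"
      by (rule prim_in_chart[OF V(1)]) (use V(2) in \<open>auto simp: path_image_def\<close>)
    ultimately have "g 1 - g (1/2) = F (f (c' 1)) - F (f (c' 0))"
      using prim_unique[OF fc[OF c(3,4)], of "F \<circ> (f \<circ> c')" "g \<circ> (\<lambda>t. 1/2 + t/2)" 0 1] by auto
    moreover have "I (c +++ c') = (g (1/2) - g 0) + (g 1 - g (1/2))" using I[OF p g] by simp
    ultimately show ?thesis using 1 c(5) by (simp add: pathfinish_def pathstart_def)
  qed
  have pc: "path_connected Y" using Y(1) by (rule simply_connected_imp_path_connected)
  define G where "G v = I (SOME c. path c \<and> path_image c \<subseteq> Y \<and> pathstart c = u \<and> pathfinish c = v)" for v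
  have G: "G v = I c" if "path c" "path_image c \<subseteq> Y" "pathstart c = u" "pathfinish c = v" for c v
  proof -
    let ?P = "\<lambda>c. path c \<and> path_image c \<subseteq> Y \<and> pathstart c = u \<and> pathfinish c = v"
    have "?P (SOME c. ?P c)" using that by (intro someI[of ?P c]) auto
    then show ?thesis unfolding G_def using that by (intro hom) auto
  qed
  have "prim Y f G"
    unfolding prim_def
  proof
    fix y assume y: "y \<in> Y"
    then have "f y \<in> topspace X" using f by (auto simp: continuous_map_def)
    then obtain V F where V: "LP V F" "f y \<in> V" using LP_cover by blast
    have "openin (top_of_set Y) {x \<in> Y. f x \<in> V}"
      using openin_continuous_map_preimage[OF f LP_open[OF V(1)]] by simp
    then obtain W where W: "openin (top_of_set Y) W" "y \<in> W" "path_connected W" "W \<subseteq> {x \<in> Y. f x \<in> V}"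
      using Y(2) V(2) y unfolding locally_path_connected by (metis (mono_tags, lifting) mem_Collect_eq)
    obtain T where T: "open T" "W = Y \<inter> T" using W(1) by (auto simp: openin_open)
    obtain c where c: "path c" "path_image c \<subseteq> Y" "pathstart c = u" "pathfinish c = y"
      using pc u y unfolding path_connected_def by blast
    have "G z - F (f z) = G y - F (f y)" if z: "z \<in> W" for z
    proof -
      obtain d where d: "path d" "path_image d \<subseteq> W" "pathstart d = y" "pathfinish d = z"
        using W(2,3) z unfolding path_connected_def by blast
      have "I (c +++ d) = I c + (F (f (pathfinish d)) - F (f (pathfinish c)))"
        by (rule join[OF c(1,2) d(1) _ _ V(1)]) (use d c W in auto)
      moreover have "G z = I (c +++ d)"
        by (rule G) (use c d W in \<open>auto simp: path_image_join\<close>)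
      ultimately show ?thesis using G[OF c] c d by simp
    qed
    then have "\<forall>\<^sub>F z in at y within Y. G z - F (f z) = G y - F (f y)"
      unfolding eventually_at_topological using T W(2) by blast
    then show "\<exists>V F. LP V F \<and> f y \<in> V \<and>
        (\<forall>\<^sub>F z in at y within Y. G z - F (f z) = G y - F (f y))" using V by blast
  qed
  then show ?thesis by blast
qed

end

section \<open>First singular homology by paths\<close>

lemma simplex_of_path_cong:
  assumes "\<And>t. t \<in> {0..1} \<Longrightarrow> \<gamma> t = \<gamma>' t"
  shows "simplex_of_path \<gamma> = simplex_of_path \<gamma>'"
  unfolding simplex_of_path_def
  by (rule restrict_ext) (use assms in \<open>auto simp: standard_simplex_def\<close>)

lemma powertop_real_subtopology:
  "subtopology (powertop_real (UNIV :: nat set)) S = top_of_set S"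
  by (simp add: euclidean_product_topology)

lemma singular_simplex_of_path:
  assumes "continuous_map (top_of_set {0..1}) X \<gamma>"
  shows "singular_simplex 1 X (simplex_of_path \<gamma>)"
proof -
  have "continuous_map (top_of_set (standard_simplex 1)) X (\<gamma> \<circ> (\<lambda>x. x 1))"
    by (rule continuous_map_compose[OF _ assms])
      (auto simp: standard_simplex_def intro!: continuous_on_product_coordinates
         intro: continuous_on_subset)
  then have "continuous_map (top_of_set (standard_simplex 1)) X (simplex_of_path \<gamma>)"
    by (rule continuous_map_eq) (auto simp: simplex_of_path_def)
  then show ?thesis
    unfolding singular_simplex_def powertop_real_subtopology by (simp add: simplex_of_path_def)
qed

lemma simplex_of_path_of_simplex:
  assumes "singular_simplex 1 X \<sigma>"
  shows "simplex_of_path (path_of_simplex \<sigma>) = \<sigma>"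
    and "continuous_map (top_of_set {0..1}) X (path_of_simplex \<sigma>)"
proof -
  have e: "(\<lambda>i. if i = 0 then 1 - x 1 else if i = 1 then x 1 else 0) = x"
    if "x \<in> standard_simplex 1" for x :: "nat \<Rightarrow> real"
  proof
    fix i
    have "x 0 + x 1 = 1" "\<And>i. i > 1 \<Longrightarrow> x i = 0"
      using that by (auto simp: standard_simplex_def)
    then show "(if i = 0 then 1 - x 1 else if i = 1 then x 1 else 0) = x i"
      by (cases "i = 0"; cases "i = 1") auto
  qed
  have ext: "\<sigma> \<in> extensional (standard_simplex 1)"
    using assms by (auto simp: singular_simplex_def)
  show "simplex_of_path (path_of_simplex \<sigma>) = \<sigma>"
  proof (rule extensionalityI[OF _ ext])
    fix x :: "nat \<Rightarrow> real" assume x: "x \<in> standard_simplex 1"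
    show "simplex_of_path (path_of_simplex \<sigma>) x = \<sigma> x"
      using x by (simp add: simplex_of_path_def path_of_simplex_def e[OF x] del: One_nat_def)
  qed (simp add: simplex_of_path_def)
  have s: "continuous_map (top_of_set (standard_simplex 1)) X \<sigma>"
    using assms unfolding singular_simplex_def powertop_real_subtopology by blast
  have "continuous_on {0..1} (\<lambda>t. if i = (0::nat) then 1 - t else if i = 1 then t else (0::real))" for i
    by (cases "i = 0"; cases "i = 1") (auto intro!: continuous_intros)
  then have "continuous_on {0..1} (\<lambda>t i. if i = (0::nat) then 1 - t else if i = 1 then t else (0::real))"
    by (rule continuous_on_coordinatewise_then_product)
  moreover have "(\<lambda>i. if i = (0::nat) then 1 - t else if i = 1 then t else 0) \<in> standard_simplex 1"
    if "t \<in> {0..1}" for t :: real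
    using that by (auto simp: standard_simplex_def)
  ultimately have "continuous_map (top_of_set {0..1}) X
      (\<sigma> \<circ> (\<lambda>t i. if i = (0::nat) then 1 - t else if i = 1 then t else 0))"
    by (intro continuous_map_compose[OF _ s]) auto
  then show "continuous_map (top_of_set {0..1}) X (path_of_simplex \<sigma>)"
    by (simp add: path_of_simplex_def[abs_def] o_def)
qed

lemma path_of_simplex_of_path:
  "t \<in> {0..1} \<Longrightarrow> path_of_simplex (simplex_of_path \<gamma>) t = \<gamma> t"
  by (auto simp: path_of_simplex_def simplex_of_path_def standard_simplex_def)

definition pt_simplex :: "'a \<Rightarrow> (nat \<Rightarrow> real) \<Rightarrow> 'a" where
  "pt_simplex x = restrict (\<lambda>_. x) (standard_simplex 0)"

lemma chain_boundary_simplex_of_path: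
  "chain_boundary 1 (frag_of (simplex_of_path \<gamma>)) =
     frag_of (pt_simplex (\<gamma> 1)) - frag_of (pt_simplex (\<gamma> 0))"
proof -
  have 0: "singular_face 1 0 (simplex_of_path \<gamma>) = pt_simplex (\<gamma> 1)"
    unfolding singular_face_def pt_simplex_def
  proof (simp del: One_nat_def, rule restrict_ext)
    fix x :: "nat \<Rightarrow> real" assume x: "x \<in> standard_simplex 0"
    then have "x 0 = 1" by (simp add: standard_simplex_def)
    moreover have "simplical_face 0 x \<in> standard_simplex 1"
      using x by (intro simplical_face_in_standard_simplex) auto
    ultimately show "(simplex_of_path \<gamma> \<circ> simplical_face 0) x = \<gamma> 1"
      by (simp add: simplex_of_path_def simplical_face_def)
  qed
  have 1: "singular_face 1 1 (simplex_of_path \<gamma>) = pt_simplex (\<gamma> 0)"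
    unfolding singular_face_def pt_simplex_def
  proof (simp del: One_nat_def, rule restrict_ext)
    fix x :: "nat \<Rightarrow> real" assume x: "x \<in> standard_simplex 0"
    have "simplical_face 1 x \<in> standard_simplex 1"
      using x by (intro simplical_face_in_standard_simplex) auto
    then show "(simplex_of_path \<gamma> \<circ> simplical_face 1) x = \<gamma> 0"
      by (simp add: simplex_of_path_def simplical_face_def)
  qed
  have "{..1::nat} = {0, 1}" by auto
  then show ?thesis by (simp add: chain_boundary_of 0 1 del: One_nat_def)
qed

text \<open>The face \<open>k\<close> omits the vertex \<open>k\<close>; the two conditionals name
  the first and the last of the remaining vertices.\<close>

lemma singular_face_triangle:
  fixes f :: "'b::real_normed_vector \<Rightarrow> 'a" and v :: "nat \<Rightarrow> 'b"
  assumes k: "k \<le> 2"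
  shows "singular_face 2 k (restrict (\<lambda>x. f (x 0 *\<^sub>R v 0 + x 1 *\<^sub>R v 1 + x 2 *\<^sub>R v 2)) (standard_simplex 2))
    = simplex_of_path (f \<circ> linepath (v (if k = 0 then 1 else 0)) (v (if k = 2 then 1 else 2)))"
proof -
  have two: "2 - Suc 0 = (1::nat)" by simp
  show ?thesis
  unfolding singular_face_def simplex_of_path_def two
proof (rule restrict_ext)
  fix x :: "nat \<Rightarrow> real" assume x: "x \<in> standard_simplex 1"
  have x01: "x 0 = 1 - x 1" using x by (simp add: standard_simplex_def)
  have mem: "simplical_face k x \<in> standard_simplex 2"
    using x k by (intro simplical_face_in_standard_simplex) auto
  consider "k = 0" | "k = 1" | "k = 2" using k by linarith
  then show "((\<lambda>x\<in>standard_simplex 2. f (x 0 *\<^sub>R v 0 + x 1 *\<^sub>R v 1 + x 2 *\<^sub>R v 2)) \<circ> simplical_face k) x =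
      (f \<circ> linepath (v (if k = 0 then 1 else 0)) (v (if k = 2 then 1 else 2))) (x 1)"
    using mem by cases (simp_all add: simplical_face_def linepath_def x01)
qed
qed

text \<open>The affine triangle with vertices \<open>a\<close>, \<open>b\<close>, \<open>c\<close>,
  mapped by \<open>f\<close>, has boundary ab + bc - ac. Degenerate triangles in an interval and the
  two halves of a square give concatenation, reversal and homotopy invariance below.\<close>

lemma homologous_triangle:
  fixes f :: "'b::real_normed_vector \<Rightarrow> 'a"
  assumes f: "continuous_map (top_of_set K) X f" and K: "convex K" "a \<in> K" "b \<in> K" "c \<in> K"
  shows "homologous_rel 1 X {} (frag_of (simplex_of_path (f \<circ> linepath a b)) +
      frag_of (simplex_of_path (f \<circ> linepath b c))) (frag_of (simplex_of_path (f \<circ> linepath a c)))"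
proof -
  define v where "v = (\<lambda>i::nat. if i = 0 then a else if i = 1 then b else c)"
  define s where "s = restrict (\<lambda>x. f (x 0 *\<^sub>R v 0 + x 1 *\<^sub>R v 1 + x 2 *\<^sub>R v 2)) (standard_simplex 2)"
  have "x 0 *\<^sub>R v 0 + x 1 *\<^sub>R v 1 + x 2 *\<^sub>R v 2 \<in> K" if "x \<in> standard_simplex 2" for x :: "nat \<Rightarrow> real"
  proof -
    have "{..2::nat} = {0,1,2}" by auto
    with that have s: "x 0 + x 1 + x 2 = 1" "\<And>i. x i \<ge> 0"
      by (auto simp: standard_simplex_def)
    have "(\<Sum>i\<in>{0,1,2}. x i *\<^sub>R v i) \<in> K"
      by (rule convex_sum[OF _ K(1)]) (use s K in \<open>auto simp: v_def\<close>)
    then show ?thesis by (simp add: add.assoc)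
  qed
  moreover have "continuous_on (standard_simplex 2) (\<lambda>x::nat \<Rightarrow> real. x 0 *\<^sub>R v 0 + x 1 *\<^sub>R v 1 + x 2 *\<^sub>R v 2)"
    by (intro continuous_intros continuous_on_subset[OF continuous_on_product_coordinates]) auto
  ultimately have "continuous_map (top_of_set (standard_simplex 2)) X
      (f \<circ> (\<lambda>x. x 0 *\<^sub>R v 0 + x 1 *\<^sub>R v 1 + x 2 *\<^sub>R v 2))"
    by (intro continuous_map_compose[OF _ f]) auto
  then have "continuous_map (top_of_set (standard_simplex 2)) X s"
    by (rule continuous_map_eq) (auto simp: s_def)
  then have s: "singular_simplex 2 X s"
    unfolding singular_simplex_def powertop_real_subtopology by (simp add: s_def)
  have "{..2::nat} = {0,1,2}" by auto
  then have "chain_boundary 2 (frag_of s) =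
     frag_of (singular_face 2 0 s) - frag_of (singular_face 2 1 s) + frag_of (singular_face 2 2 s)"
    by (simp add: chain_boundary_of)
  also have "\<dots> = (frag_of (simplex_of_path (f \<circ> linepath a b)) +
      frag_of (simplex_of_path (f \<circ> linepath b c))) - frag_of (simplex_of_path (f \<circ> linepath a c))"
    unfolding s_def by (subst (1 2 3) singular_face_triangle) (simp_all add: v_def)
  finally show ?thesis
    unfolding homologous_rel_def singular_boundary
    using s by (metis One_nat_def Suc_1 singular_chain_of)
qed

text \<open>For the constant triangle the relation reads c + c = c in homology.\<close>

lemma homologous_const:
  assumes "x \<in> topspace X"
  shows "homologous_rel 1 X {} (frag_of (simplex_of_path (\<lambda>_. x))) 0"
proof -
  have "homologous_rel 1 X {} (frag_of (simplex_of_path ((\<lambda>_::real. x) \<circ> linepath 0 0)) +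
      frag_of (simplex_of_path ((\<lambda>_::real. x) \<circ> linepath 0 0))) (frag_of (simplex_of_path ((\<lambda>_::real. x) \<circ> linepath 0 0)))"
    by (rule homologous_triangle[where K = UNIV]) (use assms in auto)
  then have "homologous_rel 1 X {} (frag_of (simplex_of_path (\<lambda>_::real. x)) +
      frag_of (simplex_of_path (\<lambda>_. x))) (frag_of (simplex_of_path (\<lambda>_. x)))" by (simp add: o_def)
  then show ?thesis by (simp add: homologous_rel_def)
qed

text \<open>The diagonal cuts the square of the homotopy into two triangles, and the edges on which
  the homotopy rests are constant paths, which are null.\<close>

lemma homologous_homotopic:
  assumes q: "continuous_map (top_of_set U) X q" and h: "homotopic_paths U c c'"
  shows "homologous_rel 1 X {} (frag_of (simplex_of_path (q \<circ> c))) (frag_of (simplex_of_path (q \<circ> c')))"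
proof -
  let ?Q = "{0..1::real} \<times> {0..1::real}"
  obtain h where h: "continuous_on ?Q h" "h \<in> ?Q \<rightarrow> U"
    "\<And>x. x \<in> {0..1} \<Longrightarrow> h (0,x) = c x" "\<And>x. x \<in> {0..1} \<Longrightarrow> h (1,x) = c' x"
    "\<And>t::real. t \<in> {0..1} \<Longrightarrow> h (t, 0) = c 0 \<and> h (t,1) = c 1"
    using h unfolding homotopic_paths by (auto simp: pathstart_def pathfinish_def)
  have f: "continuous_map (top_of_set ?Q) X (q \<circ> h)"
    by (rule continuous_map_compose[OF _ q]) (use h in auto)
  have K: "convex ?Q" by (intro convex_Times) auto
  let ?S = "\<lambda>a b. frag_of (simplex_of_path ((q \<circ> h) \<circ> linepath a b))"
  have 1: "homologous_rel 1 X {} (?S (0,0) (0,1) + ?S (0,1) (1,1)) (?S (0,0) (1,1))"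
    by (rule homologous_triangle[OF f K]) auto
  have 2: "homologous_rel 1 X {} (?S (0,0) (1,0) + ?S (1,0) (1,1)) (?S (0,0) (1,1))"
    by (rule homologous_triangle[OF f K]) auto
  have pts: "q (c 0) \<in> topspace X" "q (c 1) \<in> topspace X"
    using h(2) h(5)[of 0] q unfolding continuous_map_def
    by (auto simp: Pi_iff) (metis atLeastAtMost_iff order_refl zero_le_one)+
  have e: "simplex_of_path ((q \<circ> h) \<circ> linepath (0,0) (0,1)) = simplex_of_path (q \<circ> c)"
     "simplex_of_path ((q \<circ> h) \<circ> linepath (1,0) (1,1)) = simplex_of_path (q \<circ> c')"
     "simplex_of_path ((q \<circ> h) \<circ> linepath (0,1) (1,1)) = simplex_of_path (\<lambda>_. q (c 1))"
     "simplex_of_path ((q \<circ> h) \<circ> linepath (0,0) (1,0)) = simplex_of_path (\<lambda>_. q (c 0))"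
    by (rule simplex_of_path_cong; use h in \<open>auto simp: linepath_def\<close>)+
  have 3: "homologous_rel 1 X {} (?S (0,0) (0,1) + ?S (0,1) (1,1)) (frag_of (simplex_of_path (q \<circ> c)) + 0)"
    unfolding e by (intro homologous_rel_add homologous_const pts homologous_rel_refl)
  have 4: "homologous_rel 1 X {} (?S (0,0) (1,0) + ?S (1,0) (1,1)) (0 + frag_of (simplex_of_path (q \<circ> c')))"
    unfolding e by (intro homologous_rel_add homologous_const pts homologous_rel_refl)
  from 1 2 3 4 show ?thesis
    by (metis (no_types, lifting) add.left_neutral add.right_neutral homologous_rel_eq)
qed

lemma continuous_map_path_compose:
  assumes "continuous_map (top_of_set U) X q" "path c" "path_image c \<subseteq> U"
  shows "continuous_map (top_of_set {0..1}) X (q \<circ> c)"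
  by (rule continuous_map_compose[OF _ assms(1)]) (use assms in \<open>auto simp: path_def path_image_def\<close>)

text \<open>This is the degenerate triangle with vertices 0, 1/2, 1 in the parameter interval of the
  joined path.\<close>

lemma homologous_join:
  assumes q: "continuous_map (top_of_set U) X q"
    and c: "path c" "path_image c \<subseteq> U" "path c'" "path_image c' \<subseteq> U" "pathstart c' = pathfinish c"
  shows "homologous_rel 1 X {} (frag_of (simplex_of_path (q \<circ> (c +++ c'))))
     (frag_of (simplex_of_path (q \<circ> c)) + frag_of (simplex_of_path (q \<circ> c')))"
proof -
  have p: "path (c +++ c')" "path_image (c +++ c') \<subseteq> U"
    using c by (auto simp: path_image_join)
  have "continuous_map (top_of_set {0..1}) X (q \<circ> (c +++ c'))"
    by (rule continuous_map_path_compose[OF q p])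
  then have "homologous_rel 1 X {} (frag_of (simplex_of_path ((q \<circ> (c +++ c')) \<circ> linepath 0 (1/2))) +
      frag_of (simplex_of_path ((q \<circ> (c +++ c')) \<circ> linepath (1/2) 1)))
      (frag_of (simplex_of_path ((q \<circ> (c +++ c')) \<circ> linepath 0 1)))"
    by (rule homologous_triangle) auto
  moreover have "simplex_of_path ((q \<circ> (c +++ c')) \<circ> linepath 0 (1/2)) = simplex_of_path (q \<circ> c)"
    by (rule simplex_of_path_cong) (auto simp: joinpaths_def linepath_def)
  moreover have "simplex_of_path ((q \<circ> (c +++ c')) \<circ> linepath (1/2) 1) = simplex_of_path (q \<circ> c')"
  proof (rule simplex_of_path_cong)
    fix t :: real assume t: "t \<in> {0..1}"
    have "linepath (1/2) 1 t = 1/2 + t/2" by (simp add: linepath_def field_simps)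
    then show "((q \<circ> (c +++ c')) \<circ> linepath (1/2) 1) t = (q \<circ> c') t"
      using c(5) t by (cases "t = 0") (auto simp: joinpaths_def pathstart_def pathfinish_def linepath_def field_simps)
  qed
  moreover have "simplex_of_path ((q \<circ> (c +++ c')) \<circ> linepath 0 1) = simplex_of_path (q \<circ> (c +++ c'))"
    by (rule simplex_of_path_cong) (auto simp: linepath_def)
  ultimately show ?thesis by (simp add: homologous_rel_sym)
qed

text \<open>The degenerate triangle 0, 1, 0 has a constant third side, so a path and its reverse
  cancel.\<close>

lemma homologous_reverse:
  assumes q: "continuous_map (top_of_set U) X q" and c: "path c" "path_image c \<subseteq> U"
  shows "homologous_rel 1 X {} (frag_of (simplex_of_path (q \<circ> reversepath c)))
     (- frag_of (simplex_of_path (q \<circ> c)))"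
proof -
  have f: "continuous_map (top_of_set {0..1}) X (q \<circ> c)"
    by (rule continuous_map_path_compose[OF q c])
  have "homologous_rel 1 X {} (frag_of (simplex_of_path ((q \<circ> c) \<circ> linepath 0 1)) +
      frag_of (simplex_of_path ((q \<circ> c) \<circ> linepath 1 0)))
      (frag_of (simplex_of_path ((q \<circ> c) \<circ> linepath 0 0)))"
    by (rule homologous_triangle[OF f]) auto
  moreover have "simplex_of_path ((q \<circ> c) \<circ> linepath 0 1) = simplex_of_path (q \<circ> c)"
    "simplex_of_path ((q \<circ> c) \<circ> linepath 1 0) = simplex_of_path (q \<circ> reversepath c)"
    "simplex_of_path ((q \<circ> c) \<circ> linepath 0 0) = simplex_of_path (\<lambda>_. q (c 0))"
    by (rule simplex_of_path_cong; auto simp: linepath_def reversepath_def)+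
  moreover have "q (c 0) \<in> topspace X" using f by (auto simp: continuous_map_def)
  ultimately have "homologous_rel 1 X {} (frag_of (simplex_of_path (q \<circ> c)) +
      frag_of (simplex_of_path (q \<circ> reversepath c))) 0"
    using homologous_const homologous_rel_trans by metis
  then show ?thesis by (simp add: homologous_rel_def algebra_simps)
qed

lemma homologous_simply_connected:
  fixes U :: "'b::real_normed_vector set"
  assumes q: "continuous_map (top_of_set U) X q" and U: "simply_connected U"
    and c: "path c" "path_image c \<subseteq> U" "path c'" "path_image c' \<subseteq> U"
     "pathstart c' = pathstart c" "pathfinish c' = pathfinish c"
  shows "homologous_rel 1 X {} (frag_of (simplex_of_path (q \<circ> c))) (frag_of (simplex_of_path (q \<circ> c')))"
proof -
  have "homotopic_paths U c c'" using U c unfolding simply_connected_eq_homotopic_paths by blast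
  then show ?thesis by (rule homologous_homotopic[OF q])
qed

lemma chain_simplex_of_path:
  assumes "continuous_map (top_of_set {0..1}) X \<gamma>"
  shows "singular_chain 1 X (frag_of (simplex_of_path \<gamma>))"
  using singular_simplex_of_path[OF assms] by (simp add: singular_chain_of)

lemma cycle_simplex_of_loop:
  assumes "continuous_map (top_of_set {0..1}) X \<gamma>" "\<gamma> 0 = \<gamma> 1"
  shows "singular_relcycle 1 X {} (frag_of (simplex_of_path \<gamma>))"
  unfolding singular_cycle using chain_simplex_of_path[OF assms(1)] chain_boundary_simplex_of_path[of \<gamma>] assms(2)
  by simp

lemma frag_extend_frag_extend:
  "frag_extend d (frag_extend F c) = frag_extend (\<lambda>x. frag_extend d (F x)) c"
  by (induction c rule: frag_induction[OF subset_UNIV]) (auto simp: frag_extend_diff)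

text \<open>Joining both ends of every simplex of a cycle to a base point by chains \<open>\<delta> x\<close> does not
  change the cycle, because the \<open>\<delta> x\<close> cancel along its boundary.\<close>

lemma cycle_induct:
  assumes c: "singular_relcycle 1 X {} c"
    and P0: "P 0" and Padd: "\<And>a b. P a \<Longrightarrow> P b \<Longrightarrow> P (a + b)" and Pminus: "\<And>a. P a \<Longrightarrow> P (- a)"
    and path: "\<And>\<gamma>. continuous_map (top_of_set {0..1}) X \<gamma> \<Longrightarrow>
       P (\<delta> (\<gamma> 0) + frag_of (simplex_of_path \<gamma>) - \<delta> (\<gamma> 1))"
  shows "P (c :: 'a chain)"
proof -
  have ch: "singular_chain 1 X c" and bd: "chain_boundary 1 c = 0"
    using c unfolding singular_cycle by auto
  define s where "s \<sigma> = path_of_simplex \<sigma> 0" for \<sigma> :: "(nat \<Rightarrow> real) \<Rightarrow> 'a"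
  define e where "e \<sigma> = path_of_simplex \<sigma> 1" for \<sigma> :: "(nat \<Rightarrow> real) \<Rightarrow> 'a"
  \<comment> \<open>A 0-simplex is determined by its value at the vertex; \<open>d\<close> is
    \<open>\<delta>\<close> read on 0-simplices.\<close>
  define d where "d \<tau> = \<delta> (\<tau> (\<lambda>j. if j = 0 then 1 else 0))" for \<tau> :: "(nat \<Rightarrow> real) \<Rightarrow> 'a"
  have simplex: "singular_simplex 1 X \<sigma>" if "\<sigma> \<in> Poly_Mapping.keys c" for \<sigma>
    using ch that by (auto simp: singular_chain_def)
  have dpt: "d (pt_simplex x) = \<delta> x" for x
    by (simp add: d_def pt_simplex_def)
  have P_int: "P (frag_cmul n a)" if a: "P a" for n :: int and a
  proof (induction n rule: int_induct[of _ 0])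
    case base
    then show ?case using P0 by simp
  next
    case (step1 i)
    then show ?case using Padd[OF step1(2) a] by (simp add: frag_cmul_distrib)
  next
    case (step2 i)
    then show ?case using Padd[OF step2(2) Pminus[OF a]]
      by (simp add: frag_cmul_distrib left_diff_distrib frag_cmul_distrib diff_conv_add_uminus del: add_uminus_conv_diff)
  qed
  have P_sum: "P (sum f A)" if "finite A" "\<And>i. i \<in> A \<Longrightarrow> P (f i)" for f and A :: "((nat \<Rightarrow> real) \<Rightarrow> 'a) set"
    using that by (induction A rule: finite_induct) (auto intro: P0 Padd)
  have "chain_boundary 1 c = frag_extend (\<lambda>\<sigma>. frag_of (pt_simplex (e \<sigma>)) - frag_of (pt_simplex (s \<sigma>))) c"
  proof -
    have "chain_boundary 1 c = frag_extend (\<lambda>\<sigma>. chain_boundary 1 (frag_of \<sigma>)) c"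
      by (simp add: chain_boundary_def)
    also have "\<dots> = frag_extend (\<lambda>\<sigma>. frag_of (pt_simplex (e \<sigma>)) - frag_of (pt_simplex (s \<sigma>))) c"
    proof (rule frag_extend_eq)
      fix \<sigma> assume "\<sigma> \<in> Poly_Mapping.keys c"
      then show "chain_boundary 1 (frag_of \<sigma>) = frag_of (pt_simplex (e \<sigma>)) - frag_of (pt_simplex (s \<sigma>))"
        using simplex_of_path_of_simplex(1)[OF simplex] chain_boundary_simplex_of_path[of "path_of_simplex \<sigma>"]
        by (simp add: s_def e_def)
    qed
    finally show ?thesis .
  qed
  \<comment> \<open>Extending \<open>d\<close> additively and applying it to the boundary, which is
    zero, shows that the connecting chains cancel.\<close>
  then have "0 = frag_extend d (frag_extend (\<lambda>\<sigma>. frag_of (pt_simplex (e \<sigma>)) - frag_of (pt_simplex (s \<sigma>))) c)"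
    using bd by simp
  also have "\<dots> = frag_extend (\<lambda>\<sigma>. \<delta> (e \<sigma>) - \<delta> (s \<sigma>)) c"
    by (simp add: frag_extend_frag_extend frag_extend_diff dpt)
  finally have z: "frag_extend (\<lambda>\<sigma>. \<delta> (e \<sigma>) - \<delta> (s \<sigma>)) c = 0" by simp
  have "frag_extend (\<lambda>\<sigma>. \<delta> (s \<sigma>) + frag_of \<sigma> - \<delta> (e \<sigma>)) c
      = c - frag_extend (\<lambda>\<sigma>. \<delta> (e \<sigma>) - \<delta> (s \<sigma>)) c"
  proof -
    have "frag_cmul n (a + b - d) = frag_cmul n b - frag_cmul n (d - a)" for n and a b d :: "'a chain"
      using frag_cmul_distrib2[of n "a + b - d" "d - a"] by (simp add: algebra_simps)
    then have "frag_extend (\<lambda>\<sigma>. \<delta> (s \<sigma>) + frag_of \<sigma> - \<delta> (e \<sigma>)) c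
      = frag_extend frag_of c - frag_extend (\<lambda>\<sigma>. \<delta> (e \<sigma>) - \<delta> (s \<sigma>)) c"
      by (simp only: frag_extend_def sum_subtractf)
    then show ?thesis by (simp only: frag_expansion[symmetric])
  qed
  then have "c = frag_extend (\<lambda>\<sigma>. \<delta> (s \<sigma>) + frag_of \<sigma> - \<delta> (e \<sigma>)) c" using z by simp
  also have "P \<dots>"
    unfolding frag_extend_def
  proof (rule P_sum)
    fix \<sigma> assume "\<sigma> \<in> Poly_Mapping.keys c"
    then show "P (frag_cmul (Poly_Mapping.lookup c \<sigma>) (\<delta> (s \<sigma>) + frag_of \<sigma> - \<delta> (e \<sigma>)))"
      using path[OF simplex_of_path_of_simplex(2)[OF simplex]] simplex_of_path_of_simplex(1)[OF simplex]
      by (intro P_int) (simp add: s_def e_def)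
  qed auto
  finally show ?thesis .
qed

abbreviation hclass :: "'a topology \<Rightarrow> 'a chain \<Rightarrow> 'a chain set" where
  "hclass X c \<equiv> homologous_rel_set 1 X {} c"

lemma carrier_homology_1:
  "carrier (homology_group 1 X) = hclass X ` singular_relcycle_set 1 X {}"
  using carrier_relative_homology_group[of 1 X "{}"] by simp

lemma one_homology_1: "\<one>\<^bsub>homology_group 1 X\<^esub> = hclass X 0"
  using one_relative_homology_group[of 1 X "{}"] homologous_rel_set_eq_relboundary[of 1 X "{}" 0]
  by simp

lemma mult_homology_1: "hclass X a \<otimes>\<^bsub>homology_group 1 X\<^esub> hclass X b = hclass X (a + b)"
proof -
  have "hclass X a \<otimes>\<^bsub>homology_group (int 1) X\<^esub> hclass X b = (\<Union>r\<in>hclass X a. \<Union>s\<in>hclass X b. {r + s})"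
    by (subst mult_relative_homology_group) simp
  also have "\<dots> = hclass X (a + b)"
  proof (intro equalityI subsetI)
    fix x assume "x \<in> (\<Union>r\<in>hclass X a. \<Union>s\<in>hclass X b. {r + s})"
    then show "x \<in> hclass X (a + b)" using homologous_rel_add by fastforce
  next
    fix x assume "x \<in> hclass X (a + b)"
    then have "homologous_rel 1 X {} b (x - a)"
      by (simp add: homologous_rel_def algebra_simps)
    moreover have "x = a + (x - a)" by simp
    ultimately show "x \<in> (\<Union>r\<in>hclass X a. \<Union>s\<in>hclass X b. {r + s})"
      by (metis (mono_tags, lifting) UN_I homologous_rel_refl mem_Collect_eq singletonI)
  qed
  finally show ?thesis by simp
qed

lemma comm_group_homology_1: "comm_group (homology_group 1 X)"
  using abelian_relative_homology_group by blast

lemma inv_homology_1: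
  assumes "singular_relcycle 1 X {} a"
  shows "inv\<^bsub>homology_group 1 X\<^esub> (hclass X a) = hclass X (- a)"
proof (rule group.inv_equality)
  show "hclass X (-a) \<otimes>\<^bsub>homology_group 1 X\<^esub> hclass X a = \<one>\<^bsub>homology_group 1 X\<^esub>"
    unfolding mult_homology_1 one_homology_1 by simp
  have "singular_relcycle 1 X {} (- a)" using assms by (simp only: singular_relcycle_minus)
  then show "hclass X (- a) \<in> carrier (homology_group 1 X)"
    unfolding carrier_homology_1 by (intro imageI CollectI)
  show "hclass X a \<in> carrier (homology_group 1 X)"
    unfolding carrier_homology_1 using assms by (intro imageI CollectI)
qed simp

section \<open>Charts of the generalized Fermat curve\<close>

lemma proj_point_eqI:
  assumes "t \<noteq> 0" "\<And>i. i \<in> {0..n} \<Longrightarrow> w i = t * v i"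
  shows "proj_point n w = proj_point n v"
proof -
  have "(\<exists>c. c \<noteq> 0 \<and> (\<forall>i\<in>{0..n}. x i = c * w i)) \<longleftrightarrow> (\<exists>c. c \<noteq> 0 \<and> (\<forall>i\<in>{0..n}. x i = c * v i))" for x
  proof
    assume "\<exists>c. c \<noteq> 0 \<and> (\<forall>i\<in>{0..n}. x i = c * w i)"
    then obtain c where "c \<noteq> 0" "\<forall>i\<in>{0..n}. x i = c * w i" by blast
    then show "\<exists>c. c \<noteq> 0 \<and> (\<forall>i\<in>{0..n}. x i = c * v i)"
      using assms by (intro exI[of _ "c * t"]) auto
  next
    assume "\<exists>c. c \<noteq> 0 \<and> (\<forall>i\<in>{0..n}. x i = c * v i)"
    then obtain c where "c \<noteq> 0" "\<forall>i\<in>{0..n}. x i = c * v i" by blast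
    then show "\<exists>c. c \<noteq> 0 \<and> (\<forall>i\<in>{0..n}. x i = c * w i)"
      using assms by (intro exI[of _ "c / t"]) auto
  qed
  then show ?thesis unfolding proj_point_def by blast
qed

lemma proj_point_cong: "(\<And>i. i \<in> {0..n} \<Longrightarrow> w i = v i) \<Longrightarrow> proj_point n w = proj_point n v"
  by (rule proj_point_eqI[of 1]) auto

lemma restrict_in_proj_point: "restrict v {0..n} \<in> proj_point n v"
  unfolding proj_point_def by (auto intro!: exI[of _ 1])

lemma proj_point_eqD:
  assumes "proj_point n w = proj_point n v"
  obtains t where "t \<noteq> 0" "\<And>i. i \<in> {0..n} \<Longrightarrow> w i = t * v i"
proof -
  have "restrict w {0..n} \<in> proj_point n v" using restrict_in_proj_point assms by blast
  then obtain t where t: "t \<noteq> 0" "\<forall>i\<in>{0..n}. restrict w {0..n} i = t * v i"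
    unfolding proj_point_def by blast
  show ?thesis by (rule that[OF t(1)]) (use t(2) in auto)
qed

text \<open>The affine coordinate \<open>x i / x j\<close>; representatives are proportional, so the
  choice does not matter. As division by zero yields 0, \<open>hratio j j\<close> is 1 where
  \<open>x j\<close> is nonzero and 0 elsewhere, which makes it a test for the affine patch.\<close>

definition hratio :: "nat \<Rightarrow> nat \<Rightarrow> (nat \<Rightarrow> complex) set \<Rightarrow> complex" where
  "hratio i j P = (SOME x. x \<in> P) i / (SOME x. x \<in> P) j"

lemma hratio_proj_point:
  assumes "i \<in> {0..n}" "j \<in> {0..n}"
  shows "hratio i j (proj_point n v) = v i / v j"
proof -
  have "(SOME x. x \<in> proj_point n v) \<in> proj_point n v"
    by (rule someI[of "\<lambda>x. x \<in> proj_point n v", OF restrict_in_proj_point])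
  then obtain t where "t \<noteq> 0" "\<forall>i\<in>{0..n}. (SOME x. x \<in> proj_point n v) i = t * v i"
    unfolding proj_point_def by blast
  then show ?thesis using assms by (simp add: hratio_def)
qed

lemma topspace_coord_space:
  "topspace (coord_space n) = {x \<in> extensional {0..n}. \<exists>i\<in>{0..n}. x i \<noteq> 0}"
  by (auto simp: coord_space_def PiE_def)

lemma restrict_in_coord_space:
  "(\<exists>i\<in>{0..n}. v i \<noteq> 0) \<Longrightarrow> restrict v {0..n} \<in> topspace (coord_space n)"
  by (auto simp: topspace_coord_space)

lemma proj_point_restrict: "proj_point n (restrict v {0..n}) = proj_point n v"
  by (rule proj_point_cong) auto

lemma proj_point_in_proj_space:
  "proj_point n v \<in> topspace (proj_space n) \<longleftrightarrow> (\<exists>i\<in>{0..n}. v i \<noteq> 0)"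
proof
  assume "proj_point n v \<in> topspace (proj_space n)"
  then obtain x where x: "x \<in> topspace (coord_space n)" "proj_point n v = proj_point n x"
    by (auto simp: topspace_proj_space)
  from x(2) obtain t where "t \<noteq> 0" "\<And>i. i \<in> {0..n} \<Longrightarrow> v i = t * x i" by (rule proj_point_eqD) blast
  then show "\<exists>i\<in>{0..n}. v i \<noteq> 0" using x(1) by (auto simp: topspace_coord_space)
next
  assume "\<exists>i\<in>{0..n}. v i \<noteq> 0"
  then show "proj_point n v \<in> topspace (proj_space n)"
    unfolding topspace_proj_space using restrict_in_coord_space proj_point_restrict by (metis imageI)
qed

lemma continuous_map_coord: "i \<in> {0..n} \<Longrightarrow> continuous_map (coord_space n) euclidean (\<lambda>x. x i)"
  unfolding coord_space_def
  by (intro continuous_map_from_subtopology continuous_map_product_projection)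

lemma continuous_map_proj_point:
  assumes "\<And>i. i \<in> {0..n} \<Longrightarrow> continuous_on T (f i)" "\<And>y. y \<in> T \<Longrightarrow> \<exists>i\<in>{0..n}. f i y \<noteq> 0"
  shows "continuous_map (top_of_set T) (proj_space n) (\<lambda>y. proj_point n (\<lambda>i. f i y))"
proof -
  have "continuous_map (top_of_set T) (product_topology (\<lambda>_. euclidean) {0..n}) (\<lambda>y. restrict (\<lambda>i. f i y) {0..n})"
    unfolding continuous_map_componentwise using assms(1) by auto
  then have "continuous_map (top_of_set T) (coord_space n) (\<lambda>y. restrict (\<lambda>i. f i y) {0..n})"
    unfolding coord_space_def using assms(2) by (auto simp: continuous_map_in_subtopology)
  then have "continuous_map (top_of_set T) (proj_space n) (proj_point n \<circ> (\<lambda>y. restrict (\<lambda>i. f i y) {0..n}))"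
    using quotient_imp_continuous_map[OF quotient_map_proj_point] by (rule continuous_map_compose)
  then show ?thesis by (simp add: o_def proj_point_restrict)
qed

text \<open>On the affine patch the coordinates are continuous, and openness descends through the
  quotient map. Two coordinates occur jointly because membership in a chart image compares
  \<open>x i\<close> with a function of the chart parameter \<open>x m\<close>.\<close>

lemma openin_hratio:
  assumes "i \<in> {0..n}" "j \<in> {0..n}" "m \<in> {0..n}" "open B"
  shows "openin (proj_space n) {P \<in> topspace (proj_space n). hratio j j P \<noteq> 0 \<and> (hratio i j P, hratio m j P) \<in> B}"
proof -
  define Y where "Y = {x \<in> topspace (coord_space n). x j \<in> - {0::complex}}"
  have Y: "openin (coord_space n) Y"
    unfolding Y_def by (rule openin_continuous_map_preimage[OF continuous_map_coord]) (use assms in auto)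
  have c: "continuous_map (subtopology (coord_space n) Y) euclidean (\<lambda>x. x l)" if "l \<in> {0..n}" for l
    using that by (intro continuous_map_from_subtopology continuous_map_coord)
  have d: "continuous_map (subtopology (coord_space n) Y) euclidean (\<lambda>x. x l / x j)" if "l \<in> {0..n}" for l
    using c[OF that] c[OF assms(2)]
    by (auto simp: continuous_map_atin Y_def intro!: tendsto_divide)
  have "continuous_map (subtopology (coord_space n) Y) euclidean (\<lambda>x. (x i / x j, x m / x j))"
    using d[OF assms(1)] d[OF assms(3)]
    by (auto simp: continuous_map_atin intro!: tendsto_Pair)
  then have "openin (subtopology (coord_space n) Y)
      {x \<in> topspace (subtopology (coord_space n) Y). (x i / x j, x m / x j) \<in> B}"
    by (rule openin_continuous_map_preimage) (use assms in auto)
  then have "openin (coord_space n) {x \<in> topspace (subtopology (coord_space n) Y). (x i / x j, x m / x j) \<in> B}"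
    using Y by (rule openin_trans_full)
  also have "{x \<in> topspace (subtopology (coord_space n) Y). (x i / x j, x m / x j) \<in> B} =
     {x \<in> topspace (coord_space n). proj_point n x \<in> {P \<in> topspace (proj_space n). hratio j j P \<noteq> 0 \<and> (hratio i j P, hratio m j P) \<in> B}}"
    using assms by (auto simp: Y_def hratio_proj_point proj_point_in_proj_space topspace_coord_space)
  finally show ?thesis
    unfolding openin_proj_space by (auto simp: topspace_proj_space)
qed

text \<open>Separates the branches of a k-th root: a ratio of two branches that is close to 1 must
  be 1.\<close>

lemma roots_of_unity_gap:
  assumes "k \<ge> 1"
  obtains e :: real where "e > 0" "\<And>w::complex. w ^ k = 1 \<Longrightarrow> norm (w - 1) < e \<Longrightarrow> w = 1"
proof -
  have "finite {w::complex. w ^ k = 1}" using finite_roots_unity[of k] assms by simp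
  then obtain e where "e > 0" "\<forall>w\<in>{w::complex. w ^ k = 1}. w \<noteq> 1 \<longrightarrow> e \<le> dist 1 w"
    using finite_set_avoid by metis
  then show ?thesis
    by (intro that[of e]) (auto simp: dist_norm norm_minus_commute not_le[symmetric])
qed

definition form_expr :: "nat \<Rightarrow> (nat \<Rightarrow> int) \<Rightarrow> one_form" where
  "form_expr n \<alpha> h s = (h 1 s / h 0 s) powi \<alpha> 1 * deriv (\<lambda>z. h 1 z / h 0 z) s /
     (\<Prod>j=2..n. (h j s / h 0 s) powi \<alpha> j)"

lemma theta_conv: "theta n \<alpha> h = remove_sings (form_expr n \<alpha> h)"
  unfolding theta_def form_expr_def ..

text \<open>Where no coordinate vanishes the expression is analytic, so there is no singularity to
  remove.\<close>

lemma theta_eq_form_expr: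
  assumes "open D" "\<And>i. i \<in> {0..n} \<Longrightarrow> h i holomorphic_on D" "s \<in> D"
    and "\<And>i. i \<in> {0..n} \<Longrightarrow> h i s \<noteq> 0" and n: "n \<ge> 1"
  shows "theta n \<alpha> h s = form_expr n \<alpha> h s"
proof -
  have an: "h i analytic_on {s}" if "i \<in> {0..n}" for i
    using assms that by (meson analytic_at)
  have q: "(\<lambda>z. h i z / h 0 z) analytic_on {s}" if "i \<in> {0..n}" for i
    using an[OF that] an[of 0] assms(4)[of 0] by (auto intro!: analytic_intros)
  have "form_expr n \<alpha> h analytic_on {s}"
    unfolding form_expr_def using q assms(4) n
    by (intro analytic_intros q) (auto simp: prod_zero_iff)
  then show ?thesis unfolding theta_conv by (rule remove_sings_at_analytic)
qed

locale fermat =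
  fixes k n :: nat and r :: "nat \<Rightarrow> complex"
  assumes k: "k \<ge> 2" and n: "n \<ge> 2" and inj_r: "inj_on r {1..n}" and r1: "r 1 = 0"
begin

definition C where "C = fermat_curve k n r"

definition on_curve :: "(nat \<Rightarrow> complex) \<Rightarrow> bool" where
  "on_curve x \<longleftrightarrow> (\<forall>i\<in>{2..n}. r i * x 0 ^ k + x 1 ^ k + x i ^ k = 0)"

lemma on_curve_scale:
  assumes "\<And>i. i \<in> {0..n} \<Longrightarrow> w i = t * v i" "on_curve v"
  shows "on_curve w"
  unfolding on_curve_def
proof
  fix i assume i: "i \<in> {2..n}"
  have "r i * w 0 ^ k + w 1 ^ k + w i ^ k = t ^ k * (r i * v 0 ^ k + v 1 ^ k + v i ^ k)"
    using assms(1)[of 0] assms(1)[of 1] assms(1)[of i] n i by (simp add: power_mult_distrib algebra_simps)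
  then show "r i * w 0 ^ k + w 1 ^ k + w i ^ k = 0" using assms(2) i by (simp add: on_curve_def)
qed

lemma in_C: "proj_point n v \<in> topspace C \<longleftrightarrow> (\<exists>i\<in>{0..n}. v i \<noteq> 0) \<and> on_curve v"
proof
  assume "proj_point n v \<in> topspace C"
  then have 1: "proj_point n v \<in> topspace (proj_space n)"
    and "\<exists>x. proj_point n v = proj_point n x \<and> x \<in> topspace (coord_space n) \<and> on_curve x"
    unfolding C_def fermat_curve_def on_curve_def by auto
  then obtain x where x: "proj_point n v = proj_point n x" "on_curve x" by blast
  from x(1) obtain t where "t \<noteq> 0" "\<And>i. i \<in> {0..n} \<Longrightarrow> v i = t * x i" by (rule proj_point_eqD) blast
  then show "(\<exists>i\<in>{0..n}. v i \<noteq> 0) \<and> on_curve v"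
    using 1 x(2) on_curve_scale by (auto simp: proj_point_in_proj_space)
next
  assume v: "(\<exists>i\<in>{0..n}. v i \<noteq> 0) \<and> on_curve v"
  let ?x = "restrict v {0..n}"
  have "on_curve ?x" by (rule on_curve_scale[of _ 1 v]) (use v in auto)
  moreover have "?x \<in> topspace (coord_space n)" using v restrict_in_coord_space by blast
  moreover have "proj_point n v = proj_point n ?x" by (simp add: proj_point_restrict)
  ultimately show "proj_point n v \<in> topspace C"
    unfolding C_def fermat_curve_def topspace_subtopology on_curve_def
    using v proj_point_in_proj_space by blast
qed

lemma C_E:
  assumes "P \<in> topspace C"
  obtains v where "P = proj_point n v" "\<exists>i\<in>{0..n}. v i \<noteq> 0" "on_curve v"
proof -
  have "P \<in> topspace (proj_space n)" using assms by (auto simp: C_def fermat_curve_def)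
  then obtain v where "P = proj_point n v" by (auto simp: topspace_proj_space)
  then show ?thesis using that assms in_C by auto
qed

lemma continuous_map_C:
  assumes "\<And>i. i \<in> {0..n} \<Longrightarrow> continuous_on T (f i)" "\<And>y. y \<in> T \<Longrightarrow> \<exists>i\<in>{0..n}. f i y \<noteq> 0"
    "\<And>y. y \<in> T \<Longrightarrow> on_curve (\<lambda>i. f i y)"
  shows "continuous_map (top_of_set T) C (\<lambda>y. proj_point n (\<lambda>i. f i y))"
proof -
  have "continuous_map (top_of_set T) (proj_space n) (\<lambda>y. proj_point n (\<lambda>i. f i y))"
    by (rule continuous_map_proj_point[OF assms(1,2)])
  moreover have "proj_point n (\<lambda>i. f i y) \<in> topspace C" if "y \<in> T" for y
    using assms that in_C by blast
  ultimately show ?thesis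
    unfolding C_def fermat_curve_def by (auto simp: continuous_map_in_subtopology)
qed

text \<open>Affine coordinates with \<open>x j = 1\<close>, parametrized by \<open>s = x m\<close>.
  The other coordinates never vanish, so only \<open>s = 0\<close> can lie over a branch value or
  infinity. The two index cases are the finite part, where \<open>m\<close> is the coordinate
  allowed to vanish, and a neighbourhood of a point over infinity. Convexity provides primitives and
  simple connectedness.\<close>

definition chart :: "nat \<Rightarrow> nat \<Rightarrow> complex set \<Rightarrow> (nat \<Rightarrow> complex \<Rightarrow> complex) \<Rightarrow> bool" where
  "chart j m D \<rho> \<longleftrightarrow> (j = 0 \<and> m \<in> {1..n} \<or> j = 1 \<and> m = 0) \<and> open D \<and> convex D \<and>
     (\<forall>i\<in>{0..n}. \<rho> i holomorphic_on D) \<and>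
     (\<forall>s\<in>D. \<rho> j s = 1 \<and> \<rho> m s = s \<and> (\<forall>i\<in>{0..n}. i \<noteq> m \<longrightarrow> \<rho> i s \<noteq> 0) \<and> on_curve (\<lambda>i. \<rho> i s))"

abbreviation cpt :: "(nat \<Rightarrow> complex \<Rightarrow> complex) \<Rightarrow> complex \<Rightarrow> (nat \<Rightarrow> complex) set" where
  "cpt \<rho> s \<equiv> proj_point n (\<lambda>i. \<rho> i s)"

lemma chart_index:
  assumes "chart j m D \<rho>" shows "j \<in> {0..n}" "m \<in> {0..n}" "j \<noteq> m"
  using assms n by (auto simp: chart_def)

lemma chart_coord:
  assumes "chart j m D \<rho>" "s \<in> D"
  shows "hratio m j (cpt \<rho> s) = s" "hratio j j (cpt \<rho> s) = 1"
    "i \<in> {0..n} \<Longrightarrow> hratio i j (cpt \<rho> s) = \<rho> i s"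
proof -
  have s: "\<rho> j s = 1" "\<rho> m s = s" using assms by (auto simp: chart_def)
  show "hratio m j (cpt \<rho> s) = s" "hratio j j (cpt \<rho> s) = 1"
    using s chart_index[OF assms(1)] by (simp_all add: hratio_proj_point)
  show "i \<in> {0..n} \<Longrightarrow> hratio i j (cpt \<rho> s) = \<rho> i s"
    using s chart_index[OF assms(1)] by (simp add: hratio_proj_point)
qed

lemma chart_continuous:
  assumes "chart j m D \<rho>"
  shows "continuous_map (top_of_set D) C (cpt \<rho>)"
proof (rule continuous_map_C)
  show "continuous_on D (\<rho> i)" if "i \<in> {0..n}" for i
    using assms that unfolding chart_def by (blast intro: holomorphic_on_imp_continuous_on)
  show "\<exists>i\<in>{0..n}. \<rho> i y \<noteq> 0" if "y \<in> D" for y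
    using assms that chart_index[OF assms] unfolding chart_def by (metis zero_neq_one)
  show "on_curve (\<lambda>i. \<rho> i y)" if "y \<in> D" for y
    using assms that unfolding chart_def by blast
qed

lemma chart_local_param:
  assumes "chart j m D \<rho>"
  shows "local_param n C D \<rho>"
proof -
  have "inj_on (cpt \<rho>) D" by (rule inj_on_inverseI[of _ "hratio m j"]) (use chart_coord[OF assms] in auto)
  moreover have "\<exists>i\<in>{0..n}. \<rho> i y \<noteq> 0" if "y \<in> D" for y
    using assms that chart_index[OF assms] unfolding chart_def by (metis zero_neq_one)
  moreover have "cpt \<rho> s \<in> topspace C" if "s \<in> D" for s
    using chart_continuous[OF assms] that by (auto simp: continuous_map_def)
  ultimately show ?thesis
    using assms unfolding local_param_def chart_def by blast
qed

text \<open>In terms of the k-th powers the curve is a projective line, cut out by linear equations,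
  and the \<open>j\<close>-th and \<open>m\<close>-th powers are two independent linear coordinates
  on it.\<close>

lemma line_unique:
  assumes jm: "j = 0 \<and> m \<in> {1..n} \<or> j = 1 \<and> m = 0"
    and x: "on_curve x" "on_curve y" and eq: "x j ^ k = y j ^ k" "x m ^ k = y m ^ k" and i: "i \<in> {0..n}"
  shows "x i ^ k = y i ^ k"
proof -
  have e: "x i ^ k = - r i * x 0 ^ k - x 1 ^ k" "y i ^ k = - r i * y 0 ^ k - y 1 ^ k" if "i \<in> {2..n}" for i
    using x that unfolding on_curve_def by (auto simp: algebra_simps eq_neg_iff_add_eq_0)
  have 01: "x 0 ^ k = y 0 ^ k \<and> x 1 ^ k = y 1 ^ k"
  proof (cases "j = 0 \<and> m \<in> {2..n}")
    case True
    then show ?thesis using e[of m] eq by auto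
  next
    case False
    then have "j = 0 \<and> m = 1 \<or> j = 1 \<and> m = 0" using jm by auto
    then show ?thesis using eq by auto
  qed
  show ?thesis
  proof (cases "i \<ge> 2")
    case True
    then show ?thesis using e[of i] 01 i by simp
  next
    case False
    then have "i = 0 \<or> i = 1" by auto
    then show ?thesis using 01 by auto
  qed
qed

text \<open>By \<open>line_unique\<close> each coordinate agrees with the chart up to a k-th root of
  unity, and closeness to the branch chosen by the chart forces that root to be 1.\<close>

lemma chart_eq_iff:
  assumes ch: "chart j m D \<rho>" and e: "\<And>w::complex. w ^ k = 1 \<Longrightarrow> norm (w - 1) < e \<Longrightarrow> w = 1"
    and v: "on_curve v" "v j \<noteq> 0" "v m / v j \<in> D"
    and close: "\<And>i. i \<in> {0..n} \<Longrightarrow> i \<noteq> m \<Longrightarrow> norm (v i / v j / \<rho> i (v m / v j) - 1) < e"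
  shows "proj_point n v = cpt \<rho> (v m / v j)"
proof (rule proj_point_eqI[of "v j"])
  let ?s = "v m / v j"
  have rho: "\<rho> j ?s = 1" "\<rho> m ?s = ?s" "\<And>i. i \<in> {0..n} \<Longrightarrow> i \<noteq> m \<Longrightarrow> \<rho> i ?s \<noteq> 0"
    "on_curve (\<lambda>i. \<rho> i ?s)" using ch v(3) by (auto simp: chart_def)
  have w: "on_curve (\<lambda>i. v i / v j)"
    by (rule on_curve_scale[of _ "1 / v j" v]) (use v in auto)
  have eq: "(v i / v j) ^ k = \<rho> i ?s ^ k" if "i \<in> {0..n}" for i
  proof (rule line_unique[of j m "\<lambda>i. v i / v j" "\<lambda>i. \<rho> i ?s"])
    show "j = 0 \<and> m \<in> {1..n} \<or> j = 1 \<and> m = 0" using ch by (auto simp: chart_def)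
  qed (use w rho that v(2) in simp_all)
  fix i assume i: "i \<in> {0..n}"
  have "v i / v j = \<rho> i ?s"
  proof (cases "i = m")
    case False
    have "(v i / v j / \<rho> i ?s) ^ k = \<rho> i ?s ^ k / \<rho> i ?s ^ k"
      by (simp only: power_divide[of "v i / v j"] eq[OF i])
    then have "(v i / v j / \<rho> i ?s) ^ k = 1" using rho(3)[OF i False] by simp
    then have "v i / v j / \<rho> i ?s = 1" using e close[OF i False] by blast
    then show ?thesis by simp
  qed (use rho in simp)
  then show "v i = v j * \<rho> i ?s" using v(2) by (simp add: field_simps)
qed (use v in auto)

lemma chart_open:
  assumes ch: "chart j m D \<rho>"
  shows "openin C (cpt \<rho> ` D)"
proof -
  obtain e :: real where e: "e > 0" "\<And>w::complex. w ^ k = 1 \<Longrightarrow> norm (w - 1) < e \<Longrightarrow> w = 1"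
    using roots_of_unity_gap[of k] k by auto
  have jm: "j \<in> {0..n}" "m \<in> {0..n}" "j \<noteq> m" using chart_index[OF ch] by auto
  \<comment> \<open>The condition on coordinate \<open>i\<close> that selects the branch of the
    chart. On the curve these open conditions, which include that the parameter lies in
    \<open>D\<close>, cut out exactly the chart image.\<close>
  define B where "B i = {(y, s). s \<in> D \<and> norm (y / \<rho> i s - 1) < e}" for i
  have B: "open (B i)" if i: "i \<in> {0..n} - {m}" for i
  proof -
    have D: "open D" "continuous_on D (\<rho> i)" "\<And>s. s \<in> D \<Longrightarrow> \<rho> i s \<noteq> 0"
      using ch i by (auto simp: chart_def intro: holomorphic_on_imp_continuous_on)
    have "continuous_on (UNIV \<times> D) (\<lambda>x. norm (fst x / \<rho> i (snd x) - 1))"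
      by (intro continuous_intros continuous_on_compose2[OF D(2)]) (use D(3) in auto)
    then have "openin (top_of_set (UNIV \<times> D)) ((UNIV \<times> D) \<inter> (\<lambda>x. norm (fst x / \<rho> i (snd x) - 1)) -` {..<e})"
      by (rule continuous_openin_preimage_gen) auto
    moreover have "open (UNIV \<times> D)" using D(1) by (intro open_Times) auto
    ultimately have "open ((UNIV \<times> D) \<inter> (\<lambda>x. norm (fst x / \<rho> i (snd x) - 1)) -` {..<e})"
      by (rule openin_open_trans)
    also have "(UNIV \<times> D) \<inter> (\<lambda>x. norm (fst x / \<rho> i (snd x) - 1)) -` {..<e} = B i"
      by (auto simp: B_def)
    finally show ?thesis .
  qed
  define W where "W i = {P \<in> topspace (proj_space n). hratio j j P \<noteq> 0 \<and> (hratio i j P, hratio m j P) \<in> B i}" for i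
  have "openin (proj_space n) (\<Inter>i\<in>{0..n} - {m}. W i)"
    by (intro openin_INT2) (use B jm in \<open>auto simp: W_def intro!: openin_hratio\<close>)
  moreover obtain S where S: "C = subtopology (proj_space n) S"
    unfolding C_def fermat_curve_def by blast
  ultimately have "openin C ((\<Inter>i\<in>{0..n} - {m}. W i) \<inter> S)"
    by (simp add: openin_subtopology_Int)
  moreover have "(\<Inter>i\<in>{0..n} - {m}. W i) \<inter> S = topspace C \<inter> (\<Inter>i\<in>{0..n} - {m}. W i)"
    using jm S by (auto simp: W_def)
  ultimately have "openin C (topspace C \<inter> (\<Inter>i\<in>{0..n} - {m}. W i))" by (simp only:)
  also have "topspace C \<inter> (\<Inter>i\<in>{0..n} - {m}. W i) = cpt \<rho> ` D"
  proof (intro equalityI subsetI)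
    fix P assume P: "P \<in> topspace C \<inter> (\<Inter>i\<in>{0..n} - {m}. W i)"
    then obtain v where v: "P = proj_point n v" "on_curve v" by (auto elim: C_E)
    have PW: "P \<in> W i" if "i \<in> {0..n} - {m}" for i using P that by auto
    have "hratio j j P \<noteq> 0" "hratio m j P \<in> D" using PW[of j] jm by (auto simp: W_def B_def)
    then have vj: "v j \<noteq> 0" "v m / v j \<in> D" using v jm by (auto simp: hratio_proj_point)
    have "proj_point n v = cpt \<rho> (v m / v j)"
    proof (rule chart_eq_iff[OF ch e(2) v(2) vj])
      show "norm (v i / v j / \<rho> i (v m / v j) - 1) < e" if "i \<in> {0..n}" "i \<noteq> m" for i
        using PW[of i] that v jm by (auto simp: W_def B_def hratio_proj_point)
    qed
    then show "P \<in> cpt \<rho> ` D" using v vj by auto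
  next
    fix P assume "P \<in> cpt \<rho> ` D"
    then obtain s where s: "s \<in> D" "P = cpt \<rho> s" by auto
    have PC: "P \<in> topspace C" using chart_continuous[OF ch] s by (auto simp: continuous_map_def)
    then have "P \<in> topspace (proj_space n)" by (auto simp: C_def fermat_curve_def)
    moreover have "\<rho> i s \<noteq> 0" if "i \<in> {0..n} - {m}" for i using ch s that by (auto simp: chart_def)
    ultimately show "P \<in> topspace C \<inter> (\<Inter>i\<in>{0..n} - {m}. W i)"
      using PC e(1) s chart_coord[OF ch s(1)] jm by (auto simp: W_def B_def)
  qed
  finally show ?thesis .
qed

lemma chart_subset: "chart j m D \<rho> \<Longrightarrow> open D' \<Longrightarrow> convex D' \<Longrightarrow> D' \<subseteq> D \<Longrightarrow> chart j m D' \<rho>"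
  unfolding chart_def by (auto intro: holomorphic_on_subset)

text \<open>Two local integrals of the same form differ by a constant where their parametrizations
  overlap; the coordinate change is \<open>\<psi> = h m / h j\<close>, and the pulled-back forms can be compared
  off its at most one zero.\<close>

lemma chart_compare:
  assumes ch: "chart j m D \<rho>" and lp: "local_param n C D' h"
    and F: "\<And>s. s \<in> D' \<Longrightarrow> (F has_field_derivative theta n \<alpha> h s) (at s)"
    and \<Phi>: "\<And>s. s \<in> D \<Longrightarrow> (\<Phi> has_field_derivative theta n \<alpha> \<rho> s) (at s)"
    and s0: "s0 \<in> D'" "cpt h s0 \<in> cpt \<rho> ` D"
  shows "\<exists>e>0. ball s0 e \<subseteq> D' \<and> (\<forall>s\<in>ball s0 e. cpt h s \<in> cpt \<rho> ` D \<and>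
     F s - \<Phi> (hratio m j (cpt h s)) = F s0 - \<Phi> (hratio m j (cpt h s0)))"
proof -
  have jm: "j \<in> {0..n}" "m \<in> {0..n}" "j \<noteq> m" using chart_index[OF ch] by auto
  have D': "open D'" and hol: "\<And>i. i \<in> {0..n} \<Longrightarrow> h i holomorphic_on D'"
    and nz: "\<And>s. s \<in> D' \<Longrightarrow> \<exists>i\<in>{0..n}. h i s \<noteq> 0" and hC: "\<And>s. s \<in> D' \<Longrightarrow> cpt h s \<in> topspace C"
    and inj: "inj_on (cpt h) D'" using lp by (auto simp: local_param_def)
  have "continuous_map (top_of_set D') C (cpt h)"
    by (rule continuous_map_C) (use hol nz hC in_C in \<open>auto intro: holomorphic_on_imp_continuous_on\<close>)
  then have "openin (top_of_set D') {s \<in> D'. cpt h s \<in> cpt \<rho> ` D}"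
    using openin_continuous_map_preimage[OF _ chart_open[OF ch]] by fastforce
  then have "open {s \<in> D'. cpt h s \<in> cpt \<rho> ` D}" using D' by (rule openin_open_trans)
  then obtain e where e: "e > 0" "ball s0 e \<subseteq> {s \<in> D'. cpt h s \<in> cpt \<rho> ` D}"
    using s0 unfolding open_contains_ball by blast
  let ?B = "ball s0 e"
  define \<psi> where "\<psi> s = h m s / h j s" for s
  have \<psi>: "hratio m j (cpt h s) = \<psi> s" for s using jm by (simp add: \<psi>_def hratio_proj_point)
  have B: "s \<in> D'" "\<psi> s \<in> D" "h j s \<noteq> 0" "cpt h s = cpt \<rho> (\<psi> s)"
     "\<And>i. i \<in> {0..n} \<Longrightarrow> h i s / h j s = \<rho> i (\<psi> s)" if "s \<in> ?B" for s
  proof -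
    have "s \<in> {s \<in> D'. cpt h s \<in> cpt \<rho> ` D}" using that e(2) by blast
    then obtain w where w: "s \<in> D'" "w \<in> D" "cpt h s = cpt \<rho> w" by auto
    have "w = \<psi> s" using \<psi>[of s] w chart_coord(1)[OF ch w(2)] by simp
    moreover have "h j s / h j s = 1"
      using w chart_coord(2)[OF ch w(2)] hratio_proj_point[OF jm(1) jm(1), of "\<lambda>i. h i s"] by simp
    moreover have "h i s / h j s = \<rho> i w" if "i \<in> {0..n}" for i
      using w chart_coord(3)[OF ch w(2) that] hratio_proj_point[OF that jm(1), of "\<lambda>i. h i s"] by simp
    ultimately show "s \<in> D'" "\<psi> s \<in> D" "h j s \<noteq> 0" "cpt h s = cpt \<rho> (\<psi> s)"
      "\<And>i. i \<in> {0..n} \<Longrightarrow> h i s / h j s = \<rho> i (\<psi> s)" using w by auto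
  qed
  have rho: "\<rho> i holomorphic_on D" if "i \<in> {0..n}" for i using ch that by (auto simp: chart_def)
  have Dopen: "open D" using ch by (auto simp: chart_def)
  have \<psi>hol: "\<psi> holomorphic_on ?B"
    unfolding \<psi>_def using B(1,3) jm by (intro holomorphic_intros holomorphic_on_subset[OF hol]) auto
  \<comment> \<open>At a zero of \<open>\<psi>\<close> a coordinate vanishes and the expression of
    the form says nothing. Injectivity of the parametrization \<open>h\<close> leaves at most one
    such point.\<close>
  define K where "K = {s \<in> ?B. \<psi> s = 0}"
  have "s = s'" if "s \<in> K" "s' \<in> K" for s s'
  proof -
    have s: "s \<in> ?B" "s' \<in> ?B" "\<psi> s = \<psi> s'" using that by (auto simp: K_def)
    then have "cpt h s = cpt h s'" using B(4) by metis
    then show ?thesis using inj B(1) s by (metis inj_onD)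
  qed
  then have "K \<subseteq> {SOME s. s \<in> K}" by (metis singletonI someI subsetI)
  then have K: "finite K" by (rule finite_subset) auto
  define g where "g s = F s - \<Phi> (\<psi> s)" for s
  have der\<psi>: "(\<psi> has_field_derivative deriv \<psi> s) (at s)" if "s \<in> ?B" for s
    using \<psi>hol that by (simp add: holomorphic_derivI)
  have der: "(g has_field_derivative theta n \<alpha> h s - theta n \<alpha> \<rho> (\<psi> s) * deriv \<psi> s) (at s)" if "s \<in> ?B" for s
    unfolding g_def
    by (intro DERIV_diff F B DERIV_chain2[OF \<Phi>] der\<psi>) (use that B in auto)
  have zero: "theta n \<alpha> h s = theta n \<alpha> \<rho> (\<psi> s) * deriv \<psi> s" if s: "s \<in> ?B - K" for s
  proof -
    have sB: "s \<in> ?B" and \<psi>0: "\<psi> s \<noteq> 0" using s by (auto simp: K_def)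
    have r0: "\<rho> i (\<psi> s) \<noteq> 0" if "i \<in> {0..n}" for i
      using ch B(2)[OF sB] \<psi>0 that by (cases "i = m") (auto simp: chart_def)
    have h0: "h i s \<noteq> 0" if "i \<in> {0..n}" for i
      using B(5)[OF sB that] r0[OF that] by auto
    have quot: "h i z / h 0 z = \<rho> i (\<psi> z) / \<rho> 0 (\<psi> z)" if "i \<in> {0..n}" "z \<in> ?B" for i z
    proof -
      have "h i z / h 0 z = (h i z / h j z) / (h 0 z / h j z)" using B(3)[OF that(2)] by simp
      then show ?thesis using B(5)[OF that(2,1)] B(5)[OF that(2), of 0] by simp
    qed
    have "((\<lambda>z. \<rho> 1 (\<psi> z) / \<rho> 0 (\<psi> z)) has_field_derivative
        deriv (\<lambda>w. \<rho> 1 w / \<rho> 0 w) (\<psi> s) * deriv \<psi> s) (at s)"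
    proof (rule DERIV_chain2[where f = "\<lambda>w. \<rho> 1 w / \<rho> 0 w"])
      have "(\<lambda>w. \<rho> 1 w / \<rho> 0 w) analytic_on {\<psi> s}"
        using rho[of 0] rho[of 1] n Dopen B(2)[OF sB] r0[of 0]
        by (intro analytic_intros) (auto simp: analytic_at)
      then show "((\<lambda>w. \<rho> 1 w / \<rho> 0 w) has_field_derivative deriv (\<lambda>w. \<rho> 1 w / \<rho> 0 w) (\<psi> s)) (at (\<psi> s))"
        using analytic_derivI by blast
    qed (rule der\<psi>[OF sB])
    then have "((\<lambda>z. h 1 z / h 0 z) has_field_derivative
        deriv (\<lambda>w. \<rho> 1 w / \<rho> 0 w) (\<psi> s) * deriv \<psi> s) (at s)"
      by (rule has_field_derivative_transform_within_open[of _ _ _ ?B]) (use sB quot[of 1] n in auto)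
    then have d: "deriv (\<lambda>z. h 1 z / h 0 z) s = deriv (\<lambda>w. \<rho> 1 w / \<rho> 0 w) (\<psi> s) * deriv \<psi> s"
      by (rule DERIV_imp_deriv)
    have "form_expr n \<alpha> h s = form_expr n \<alpha> \<rho> (\<psi> s) * deriv \<psi> s"
      unfolding form_expr_def d using quot[OF _ sB] n by simp
    moreover have "theta n \<alpha> h s = form_expr n \<alpha> h s"
      by (rule theta_eq_form_expr[OF D' hol B(1)[OF sB] h0]) (use n in auto)
    moreover have "theta n \<alpha> \<rho> (\<psi> s) = form_expr n \<alpha> \<rho> (\<psi> s)"
      by (rule theta_eq_form_expr[OF Dopen rho B(2)[OF sB] r0]) (use n in auto)
    ultimately show ?thesis by simp
  qed
  \<comment> \<open>Continuity of \<open>g\<close> carries constancy across the exceptional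
    point.\<close>
  have "continuous_on ?B g"
    using der by (meson DERIV_isCont continuous_at_imp_continuous_on)
  moreover have "\<forall>s\<in>?B - K. (g has_field_derivative 0) (at s)"
    using der zero by fastforce
  ultimately obtain c where c: "\<And>s. s \<in> ?B \<Longrightarrow> g s = c"
    using DERIV_zero_connected_constant[OF connected_ball open_ball K] by metis
  have gg: "F s - \<Phi> (hratio m j (cpt h s)) = F s0 - \<Phi> (hratio m j (cpt h s0))" if "s \<in> ?B" for s
    using c[OF that] c[of s0] e(1) unfolding \<psi> g_def by simp
  have "?B \<subseteq> D'" using B(1) by blast
  moreover have "cpt h s \<in> cpt \<rho> ` D" if "s \<in> ?B" for s
    unfolding B(4)[OF that] using B(2)[OF that] by (rule imageI)
  ultimately show ?thesis
    using e(1) gg by (intro exI[of _ e] conjI ballI)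
qed

end

section \<open>Existence of charts, and holomorphy of the forms in them\<close>

lemma holomorphic_root:
  assumes D: "convex D" and f: "f holomorphic_on D" "\<And>s. s \<in> D \<Longrightarrow> f s \<noteq> 0"
    and s0: "s0 \<in> D" "y ^ k = f s0" and k: "k \<ge> (1::nat)"
  obtains \<rho> where "\<rho> holomorphic_on D" "\<And>s. s \<in> D \<Longrightarrow> \<rho> s ^ k = f s" "\<rho> s0 = y"
proof -
  obtain g where g: "g holomorphic_on D" "\<And>z. z \<in> D \<Longrightarrow> f z = exp (g z)"
    using contractible_imp_holomorphic_log[OF f(1) convex_imp_contractible[OF D]] f(2) by metis
  \<comment> \<open>The branch of the root is fixed by its value \<open>y\<close> at
    \<open>s0\<close>, so the logarithm enters only through its increment from there.\<close>
  define \<rho> where "\<rho> s = y * exp ((g s - g s0) / of_nat k)" for s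
  show ?thesis
  proof
    show "\<rho> holomorphic_on D" unfolding \<rho>_def by (intro holomorphic_intros g) (use k in auto)
    show "\<rho> s0 = y" by (simp add: \<rho>_def)
    fix s assume s: "s \<in> D"
    have "\<rho> s ^ k = y ^ k * exp (of_nat k * ((g s - g s0) / of_nat k))"
      unfolding \<rho>_def power_mult_distrib exp_of_nat_mult ..
    also have "\<dots> = exp (g s0) * exp (g s - g s0)" using k s0 g(2) by simp
    also have "\<dots> = f s" using g(2)[OF s] by (simp flip: exp_add)
    finally show "\<rho> s ^ k = f s" .
  qed
qed

lemma prod_power_int_same:
  assumes "s \<noteq> (0::complex)"
  shows "(\<Prod>j\<in>A. s powi a j) = s powi (\<Sum>j\<in>A. a j)"
  by (induction A rule: infinite_finite_induct) (use assms in \<open>auto simp: power_int_add\<close>)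

lemma theta_extends:
  assumes D: "open D" and \<omega>: "\<omega> holomorphic_on D"
    and eq: "\<And>s. s \<in> D \<Longrightarrow> s \<noteq> 0 \<Longrightarrow> form_expr n \<alpha> h s = \<omega> s" and s: "s \<in> D"
  shows "theta n \<alpha> h s = \<omega> s"
  unfolding theta_conv
proof (rule remove_sings_eqI)
  have "isCont \<omega> s" using \<omega> D s by (meson continuous_on_eq_continuous_at holomorphic_on_imp_continuous_on)
  then have "(\<omega> \<longlongrightarrow> \<omega> s) (at s)" by (simp add: isCont_def)
  moreover have "\<forall>\<^sub>F z in at s. \<omega> z = form_expr n \<alpha> h z"
  proof -
    \<comment> \<open>The expression is known to equal \<open>\<omega>\<close> only off 0. When
      \<open>s\<close> is another point, 0 must be removed; when \<open>s = 0\<close>, the punctured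
      filter removes it already.\<close>
    let ?S = "if s = 0 then D else D - {0}"
    have "open ?S" "s \<in> ?S" using D s by auto
    moreover have "\<omega> z = form_expr n \<alpha> h z" if "z \<in> ?S" "z \<noteq> s" for z
      using that eq by (auto split: if_splits)
    ultimately show ?thesis unfolding eventually_at_topological by blast
  qed
  ultimately show "(form_expr n \<alpha> h \<longlongrightarrow> \<omega> s) (at s)" by (rule Lim_transform_eventually)
qed

text \<open>The sign for which \<open>y i ^ k = eps i * (z - r i)\<close> holds for all
  \<open>i\<close>, as the first coordinate satisfies \<open>y 1 ^ k = - z\<close> and
  \<open>r 1 = 0\<close>.\<close>

definition eps :: "nat \<Rightarrow> complex" where
  "eps i = (if i = 1 then -1 else 1)"

lemma eps_simps [simp]: "eps i * eps i = 1" "eps i * (eps i * x) = x" "eps i \<noteq> 0"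
  by (auto simp: eps_def)

context fermat
begin

lemma on_curve_affine:
  assumes "x 0 = 1" "\<And>i. i \<in> {1..n} \<Longrightarrow> x i ^ k = eps i * (z - r i)"
  shows "on_curve x"
  unfolding on_curve_def
proof
  fix i assume "i \<in> {2..n}"
  then show "r i * x 0 ^ k + x 1 ^ k + x i ^ k = 0"
    using assms(1) assms(2)[of 1] assms(2)[of i] r1 by (simp add: eps_def)
qed

lemma on_curve_affineD:
  assumes "x 0 = 1" "on_curve x" "i \<in> {1..n}"
  shows "x i ^ k = eps i * (- (x 1 ^ k) - r i)"
proof (cases "i = 1")
  case False
  then have "r i * x 0 ^ k + x 1 ^ k + x i ^ k = 0" using assms by (auto simp: on_curve_def)
  then show ?thesis using assms(1) False by (simp add: eps_def algebra_simps eq_neg_iff_add_eq_0)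
qed (use r1 in \<open>simp add: eps_def\<close>)

text \<open>With \<open>s = y m\<close> the base coordinate is \<open>r m + eps m * s ^ k\<close>,
  since \<open>eps m\<close> is its own inverse. The other coordinates are k-th roots of functions
  without zeros on the convex set \<open>D\<close>, normalized at \<open>s0\<close>.\<close>

lemma chart_affine:
  assumes m: "m \<in> {1..n}" and D: "open D" "convex D"
    and avoid: "\<And>s i. s \<in> D \<Longrightarrow> i \<in> {1..n} \<Longrightarrow> i \<noteq> m \<Longrightarrow> r m + eps m * s ^ k \<noteq> r i"
    and s0: "s0 \<in> D" "\<And>i. i \<in> {1..n} \<Longrightarrow> i \<noteq> m \<Longrightarrow> y i ^ k = eps i * (r m + eps m * s0 ^ k - r i)"
  obtains \<rho> where "chart 0 m D \<rho>" "\<And>i. i \<in> {1..n} \<Longrightarrow> i \<noteq> m \<Longrightarrow> \<rho> i s0 = y i"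
proof -
  have "\<exists>\<rho>. \<rho> holomorphic_on D \<and> (\<forall>s\<in>D. \<rho> s ^ k = eps i * (r m + eps m * s ^ k - r i)) \<and> \<rho> s0 = y i"
    if i: "i \<in> {1..n}" "i \<noteq> m" for i
  proof -
    have nz: "eps i * (r m + eps m * s ^ k - r i) \<noteq> 0" if "s \<in> D" for s
      using avoid[OF that i] by simp
    have hol: "(\<lambda>s. eps i * (r m + eps m * s ^ k - r i)) holomorphic_on D"
      by (intro holomorphic_intros)
    have "1 \<le> k" using k by simp
    then show ?thesis
      using holomorphic_root[OF D(2) hol nz s0(1) s0(2)[OF i]] by metis
  qed
  then obtain \<rho>' where \<rho>': "\<And>i. i \<in> {1..n} \<Longrightarrow> i \<noteq> m \<Longrightarrow> \<rho>' i holomorphic_on D \<and>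
      (\<forall>s\<in>D. \<rho>' i s ^ k = eps i * (r m + eps m * s ^ k - r i)) \<and> \<rho>' i s0 = y i"
    by metis
  define \<rho> where "\<rho> i = (if i = 0 then (\<lambda>s. 1) else if i = m then (\<lambda>s. s) else \<rho>' i)" for i :: nat
  have "chart 0 m D \<rho>"
    unfolding chart_def
  proof (intro conjI ballI impI)
    show "\<rho> i holomorphic_on D" if "i \<in> {0..n}" for i
      using \<rho>'[of i] that by (auto simp: \<rho>_def)
    fix s assume s: "s \<in> D"
    show "\<rho> i s \<noteq> 0" if i: "i \<in> {0..n}" "i \<noteq> m" for i
    proof (cases "i = 0")
      case False
      have "\<rho> i s ^ k \<noteq> 0" using \<rho>'[of i] avoid[OF s, of i] i s False by (auto simp: \<rho>_def)
      then show ?thesis using k by auto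
    qed (simp add: \<rho>_def)
    show "on_curve (\<lambda>i. \<rho> i s)"
    proof (rule on_curve_affine[of _ "r m + eps m * s ^ k"])
      show "\<rho> i s ^ k = eps i * (r m + eps m * s ^ k - r i)" if i: "i \<in> {1..n}" for i
        using \<rho>'[of i] i s by (auto simp: \<rho>_def)
    qed (simp add: \<rho>_def)
  qed (use m D in \<open>auto simp: \<rho>_def\<close>)
  then show ?thesis using that \<rho>' by (auto simp: \<rho>_def)
qed

text \<open>The coordinates other than \<open>y m\<close> are nonzero, so on a small ball about
  \<open>y m\<close> the base coordinate avoids their branch values.\<close>

lemma chart_at:
  assumes m: "m \<in> {1..n}" and y: "\<And>i. i \<in> {1..n} \<Longrightarrow> y i ^ k = eps i * (z - r i)"
    and nz: "\<And>i. i \<in> {1..n} \<Longrightarrow> i \<noteq> m \<Longrightarrow> y i \<noteq> 0"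
  obtains D \<rho> where "chart 0 m D \<rho>" "y m \<in> D"
    "cpt \<rho> (y m) = proj_point n (\<lambda>i. if i = 0 then 1 else y i)"
proof -
  define E where "E = (\<Inter>i\<in>{1..n} - {m}. {s. r m + eps m * s ^ k \<noteq> r i})"
  have z: "r m + eps m * y m ^ k = z" using y[OF m] by simp
  have "open {s. r m + eps m * s ^ k \<noteq> r i}" for i
    by (intro open_Collect_neq continuous_intros)
  then have "open E" unfolding E_def by (intro open_INT) auto
  moreover have "y m \<in> E"
    unfolding E_def using z y nz k by fastforce
  ultimately obtain e where e: "e > 0" "ball (y m) e \<subseteq> E" unfolding open_contains_ball by blast
  have avoid: "r m + eps m * s ^ k \<noteq> r i" if "s \<in> ball (y m) e" "i \<in> {1..n}" "i \<noteq> m" for s i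
    using e(2) that unfolding E_def by blast
  obtain \<rho> where \<rho>: "chart 0 m (ball (y m) e) \<rho>" "\<And>i. i \<in> {1..n} \<Longrightarrow> i \<noteq> m \<Longrightarrow> \<rho> i (y m) = y i"
    by (rule chart_affine[OF m, of "ball (y m) e" "y m" y]) (use avoid e(1) z y in auto)
  have "\<rho> 0 (y m) = 1" "\<rho> m (y m) = y m" using \<rho>(1) e(1) by (auto simp: chart_def)
  then have "cpt \<rho> (y m) = proj_point n (\<lambda>i. if i = 0 then 1 else y i)"
    using \<rho>(2) by (intro proj_point_cong) (metis One_nat_def atLeastAtMost_iff not_less_eq_eq le_zero_eq)
  then show ?thesis using that[OF \<rho>(1)] e(1) by auto
qed

text \<open>Over infinity one normalizes \<open>x 1 = 1\<close> and takes \<open>s = x 0\<close>;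
  then \<open>x i ^ k = - (1 + r i * s ^ k)\<close>, which is -1 at the point itself.\<close>

lemma chart_infinity:
  assumes y: "\<And>i. i \<in> {2..n} \<Longrightarrow> y i ^ k = -1"
  obtains D \<rho> where "chart 1 0 D \<rho>" "0 \<in> D" "\<And>i. i \<in> {2..n} \<Longrightarrow> \<rho> i 0 = y i"
proof -
  define E where "E = (\<Inter>i\<in>{2..n}. {s. 1 + r i * s ^ k \<noteq> 0})"
  have "open {s. 1 + r i * s ^ k \<noteq> 0}" for i
    by (intro open_Collect_neq continuous_intros)
  then have "open E" unfolding E_def by (intro open_INT) auto
  moreover have "0 \<in> E" unfolding E_def using k by (auto simp: power_0_left)
  ultimately obtain e where e: "e > 0" "ball 0 e \<subseteq> E" unfolding open_contains_ball by blast
  let ?D = "ball (0::complex) e"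
  have "\<exists>\<rho>. \<rho> holomorphic_on ?D \<and> (\<forall>s\<in>?D. \<rho> s ^ k = - (1 + r i * s ^ k)) \<and> \<rho> 0 = y i"
    if i: "i \<in> {2..n}" for i
  proof -
    have "1 + r i * s ^ k \<noteq> 0" if "s \<in> ?D" for s
      using e(2) that i unfolding E_def by blast
    then have "- (1 + r i * s ^ k) \<noteq> 0" if "s \<in> ?D" for s
      unfolding neg_equal_0_iff_equal using that by blast
    moreover have "y i ^ k = - (1 + r i * 0 ^ k)" using y[OF i] k by simp
    moreover have "(\<lambda>s. - (1 + r i * s ^ k)) holomorphic_on ?D" by (intro holomorphic_intros)
    moreover have "1 \<le> k" using k by simp
    moreover have "0 \<in> ?D" using e(1) by simp
    ultimately obtain \<rho> where "\<rho> holomorphic_on ?D" "\<And>s. s \<in> ?D \<Longrightarrow> \<rho> s ^ k = - (1 + r i * s ^ k)" "\<rho> 0 = y i"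
      using holomorphic_root[OF convex_ball, of "\<lambda>s. - (1 + r i * s ^ k)" 0 e 0 "y i" k] by blast
    then show ?thesis by blast
  qed
  then obtain \<rho>' where \<rho>': "\<And>i. i \<in> {2..n} \<Longrightarrow> \<rho>' i holomorphic_on ?D \<and>
      (\<forall>s\<in>?D. \<rho>' i s ^ k = - (1 + r i * s ^ k)) \<and> \<rho>' i 0 = y i"
    by metis
  define \<rho> where "\<rho> i = (if i = 0 then (\<lambda>s. s) else if i = 1 then (\<lambda>s. 1) else \<rho>' i)" for i :: nat
  have "chart 1 0 ?D \<rho>"
    unfolding chart_def
  proof (intro conjI ballI impI)
    show "\<rho> i holomorphic_on ?D" if "i \<in> {0..n}" for i
      using \<rho>'[of i] that by (auto simp: \<rho>_def)
    fix s assume s: "s \<in> ?D"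
    show "\<rho> i s \<noteq> 0" if i: "i \<in> {0..n}" "i \<noteq> 0" for i
    proof (cases "i = 1")
      case False
      then have i2: "i \<in> {2..n}" using i by auto
      have "1 + r i * s ^ k \<noteq> 0" using e(2) s i2 unfolding E_def by blast
      then have "- (1 + r i * s ^ k) \<noteq> 0" unfolding neg_equal_0_iff_equal .
      moreover have "\<rho> i s ^ k = - (1 + r i * s ^ k)" using \<rho>'[OF i2] s i2 by (simp add: \<rho>_def)
      ultimately have "\<rho> i s ^ k \<noteq> 0" by (simp only: not_False_eq_True)
      then show ?thesis using k by auto
    qed (simp add: \<rho>_def)
    show "on_curve (\<lambda>i. \<rho> i s)"
      unfolding on_curve_def
    proof
      fix i assume i: "i \<in> {2..n}"
      then have "\<rho> i s ^ k = - (1 + r i * s ^ k)" using \<rho>'[OF i] s by (auto simp: \<rho>_def)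
      then show "r i * \<rho> 0 s ^ k + \<rho> 1 s ^ k + \<rho> i s ^ k = 0" by (simp add: \<rho>_def)
    qed
  qed (auto simp: \<rho>_def)
  then show ?thesis using that[of ?D \<rho>] \<rho>' e(1) by (auto simp: \<rho>_def)
qed

lemma chart_exists:
  assumes "P \<in> topspace C"
  obtains j m D \<rho> where "chart j m D \<rho>" "P \<in> cpt \<rho> ` D"
proof -
  obtain v where v: "P = proj_point n v" "\<exists>i\<in>{0..n}. v i \<noteq> 0" "on_curve v"
    using C_E[OF assms] .
  show ?thesis
  proof (cases "v 0 = 0")
    case False
    define y where "y i = v i / v 0" for i
    have "on_curve y" unfolding y_def by (rule on_curve_scale[of _ "1 / v 0" v]) (use v in auto)
    moreover have y0: "y 0 = 1" using False by (simp add: y_def)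
    ultimately have y: "y i ^ k = eps i * (- (y 1 ^ k) - r i)" if "i \<in> {1..n}" for i
      using on_curve_affineD that by blast
    \<comment> \<open>The parameter is the vanishing coordinate if there is one. There is at most
      one, since two would force two equal branch values.\<close>
    define m where "m = (if \<exists>m\<in>{1..n}. y m = 0 then SOME m. m \<in> {1..n} \<and> y m = 0 else 1)"
    have m: "m \<in> {1..n} \<and> ((\<exists>m\<in>{1..n}. y m = 0) \<longrightarrow> y m = 0)"
    proof (cases "\<exists>m\<in>{1..n}. y m = 0")
      case True
      then have "\<exists>m. m \<in> {1..n} \<and> y m = 0" by blast
      from someI_ex[OF this] True show ?thesis unfolding m_def by simp
    next
      case False
      then show ?thesis using n unfolding m_def by simp
    qed
    have nz: "y i \<noteq> 0" if i: "i \<in> {1..n}" "i \<noteq> m" for i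
    proof
      assume 0: "y i = 0"
      then have "y m = 0" using m i by blast
      then have "r i = r m" using 0 y[of i] y[of m] m i k by (simp add: power_0_left)
      then show False using inj_r m i by (auto dest: inj_onD)
    qed
    obtain D \<rho> where *: "chart 0 m D \<rho>" "y m \<in> D" "cpt \<rho> (y m) = proj_point n (\<lambda>i. if i = 0 then 1 else y i)"
      by (rule chart_at[OF conjunct1[OF m] y nz]) (assumption | rule that)+
    have "P = proj_point n (\<lambda>i. if i = 0 then 1 else y i)"
      unfolding v(1) by (rule proj_point_eqI[of "v 0"]) (use False in \<open>auto simp: y_def\<close>)
    then have "P = cpt \<rho> (y m)" using *(3) by simp
    then have "P \<in> cpt \<rho> ` D" using *(2) by (rule image_eqI)
    then show ?thesis by (rule that[OF *(1)])
  next
    case True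
    have e: "v i ^ k = - (v 1 ^ k)" if "i \<in> {2..n}" for i
      using v(3) True that k by (auto simp: on_curve_def eq_neg_iff_add_eq_0 add.commute power_0_left)
    \<comment> \<open>When \<open>v 0 = 0\<close>, the k-th powers of the coordinates from 2 on all
      equal \<open>- (v 1 ^ k)\<close>, so \<open>v 1 = 0\<close> would make every coordinate
      vanish.\<close>
    have v1: "v 1 \<noteq> 0"
    proof
      assume 1: "v 1 = 0"
      have "v i = 0" if "i \<in> {0..n}" for i
      proof (cases "i \<ge> 2")
        case True
        then show ?thesis using e[of i] 1 that k by (simp add: power_0_left)
      next
        case False
        then have "i = 0 \<or> i = 1" by auto
        then show ?thesis using 1 \<open>v 0 = 0\<close> by auto
      qed
      then show False using v(2) by blast
    qed
    obtain D \<rho> where *: "chart 1 0 D \<rho>" "0 \<in> D" "\<And>i. i \<in> {2..n} \<Longrightarrow> \<rho> i 0 = v i / v 1"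
      by (rule chart_infinity[of "\<lambda>i. v i / v 1"]) (use e v1 in \<open>auto simp: power_divide\<close>)
    have **: "\<rho> 1 0 = 1" "\<rho> 0 0 = 0" using *(1,2) by (auto simp: chart_def)
    have "P = cpt \<rho> 0"
      unfolding v(1)
    proof (rule proj_point_eqI[of "v 1"])
      fix i assume i: "i \<in> {0..n}"
      show "v i = v 1 * \<rho> i 0"
      proof (cases "i \<ge> 2")
        case True
        then show ?thesis using *(3)[of i] i v1 by simp
      next
        case False
        then have "i = 0 \<or> i = 1" by auto
        then show ?thesis using ** \<open>v 0 = 0\<close> by auto
      qed
    qed (use v1 in auto)
    then have "P \<in> cpt \<rho> ` D" using *(2) by (rule image_eqI)
    then show ?thesis by (rule that[OF *(1)])
  qed
qed

text \<open>The upper bounds in \<open>form_index\<close> and \<open>0 \<le> \<alpha> 1\<close> say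
  precisely that the exponent of \<open>s\<close> is nonnegative in each kind of chart. It is
  \<open>\<alpha> 1\<close> for \<open>m = 1\<close>; it is \<open>k - 1 - \<alpha> m\<close> for
  \<open>m \<ge> 2\<close>, where dy1 = - s^(k-1) y1^(1-k) ds; at infinity, where y1 = 1/s, it is
  the sum of the other \<open>\<alpha> i\<close> minus \<open>2 + \<alpha> 1\<close>.\<close>

lemma chart_form:
  assumes ch: "chart j m D \<rho>" and \<alpha>: "\<alpha> \<in> form_index k n"
  obtains \<omega> where "\<omega> holomorphic_on D" "\<And>s. s \<in> D \<Longrightarrow> s \<noteq> 0 \<Longrightarrow> form_expr n \<alpha> \<rho> s = \<omega> s"
proof -
  have D: "open D" and hol: "\<And>i. i \<in> {0..n} \<Longrightarrow> \<rho> i holomorphic_on D"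
    and nz: "\<And>i s. s \<in> D \<Longrightarrow> i \<in> {0..n} \<Longrightarrow> i \<noteq> m \<Longrightarrow> \<rho> i s \<noteq> 0"
    and jm: "\<And>s. s \<in> D \<Longrightarrow> \<rho> j s = 1" "\<And>s. s \<in> D \<Longrightarrow> \<rho> m s = s"
    and cur: "\<And>s. s \<in> D \<Longrightarrow> on_curve (\<lambda>i. \<rho> i s)" using ch by (auto simp: chart_def)
  have a: "\<And>i. i \<in> {2..n} \<Longrightarrow> 0 \<le> \<alpha> i \<and> \<alpha> i \<le> int k - 1" "0 \<le> \<alpha> 1" "\<alpha> 1 \<le> (\<Sum>i=2..n. \<alpha> i) - 2"
    using \<alpha> by (auto simp: form_index_def)
  consider "j = 0" "m = 1" | "j = 0" "m \<in> {2..n}" | "j = 1" "m = 0"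
    using ch n by (cases "m = 1") (auto simp: chart_def)
  then show ?thesis
  proof cases
    case 1
    let ?w = "\<lambda>s. s ^ nat (\<alpha> 1) / (\<Prod>i=2..n. \<rho> i s powi \<alpha> i)"
    show ?thesis
    proof (rule that[of ?w])
      show "?w holomorphic_on D"
        by (intro holomorphic_intros hol) (use nz 1 in \<open>auto simp: prod_zero_iff\<close>)
      fix s assume s: "s \<in> D"
      have "((\<lambda>z. z) has_field_derivative 1) (at s)" by (rule DERIV_ident)
      then have "((\<lambda>z. \<rho> 1 z / \<rho> 0 z) has_field_derivative 1) (at s)"
        by (rule has_field_derivative_transform_within_open[OF _ D s]) (use jm 1 in auto)
      then have "deriv (\<lambda>z. \<rho> 1 z / \<rho> 0 z) s = 1" by (rule DERIV_imp_deriv)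
      then show "form_expr n \<alpha> \<rho> s = ?w s"
        using jm[OF s] 1 a(2) by (simp add: form_expr_def power_int_def)
    qed
  next
    case 2
    let ?w = "\<lambda>s. - (\<rho> 1 s ^ nat (\<alpha> 1) * s ^ nat (int k - 1 - \<alpha> m)) /
      (\<rho> 1 s ^ (k - 1) * (\<Prod>i\<in>{2..n} - {m}. \<rho> i s powi \<alpha> i))"
    show ?thesis
    proof (rule that[of ?w])
      show "?w holomorphic_on D"
        by (intro holomorphic_intros hol) (use nz 2 n in \<open>auto simp: prod_zero_iff\<close>)
      fix s assume s: "s \<in> D" "s \<noteq> 0"
      define d where "d = deriv (\<rho> 1) s"
      have d: "(\<rho> 1 has_field_derivative d) (at s)"
        unfolding d_def using hol[of 1] n D s by (auto intro: holomorphic_derivI)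
      \<comment> \<open>Two expressions for the derivative of the k-th power of the first coordinate
        are compared, which gives its own derivative without reference to a branch.\<close>
      have "((\<lambda>z. \<rho> 1 z ^ k) has_field_derivative of_nat k * (d * \<rho> 1 s ^ (k - Suc 0))) (at s)"
        using DERIV_power[OF d] by simp
      moreover have "((\<lambda>z. \<rho> 1 z ^ k) has_field_derivative - (of_nat k * s ^ (k - Suc 0))) (at s)"
      proof (rule has_field_derivative_transform_within_open[OF _ D s(1)])
        show "((\<lambda>z. - r m - z ^ k) has_field_derivative - (of_nat k * s ^ (k - Suc 0))) (at s)"
          by (auto intro!: derivative_eq_intros)
        fix z assume z: "z \<in> D"
        have "r m * \<rho> 0 z ^ k + \<rho> 1 z ^ k + \<rho> m z ^ k = 0"
          using cur[OF z] 2 by (auto simp: on_curve_def)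
        then show "- r m - z ^ k = \<rho> 1 z ^ k" using jm[OF z] 2 by (simp add: algebra_simps neg_eq_iff_add_eq_0)
      qed
      ultimately have "of_nat k * (d * \<rho> 1 s ^ (k - 1)) = - (of_nat k * s ^ (k - 1))"
        using DERIV_unique by fastforce
      then have "of_nat k * (d * \<rho> 1 s ^ (k - 1)) = of_nat k * - (s ^ (k - 1))" by simp
      then have "d * \<rho> 1 s ^ (k - 1) = - (s ^ (k - 1))" using k by (simp only: mult_cancel_left) simp
      moreover have "\<rho> 1 s \<noteq> 0" using nz[OF s(1), of 1] 2 n by auto
      ultimately have d': "d = - (s ^ (k - 1)) / \<rho> 1 s ^ (k - 1)"
        using k by (simp add: field_simps)
      have "(\<rho> 1 has_field_derivative d) (at s) \<Longrightarrow> ((\<lambda>z. \<rho> 1 z / \<rho> 0 z) has_field_derivative d) (at s)"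
        by (rule has_field_derivative_transform_within_open[OF _ D s(1)]) (use jm 2 in auto)
      then have d1: "deriv (\<lambda>z. \<rho> 1 z / \<rho> 0 z) s = d" using d DERIV_imp_deriv by blast
      have "(\<Prod>i=2..n. (\<rho> i s / \<rho> 0 s) powi \<alpha> i) = s powi \<alpha> m * (\<Prod>i\<in>{2..n} - {m}. \<rho> i s powi \<alpha> i)"
        using jm[OF s(1)] 2 prod.remove[of "{2..n}" m "\<lambda>i. (\<rho> i s / \<rho> 0 s) powi \<alpha> i"] by simp
      moreover have "s ^ (k - 1) = s powi \<alpha> m * s ^ nat (int k - 1 - \<alpha> m)"
      proof -
        have "s ^ (k - 1) = s powi (\<alpha> m + (int k - 1 - \<alpha> m))" using k by (simp add: power_int_def nat_diff_distrib')
        also have "\<dots> = s powi \<alpha> m * s powi (int k - 1 - \<alpha> m)"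
          using s by (intro power_int_add) auto
        also have "s powi (int k - 1 - \<alpha> m) = s ^ nat (int k - 1 - \<alpha> m)"
          using a(1) 2 by (simp add: power_int_def)
        finally show ?thesis .
      qed
      moreover have "(\<rho> 1 s / \<rho> 0 s) powi \<alpha> 1 = \<rho> 1 s ^ nat (\<alpha> 1)"
        using jm[OF s(1)] 2 a(2) by (simp add: power_int_def)
      ultimately show "form_expr n \<alpha> \<rho> s = ?w s"
        using s(2) unfolding form_expr_def d1 d' by simp
    qed
  next
    case 3
    let ?w = "\<lambda>s. - (s ^ nat ((\<Sum>i=2..n. \<alpha> i) - 2 - \<alpha> 1)) / (\<Prod>i=2..n. \<rho> i s powi \<alpha> i)"
    show ?thesis
    proof (rule that[of ?w])
      show "?w holomorphic_on D"
        by (intro holomorphic_intros hol) (use nz 3 in \<open>auto simp: prod_zero_iff\<close>)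
      fix s assume s: "s \<in> D" "s \<noteq> 0"
      have "((\<lambda>z. 1 / z) has_field_derivative - 1 / s ^ 2) (at s)"
        using s by (auto intro!: derivative_eq_intros simp: power2_eq_square)
      then have "((\<lambda>z. \<rho> 1 z / \<rho> 0 z) has_field_derivative - 1 / s ^ 2) (at s)"
        by (rule has_field_derivative_transform_within_open[OF _ D s(1)]) (use jm 3 in auto)
      then have d: "deriv (\<lambda>z. \<rho> 1 z / \<rho> 0 z) s = - 1 / s ^ 2" by (rule DERIV_imp_deriv)
      have 1: "(\<Prod>i=2..n. (\<rho> i s / \<rho> 0 s) powi \<alpha> i) = (\<Prod>i=2..n. \<rho> i s powi \<alpha> i) / s powi (\<Sum>i=2..n. \<alpha> i)"
        using jm(2)[OF s(1)] 3 s(2) prod_power_int_same[of s \<alpha> "{2..n}"] by (simp add: power_int_divide_distrib prod_dividef)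
      have 2: "(\<rho> 1 s / \<rho> 0 s) powi \<alpha> 1 = 1 / s powi \<alpha> 1"
        using jm[OF s(1)] 3 by (simp add: power_int_divide_distrib)
      have "s powi (\<Sum>i=2..n. \<alpha> i) = s powi (((\<Sum>i=2..n. \<alpha> i) - 2 - \<alpha> 1) + (\<alpha> 1 + 2))" by simp
      also have "\<dots> = s powi ((\<Sum>i=2..n. \<alpha> i) - 2 - \<alpha> 1) * (s powi \<alpha> 1 * s powi 2)"
        using s(2) by (simp only: power_int_add simp_thms)
      also have "s powi ((\<Sum>i=2..n. \<alpha> i) - 2 - \<alpha> 1) = s ^ nat ((\<Sum>i=2..n. \<alpha> i) - 2 - \<alpha> 1)"
        using a(3) by (simp add: power_int_def)
      finally have 3: "s powi (\<Sum>i=2..n. \<alpha> i) = s ^ nat ((\<Sum>i=2..n. \<alpha> i) - 2 - \<alpha> 1) * (s powi \<alpha> 1 * s ^ 2)"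
        by simp
      show "form_expr n \<alpha> \<rho> s = ?w s"
        unfolding form_expr_def d 1 2 3 using s(2) by simp
    qed
  qed
qed

lemma chart_primitive:
  assumes ch: "chart j m D \<rho>" and \<alpha>: "\<alpha> \<in> form_index k n"
  obtains \<Phi> where "\<And>s. s \<in> D \<Longrightarrow> (\<Phi> has_field_derivative theta n \<alpha> \<rho> s) (at s)"
proof -
  obtain \<omega> where \<omega>: "\<omega> holomorphic_on D" "\<And>s. s \<in> D \<Longrightarrow> s \<noteq> 0 \<Longrightarrow> form_expr n \<alpha> \<rho> s = \<omega> s"
    using chart_form[OF assms] by blast
  have D: "open D" "convex D" using ch by (auto simp: chart_def)
  obtain \<Phi> where "\<And>s. s \<in> D \<Longrightarrow> (\<Phi> has_field_derivative \<omega> s) (at s within D)"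
    using holomorphic_convex_primitive'[OF D(2,1) \<omega>(1)] by metis
  then show ?thesis
    using that theta_extends[OF D(1) \<omega>] D(1) by (metis at_within_open)
qed

end

section \<open>Integrals over chains and homology classes\<close>

lemma chain_integral_superset:
  assumes "finite A" "Poly_Mapping.keys c \<subseteq> A"
  shows "chain_integral n X \<omega> c = (\<Sum>\<sigma>\<in>A. of_int (Poly_Mapping.lookup c \<sigma>) * path_integral n X \<omega> (path_of_simplex \<sigma>))"
  unfolding chain_integral_def
  by (rule sum.mono_neutral_left) (use assms in \<open>auto simp: in_keys_iff\<close>)

lemma chain_integral_diff:
  "chain_integral n X \<omega> (a - b) = chain_integral n X \<omega> a - chain_integral n X \<omega> b"
proof -
  let ?A = "Poly_Mapping.keys a \<union> Poly_Mapping.keys b"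
  have "Poly_Mapping.keys (a - b) \<subseteq> ?A" by (rule keys_diff)
  then show ?thesis
    by (simp add: chain_integral_superset[of ?A] lookup_minus sum_subtractf left_diff_distrib)
qed

lemma chain_integral_zero: "chain_integral n X \<omega> 0 = 0"
  by (simp add: chain_integral_def)

lemma chain_integral_add:
  "chain_integral n X \<omega> (a + b) = chain_integral n X \<omega> a + chain_integral n X \<omega> b"
  using chain_integral_diff[of n X \<omega> "a + b" b] by simp

lemma chain_integral_of: "chain_integral n X \<omega> (frag_of \<sigma>) = path_integral n X \<omega> (path_of_simplex \<sigma>)"
  by (simp add: chain_integral_def)

context fermat
begin

text \<open>The coordinate inverts the parametrization, and parametrizations by charts are open
  maps, so the coordinate read along \<open>f\<close> is continuous.\<close>

lemma continuous_chart_coord: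
  assumes ch: "chart j m D \<rho>" and f: "continuous_map (top_of_set T) C f" "f ` T \<subseteq> cpt \<rho> ` D"
  shows "continuous_on T (hratio m j \<circ> f)"
  unfolding continuous_on_def
proof (intro ballI topological_tendstoI)
  fix t S assume t: "t \<in> T" and S: "open S" "(hratio m j \<circ> f) t \<in> S"
  obtain s where s: "s \<in> D" "f t = cpt \<rho> s" using f t by auto
  have D: "open D" "convex D" using ch by (auto simp: chart_def)
  have "s \<in> S \<inter> D" using s S chart_coord[OF ch] by simp
  then obtain e where e: "e > 0" "ball s e \<subseteq> S \<inter> D"
    using S D by (meson open_Int open_contains_ball)
  have ch': "chart j m (ball s e) \<rho>" by (rule chart_subset[OF ch]) (use e in auto)
  have "\<forall>\<^sub>F t' in at t within T. f t' \<in> cpt \<rho> ` ball s e"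
    by (rule eventually_in_openin[OF f(1) chart_open[OF ch'] t]) (use s e in auto)
  then show "\<forall>\<^sub>F t' in at t within T. (hratio m j \<circ> f) t' \<in> S"
  proof eventually_elim
    case (elim t')
    then show ?case using e chart_coord(1)[OF ch'] by auto
  qed
qed

end

section \<open>Path and chain integrals of one fixed form\<close>

locale fermat_form = fermat +
  fixes \<alpha> :: "nat \<Rightarrow> int"
  assumes \<alpha>: "\<alpha> \<in> form_index k n"
begin

definition LP :: "(nat \<Rightarrow> complex) set set \<Rightarrow> ((nat \<Rightarrow> complex) set \<Rightarrow> complex) \<Rightarrow> bool" where
  "LP V G \<longleftrightarrow> (\<exists>j m D \<rho> \<Phi>. chart j m D \<rho> \<and> V = cpt \<rho> ` D \<and> G = \<Phi> \<circ> hratio m j \<and>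
     (\<forall>s\<in>D. (\<Phi> has_field_derivative theta n \<alpha> \<rho> s) (at s)))"

lemma LP_chart:
  assumes "chart j m D \<rho>"
  obtains \<Phi> where "LP (cpt \<rho> ` D) (\<Phi> \<circ> hratio m j)"
    "\<And>s. s \<in> D \<Longrightarrow> (\<Phi> has_field_derivative theta n \<alpha> \<rho> s) (at s)"
  using chart_primitive[OF assms \<alpha>] assms unfolding LP_def by metis

sublocale local_primitives C LP
proof
  show "openin C V" if "LP V F" for V F
    using that chart_open by (auto simp: LP_def)
  show "\<exists>V F. LP V F \<and> x \<in> V" if x: "x \<in> topspace C" for x
  proof -
    obtain j m D \<rho> where ch: "chart j m D \<rho>" "x \<in> cpt \<rho> ` D" using chart_exists[OF x] .
    then show ?thesis using LP_chart[OF ch(1)] by metis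
  qed
  fix V F V' F' x assume VF: "LP V F" "LP V' F'" and x: "x \<in> V" "x \<in> V'"
  obtain j m D \<rho> \<Phi> where 1: "chart j m D \<rho>" "V = cpt \<rho> ` D" "F = \<Phi> \<circ> hratio m j"
     "\<And>s. s \<in> D \<Longrightarrow> (\<Phi> has_field_derivative theta n \<alpha> \<rho> s) (at s)"
    using VF(1) unfolding LP_def by blast
  obtain j' m' D' \<rho>' \<Phi>' where 2: "chart j' m' D' \<rho>'" "V' = cpt \<rho>' ` D'" "F' = \<Phi>' \<circ> hratio m' j'"
     "\<And>s. s \<in> D' \<Longrightarrow> (\<Phi>' has_field_derivative theta n \<alpha> \<rho>' s) (at s)"
    using VF(2) unfolding LP_def by blast
  obtain s0 where s0: "s0 \<in> D'" "x = cpt \<rho>' s0" using x 2(2) by blast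
  have "cpt \<rho>' s0 \<in> cpt \<rho> ` D" using x s0 1(2) by simp
  then obtain e where e: "e > 0" "ball s0 e \<subseteq> D'"
     "\<And>s. s \<in> ball s0 e \<Longrightarrow> \<Phi>' s - \<Phi> (hratio m j (cpt \<rho>' s)) = \<Phi>' s0 - \<Phi> (hratio m j (cpt \<rho>' s0))"
    using chart_compare[OF 1(1) chart_local_param[OF 2(1)] 2(4) 1(4) s0(1)] by blast
  have "openin C (cpt \<rho>' ` ball s0 e)"
    by (rule chart_open[OF chart_subset[OF 2(1)]]) (use e in auto)
  moreover have "x \<in> cpt \<rho>' ` ball s0 e" using s0 e by auto
  moreover have "F' y - F y = F' x - F x" if y: "y \<in> cpt \<rho>' ` ball s0 e" for y
  proof -
    obtain s where s: "s \<in> ball s0 e" "y = cpt \<rho>' s" using y by blast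
    then have "hratio m' j' y = s" "hratio m' j' x = s0"
      using chart_coord(1)[OF 2(1)] e(2) s0 by auto
    then show ?thesis using e(3)[OF s(1)] 1(3) 2(3) s s0 by simp
  qed
  ultimately show "\<exists>W. openin C W \<and> x \<in> W \<and> (\<forall>y\<in>W. F' y - F y = F' x - F x)" by blast
qed

text \<open>A local integral may use any local parametrization \<open>h\<close>. By
  \<open>chart_compare\<close> its primitive, read along the path, is again a primitive in the sense
  of \<open>prim\<close>, so only the increment of \<open>g\<close> is possible.\<close>

lemma local_integral_eq:
  assumes \<gamma>: "continuous_map (top_of_set {a..b}) C \<gamma>" and g: "prim {a..b} \<gamma> g"
    and I: "has_local_integral n C (theta n \<alpha>) \<gamma> a b I" and ab: "a \<le> b"
  shows "I = g b - g a"
proof -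
  obtain D h c F where lp: "local_param n C D h" and c: "continuous_on {a..b} c" "c ` {a..b} \<subseteq> D"
    and \<gamma>c: "\<And>t. t \<in> {a..b} \<Longrightarrow> \<gamma> t = cpt h (c t)"
    and F: "\<And>s. s \<in> D \<Longrightarrow> (F has_field_derivative theta n \<alpha> h s) (at s)"
    and IF: "I = F (c b) - F (c a)"
    using I unfolding has_local_integral_def by blast
  have "prim {a..b} \<gamma> (F \<circ> c)"
    unfolding prim_def
  proof
    fix t assume t: "t \<in> {a..b}"
    have "\<gamma> t \<in> topspace C" using \<gamma> t by (auto simp: continuous_map_def)
    then obtain j m D' \<rho> where ch: "chart j m D' \<rho>" "\<gamma> t \<in> cpt \<rho> ` D'" using chart_exists by blast
    obtain \<Phi> where \<Phi>: "LP (cpt \<rho> ` D') (\<Phi> \<circ> hratio m j)"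
      "\<And>s. s \<in> D' \<Longrightarrow> (\<Phi> has_field_derivative theta n \<alpha> \<rho> s) (at s)"
      using LP_chart[OF ch(1)] by blast
    have ct: "c t \<in> D" "cpt h (c t) \<in> cpt \<rho> ` D'" using t c \<gamma>c ch by auto
    obtain e where e: "e > 0"
     "\<And>s. s \<in> ball (c t) e \<Longrightarrow> F s - \<Phi> (hratio m j (cpt h s)) = F (c t) - \<Phi> (hratio m j (cpt h (c t)))"
      using chart_compare[OF ch(1) lp F \<Phi>(2) ct] by blast
    have "(c \<longlongrightarrow> c t) (at t within {a..b})" using c(1) t by (simp add: continuous_on_def)
    then have "\<forall>\<^sub>F t' in at t within {a..b}. c t' \<in> ball (c t) e"
      using e(1) by (metis centre_in_ball open_ball topological_tendstoD)
    moreover have "\<forall>\<^sub>F t' in at t within {a..b}. t' \<in> {a..b}"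
      by (simp add: eventually_at_filter)
    ultimately have "\<forall>\<^sub>F t' in at t within {a..b}. (F \<circ> c) t' - (\<Phi> \<circ> hratio m j) (\<gamma> t') = (F \<circ> c) t - (\<Phi> \<circ> hratio m j) (\<gamma> t)"
    proof eventually_elim
      case (elim t')
      then show ?case using e(2)[OF elim(1)] \<gamma>c[OF elim(2)] \<gamma>c[OF t] by simp
    qed
    then show "\<exists>V G. LP V G \<and> \<gamma> t \<in> V \<and>
        (\<forall>\<^sub>F t' in at t within {a..b}. (F \<circ> c) t' - G (\<gamma> t') = (F \<circ> c) t - G (\<gamma> t))"
      using \<Phi>(1) ch(2) by blast
  qed
  then have "(F \<circ> c) b - (F \<circ> c) a = g b - g a"
    using prim_unique[OF \<gamma> g _ connected_Icc, of "F \<circ> c" a b] ab by simp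
  then show ?thesis using IF by simp
qed

lemma local_integral_in_chart:
  assumes \<gamma>: "continuous_map (top_of_set {a..b}) C \<gamma>" and V: "LP V G" "\<gamma> ` {a..b} \<subseteq> V"
  shows "has_local_integral n C (theta n \<alpha>) \<gamma> a b (G (\<gamma> b) - G (\<gamma> a))"
proof -
  obtain j m D \<rho> \<Phi> where 1: "chart j m D \<rho>" "V = cpt \<rho> ` D" "G = \<Phi> \<circ> hratio m j"
     "\<And>s. s \<in> D \<Longrightarrow> (\<Phi> has_field_derivative theta n \<alpha> \<rho> s) (at s)"
    using V(1) unfolding LP_def by blast
  let ?c = "hratio m j \<circ> \<gamma>"
  have in_D: "?c t \<in> D \<and> \<gamma> t = cpt \<rho> (?c t)" if t: "t \<in> {a..b}" for t
  proof -
    obtain s where s: "s \<in> D" "\<gamma> t = cpt \<rho> s" using V(2) 1(2) t by blast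
    then show ?thesis using chart_coord(1)[OF 1(1) s(1)] by simp
  qed
  have "continuous_on {a..b} ?c"
    by (rule continuous_chart_coord[OF 1(1) \<gamma>]) (use V 1 in auto)
  then show ?thesis
    unfolding has_local_integral_def
    using in_D 1 chart_local_param[OF 1(1)]
    by (intro exI[of _ D] exI[of _ \<rho>] exI[of _ ?c] exI[of _ \<Phi>]) auto
qed

text \<open>The local integrals are increments of the one primitive \<open>g\<close>, and these
  telescope.\<close>

lemma has_path_integral_unique:
  assumes \<gamma>: "continuous_map (top_of_set {0..1}) C \<gamma>" and g: "prim {0..1} \<gamma> g"
    and I: "has_path_integral n C (theta n \<alpha>) \<gamma> I"
  shows "I = g 1 - g 0"
proof -
  obtain m T J where T: "T 0 = 0" "T m = 1"
      "\<And>i. i < m \<Longrightarrow> T i < T (Suc i) \<and> has_local_integral n C (theta n \<alpha>) \<gamma> (T i) (T (Suc i)) (J i)"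
    and IJ: "I = (\<Sum>i<m. J i)"
    using I unfolding has_path_integral_def by blast
  have mono: "T i \<le> T j" if "i \<le> j" "j \<le> m" for i j
    using that
  proof (induction rule: dec_induct)
    case (step l)
    then show ?case using T(3)[of l] by simp
  qed simp
  have J: "J i = g (T (Suc i)) - g (T i)" if i: "i < m" for i
  proof -
    have sub: "{T i..T (Suc i)} \<subseteq> {0..1}" using mono[of 0 i] mono[of "Suc i" m] T i by auto
    show ?thesis
    proof (rule local_integral_eq)
      show "continuous_map (top_of_set {T i..T (Suc i)}) C \<gamma>"
        using \<gamma> sub by (meson continuous_map_from_subtopology_mono)
      show "prim {T i..T (Suc i)} \<gamma> g" by (rule prim_subset[OF g sub])
    qed (use T(3)[OF i] in auto)
  qed
  have "I = (\<Sum>i<m. g (T (Suc i)) - g (T i))" unfolding IJ using J by simp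
  also have "\<dots> = g (T m) - g (T 0)" by (rule sum_lessThan_telescope)
  finally show ?thesis using T by simp
qed

text \<open>A subdivision finer than a Lebesgue number for the cover by local primitives puts every
  piece into one chart.\<close>

lemma has_path_integral_exists:
  assumes \<gamma>: "continuous_map (top_of_set {0..1}) C \<gamma>" and g: "prim {0..1} \<gamma> g"
  shows "has_path_integral n C (theta n \<alpha>) \<gamma> (g 1 - g 0)"
proof -
  define \<G> where "\<G> = {S. open S \<and> (\<exists>V G. LP V G \<and> \<gamma> ` ({0..1} \<inter> S) \<subseteq> V)}"
  have sub: "{0..1} \<subseteq> \<Union>\<G>"
  proof
    fix t :: real assume t: "t \<in> {0..1}"
    then have "\<gamma> t \<in> topspace C" using \<gamma> by (auto simp: continuous_map_def)
    then obtain V G where V: "LP V G" "\<gamma> t \<in> V" using LP_cover by blast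
    have "openin (top_of_set {0..1}) {x \<in> {0..1}. \<gamma> x \<in> V}"
      using openin_continuous_map_preimage[OF \<gamma> LP_open[OF V(1)]] by simp
    then obtain S where "open S" "{x \<in> {0..1}. \<gamma> x \<in> V} = {0..1} \<inter> S" by (auto simp: openin_open)
    then show "t \<in> \<Union>\<G>" using V t unfolding \<G>_def by blast
  qed
  have "\<exists>e>0. \<forall>x\<in>{0..1}. \<exists>S\<in>\<G>. ball x e \<subseteq> S"
    by (rule Heine_Borel_lemma[OF compact_Icc sub]) (simp add: \<G>_def, blast)
  then obtain e where e: "e > 0" "\<And>x. x \<in> {0..1} \<Longrightarrow> \<exists>S\<in>\<G>. ball x e \<subseteq> S" by blast
  obtain N where N: "inverse (of_nat (Suc N)) < e" using reals_Archimedean[OF e(1)] by blast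
  define T where "T i = real i / real (Suc N)" for i
  have sub01: "{T i..T (Suc i)} \<subseteq> {0..1}" if "i < Suc N" for i
    using that by (auto simp: T_def divide_simps)
  have c: "continuous_map (top_of_set {T i..T (Suc i)}) C \<gamma>" if "i < Suc N" for i
    using \<gamma> sub01[OF that] by (meson continuous_map_from_subtopology_mono)
  have step: "has_local_integral n C (theta n \<alpha>) \<gamma> (T i) (T (Suc i)) (g (T (Suc i)) - g (T i))" if i: "i < Suc N" for i
  proof -
    have "T i \<in> {0..1}" using i by (auto simp: T_def divide_simps)
    from e(2)[OF this] obtain S' where S': "S' \<in> \<G>" "ball (T i) e \<subseteq> S'" by blast
    then obtain V G where "LP V G" "\<gamma> ` ({0..1} \<inter> S') \<subseteq> V"
      unfolding \<G>_def by blast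
    note S = S'(2) this
    have "T (Suc i) - T i = inverse (of_nat (Suc N))" by (simp add: T_def field_simps)
    then have "{T i..T (Suc i)} \<subseteq> ball (T i) e" using N by (auto simp: dist_real_def)
    then have V: "\<gamma> ` {T i..T (Suc i)} \<subseteq> V" using S sub01[OF i] by blast
    have "(G \<circ> \<gamma>) (T (Suc i)) - (G \<circ> \<gamma>) (T i) = g (T (Suc i)) - g (T i)"
      by (rule prim_unique[OF c[OF i] prim_subset[OF g sub01[OF i]] prim_in_chart[OF S(2) V] connected_Icc])
        (auto simp: T_def divide_simps)
    then show ?thesis using local_integral_in_chart[OF c[OF i] S(2) V] by simp
  qed
  have "g 1 - g 0 = (\<Sum>i<Suc N. g (T (Suc i)) - g (T i))"
    using sum_lessThan_telescope[of "\<lambda>i. g (T i)" "Suc N"] by (simp add: T_def)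
  moreover have "T 0 = 0" "T (Suc N) = 1" "\<And>i. T i < T (Suc i)"
    by (auto simp: T_def divide_simps)
  ultimately show ?thesis
    unfolding has_path_integral_def using step
    by (intro exI[of _ "Suc N"] exI[of _ T] exI[of _ "\<lambda>i. g (T (Suc i)) - g (T i)"]) auto
qed

lemma path_integral_prim:
  assumes "continuous_map (top_of_set {0..1}) C \<gamma>" "prim {0..1} \<gamma> g"
  shows "path_integral n C (theta n \<alpha>) \<gamma> = g 1 - g 0"
  unfolding path_integral_def
  by (rule the_equality) (use assms has_path_integral_exists has_path_integral_unique in auto)

lemma chain_integral_path:
  assumes \<gamma>: "continuous_map (top_of_set {0..1}) C \<gamma>" and g: "prim {0..1} \<gamma> g"
  shows "chain_integral n C (theta n \<alpha>) (frag_of (simplex_of_path \<gamma>)) = g 1 - g 0"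
  unfolding chain_integral_of
proof (rule path_integral_prim)
  show "continuous_map (top_of_set {0..1}) C (path_of_simplex (simplex_of_path \<gamma>))"
    by (rule continuous_map_eq[OF \<gamma>]) (simp add: path_of_simplex_of_path)
  show "prim {0..1} (path_of_simplex (simplex_of_path \<gamma>)) g"
    by (rule prim_cong[OF g]) (simp_all add: path_of_simplex_of_path)
qed

text \<open>The map \<open>e\<close> collapses the square onto the triangle: the edge
  \<open>s = 0\<close> goes to vertex 0, and the edges \<open>t = 0\<close>, \<open>s = 1\<close>,
  \<open>t = 1\<close> become the faces 2, 0, 1. The relation between the edges of a square is then
  the vanishing on the boundary.\<close>

lemma chain_integral_boundary_simplex:
  assumes \<sigma>: "singular_simplex 2 C \<sigma>"
  shows "chain_integral n C (theta n \<alpha>) (chain_boundary 2 (frag_of \<sigma>)) = 0"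
proof -
  define e where "e = (\<lambda>(s::real, t::real) i::nat. if i = 0 then 1 - s else if i = 1 then s * (1 - t)
     else if i = 2 then s * t else 0)"
  define f where "f = \<sigma> \<circ> e"
  have two: "{..2::nat} = {0, 1, 2}" by auto
  have "continuous_on ({0..1} \<times> {0..1}) (\<lambda>x. e x i)" for i
    unfolding e_def by (cases "i = 0"; cases "i = 1"; cases "i = 2")
      (auto simp: case_prod_unfold intro!: continuous_intros)
  then have "continuous_on ({0..1} \<times> {0..1}) e"
    by (rule continuous_on_coordinatewise_then_product)
  moreover have "e x \<in> standard_simplex 2" if xm: "x \<in> {0..1} \<times> {0..1}" for x
  proof -
    obtain s t where x: "x = (s, t)" "0 \<le> s" "s \<le> 1" "0 \<le> t" "t \<le> 1" using xm by (cases x) auto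
    have "0 \<le> s * t" "s * t \<le> s" using x by (auto intro: mult_left_le)
    moreover from this x have "s \<le> 1 + s * t" by linarith
    ultimately show ?thesis using x by (auto simp: e_def standard_simplex_def two algebra_simps)
  qed
  moreover have "continuous_map (top_of_set (standard_simplex 2)) C \<sigma>"
    using \<sigma> unfolding singular_simplex_def powertop_real_subtopology by blast
  ultimately have f: "continuous_map (top_of_set ({0..1} \<times> {0..1})) C f"
    unfolding f_def by (intro continuous_map_compose) auto
  have face: "singular_simplex 1 C (singular_face 2 i \<sigma>)" if "i \<le> 2" for i
    using singular_simplex_singular_face[OF \<sigma> _ that] by simp
  define P where "P i = path_of_simplex (singular_face 2 i \<sigma>)" for i
  have Pc: "continuous_map (top_of_set {0..1}) C (P i)" if "i \<le> 2" for i
    unfolding P_def by (rule simplex_of_path_of_simplex(2)[OF face[OF that]])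
  obtain g where g: "\<And>i. i \<le> 2 \<Longrightarrow> prim {0..1} (P i) (g i)"
    using prim_exists_path[OF Pc] by metis
  have "\<sigma> (e (0, 0)) \<in> topspace C" using f by (auto simp: f_def continuous_map_def)
  then obtain g0 where g0: "prim {0..1} (\<lambda>t::real. \<sigma> (e (0, 0))) g0"
    using prim_exists_path[of "\<lambda>_. \<sigma> (e (0,0))"] by auto
  have P: "P i t = \<sigma> (simplical_face i (\<lambda>i. if i = 0 then 1 - t else if i = 1 then t else 0))"
    if "t \<in> {0..1}" for t i
  proof -
    have "2 - Suc 0 = (1::nat)" by simp
    moreover have "(\<lambda>i. if i = 0 then 1 - t else if i = 1 then t else 0) \<in> standard_simplex 1"
      using that by (auto simp: standard_simplex_def)
    ultimately show ?thesis by (simp add: P_def path_of_simplex_def singular_face_def del: One_nat_def)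
  qed
  have "prim {0..1} (\<lambda>t. f (t, 0)) (g 2)"
  proof (rule prim_cong[OF g])
    fix t :: real assume t: "t \<in> {0..1}"
    have "simplical_face 2 (\<lambda>i. if i = 0 then 1 - t else if i = 1 then t else 0) = e (t, 0)"
    proof
      fix l :: nat
      have "l = 0 \<or> l = 1 \<or> l = 2 \<or> (\<exists>l'. l = l' + 3)" by presburger
      then show "simplical_face 2 (\<lambda>i. if i = 0 then 1 - t else if i = 1 then t else 0) l = e (t, 0) l"
        by (elim disjE exE) (simp_all add: simplical_face_def e_def)
    qed
    then show "P 2 t = f (t, 0)" using P[OF t] by (simp add: f_def)
  qed auto
  moreover have "prim {0..1} (\<lambda>t. f (1, t)) (g 0)"
  proof (rule prim_cong[OF g])
    fix t :: real assume t: "t \<in> {0..1}"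
    have "simplical_face 0 (\<lambda>i. if i = 0 then 1 - t else if i = 1 then t else 0) = e (1, t)"
    proof
      fix l :: nat
      have "l = 0 \<or> l = 1 \<or> l = 2 \<or> (\<exists>l'. l = l' + 3)" by presburger
      then show "simplical_face 0 (\<lambda>i. if i = 0 then 1 - t else if i = 1 then t else 0) l = e (1, t) l"
        by (elim disjE exE) (simp_all add: simplical_face_def e_def)
    qed
    then show "P 0 t = f (1, t)" using P[OF t] by (simp add: f_def)
  qed auto
  moreover have "prim {0..1} (\<lambda>t. f (t, 1)) (g 1)"
  proof (rule prim_cong[OF g])
    fix t :: real assume t: "t \<in> {0..1}"
    have "simplical_face 1 (\<lambda>i. if i = 0 then 1 - t else if i = 1 then t else 0) = e (t, 1)"
    proof
      fix l :: nat
      have "l = 0 \<or> l = 1 \<or> l = 2 \<or> (\<exists>l'. l = l' + 3)" by presburger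
      then show "simplical_face 1 (\<lambda>i. if i = 0 then 1 - t else if i = 1 then t else 0) l = e (t, 1) l"
        by (elim disjE exE) (simp_all add: simplical_face_def e_def)
    qed
    then show "P 1 t = f (t, 1)" using P[OF t] by (simp add: f_def)
  qed auto
  moreover have "prim {0..1} (\<lambda>t. f (0, t)) g0"
  proof (rule prim_cong[OF g0])
    fix t :: real
    have "e (0, 0) = e (0, t)" by (simp add: e_def fun_eq_iff)
    then show "\<sigma> (e (0, 0)) = f (0, t)" by (simp add: f_def)
  qed auto
  ultimately have "(g 2 1 - g 2 0) + (g 0 1 - g 0 0) = (g0 1 - g0 0) + (g 1 1 - g 1 0)"
    using prim_square_edges[OF f] by blast
  then have *: "(g 2 1 - g 2 0) + (g 0 1 - g 0 0) = g 1 1 - g 1 0"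
    using prim_const_path[OF g0] by simp
  have ci: "chain_integral n C (theta n \<alpha>) (frag_of (singular_face 2 i \<sigma>)) = g i 1 - g i 0" if "i \<le> 2" for i
    using path_integral_prim[OF Pc[OF that] g[OF that]] by (simp add: chain_integral_of P_def)
  have "chain_boundary 2 (frag_of \<sigma>) =
     (frag_of (singular_face 2 0 \<sigma>) - frag_of (singular_face 2 1 \<sigma>)) + frag_of (singular_face 2 2 \<sigma>)"
    by (simp add: chain_boundary_of two)
  then have "chain_integral n C (theta n \<alpha>) (chain_boundary 2 (frag_of \<sigma>)) =
      (g 0 1 - g 0 0) - (g 1 1 - g 1 0) + (g 2 1 - g 2 0)"
    using ci[of 0] ci[of 1] ci[of 2] by (simp only: chain_integral_add chain_integral_diff)
  also have "\<dots> = 0" unfolding *[symmetric] by simp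
  finally show ?thesis .
qed

lemma chain_integral_homologous:
  assumes "homologous_rel 1 C {} a b"
  shows "chain_integral n C (theta n \<alpha>) a = chain_integral n C (theta n \<alpha>) b"
proof -
  obtain d where d: "singular_chain 2 C d" "chain_boundary 2 d = a - b"
    using assms unfolding homologous_rel_def singular_boundary by (auto simp: numeral_2_eq_2)
  have "chain_integral n C (theta n \<alpha>) (chain_boundary 2 d) = 0"
  proof (rule frag_induction[of d "singular_simplex_set 2 C"])
    show "Poly_Mapping.keys d \<subseteq> singular_simplex_set 2 C" using d(1) by (simp add: singular_chain_def)
  qed (auto simp: chain_integral_zero chain_integral_boundary_simplex chain_boundary_diff chain_integral_diff)
  then show ?thesis using d(2) by (simp add: chain_integral_diff)
qed

text \<open>All chains homologous to \<open>c\<close> have its integral, so the definite description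
  in \<open>class_integral\<close> is satisfied by this value alone.\<close>

lemma class_integral_eq: "class_integral n C (theta n \<alpha>) (hclass C c) = chain_integral n C (theta n \<alpha>) c"
  unfolding class_integral_def
proof (rule the_equality)
  show "\<forall>c'\<in>hclass C c. chain_integral n C (theta n \<alpha>) c' = chain_integral n C (theta n \<alpha>) c"
    using chain_integral_homologous by (metis mem_Collect_eq)
qed (metis homologous_rel_refl mem_Collect_eq)

end

section \<open>Deck transformations and their monodromy\<close>

definition deck_set :: "'u::topological_space set \<Rightarrow> ('u \<Rightarrow> 'b) \<Rightarrow> ('u \<Rightarrow> 'u) set" where
  "deck_set U f = {\<phi> \<in> Bij U. (\<exists>\<psi>. homeomorphism U U \<phi> \<psi>) \<and> (\<forall>v\<in>U. f (\<phi> v) = f v)}"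

lemma deck_group_alt: "deck_group U f = (BijGroup U)\<lparr>carrier := deck_set U f\<rparr>"
  by (simp add: deck_group_def deck_set_def)

lemma carrier_deck_group [simp]: "carrier (deck_group U f) = deck_set U f"
  by (simp add: deck_group_alt)

lemma deck_setD:
  assumes "\<phi> \<in> deck_set U f"
  shows "\<phi> \<in> Bij U" "continuous_on U \<phi>" "v \<in> U \<Longrightarrow> \<phi> v \<in> U" "v \<in> U \<Longrightarrow> f (\<phi> v) = f v"
  using assms by (auto simp: deck_set_def homeomorphism_def Bij_imp_funcset dest: Bij_imp_funcset)

lemma subgroup_deck_set: "subgroup (deck_set U f) (BijGroup U)"
proof (rule subgroup.intro)
  show "deck_set U f \<subseteq> carrier (BijGroup U)" by (auto simp: deck_set_def BijGroup_def)
  show "\<one>\<^bsub>BijGroup U\<^esub> \<in> deck_set U f"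
    by (auto simp: deck_set_def BijGroup_def id_Bij homeomorphism_def continuous_on_id'
        cong: continuous_on_cong intro!: exI[of _ "\<lambda>x. x"])
next
  fix x y assume x: "x \<in> deck_set U f" and y: "y \<in> deck_set U f"
  then have B: "x \<in> Bij U" "y \<in> Bij U" by (auto simp: deck_set_def)
  obtain x' y' where h: "homeomorphism U U x x'" "homeomorphism U U y y'"
    using x y by (auto simp: deck_set_def)
  have "homeomorphism U U (x \<circ> y) (y' \<circ> x')" by (rule homeomorphism_compose[OF h(2,1)])
  then have "homeomorphism U U (compose U x y) (y' \<circ> x')"
    by (rule homeomorphism_cong) (auto simp: compose_def)
  moreover have "f (compose U x y v) = f v" if "v \<in> U" for v
    using deck_setD[OF x] deck_setD[OF y] that by (simp add: compose_def)
  ultimately have "compose U x y \<in> deck_set U f"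
    using compose_Bij[OF B] by (auto simp: deck_set_def)
  then show "x \<otimes>\<^bsub>BijGroup U\<^esub> y \<in> deck_set U f" using B by (simp add: BijGroup_def)
next
  fix x assume x: "x \<in> deck_set U f"
  then have B: "x \<in> Bij U" by (auto simp: deck_set_def)
  obtain x' where h: "homeomorphism U U x x'" using x by (auto simp: deck_set_def)
  have e: "inv_into U x v = x' v" if "v \<in> U" for v
    using h B that by (intro inv_into_f_eq) (auto simp: homeomorphism_def Bij_def bij_betw_def)
  have "homeomorphism U U (\<lambda>v\<in>U. inv_into U x v) x"
    by (rule homeomorphism_cong[OF homeomorphism_symD[OF h]]) (auto simp: e)
  moreover have "f (inv_into U x v) = f v" if "v \<in> U" for v
  proof -
    have "x' v \<in> U" "x (x' v) = v" using h that by (auto simp: homeomorphism_def)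
    then show ?thesis using deck_setD(4)[OF x, of "x' v"] e[OF that] by simp
  qed
  ultimately have "(\<lambda>v\<in>U. inv_into U x v) \<in> deck_set U f"
    using restrict_inv_into_Bij[OF B] by (auto simp: deck_set_def)
  then show "inv\<^bsub>BijGroup U\<^esub> x \<in> deck_set U f" by (simp add: inv_BijGroup[OF B])
qed

lemma group_deck_group: "group (deck_group U f)"
  unfolding deck_group_alt by (rule group.subgroup_imp_group[OF group_BijGroup subgroup_deck_set])

lemma deck_mult: "\<phi> \<in> deck_set U f \<Longrightarrow> \<psi> \<in> deck_set U f \<Longrightarrow> v \<in> U \<Longrightarrow> (\<phi> \<otimes>\<^bsub>deck_group U f\<^esub> \<psi>) v = \<phi> (\<psi> v)"
  by (auto simp: deck_group_alt BijGroup_def compose_def deck_set_def)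

lemma deck_one: "v \<in> U \<Longrightarrow> \<one>\<^bsub>deck_group U f\<^esub> v = v"
  by (auto simp: deck_group_alt BijGroup_def)

lemma zeta_powi: "zeta_root k powi a = exp (2 * of_real pi * \<i> * of_int a / of_nat k)"
  unfolding zeta_root_def by (simp add: exp_power_int mult_ac)

lemma zeta_powi_eq_1:
  assumes "k \<ge> 1"
  shows "zeta_root k powi a = 1 \<longleftrightarrow> int k dvd a"
proof -
  have "zeta_root k powi a = 1 \<longleftrightarrow> (\<exists>m::int. 2 * of_real pi * of_int a / of_nat k = (2 * of_int m * pi :: real))"
    unfolding zeta_powi exp_eq_1 by (simp add: field_simps)
  also have "\<dots> \<longleftrightarrow> (\<exists>m::int. real_of_int a = real_of_int (int k * m))"
    using assms by (simp add: field_simps)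
  also have "\<dots> \<longleftrightarrow> int k dvd a" unfolding of_int_eq_iff dvd_def ..
  finally show ?thesis .
qed

lemma zeta_nonzero [simp]: "zeta_root k \<noteq> 0"
  by (simp add: zeta_root_def)

locale fermat_cover = fermat k n r for k n r +
  fixes U :: "'u::real_normed_vector set" and p :: "'u \<Rightarrow> complex" and L :: "nat \<Rightarrow> 'u \<Rightarrow> complex" and u :: 'u
  assumes univ: "universal_covering U p (- r ` {1..n})"
    and L: "\<forall>i\<in>{1..n}. continuous_on U (L i) \<and> (\<forall>v\<in>U. exp (L i v) = shifted r p i v)"
    and u: "u \<in> U"
begin

abbreviation R :: "complex set" where "R \<equiv> r ` {1..n}"
abbreviation G where "G \<equiv> deck_group U p"
abbreviation DP where "DP \<equiv> deck_set U p"
abbreviation q where "q \<equiv> curve_map k n L"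
abbreviation DQ where "DQ \<equiv> deck_set U q"
abbreviation xh where "xh \<equiv> root_coord k L"

lemma cov: "covering_space U p (- R)" and sc: "simply_connected U"
  using univ by (auto simp: universal_covering_def)

lemma pcon: "path_connected U" and con: "connected U"
  using sc simply_connected_imp_path_connected simply_connected_imp_connected by auto

lemma open_R: "open (- R)"
  by (intro open_Compl finite_imp_closed) auto

lemma lpc: "locally path_connected U"
  using covering_space_locally_path_connected_eq[OF cov] open_imp_locally_path_connected[OF open_R] by blast

lemma p_cont: "continuous_on U p" and p_R: "v \<in> U \<Longrightarrow> p v \<notin> R"
  using cov covering_space_imp_continuous covering_space_imp_surjective by blast+

lemma exp_L: "i \<in> {1..n} \<Longrightarrow> v \<in> U \<Longrightarrow> exp (L i v) = eps i * (p v - r i)"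
  using L r1 by (auto simp: shifted_def eps_def)

lemma L_cont: "i \<in> {1..n} \<Longrightarrow> continuous_on U (L i)"
  using L by blast

lemma xh_power: "i \<in> {1..n} \<Longrightarrow> v \<in> U \<Longrightarrow> xh i v ^ k = eps i * (p v - r i)"
  using k exp_L by (simp add: root_coord_def flip: exp_of_nat_mult)

lemma xh_nz [simp]: "xh i v \<noteq> 0"
  by (simp add: root_coord_def)

lemma xh_cont: "i \<in> {1..n} \<Longrightarrow> continuous_on U (xh i)"
  unfolding root_coord_def[abs_def] using k by (intro continuous_intros L_cont) auto

lemma q_cont: "continuous_map (top_of_set U) C q"
  unfolding curve_map_def[abs_def]
proof (rule continuous_map_C)
  show "continuous_on U (\<lambda>v. if i = 0 then 1 else xh i v)" if "i \<in> {0..n}" for i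
    using xh_cont[of i] that by (cases "i = 0") auto
  show "on_curve (\<lambda>i. if i = 0 then 1 else xh i v)" if "v \<in> U" for v
    by (rule on_curve_affine[of _ "p v"]) (use xh_power that in auto)
qed auto

lemma hratio_q: "i \<in> {1..n} \<Longrightarrow> hratio i 0 (q w) = xh i w"
  by (simp add: curve_map_def hratio_proj_point)

lemma q_eq_iff: "q v = q w \<longleftrightarrow> (\<forall>i\<in>{1..n}. xh i v = xh i w)"
proof
  assume "q v = q w"
  then show "\<forall>i\<in>{1..n}. xh i v = xh i w"
    using hratio_proj_point[of _ n 0 "\<lambda>i. if i = 0 then 1 else xh i v"]
      hratio_proj_point[of _ n 0 "\<lambda>i. if i = 0 then 1 else xh i w"]
    by (fastforce simp: curve_map_def)
next
  assume "\<forall>i\<in>{1..n}. xh i v = xh i w"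
  then show "q v = q w" unfolding curve_map_def by (intro proj_point_cong) auto
qed

lemma q_eq_p: assumes "q v = q w" "v \<in> U" "w \<in> U" shows "p v = p w"
proof -
  have "xh 1 v ^ k = xh 1 w ^ k" using assms(1) n by (simp add: q_eq_iff)
  then show ?thesis using xh_power[of 1] assms n by (simp add: eps_def)
qed

lemma lift_unique:
  assumes "continuous_on T g1" "g1 ` T \<subseteq> U" "continuous_on T g2" "g2 ` T \<subseteq> U"
    "\<And>t. t \<in> T \<Longrightarrow> p (g1 t) = p (g2 t)" "connected T" "a \<in> T" "g1 a = g2 a" "t \<in> T"
  shows "g1 t = g2 t"
proof (rule covering_space_lift_unique[OF cov assms(8) _ _ assms(1) _ _ assms(3) _ _ assms(6,7,9)])
  have "g1 t \<in> U" if "t \<in> T" for t using assms(2) that by blast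
  then show "p \<circ> g1 \<in> T \<rightarrow> - R" using p_R by auto
  show "continuous_on T (p \<circ> g1)"
    by (intro continuous_on_compose assms continuous_on_subset[OF p_cont])
qed (use assms in auto)

lemma lift_path:
  assumes "v \<in> U" "path g" "path_image g \<subseteq> - R" "pathstart g = p v"
  obtains h where "path h" "path_image h \<subseteq> U" "pathstart h = v" "\<And>t. t \<in> {0..1} \<Longrightarrow> p (h t) = g t"
  using covering_space_lift_path_strong[OF cov assms] by blast

text \<open>Lifting \<open>p\<close> through itself in both directions gives maps whose composites
  are lifts of \<open>p\<close> with a fixed point, hence the identity on \<open>U\<close>. So
  Deck(p) acts transitively on the fibres.\<close>

lemma deck_exists:
  assumes "v \<in> U" "w \<in> U" "p v = p w"
  obtains \<phi> where "\<phi> \<in> DP" "\<phi> v = w"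
proof -
  have lift: "\<exists>g. continuous_on U g \<and> g \<in> U \<rightarrow> U \<and> g v = w \<and> (\<forall>y\<in>U. p (g y) = p y)"
    if "v \<in> U" "w \<in> U" "p v = p w" for v w
    by (rule covering_space_lift_strong[OF cov that(2,1) sc lpc p_cont _ that(3)])
      (use p_R in blast)+
  obtain g where g: "continuous_on U g" "g \<in> U \<rightarrow> U" "g v = w" "\<And>y. y \<in> U \<Longrightarrow> p (g y) = p y"
    using lift[OF assms] by blast
  obtain h where h: "continuous_on U h" "h \<in> U \<rightarrow> U" "h w = v" "\<And>y. y \<in> U \<Longrightarrow> p (h y) = p y"
    using lift[OF assms(2,1) assms(3)[symmetric]] by blast
  have gU: "g y \<in> U" and hU: "h y \<in> U" if "y \<in> U" for y using that g(2) h(2) by auto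
  have hg: "h (g y) = y" if "y \<in> U" for y
    by (rule lift_unique[of U "\<lambda>y. h (g y)" "\<lambda>y. y" v])
      (use g h gU hU that assms con in \<open>auto intro!: continuous_on_compose2[OF h(1) g(1)]\<close>)
  have gh: "g (h y) = y" if "y \<in> U" for y
    by (rule lift_unique[of U "\<lambda>y. g (h y)" "\<lambda>y. y" w])
      (use g h gU hU that assms con in \<open>auto intro!: continuous_on_compose2[OF g(1) h(1)]\<close>)
  have "homeomorphism U U g h"
    by (rule homeomorphismI) (use g(1) h(1) gU hU hg gh in auto)
  \<comment> \<open>Elements of \<open>BijGroup\<close> are undefined outside \<open>U\<close>,
    hence the restriction.\<close>
  then have hom: "homeomorphism U U (restrict g U) h"
    by (rule homeomorphism_cong) auto
  then have "restrict g U \<in> Bij U"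
    unfolding Bij_def bij_betw_def by (auto simp: homeomorphism_def intro: inj_on_inverseI)
  then have "restrict g U \<in> DP" using hom g(4) by (auto simp: deck_set_def)
  then show ?thesis using that[of "restrict g U"] g(3) assms by auto
qed

text \<open>The difference of the two logarithms lies in the discrete set of integer multiples of 2
  pi i, so it cannot vary continuously.\<close>

lemma const_log_diff:
  assumes T: "connected T" and f: "continuous_on T f" "continuous_on T g"
    and e: "\<And>t. t \<in> T \<Longrightarrow> exp (f t) = exp (g t)" and ab: "a \<in> T" "b \<in> T"
  shows "f a - g a = f b - (g b :: complex)"
proof -
  define h where "h t = Re ((f t - g t) / (2 * pi * \<i>))" for t
  have int: "\<exists>m::int. f t - g t = of_int (2 * m) * (of_real pi * \<i>)" if "t \<in> T" for t
    using e[OF that] unfolding exp_eq by (auto simp: algebra_simps)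
  then have hint: "h t \<in> \<int> \<and> f t - g t = 2 * pi * \<i> * h t" if "t \<in> T" for t
    using int[OF that] by (auto simp: h_def)
  have "continuous_on T h" unfolding h_def by (intro continuous_intros f) auto
  moreover have "\<exists>e>0. \<forall>y. y \<in> T \<and> h y \<noteq> h x \<longrightarrow> e \<le> norm (h y - h x)" if "x \<in> T" for x
  proof (intro exI[of _ 1] conjI allI impI)
    fix y assume "y \<in> T \<and> h y \<noteq> h x"
    then have "h y - h x \<in> \<int>" "h y - h x \<noteq> 0" using hint that by auto
    then show "1 \<le> norm (h y - h x)" by (simp add: Ints_nonzero_abs_ge1)
  qed auto
  ultimately have "h constant_on T"
    using continuous_discrete_range_constant[OF T] by blast
  then have "h a = h b" using ab by (auto simp: constant_on_def)
  then show ?thesis using hint ab by simp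
qed

text \<open>The monodromy of the i-th logarithm, a winding number about \<open>r i\<close>. It is
  additive in \<open>\<phi>\<close> and thus the i-th exponent sum, once its values on the
  generators are known.\<close>

definition mon :: "('u \<Rightarrow> 'u) \<Rightarrow> nat \<Rightarrow> int" where
  "mon \<phi> i = (SOME m. L i (\<phi> u) - L i u = 2 * pi * \<i> * of_int m)"

text \<open>The increment of the logarithm is constant on the connected set \<open>U\<close>, so the
  value at \<open>u\<close>, which defines \<open>mon\<close>, applies everywhere.\<close>

lemma log_deck:
  assumes \<phi>: "\<phi> \<in> DP" and i: "i \<in> {1..n}" and v: "v \<in> U"
  shows "L i (\<phi> v) = L i v + 2 * pi * \<i> * of_int (mon \<phi> i)"
proof -
  have e: "exp (L i (\<phi> w)) = exp (L i w)" if "w \<in> U" for w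
    using exp_L[OF i] deck_setD(3,4)[OF \<phi>] that by simp
  then obtain m :: int where "L i (\<phi> u) - L i u = 2 * pi * \<i> * of_int m"
    using u unfolding exp_eq by (force simp: algebra_simps)
  then have 1: "L i (\<phi> u) - L i u = 2 * pi * \<i> * of_int (mon \<phi> i)"
    unfolding mon_def by (rule someI[of "\<lambda>m. L i (\<phi> u) - L i u = 2 * pi * \<i> * of_int m"])
  have "L i (\<phi> v) - L i v = L i (\<phi> u) - L i u"
    by (rule const_log_diff[OF con _ L_cont[OF i] _ v u, of "\<lambda>v. L i (\<phi> v)"])
      (use e deck_setD[OF \<phi>] in \<open>auto intro!: continuous_on_compose2[OF L_cont[OF i]]\<close>)
  then show ?thesis using 1 by (simp add: algebra_simps)
qed

lemma mon_eqI:
  assumes \<phi>: "\<phi> \<in> DP" and i: "i \<in> {1..n}" and v: "v \<in> U" "L i (\<phi> v) = L i v + 2 * pi * \<i> * of_int m"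
  shows "mon \<phi> i = m"
  using log_deck[OF \<phi> i v(1)] v(2) by simp

lemma xh_mon:
  assumes \<phi>: "\<phi> \<in> DP" and i: "i \<in> {1..n}" and v: "v \<in> U"
  shows "xh i (\<phi> v) = zeta_root k powi mon \<phi> i * xh i v"
  unfolding root_coord_def log_deck[OF assms] zeta_powi by (simp add: add_divide_distrib exp_add mult_ac)

lemma G_group: "group G" by (rule group_deck_group)

lemma G_mult: "\<phi> \<in> DP \<Longrightarrow> \<psi> \<in> DP \<Longrightarrow> \<phi> \<otimes>\<^bsub>G\<^esub> \<psi> \<in> DP"
  using group.subgroup_self[OF G_group] subgroup.m_closed by fastforce

lemma G_inv: "\<phi> \<in> DP \<Longrightarrow> inv\<^bsub>G\<^esub> \<phi> \<in> DP"
  using group.inv_closed[OF G_group] by fastforce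

lemma G_one: "\<one>\<^bsub>G\<^esub> \<in> DP"
  using group.subgroup_self[OF G_group] subgroup.one_closed by fastforce

lemma mon_mult: "\<phi> \<in> DP \<Longrightarrow> \<psi> \<in> DP \<Longrightarrow> i \<in> {1..n} \<Longrightarrow> mon (\<phi> \<otimes>\<^bsub>G\<^esub> \<psi>) i = mon \<phi> i + mon \<psi> i"
  using log_deck[of \<psi> i u] log_deck[of \<phi> i "\<psi> u"] u deck_setD(3)[of \<psi> U p u]
  by (intro mon_eqI[OF G_mult _ u]) (auto simp: deck_mult algebra_simps)

lemma mon_one: "i \<in> {1..n} \<Longrightarrow> mon \<one>\<^bsub>G\<^esub> i = 0"
  by (rule mon_eqI[OF G_one _ u]) (use u in \<open>auto simp: deck_one\<close>)

lemma mon_inv: "\<phi> \<in> DP \<Longrightarrow> i \<in> {1..n} \<Longrightarrow> mon (inv\<^bsub>G\<^esub> \<phi>) i = - mon \<phi> i"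
  using mon_mult[of "inv\<^bsub>G\<^esub> \<phi>" \<phi> i] mon_one group.l_inv[OF G_group, of \<phi>] G_inv by simp

lemma mon_pow: "\<phi> \<in> DP \<Longrightarrow> i \<in> {1..n} \<Longrightarrow> mon (\<phi> [^]\<^bsub>G\<^esub> (m::nat)) i = int m * mon \<phi> i"
proof (induction m)
  case (Suc m)
  have "\<phi> [^]\<^bsub>G\<^esub> m \<in> DP"
    using monoid.nat_pow_closed[OF group.is_monoid[OF G_group], of \<phi> m] Suc by simp
  then have "mon (\<phi> [^]\<^bsub>G\<^esub> m \<otimes>\<^bsub>G\<^esub> \<phi>) i = mon (\<phi> [^]\<^bsub>G\<^esub> m) i + mon \<phi> i"
    using Suc by (intro mon_mult)
  then show ?case using Suc by (simp add: algebra_simps)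
qed (simp add: mon_one)

text \<open>The i-th root coordinate is multiplied by the power of zeta with exponent
  \<open>mon \<phi> i\<close>. Deck(q) is thus the kernel of the monodromy modulo \<open>k\<close>;
  in particular it is normal and contains all commutators.\<close>

lemma DQ_iff: "\<phi> \<in> DQ \<longleftrightarrow> \<phi> \<in> DP \<and> (\<forall>i\<in>{1..n}. int k dvd mon \<phi> i)"
proof
  assume Q: "\<phi> \<in> DQ"
  have "p (\<phi> v) = p v" if "v \<in> U" for v
    using q_eq_p deck_setD(3,4)[OF Q] that by blast
  then have P: "\<phi> \<in> DP" using Q by (simp add: deck_set_def)
  moreover have "int k dvd mon \<phi> i" if i: "i \<in> {1..n}" for i
  proof -
    have "xh i (\<phi> u) = xh i u" using deck_setD(4)[OF Q u] i by (simp add: q_eq_iff)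
    then have "zeta_root k powi mon \<phi> i = 1" using xh_mon[OF P i u] by simp
    then show ?thesis using zeta_powi_eq_1 k by simp
  qed
  ultimately show "\<phi> \<in> DP \<and> (\<forall>i\<in>{1..n}. int k dvd mon \<phi> i)" by blast
next
  assume P: "\<phi> \<in> DP \<and> (\<forall>i\<in>{1..n}. int k dvd mon \<phi> i)"
  then have "q (\<phi> v) = q v" if "v \<in> U" for v
    using xh_mon[of \<phi> _ v] that zeta_powi_eq_1[of k] k by (auto simp: q_eq_iff)
  then show "\<phi> \<in> DQ" using P by (simp add: deck_set_def)
qed

lemma DQ_DP: "\<phi> \<in> DQ \<Longrightarrow> \<phi> \<in> DP" by (simp add: DQ_iff)

lemma deck_q_exists:
  assumes "v \<in> U" "w \<in> U" "q v = q w"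
  obtains \<phi> where "\<phi> \<in> DQ" "\<phi> v = w"
proof -
  obtain \<phi> where \<phi>: "\<phi> \<in> DP" "\<phi> v = w" using deck_exists[OF assms(1,2) q_eq_p[OF assms(3,1,2)]] .
  have "int k dvd mon \<phi> i" if i: "i \<in> {1..n}" for i
  proof -
    have "xh i (\<phi> v) = xh i v" using assms(3) \<phi>(2) i by (simp add: q_eq_iff)
    then have "zeta_root k powi mon \<phi> i = 1" using xh_mon[OF \<phi>(1) i assms(1)] by simp
    then show ?thesis using zeta_powi_eq_1 k by simp
  qed
  then show ?thesis using that \<phi> DQ_iff by blast
qed

section \<open>Homology classes of the loops given by deck transformations\<close>

abbreviation qchain :: "(real \<Rightarrow> 'u) \<Rightarrow> (nat \<Rightarrow> complex) set chain" where
  "qchain c \<equiv> frag_of (simplex_of_path (q \<circ> c))"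

abbreviation upath :: "(real \<Rightarrow> 'u) \<Rightarrow> 'u \<Rightarrow> 'u \<Rightarrow> bool" where
  "upath c v w \<equiv> path c \<and> path_image c \<subseteq> U \<and> pathstart c = v \<and> pathfinish c = w"

lemma upath_exists: "v \<in> U \<Longrightarrow> w \<in> U \<Longrightarrow> \<exists>c. upath c v w"
  using pcon unfolding path_connected_def by blast

lemma upath_deck:
  assumes "upath c v w" "\<phi> \<in> DP"
  shows "upath (\<phi> \<circ> c) (\<phi> v) (\<phi> w)"
proof (intro conjI)
  show "path (\<phi> \<circ> c)"
    by (rule path_continuous_image) (use assms deck_setD(2)[OF assms(2)] continuous_on_subset in auto)
  show "path_image (\<phi> \<circ> c) \<subseteq> U"
    using assms(1) deck_setD(3)[OF assms(2)] by (auto simp: path_image_def)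
qed (use assms(1) in \<open>auto simp: pathstart_def pathfinish_def\<close>)

lemma qchain_eq:
  assumes "upath c v w" "upath c' v w"
  shows "homologous_rel 1 C {} (qchain c) (qchain c')"
  by (rule homologous_simply_connected[OF q_cont sc]) (use assms in auto)

lemma deck_class_eq:
  assumes "upath c u (\<phi> u)"
  shows "deck_class C U q u \<phi> = hclass C (qchain c)"
proof -
  have "upath (SOME c. upath c u (\<phi> u)) u (\<phi> u)" by (rule someI[of "\<lambda>c. upath c u (\<phi> u)", OF assms])
  then show ?thesis
    unfolding deck_class_def homologous_rel_set_eq by (rule qchain_eq[OF _ assms])
qed

text \<open>An equality of chains and not just a homology, because \<open>q\<close> absorbs
  \<open>\<phi>\<close> pointwise.\<close>

lemma qchain_DQ:
  assumes "upath c v w" "\<phi> \<in> DQ"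
  shows "qchain (\<phi> \<circ> c) = qchain c"
  using simplex_of_path_cong[of "q \<circ> (\<phi> \<circ> c)" "q \<circ> c"] deck_setD(4)[OF assms(2)] assms(1)
  by (auto simp: path_image_def image_subset_iff)

lemma DQ_cycle:
  assumes "\<phi> \<in> DQ" "upath c u (\<phi> u)"
  shows "singular_relcycle 1 C {} (qchain c)"
proof (rule cycle_simplex_of_loop)
  show "continuous_map (top_of_set {0..1}) C (q \<circ> c)"
    using assms(2) continuous_map_path_compose[OF q_cont] by blast
  show "(q \<circ> c) 0 = (q \<circ> c) 1"
    using assms deck_setD(4)[OF assms(1) u] by (simp add: pathstart_def pathfinish_def)
qed

lemma deck_class_carrier: "\<phi> \<in> DQ \<Longrightarrow> deck_class C U q u \<phi> \<in> carrier (homology_group 1 C)"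
  using upath_exists[OF u deck_setD(3)[OF _ u], of \<phi> q] DQ_cycle deck_class_eq
  unfolding carrier_homology_1 by blast

lemma qchain_join:
  assumes "upath c v w" "upath c' w x"
  shows "homologous_rel 1 C {} (qchain (c +++ c')) (qchain c + qchain c')" "upath (c +++ c') v x"
proof -
  show "homologous_rel 1 C {} (qchain (c +++ c')) (qchain c + qchain c')"
    by (rule homologous_join[OF q_cont]) (use assms in auto)
  show "upath (c +++ c') v x" using assms by (auto simp: path_image_join)
qed

lemma qchain_reverse:
  assumes "upath c v w"
  shows "homologous_rel 1 C {} (qchain (reversepath c)) (- qchain c)" "upath (reversepath c) w v"
proof -
  show "homologous_rel 1 C {} (qchain (reversepath c)) (- qchain c)"
    by (rule homologous_reverse[OF q_cont]) (use assms in auto)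
  show "upath (reversepath c) w v" using assms by auto
qed

lemma DQ_mult: "\<phi> \<in> DQ \<Longrightarrow> \<psi> \<in> DQ \<Longrightarrow> \<phi> \<otimes>\<^bsub>G\<^esub> \<psi> \<in> DQ"
  by (auto simp: DQ_iff G_mult mon_mult)

lemma DQ_inv: "\<phi> \<in> DQ \<Longrightarrow> inv\<^bsub>G\<^esub> \<phi> \<in> DQ"
  by (auto simp: DQ_iff G_inv mon_inv)

lemma DQ_conj: "\<phi> \<in> DQ \<Longrightarrow> \<rho> \<in> DP \<Longrightarrow> \<rho> \<otimes>\<^bsub>G\<^esub> \<phi> \<otimes>\<^bsub>G\<^esub> inv\<^bsub>G\<^esub> \<rho> \<in> DQ"
  by (auto simp: DQ_iff G_inv mon_inv G_mult mon_mult)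

text \<open>The path to \<open>\<phi> u\<close> followed by the \<open>\<phi>\<close>-translate of
  the path to \<open>\<psi> u\<close> ends at the image of \<open>u\<close> under the product, and
  \<open>q\<close> does not distinguish a path from its translate by Deck(q).\<close>

lemma deck_class_mult:
  assumes "\<phi> \<in> DQ" "\<psi> \<in> DQ"
  shows "deck_class C U q u (\<phi> \<otimes>\<^bsub>G\<^esub> \<psi>) = deck_class C U q u \<phi> \<otimes>\<^bsub>homology_group 1 C\<^esub> deck_class C U q u \<psi>"
proof -
  have P: "\<phi> \<in> DP" "\<psi> \<in> DP" using assms DQ_DP by auto
  obtain c d where c: "upath c u (\<phi> u)" and d: "upath d u (\<psi> u)"
    using upath_exists u deck_setD(3)[OF P(1) u] deck_setD(3)[OF P(2) u] by blast
  have d': "upath (\<phi> \<circ> d) (\<phi> u) (\<phi> (\<psi> u))" by (rule upath_deck[OF d P(1)])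
  have e: "upath (c +++ (\<phi> \<circ> d)) u ((\<phi> \<otimes>\<^bsub>G\<^esub> \<psi>) u)"
    using qchain_join(2)[OF c d'] deck_mult[OF P u] by simp
  have "hclass C (qchain (c +++ (\<phi> \<circ> d))) = hclass C (qchain c + qchain d)"
    using qchain_join(1)[OF c d'] qchain_DQ[OF d assms(1)] by (simp add: homologous_rel_set_eq)
  then show ?thesis
    unfolding deck_class_eq[of c \<phi>, OF c] deck_class_eq[of d \<psi>, OF d] deck_class_eq[of _ "\<phi> \<otimes>\<^bsub>G\<^esub> \<psi>", OF e] mult_homology_1 .
qed

text \<open>The conjugate, called \<open>?k\<close>, moves \<open>u\<close> along a path
  \<open>d\<close> to \<open>\<rho> u\<close>, then the \<open>\<rho>\<close>-translate of
  \<open>c\<close>, then the \<open>?k\<close>-translate of \<open>d\<close> backwards. As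
  \<open>?k\<close> lies in Deck(q), the two copies of \<open>d\<close> have the same image under
  \<open>q\<close> and cancel.\<close>

lemma deck_class_conj:
  assumes \<rho>: "\<rho> \<in> DP" and \<phi>: "\<phi> \<in> DQ" and c: "upath c u (\<phi> u)"
  shows "deck_class C U q u (\<rho> \<otimes>\<^bsub>G\<^esub> \<phi> \<otimes>\<^bsub>G\<^esub> inv\<^bsub>G\<^esub> \<rho>) = hclass C (qchain (\<rho> \<circ> c))"
proof -
  let ?k = "\<rho> \<otimes>\<^bsub>G\<^esub> \<phi> \<otimes>\<^bsub>G\<^esub> inv\<^bsub>G\<^esub> \<rho>"
  have P: "\<phi> \<in> DP" and k: "?k \<in> DQ" using \<phi> \<rho> DQ_DP DQ_conj by auto
  have kP: "?k \<in> DP" using k DQ_DP by blast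
  obtain d where d: "upath d u (\<rho> u)" using upath_exists u deck_setD(3)[OF \<rho> u] by blast
  have c': "upath (\<rho> \<circ> c) (\<rho> u) (\<rho> (\<phi> u))" by (rule upath_deck[OF c \<rho>])
  have "?k \<otimes>\<^bsub>G\<^esub> \<rho> = \<rho> \<otimes>\<^bsub>G\<^esub> \<phi>"
    using group.inv_solve_right'[OF G_group] \<rho> P G_mult kP group.is_monoid[OF G_group]
    by (metis (no_types, lifting) G_group G_inv carrier_deck_group group.l_inv monoid.m_assoc monoid.r_one)
  then have "?k (\<rho> u) = \<rho> (\<phi> u)" using deck_mult[OF kP \<rho> u] deck_mult[OF \<rho> P u] by simp
  then have d': "upath (?k \<circ> d) (?k u) (\<rho> (\<phi> u))" using upath_deck[OF d kP] by simp
  have r: "upath (reversepath (?k \<circ> d)) (\<rho> (\<phi> u)) (?k u)" by (rule qchain_reverse(2)[OF d'])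
  have j1: "upath (d +++ (\<rho> \<circ> c)) u (\<rho> (\<phi> u))" by (rule qchain_join(2)[OF d c'])
  have j2: "upath ((d +++ (\<rho> \<circ> c)) +++ reversepath (?k \<circ> d)) u (?k u)" by (rule qchain_join(2)[OF j1 r])
  have "homologous_rel 1 C {} (qchain ((d +++ (\<rho> \<circ> c)) +++ reversepath (?k \<circ> d)))
      (qchain (d +++ (\<rho> \<circ> c)) + qchain (reversepath (?k \<circ> d)))"
    by (rule qchain_join(1)[OF j1 r])
  moreover have "homologous_rel 1 C {} (qchain (d +++ (\<rho> \<circ> c)) + qchain (reversepath (?k \<circ> d)))
      ((qchain d + qchain (\<rho> \<circ> c)) + (- qchain d))"
    using qchain_join(1)[OF d c'] qchain_reverse(1)[OF d'] qchain_DQ[OF d k]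
    by (intro homologous_rel_add) simp_all
  ultimately have "homologous_rel 1 C {} (qchain ((d +++ (\<rho> \<circ> c)) +++ reversepath (?k \<circ> d))) (qchain (\<rho> \<circ> c))"
    using homologous_rel_trans by fastforce
  then show ?thesis unfolding deck_class_eq[of _ ?k, OF j2] homologous_rel_set_eq .
qed

end

section \<open>Loops around the branch points\<close>

lemma root_of_unity_zeta:
  assumes "w ^ k = 1" "k \<ge> 1"
  obtains a where "w = zeta_root k powi int a"
proof -
  have "w \<in> {z. z ^ k = 1}" using assms by simp
  then obtain a where "w = exp (2 * of_real pi * \<i> * of_nat a / of_nat k)"
    unfolding complex_roots_unity[OF assms(2)] by blast
  then have "w = zeta_root k powi int a"
    unfolding zeta_powi by simp
  then show ?thesis by (rule that)
qed

lemma finite_gap_above: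
  assumes "finite A" "\<And>a. a \<in> A \<Longrightarrow> x < (a::real)"
  obtains e where "x < e" "\<And>a. a \<in> A \<Longrightarrow> e \<le> a"
proof
  show "x < Min (insert (x + 1) A)" using assms by simp
  show "\<And>a. a \<in> A \<Longrightarrow> Min (insert (x + 1) A) \<le> a" using assms by simp
qed

context fermat_cover
begin

text \<open>Unique lifting splits the lifted loop into three pieces: the first half is
  \<open>b\<close>, the last quarter is the \<open>\<phi>\<close>-translate of \<open>b\<close> run
  backwards, and what remains is a path over the circle from \<open>b \<sigma>\<close> to its
  translate. The last clause keeps the rest of the arc inside that circle.\<close>

lemma arc_lift_loop:
  assumes i: "i \<in> {1..n}" and \<beta>: "branch_arc R (p u) (r i) \<beta>"
    and deck: "deck_of_arc R U p u \<beta> \<phi>" and b: "arc_lift U p u \<beta> b" and \<phi>: "\<phi> \<in> DP"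
  shows "\<exists>\<sigma> d. 0 \<le> \<sigma> \<and> \<sigma> < 1 \<and> upath d (b \<sigma>) (\<phi> (b \<sigma>)) \<and>
    (\<forall>t\<in>{0..1}. p (d t) = r i + (\<beta> \<sigma> - r i) * cis (2 * pi * t)) \<and>
    cball (r i) (dist (\<beta> \<sigma>) (r i)) \<inter> R = {r i} \<and>
    (\<forall>s. \<sigma> \<le> s \<and> s < 1 \<longrightarrow> dist (\<beta> s) (r i) \<le> dist (\<beta> \<sigma>) (r i))"
proof -
  have \<beta>1: "\<beta> 1 = r i" and \<beta>c: "continuous_on {0..1} \<beta>"
    using \<beta> by (auto simp: branch_arc_def pathfinish_def path_def dest!: valid_path_imp_path)
  obtain \<tau> \<sigma> c where st: "straight_from \<tau> \<beta>" "\<tau> \<le> \<sigma>" "\<sigma> < 1"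
    and ball: "cball (r i) (dist (\<beta> \<sigma>) (r i)) \<inter> R = {r i}"
    and c: "path c" "path_image c \<subseteq> U" "c 0 = u" "c 1 = \<phi> u"
    and pc: "\<And>t. t \<in> {0..1} \<Longrightarrow> p (c t) = branch_loop \<beta> \<sigma> t"
    using deck \<beta>1 unfolding deck_of_arc_def pathstart_def pathfinish_def by auto
  have \<tau>: "0 \<le> \<tau>" "\<tau> < 1" "inj_on \<beta> {\<tau>..1}" using st(1) by (auto simp: straight_from_def)
  have \<sigma>: "0 \<le> \<sigma>" using \<tau> st by linarith
  have bc: "continuous_on {0..<1} b" "\<And>t. t \<in> {0..<1} \<Longrightarrow> b t \<in> U" "b 0 = u"
    "\<And>t. t \<in> {0..<1} \<Longrightarrow> p (b t) = \<beta> t" using b by (auto simp: arc_lift_def)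
  have cc: "continuous_on {0..1} c" "\<And>t. t \<in> {0..1} \<Longrightarrow> c t \<in> U"
    using c by (auto simp: path_def path_image_def)
  have in01: "\<sigma> * x \<in> {0..<1}" if "x \<in> {0..1}" for x
    using that \<sigma> st(3) by (auto simp: mult_left_le intro: le_less_trans[of _ \<sigma>])
  have 1: "c (1/2) = b \<sigma>"
  proof -
    have "c (1/2) = b (\<sigma> * (2 * (1/2)))"
    proof (rule lift_unique[of "{0..1/2}" c "\<lambda>t. b (\<sigma> * (2 * t))" 0 "1/2"])
      show "continuous_on {0..1/2} c" by (rule continuous_on_subset[OF cc(1)]) auto
      show "continuous_on {0..1/2} (\<lambda>t. b (\<sigma> * (2 * t)))"
        by (rule continuous_on_compose2[OF bc(1)]) (use in01 in \<open>auto intro!: continuous_intros\<close>)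
      show "p (c t) = p (b (\<sigma> * (2 * t)))" if "t \<in> {0..1/2}" for t
        using pc[of t] bc(4)[OF in01[of "2 * t"]] that
        by (auto simp: branch_loop_def joinpaths_def subpath_def)
      show "c ` {0..1/2} \<subseteq> U" using cc(2) by auto
      show "(\<lambda>t. b (\<sigma> * (2 * t))) ` {0..1/2} \<subseteq> U" using bc(2) in01 by auto
    qed (use c bc in auto)
    then show ?thesis by simp
  qed
  have 2: "c (3/4) = \<phi> (b \<sigma>)"
  proof -
    have "c (3/4 + 0/4) = \<phi> (b (\<sigma> * (1 - 0)))"
    \<comment> \<open>The two lifts are compared at their common end \<open>\<phi> u\<close>,
      reached at parameter 1.\<close>
    proof (rule lift_unique[of "{0..1}" "\<lambda>t. c (3/4 + t/4)" "\<lambda>t. \<phi> (b (\<sigma> * (1 - t)))" 1 0])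
      show "continuous_on {0..1} (\<lambda>t. c (3/4 + t/4))"
        by (rule continuous_on_compose2[OF cc(1)]) (auto intro!: continuous_intros)
      have "continuous_on {0..1} (\<lambda>t. b (\<sigma> * (1 - t)))"
        by (rule continuous_on_compose2[OF bc(1)]) (use in01 in \<open>auto intro!: continuous_intros\<close>)
      then show "continuous_on {0..1} (\<lambda>t. \<phi> (b (\<sigma> * (1 - t))))"
        by (rule continuous_on_compose2[OF deck_setD(2)[OF \<phi>]]) (use in01 bc(2) in auto)
      show "(\<lambda>t. c (3/4 + t/4)) ` {0..1} \<subseteq> U" using cc(2) by auto
      show "(\<lambda>t. \<phi> (b (\<sigma> * (1 - t)))) ` {0..1} \<subseteq> U" using bc(2) in01 deck_setD(3)[OF \<phi>] by auto
      fix t :: real assume t: "t \<in> {0..1}"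
      have "p (\<phi> (b (\<sigma> * (1 - t)))) = \<beta> (\<sigma> * (1 - t))"
        using deck_setD(4)[OF \<phi>] bc(2,4)[OF in01[of "1 - t"]] t by simp
      moreover have "branch_loop \<beta> \<sigma> (3/4 + t/4) = \<beta> (\<sigma> * (1 - t))"
      proof (cases "t = 0")
        case True
        then show ?thesis by (simp add: branch_loop_def joinpaths_def cis.ctr complex_eq_iff)
      next
        case False
        have "2 * (2 * (3 / 4 + t / 4) - 1) - 1 = t" by simp
        moreover have "\<not> 3 / 4 + t / 4 \<le> 1/2" "\<not> 2 * (3 / 4 + t / 4) - 1 \<le> 1/2" using False t by auto
        ultimately show ?thesis
          by (simp only: branch_loop_def joinpaths_def reversepath_def subpath_def if_False) simp
      qed
      ultimately show "p (c (3/4 + t/4)) = p (\<phi> (b (\<sigma> * (1 - t))))"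
        using pc[of "3/4 + t/4"] t by simp
    qed (use c bc in auto)
    then show ?thesis by simp
  qed
  define d where "d t = c (1/2 + t/4)" for t
  have pd: "p (d t) = r i + (\<beta> \<sigma> - r i) * cis (2 * pi * t)" if t: "t \<in> {0..1}" for t
  proof -
    have "branch_loop \<beta> \<sigma> (1/2 + t/4) = r i + (\<beta> \<sigma> - r i) * cis (2 * pi * t)"
    proof (cases "t = 0")
      case True
      then show ?thesis by (simp add: branch_loop_def joinpaths_def subpath_def)
    next
      case False
      have "2 * (2 * (1/2 + t / 4) - 1) = t" by simp
      moreover have "\<not> 1/2 + t / 4 \<le> 1/2" "2 * (1/2 + t / 4) - 1 \<le> 1/2" using False t by auto
      ultimately show ?thesis
        by (simp only: branch_loop_def joinpaths_def if_False if_True \<beta>1)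
    qed
    then show ?thesis using pc[of "1/2 + t/4"] t by (simp add: d_def)
  qed
  have "path d" unfolding d_def path_def
    by (rule continuous_on_compose2[OF cc(1)]) (auto intro!: continuous_intros)
  moreover have "path_image d \<subseteq> U" using cc(2) by (auto simp: path_image_def d_def)
  ultimately have ud: "upath d (b \<sigma>) (\<phi> (b \<sigma>))"
    using 1 2 by (simp add: d_def pathstart_def pathfinish_def)
  \<comment> \<open>A straight end run injectively meets each distance to \<open>r i\<close> only
    once; an excursion outside the circle would meet its radius again by the intermediate value
    theorem.\<close>
  have mono: "dist (\<beta> s) (r i) \<le> dist (\<beta> \<sigma>) (r i)" if s: "\<sigma> \<le> s" "s < 1" for s
  proof (rule ccontr)
    assume "\<not> ?thesis"
    then have gt: "dist (\<beta> \<sigma>) (r i) < dist (\<beta> s) (r i)" by simp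
    have "continuous_on {s..1} (\<lambda>t. dist (\<beta> t) (r i))"
      by (intro continuous_intros continuous_on_subset[OF \<beta>c]) (use s \<sigma> in auto)
    moreover have "dist (\<beta> 1) (r i) \<le> dist (\<beta> \<sigma>) (r i)" using \<beta>1 by simp
    ultimately obtain t where t: "s \<le> t" "t \<le> 1" "dist (\<beta> t) (r i) = dist (\<beta> \<sigma>) (r i)"
      using IVT2'[of "\<lambda>t. dist (\<beta> t) (r i)" 1 "dist (\<beta> \<sigma>) (r i)" s] gt s by auto
    have seg: "\<beta> t \<in> closed_segment (\<beta> \<tau>) (r i)" "\<beta> \<sigma> \<in> closed_segment (\<beta> \<tau>) (r i)"
      using st(1) st(2,3) t s \<beta>1 unfolding straight_from_def by auto
    then obtain x y where xy: "\<beta> t = (1 - x) *\<^sub>R \<beta> \<tau> + x *\<^sub>R r i" "x \<le> 1" "\<beta> \<sigma> = (1 - y) *\<^sub>R \<beta> \<tau> + y *\<^sub>R r i" "y \<le> 1"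
      by (auto simp: closed_segment_def)
    have "\<beta> t - r i = (1 - x) *\<^sub>R (\<beta> \<tau> - r i)" "\<beta> \<sigma> - r i = (1 - y) *\<^sub>R (\<beta> \<tau> - r i)"
      using xy by (simp_all add: algebra_simps)
    then have "dist (\<beta> t) (r i) = (1 - x) * dist (\<beta> \<tau>) (r i)" "dist (\<beta> \<sigma>) (r i) = (1 - y) * dist (\<beta> \<tau>) (r i)"
      using xy by (simp_all add: dist_norm)
    moreover have "\<beta> \<tau> \<noteq> \<beta> 1" using inj_onD[OF \<tau>(3), of \<tau> 1] \<tau>(2) by auto
    then have "dist (\<beta> \<tau>) (r i) \<noteq> 0" using \<beta>1 by simp
    ultimately have "x = y" using t(3) by simp
    then have "\<beta> t = \<beta> \<sigma>" using xy by simp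
    then have "t = \<sigma>" using \<tau>(3) t s st(2,3) by (auto dest: inj_onD)
    then have "s = \<sigma>" using t s by simp
    then show False using gt by simp
  qed
  show ?thesis
    by (intro exI[of _ \<sigma>] exI[of _ d] conjI ballI allI impI) (use \<sigma> st(3) ud pd ball mono in blast)+
qed

text \<open>The circle about \<open>r i\<close> adds 2 pi i to the logarithm that belongs to
  \<open>r i\<close>. For any other \<open>j\<close> the logarithm that belongs to
  \<open>r j\<close> extends to the closed disc and so returns to its value.\<close>

lemma arc_mon:
  assumes i: "i \<in> {1..n}" and \<beta>: "branch_arc R (p u) (r i) \<beta>"
    and deck: "deck_of_arc R U p u \<beta> \<phi>" and b: "arc_lift U p u \<beta> b" and \<phi>: "\<phi> \<in> DP"
    and j: "j \<in> {1..n}"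
  shows "mon \<phi> j = (if j = i then 1 else 0)"
proof -
  obtain \<sigma> d where \<sigma>: "0 \<le> \<sigma>" "\<sigma> < 1" and d: "upath d (b \<sigma>) (\<phi> (b \<sigma>))"
    and pd: "\<And>t. t \<in> {0..1} \<Longrightarrow> p (d t) = r i + (\<beta> \<sigma> - r i) * cis (2 * pi * t)"
    and ball: "cball (r i) (dist (\<beta> \<sigma>) (r i)) \<inter> R = {r i}"
    using arc_lift_loop[OF i \<beta> deck b \<phi>] by (elim exE conjE) blast
  have d01: "d 0 = b \<sigma>" "d 1 = \<phi> (b \<sigma>)" "\<And>t. t \<in> {0..1} \<Longrightarrow> d t \<in> U" "continuous_on {0..1} d"
    using d by (auto simp: pathstart_def pathfinish_def path_image_def path_def)
  have bU: "b \<sigma> \<in> U" using d01(3)[of 0] d01(1) by simp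
  have Ld: "continuous_on {0..1} (\<lambda>t. L j (d t))"
    by (rule continuous_on_compose2[OF L_cont[OF j] d01(4)]) (use d01 in auto)
  show ?thesis
  proof (cases "j = i")
    case True
    have "L j (d 0) - (L j (b \<sigma>) + 2 * pi * \<i> * of_real 0) = L j (d 1) - (L j (b \<sigma>) + 2 * pi * \<i> * of_real 1)"
    proof (rule const_log_diff[of "{0..1}" "\<lambda>t. L j (d t)" "\<lambda>t. L j (b \<sigma>) + 2 * pi * \<i> * of_real t" 0 1])
      fix t :: real assume t: "t \<in> {0..1}"
      have "exp (L j (d t)) = eps i * ((\<beta> \<sigma> - r i) * cis (2 * pi * t))"
        using exp_L[OF i d01(3)[OF t]] pd[OF t] True by simp
      moreover have "exp (L j (b \<sigma>)) = eps i * (\<beta> \<sigma> - r i)"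
        using exp_L[OF i bU] pd[of 0] True d01(1) by simp
      ultimately show "exp (L j (d t)) = exp (L j (b \<sigma>) + 2 * pi * \<i> * of_real t)"
        by (simp add: exp_add cis_conv_exp mult_ac)
    qed (use Ld in \<open>auto intro!: continuous_intros\<close>)
    then have "L j (\<phi> (b \<sigma>)) = L j (b \<sigma>) + 2 * pi * \<i> * of_int 1"
      unfolding d01(1,2) by (simp add: algebra_simps)
    then show ?thesis using mon_eqI[OF \<phi> j bU] True by simp
  next
    case False
    let ?S = "cball (r i) (dist (\<beta> \<sigma>) (r i))"
    have "r j \<noteq> r i" using False inj_r i j by (auto dest: inj_onD)
    then have rj: "r j \<notin> ?S" using ball j by blast
    have nz: "eps j * (w - r j) \<noteq> 0" if "w \<in> ?S" for w using rj that by auto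
    obtain g where g: "g holomorphic_on ?S" "\<And>w. w \<in> ?S \<Longrightarrow> eps j * (w - r j) = exp (g w)"
      by (rule contractible_imp_holomorphic_log[of "\<lambda>w. eps j * (w - r j)" ?S])
        (use nz in \<open>auto intro!: holomorphic_intros convex_imp_contractible\<close>)
    have pS: "p (d t) \<in> ?S" if t: "t \<in> {0..1}" for t
      using pd[OF t] by (simp add: dist_norm norm_mult norm_minus_commute)
    have "L j (d 0) - g (p (d 0)) = L j (d 1) - g (p (d 1))"
    proof (rule const_log_diff[of "{0..1}" "\<lambda>t. L j (d t)" "\<lambda>t. g (p (d t))" 0 1])
      have "continuous_on {0..1} (\<lambda>t. p (d t))"
        by (rule continuous_on_compose2[OF p_cont d01(4)]) (use d01 in auto)
      then show "continuous_on {0..1} (\<lambda>t. g (p (d t)))"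
        by (rule continuous_on_compose2[OF holomorphic_on_imp_continuous_on[OF g(1)]]) (use pS in auto)
      show "exp (L j (d t)) = exp (g (p (d t)))" if "t \<in> {0..1}" for t
        using exp_L[OF j d01(3)[OF that]] g(2)[OF pS[OF that]] by simp
    qed (use Ld in auto)
    moreover have "p (d 0) = p (d 1)" using pd[of 0] pd[of 1] by simp
    ultimately have "L j (\<phi> (b \<sigma>)) = L j (b \<sigma>) + 2 * pi * \<i> * of_int 0"
      unfolding d01(1,2) by simp
    then show ?thesis using mon_eqI[OF \<phi> j bU] False by simp
  qed
qed

text \<open>\<open>T\<close> is a path component of the part of \<open>U\<close> over a disc about
  \<open>r i\<close>. The lifted circle joins \<open>b \<sigma>\<close> to its translate inside that
  part, so \<open>\<phi>\<close> maps the component into itself, and the end of the arc lies in one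
  connected set with its translate.\<close>

lemma arc_disc:
  assumes i: "i \<in> {1..n}" and \<beta>: "branch_arc R (p u) (r i) \<beta>"
    and deck: "deck_of_arc R U p u \<beta> \<phi>" and b: "arc_lift U p u \<beta> b" and \<phi>: "\<phi> \<in> DP"
  obtains \<sigma> T e where "0 \<le> \<sigma>" "\<sigma> < 1" "T \<subseteq> U" "path_connected T" "e > 0" "p ` T \<subseteq> ball (r i) e"
    "ball (r i) e \<inter> R \<subseteq> {r i}" "\<And>s. \<sigma> \<le> s \<Longrightarrow> s < 1 \<Longrightarrow> b s \<in> T" "\<And>x. x \<in> T \<Longrightarrow> \<phi> x \<in> T"
proof -
  obtain \<sigma> d where \<sigma>: "0 \<le> \<sigma>" "\<sigma> < 1" and d: "upath d (b \<sigma>) (\<phi> (b \<sigma>))"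
    and pd: "\<And>t. t \<in> {0..1} \<Longrightarrow> p (d t) = r i + (\<beta> \<sigma> - r i) * cis (2 * pi * t)"
    and ball: "cball (r i) (dist (\<beta> \<sigma>) (r i)) \<inter> R = {r i}"
    and mono: "\<And>s. \<sigma> \<le> s \<Longrightarrow> s < 1 \<Longrightarrow> dist (\<beta> s) (r i) \<le> dist (\<beta> \<sigma>) (r i)"
    using arc_lift_loop[OF i \<beta> deck b \<phi>] by (elim exE conjE) blast
  \<comment> \<open>Beyond the radius of the circle, but not beyond the nearest other branch point,
    so that the open disc contains \<open>r i\<close> alone.\<close>
  obtain e where e: "dist (\<beta> \<sigma>) (r i) < e" "\<And>a. a \<in> dist (r i) ` (R - {r i}) \<Longrightarrow> e \<le> a"
  proof (rule finite_gap_above[of "dist (r i) ` (R - {r i})" "dist (\<beta> \<sigma>) (r i)"])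
    fix a assume "a \<in> dist (r i) ` (R - {r i})"
    then obtain x where x: "x \<in> R" "x \<noteq> r i" "a = dist (r i) x" by blast
    then have "x \<notin> cball (r i) (dist (\<beta> \<sigma>) (r i))" using ball by blast
    then show "dist (\<beta> \<sigma>) (r i) < a" using x by simp
  qed auto
  have e0: "e > 0" using e(1) zero_le_dist[of "\<beta> \<sigma>" "r i"] by linarith
  define A where "A = {v \<in> U. p v \<in> ball (r i) e}"
  define T where "T = path_component_set A (b \<sigma>)"
  have bc: "continuous_on {0..<1} b" "\<And>t. t \<in> {0..<1} \<Longrightarrow> b t \<in> U"
    "\<And>t. t \<in> {0..<1} \<Longrightarrow> p (b t) = \<beta> t" using b by (auto simp: arc_lift_def)
  have bA: "b ` {\<sigma>..<1} \<subseteq> A"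
  proof
    fix x assume "x \<in> b ` {\<sigma>..<1}"
    then obtain s where s: "\<sigma> \<le> s" "s < 1" "x = b s" by auto
    then have "dist (\<beta> s) (r i) < e" using mono[OF s(1,2)] e(1) by linarith
    then show "x \<in> A" using s bc(2,3)[of s] \<sigma> by (simp add: A_def dist_commute)
  qed
  have bT: "b ` {\<sigma>..<1} \<subseteq> T"
    unfolding T_def
  proof (rule path_component_maximal)
    show "path_connected (b ` {\<sigma>..<1})"
      by (intro path_connected_continuous_image continuous_on_subset[OF bc(1)] convex_imp_path_connected)
        (use \<sigma> in auto)
  qed (use bA \<sigma> in auto)
  have TA: "T \<subseteq> A" unfolding T_def by (rule path_component_subset)
  have "path_image d \<subseteq> T"
    unfolding T_def
  proof (rule path_component_maximal)
    show "path_image d \<subseteq> A"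
    proof
      fix x assume "x \<in> path_image d"
      then obtain t where t: "t \<in> {0..1}" "x = d t" by (auto simp: path_image_def)
      have "dist (r i) (p (d t)) = dist (\<beta> \<sigma>) (r i)"
        using pd[OF t(1)] by (simp add: dist_norm norm_mult)
      then show "x \<in> A" using t d e(1) by (auto simp: A_def path_image_def)
    qed
    show "b \<sigma> \<in> path_image d" using d pathstart_in_path_image[of d] by simp
  qed (use d in \<open>auto simp: path_connected_path_image\<close>)
  then have \<phi>b: "path_component A (b \<sigma>) (\<phi> (b \<sigma>))"
    using d pathfinish_in_path_image[of d] unfolding T_def by auto
  have \<phi>A: "\<phi> ` A \<subseteq> A" using deck_setD[OF \<phi>] by (auto simp: A_def)
  have \<phi>T: "\<phi> x \<in> T" if x: "x \<in> T" for x
  proof -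
    obtain g where g: "path g" "path_image g \<subseteq> A" "pathstart g = b \<sigma>" "pathfinish g = x"
      using x unfolding T_def path_component_def by auto
    have "path_component A (\<phi> (b \<sigma>)) (\<phi> x)"
      unfolding path_component_def
    proof (intro exI[of _ "\<phi> \<circ> g"] conjI)
      show "path (\<phi> \<circ> g)"
        by (rule path_continuous_image[OF g(1)])
          (use g(2) in \<open>auto simp: A_def intro: continuous_on_subset[OF deck_setD(2)[OF \<phi>]]\<close>)
      show "path_image (\<phi> \<circ> g) \<subseteq> A" using g(2) \<phi>A by (auto simp: path_image_def)
    qed (use g in \<open>auto simp: pathstart_def pathfinish_def\<close>)
    then show ?thesis using \<phi>b path_component_trans unfolding T_def by auto
  qed
  show ?thesis
  proof (rule that[OF \<sigma>, of T e])
    show "path_connected T" unfolding T_def by (rule path_connected_path_component)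
    show "ball (r i) e \<inter> R \<subseteq> {r i}" using e(2) by force
  qed (use TA bT \<phi>T e0 in \<open>auto simp: A_def\<close>)
qed

text \<open>Over a disc with a single branch value the root coordinate \<open>xh i\<close> serves as
  parameter. The other coordinates agree with the chart up to roots of unity; such a ratio has
  finite range, so it is constant on the connected set \<open>T\<close>, and it is 1 at the point
  \<open>v0\<close> of normalization.\<close>

lemma disc_chart:
  assumes i: "i \<in> {1..n}" and e: "e > 0" "ball (r i) e \<inter> R \<subseteq> {r i}"
    and T: "connected T" "T \<subseteq> U" "p ` T \<subseteq> ball (r i) e" "T \<noteq> {}"
  obtains D \<rho> where "chart 0 i D \<rho>" "0 \<in> D" "\<And>v. v \<in> T \<Longrightarrow> xh i v \<in> D \<and> q v = cpt \<rho> (xh i v)"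
proof -
  obtain v0 where v0: "v0 \<in> T" using T by blast
  \<comment> \<open>The radius is chosen so that \<open>s ^ k\<close> runs through the disc of
    radius \<open>e\<close>.\<close>
  define D where "D = ball (0::complex) (root k e)"
  have root: "root k e > 0" "root k e ^ k = e" using e k by auto
  have D_iff: "s \<in> D \<longleftrightarrow> norm (s ^ k) < e" for s
  proof -
    have "norm s < root k e \<longleftrightarrow> norm s ^ k < root k e ^ k"
      using root(1) k by (metis less_eq_real_def norm_ge_zero not_numeral_le_zero power_less_imp_less_base power_strict_mono zero_less_iff_neq_zero)
    then show ?thesis using root(2) by (simp add: D_def norm_power)
  qed
  have norm_eps: "norm (eps i * x) = norm x" for x by (simp add: eps_def norm_mult)
  have xD: "xh i v \<in> D" if "v \<in> T" for v
  proof -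
    have "xh i v ^ k = eps i * (p v - r i)" using xh_power[OF i] that T(2) by blast
    then show ?thesis using T(3) that by (force simp: D_iff norm_eps dist_norm norm_minus_commute)
  qed
  have avoid: "r i + eps i * s ^ k \<noteq> r j" if s: "s \<in> D" and j: "j \<in> {1..n}" "j \<noteq> i" for s j
  proof
    assume eq: "r i + eps i * s ^ k = r j"
    have "r i + eps i * s ^ k \<in> ball (r i) e"
      using s by (simp add: D_iff dist_norm norm_eps)
    then have "r j = r i" using e(2) eq j by auto
    then show False using inj_r i j by (auto dest: inj_onD)
  qed
  have pv: "r i + eps i * xh i v ^ k = p v" if "v \<in> U" for v using xh_power[OF i that] by simp
  have v0U: "v0 \<in> U" using v0 T by blast
  obtain \<rho> where ch: "chart 0 i D \<rho>" and \<rho>: "\<And>j. j \<in> {1..n} \<Longrightarrow> j \<noteq> i \<Longrightarrow> \<rho> j (xh i v0) = xh j v0"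
  proof (rule chart_affine[OF i, of D "xh i v0" "\<lambda>j. xh j v0"])
    show "xh j v0 ^ k = eps j * (r i + eps i * xh i v0 ^ k - r j)" if "j \<in> {1..n}" "j \<noteq> i" for j
      unfolding pv[OF v0U] using xh_power that v0U by blast
  qed (use avoid xD[OF v0] in \<open>auto simp: D_def\<close>)
  have rho: "\<rho> 0 s = 1" "\<rho> i s = s" "\<And>j. j \<in> {0..n} \<Longrightarrow> j \<noteq> i \<Longrightarrow> \<rho> j s \<noteq> 0" "on_curve (\<lambda>j. \<rho> j s)" if "s \<in> D" for s
    using ch that by (auto simp: chart_def)
  have "xh j v = \<rho> j (xh i v)" if v: "v \<in> T" and j: "j \<in> {1..n}" "j \<noteq> i" for v j
  proof -
    define f where "f v = xh j v / \<rho> j (xh i v)" for v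
    have "continuous_on T (\<lambda>v. \<rho> j (xh i v))"
    proof (rule continuous_on_compose2[of D "\<rho> j"])
      show "continuous_on D (\<rho> j)" using ch j by (auto simp: chart_def intro: holomorphic_on_imp_continuous_on)
      show "continuous_on T (xh i)" by (rule continuous_on_subset[OF xh_cont[OF i] T(2)])
    qed (use xD in auto)
    then have "continuous_on T f" unfolding f_def
      by (intro continuous_intros continuous_on_subset[OF xh_cont[OF j(1)] T(2)]) (use rho(3) xD j in auto)
    moreover have "f w ^ k = 1" if w: "w \<in> T" for w
    proof -
      have wU: "w \<in> U" using w T by blast
      have "\<rho> j (xh i w) ^ k = eps j * (- (\<rho> 1 (xh i w) ^ k) - r j)"
        using on_curve_affineD[OF _ rho(4)[OF xD[OF w]] j(1)] rho(1)[OF xD[OF w]] by simp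
      moreover have "xh i w ^ k = eps i * (- (\<rho> 1 (xh i w) ^ k) - r i)"
        using on_curve_affineD[OF _ rho(4)[OF xD[OF w]] i] rho(1,2)[OF xD[OF w]] by simp
      then have "p w = - (\<rho> 1 (xh i w) ^ k)" using pv[OF wU] by simp
      ultimately have "\<rho> j (xh i w) ^ k = xh j w ^ k" using xh_power[OF j(1) wU] by simp
      then show ?thesis using rho(3)[OF xD[OF w], of j] j by (simp add: f_def power_divide)
    qed
    then have "f ` T \<subseteq> {z. z ^ k = 1}" by auto
    then have "finite (f ` T)" using finite_roots_unity[of k] k by (metis finite_subset nat_le_linear not_numeral_le_zero one_le_numeral order_trans)
    ultimately have "f constant_on T" by (intro continuous_finite_range_constant[OF T(1)])
    then have "f v = f v0" using v v0 by (auto simp: constant_on_def)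
    also have "f v0 = 1" using \<rho>[OF j] by (simp add: f_def)
    finally show ?thesis using rho(3)[OF xD[OF v], of j] j by (simp add: f_def)
  qed
  then have "q v = cpt \<rho> (xh i v)" if "v \<in> T" for v
    unfolding curve_map_def using rho(1,2)[OF xD[OF that]] that
    by (intro proj_point_cong) (metis One_nat_def atLeastAtMost_iff le_zero_eq not_less_eq_eq)
  then show ?thesis using that[OF ch] xD root(1) by (auto simp: D_def)
qed

text \<open>Deck(p) acts on the root coordinates by scalars, and those of \<open>\<kappa>\<close>
  are 1.\<close>

lemma q_comm:
  assumes "\<kappa> \<in> DQ" "\<rho> \<in> DP" "x \<in> U"
  shows "q (\<rho> (\<kappa> x)) = q (\<rho> x)"
  unfolding q_eq_iff
proof
  fix i assume i: "i \<in> {1..n}"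
  have "zeta_root k powi mon \<kappa> i = 1" using assms(1) i zeta_powi_eq_1[of k] k by (auto simp: DQ_iff)
  then show "xh i (\<rho> (\<kappa> x)) = xh i (\<rho> x)"
    using xh_mon[OF assms(2) i] xh_mon[OF DQ_DP[OF assms(1)] i assms(3)] deck_setD(3)[OF DQ_DP[OF assms(1)] assms(3)] assms(3)
    by simp
qed

text \<open>In the coordinate of \<open>disc_chart\<close> the path closes up, because its ends have
  the same image under \<open>q\<close>, and it contracts in the convex domain.\<close>

lemma qchain_disc_null:
  assumes i: "i \<in> {1..n}" and e: "e > 0" "ball (r i) e \<inter> R \<subseteq> {r i}"
    and T: "connected T" "T \<subseteq> U" "p ` T \<subseteq> ball (r i) e"
    and c: "path c" "path_image c \<subseteq> T" "q (pathfinish c) = q (pathstart c)"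
  shows "homologous_rel 1 C {} (qchain c) 0"
proof -
  have "T \<noteq> {}" using c(2) by auto
  then obtain D \<rho> where ch: "chart 0 i D \<rho>" "0 \<in> D" and \<rho>: "\<And>v. v \<in> T \<Longrightarrow> xh i v \<in> D \<and> q v = cpt \<rho> (xh i v)"
    using disc_chart[OF i e T] by blast
  define c' where "c' = xh i \<circ> c"
  have cT: "c t \<in> T" if "t \<in> {0..1}" for t using c(2) that by (auto simp: path_image_def)
  have f: "continuous_map (top_of_set D) C (cpt \<rho>)" by (rule chart_continuous[OF ch(1)])
  have "path c'" unfolding c'_def
    by (rule path_continuous_image[OF c(1)]) (use c(2) T(2) continuous_on_subset[OF xh_cont[OF i]] in blast)
  moreover have "path_image c' \<subseteq> D" using \<rho> cT by (auto simp: path_image_def c'_def)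
  moreover have cl: "c' 1 = c' 0" using c(3) i by (simp add: c'_def q_eq_iff pathstart_def pathfinish_def)
  moreover have "c' 0 \<in> D" using \<rho> cT[of 0] by (simp add: c'_def)
  ultimately have h: "homologous_rel 1 C {} (frag_of (simplex_of_path (cpt \<rho> \<circ> c')))
      (frag_of (simplex_of_path (cpt \<rho> \<circ> linepath (c' 0) (c' 0))))"
    by (intro homologous_simply_connected[OF f]) (use ch in \<open>auto simp: chart_def pathstart_def pathfinish_def convex_imp_simply_connected\<close>)
  have e1: "simplex_of_path (cpt \<rho> \<circ> c') = simplex_of_path (q \<circ> c)"
    by (rule simplex_of_path_cong) (use \<rho> cT in \<open>simp add: c'_def\<close>)
  have e2: "simplex_of_path (cpt \<rho> \<circ> linepath (c' 0) (c' 0)) = simplex_of_path (\<lambda>_. cpt \<rho> (c' 0))"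
    by (rule simplex_of_path_cong) (simp add: linepath_refl)
  have "homologous_rel 1 C {} (frag_of (simplex_of_path (\<lambda>_. cpt \<rho> (c' 0)))) 0"
    by (rule homologous_const) (use f \<open>c' 0 \<in> D\<close> in \<open>auto simp: continuous_map_def\<close>)
  then show ?thesis using h unfolding e1 e2 by (rule homologous_rel_trans)
qed

end

section \<open>Homology classes come from deck transformations\<close>

locale fermat_loops = fermat_cover k n r U p L u for k n r and U :: "'u::real_normed_vector set" and p L u +
  fixes \<phi> :: "nat \<Rightarrow> 'u \<Rightarrow> 'u" and \<beta> :: "nat \<Rightarrow> real \<Rightarrow> complex" and b :: "nat \<Rightarrow> real \<Rightarrow> 'u"
  assumes gens: "free_generators (deck_group U p) {1..n} \<phi>"
    and arcs: "\<forall>i\<in>{1..n}. branch_arc (r ` {1..n}) (p u) (r i) (\<beta> i)"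
    and decks: "\<forall>i\<in>{1..n}. deck_of_arc (r ` {1..n}) U p u (\<beta> i) (\<phi> i)"
    and lifts: "\<forall>i\<in>{1..n}. arc_lift U p u (\<beta> i) (b i)"
begin

lemma \<phi>_DP: "i \<in> {1..n} \<Longrightarrow> \<phi> i \<in> DP"
  using gens by (auto simp: free_generators_def)

lemma generate_\<phi>: "generate G (\<phi> ` {1..n}) = DP"
  using gens by (simp add: free_generators_def)

lemma mon_\<phi>: "i \<in> {1..n} \<Longrightarrow> j \<in> {1..n} \<Longrightarrow> mon (\<phi> i) j = (if j = i then 1 else 0)"
  by (rule arc_mon[of i "\<beta> i" "\<phi> i" "b i"]) (use arcs decks lifts \<phi>_DP in auto)

lemma pow_DP: "x \<in> DP \<Longrightarrow> x [^]\<^bsub>G\<^esub> (m::nat) \<in> DP"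
  using monoid.nat_pow_closed[OF group.is_monoid[OF G_group], of x m] by simp

lemma foldr_DP_mon:
  assumes "set xs \<subseteq> {1..n}" "distinct xs"
  shows "foldr (\<lambda>d x. (\<phi> d [^]\<^bsub>G\<^esub> (g d :: nat)) \<otimes>\<^bsub>G\<^esub> x) xs \<one>\<^bsub>G\<^esub> \<in> DP \<and>
    (\<forall>i\<in>{1..n}. mon (foldr (\<lambda>d x. (\<phi> d [^]\<^bsub>G\<^esub> g d) \<otimes>\<^bsub>G\<^esub> x) xs \<one>\<^bsub>G\<^esub>) i = (if i \<in> set xs then int (g i) else 0))"
  using assms
proof (induction xs)
  case Nil
  then show ?case using G_one mon_one by simp
next
  case (Cons d xs)
  then have IH: "foldr (\<lambda>d x. (\<phi> d [^]\<^bsub>G\<^esub> g d) \<otimes>\<^bsub>G\<^esub> x) xs \<one>\<^bsub>G\<^esub> \<in> DP"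
    "\<And>i. i \<in> {1..n} \<Longrightarrow> mon (foldr (\<lambda>d x. (\<phi> d [^]\<^bsub>G\<^esub> g d) \<otimes>\<^bsub>G\<^esub> x) xs \<one>\<^bsub>G\<^esub>) i = (if i \<in> set xs then int (g i) else 0)"
    by auto
  have d: "d \<in> {1..n}" using Cons by auto
  then have P: "\<phi> d [^]\<^bsub>G\<^esub> g d \<in> DP" using \<phi>_DP pow_DP by blast
  show ?case
    using G_mult[OF P IH(1)] mon_mult[OF P IH(1)] IH(2) mon_pow[OF \<phi>_DP[OF d]] mon_\<phi>[OF d] Cons(3)
    by auto
qed

abbreviation opp where "opp \<equiv> ordered_power_product G n \<phi>"

text \<open>Every vector of exponents in the natural numbers is the monodromy of some
  \<open>opp g\<close>, so these products represent all cosets of Deck(q) in Deck(p).\<close>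

lemma opp_DP: "opp g \<in> DP" and opp_mon: "i \<in> {1..n} \<Longrightarrow> mon (opp g) i = int (g i)"
proof -
  have "set [1..<Suc n] \<subseteq> {1..n}" "distinct [1..<Suc n]" by auto
  from foldr_DP_mon[OF this, of g] show "opp g \<in> DP" "i \<in> {1..n} \<Longrightarrow> mon (opp g) i = int (g i)"
    unfolding ordered_power_product_def by (auto simp del: upt_Suc)
qed

text \<open>Any preimage under \<open>p\<close> of the base coordinate gives root coordinates with
  the right k-th powers; the missing roots of unity are supplied by the monodromy of a suitable
  \<open>opp a\<close>.\<close>

lemma q_surj:
  assumes v: "on_curve v" "\<And>i. i \<in> {0..n} \<Longrightarrow> v i \<noteq> 0"
  shows "proj_point n v \<in> q ` U"
proof -
  define y where "y i = v i / v 0" for i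
  have y: "on_curve y" unfolding y_def by (rule on_curve_scale[of _ "1 / v 0" v]) (use v in auto)
  have y0: "y 0 = 1" using v(2)[of 0] by (simp add: y_def)
  have ynz: "y i \<noteq> 0" if "i \<in> {0..n}" for i using v(2)[OF that] v(2)[of 0] by (simp add: y_def)
  define z where "z = - (y 1 ^ k)"
  have yk: "y i ^ k = eps i * (z - r i)" if "i \<in> {1..n}" for i
    unfolding z_def by (rule on_curve_affineD[OF y0 y that])
  have "z \<notin> R"
  proof
    assume "z \<in> R"
    then obtain i where "i \<in> {1..n}" "z = r i" by blast
    then have "y i ^ k = 0" using yk[of i] by simp
    then show False using ynz[of i] \<open>i \<in> {1..n}\<close> by simp
  qed
  then have "z \<in> p ` U" using covering_space_imp_surjective[OF cov] by simp
  then obtain w where w: "w \<in> U" "p w = z" by blast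
  have "\<exists>a. y i = zeta_root k powi int a * xh i w" if i: "i \<in> {1..n}" for i
  proof -
    have e: "y i ^ k = xh i w ^ k" using yk[OF i] xh_power[OF i w(1)] w(2) by simp
    have "(y i / xh i w) ^ k = y i ^ k / xh i w ^ k" by (rule power_divide)
    also have "\<dots> = 1" unfolding e by simp
    finally have "(y i / xh i w) ^ k = 1" .
    then obtain a where "y i / xh i w = zeta_root k powi int a"
      using root_of_unity_zeta[of "y i / xh i w" k] k by (metis le_trans one_le_numeral)
    then have "y i = zeta_root k powi int a * xh i w" by (simp add: field_simps)
    then show ?thesis by blast
  qed
  then obtain a where a: "\<And>i. i \<in> {1..n} \<Longrightarrow> y i = zeta_root k powi int (a i) * xh i w" by metis
  have "proj_point n v = q (opp a w)"
    unfolding curve_map_def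
  proof (rule proj_point_eqI[of "v 0"])
    fix i assume i: "i \<in> {0..n}"
    show "v i = v 0 * (if i = 0 then 1 else xh i (opp a w))"
    proof (cases "i = 0")
      case False
      then have i1: "i \<in> {1..n}" using i by auto
      have "xh i (opp a w) = y i" using xh_mon[OF opp_DP i1 w(1)] opp_mon[OF i1] a[OF i1] by simp
      then show ?thesis using False v(2)[of 0] by (simp add: y_def)
    qed simp
  qed (use v in auto)
  then show ?thesis using deck_setD(3)[OF opp_DP w(1)] by blast
qed

lemma chart_q:
  assumes "chart j m D \<rho>" "s \<in> D" "s \<noteq> 0"
  shows "cpt \<rho> s \<in> q ` U"
proof (rule q_surj)
  show "on_curve (\<lambda>i. \<rho> i s)" using assms by (auto simp: chart_def)
  show "\<rho> i s \<noteq> 0" if "i \<in> {0..n}" for i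
    using assms that by (cases "i = m") (auto simp: chart_def)
qed

lemma q_image_nonzero: "P \<in> q ` U \<Longrightarrow> i \<in> {0..n} \<Longrightarrow> hratio i 0 P \<noteq> 0"
  by (auto simp: curve_map_def hratio_proj_point split: if_splits)

lemma openin_C:
  assumes "openin (proj_space n) W"
  shows "openin C (topspace C \<inter> W)"
proof -
  obtain S where S: "C = subtopology (proj_space n) S"
    unfolding C_def fermat_curve_def by blast
  have "openin C (W \<inter> S)" unfolding S using assms by (rule openin_subtopology_Int)
  moreover have "W \<inter> S = topspace C \<inter> W" using openin_subset[OF assms] S by auto
  ultimately show ?thesis by (simp only:)
qed

lemma hratio_continuous:
  assumes f: "continuous_map (top_of_set T) C f" "\<And>t. t \<in> T \<Longrightarrow> hratio 0 0 (f t) \<noteq> 0" and i: "i \<in> {0..n}"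
  shows "continuous_on T (\<lambda>t. hratio i 0 (f t))"
  unfolding continuous_on_def
proof (intro ballI topological_tendstoI)
  fix t S assume t: "t \<in> T" and S: "open S" "hratio i 0 (f t) \<in> S"
  define W where "W = {P \<in> topspace (proj_space n). hratio 0 0 P \<noteq> 0 \<and> (hratio i 0 P, hratio i 0 P) \<in> S \<times> UNIV}"
  have "openin (proj_space n) W"
    unfolding W_def by (rule openin_hratio) (use i S in \<open>auto intro: open_Times\<close>)
  then have "openin C (topspace C \<inter> W)"
    by (rule openin_C)
  moreover have ft: "f t \<in> topspace C" using f t by (auto simp: continuous_map_def)
  then have "f t \<in> topspace (proj_space n)" by (auto simp: C_def fermat_curve_def)
  then have "f t \<in> topspace C \<inter> W" using ft f(2)[OF t] S by (simp add: W_def)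
  ultimately have "\<forall>\<^sub>F t' in at t within T. f t' \<in> topspace C \<inter> W"
    using eventually_in_openin[OF f(1) _ t] by blast
  then show "\<forall>\<^sub>F t' in at t within T. hratio i 0 (f t') \<in> S"
    by eventually_elim (simp add: W_def)
qed

text \<open>Lifting goes through \<open>p\<close>: the base coordinate along the path is lifted to
  \<open>U\<close>, and the root coordinates of the lift can differ from those of the path only by a
  constant root of unity, which is 1 at the start.\<close>

lemma lift_C:
  assumes \<gamma>: "continuous_map (top_of_set {0..1}) C \<gamma>" "\<gamma> ` {0..1} \<subseteq> q ` U" and v: "v \<in> U" "q v = \<gamma> 0"
  obtains h where "path h" "path_image h \<subseteq> U" "h 0 = v" "\<And>t. t \<in> {0..1} \<Longrightarrow> q (h t) = \<gamma> t"
proof -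
  have gq: "\<gamma> t \<in> q ` U" if "t \<in> {0..1}" for t
    by (rule subsetD[OF \<gamma>(2) imageI[OF that]])
  have nz: "hratio i 0 (\<gamma> t) \<noteq> 0" if "i \<in> {0..n}" "t \<in> {0..1}" for i t
    by (rule q_image_nonzero[OF gq[OF that(2)] that(1)])
  have wit: "\<exists>w. w \<in> U \<and> q w = \<gamma> t" if "t \<in> {0..1}" for t
    using gq[OF that] by (elim imageE) (rule exI, rule conjI, assumption, rule sym)
  have hc: "continuous_on {0..1} (\<lambda>t. hratio i 0 (\<gamma> t))" if "i \<in> {0..n}" for i
    by (rule hratio_continuous[OF \<gamma>(1) _ that]) (use nz in auto)
  define z where "z t = - (hratio 1 0 (\<gamma> t) ^ k)" for t
  have zp: "z t = p w" if "q w = \<gamma> t" "w \<in> U" for t w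
    using hratio_q[of 1 w] xh_power[of 1 w] that n r1 by (simp add: z_def eps_def)
  have "continuous_on {0..1} z" unfolding z_def by (intro continuous_intros hc) (use n in auto)
  moreover have zR: "z t \<in> - R" if t: "t \<in> {0..1}" for t
  proof -
    obtain w where "w \<in> U" "q w = \<gamma> t" using wit[OF t] by blast
    then show ?thesis using zp p_R by simp
  qed
  ultimately have z: "path z" "pathstart z = p v"
    using zp[OF v(2,1)] unfolding path_def pathstart_def by auto
  have zI: "path_image z \<subseteq> - R"
    unfolding path_image_def by (rule image_subsetI) (rule zR)
  obtain h where h: "path h" "path_image h \<subseteq> U" "pathstart h = v" "\<And>t. t \<in> {0..1} \<Longrightarrow> p (h t) = z t"
    using lift_path[OF v(1) z(1) zI z(2)] by blast
  have hU: "h t \<in> U" if "t \<in> {0..1}" for t using h(2) that by (auto simp: path_image_def)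
  have "q (h t) = \<gamma> t" if t: "t \<in> {0..1}" for t
  proof -
    obtain w where w: "w \<in> U" "q w = \<gamma> t" using wit[OF t] by blast
    have "xh i (h t) = xh i w" if i: "i \<in> {1..n}" for i
    proof -
      define f where "f s = hratio i 0 (\<gamma> s) / xh i (h s)" for s
      have "continuous_on {0..1} (\<lambda>s. xh i (h s))"
        by (rule continuous_on_compose2[OF xh_cont[OF i]]) (use h hU in \<open>auto simp: path_def\<close>)
      then have "continuous_on {0..1} f" unfolding f_def by (intro continuous_intros hc) (use i in auto)
      moreover have "f s ^ k = 1" if s: "s \<in> {0..1}" for s
      proof -
        obtain w where w: "w \<in> U" "q w = \<gamma> s" using wit[OF s] by blast
        have "p (h s) = p w" using h(4)[OF s] zp[OF w(2,1)] by simp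
        then have "xh i w ^ k = xh i (h s) ^ k" using xh_power[OF i] w(1) hU[OF s] by simp
        then show ?thesis using hratio_q[OF i, of w] w(2) by (simp add: f_def power_divide)
      qed
      then have "f ` {0..1} \<subseteq> {z. z ^ k = 1}" by auto
      moreover have "finite {z::complex. z ^ k = 1}" using finite_roots_unity[of k] k by simp
      ultimately have fin: "continuous_on {0..1} f" "finite (f ` {0..1})"
        by (simp_all only: finite_subset)
      have "f constant_on {0..1}"
        by (rule continuous_finite_range_constant[OF connected_Icc fin])
      then have "f t = f 0" using t by (auto simp: constant_on_def)
      also have "f 0 = 1" using v(2) hratio_q[OF i, of v] h(3) by (simp add: f_def pathstart_def)
      finally show ?thesis using hratio_q[OF i, of w] w(2) by (simp add: f_def)
    qed
    then show ?thesis using w(2) by (metis q_eq_iff)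
  qed
  then show ?thesis using that h by (simp add: pathstart_def)
qed

text \<open>The path from \<open>u\<close> to \<open>?\<kappa> u\<close> is a path to the set
  \<open>T\<close> over the disc, a path inside \<open>T\<close>, and the
  \<open>?\<kappa>\<close>-translate of the first path backwards. Even after translation by
  \<open>\<rho>\<close>, the outer pieces have the same image under \<open>q\<close>, and the middle
  one contracts over the disc.\<close>

lemma null_power:
  assumes i: "i \<in> {1..n}" and \<rho>: "\<rho> \<in> DP"
  shows "\<phi> i [^]\<^bsub>G\<^esub> k \<in> DQ"
    "deck_class C U q u (\<rho> \<otimes>\<^bsub>G\<^esub> (\<phi> i [^]\<^bsub>G\<^esub> k) \<otimes>\<^bsub>G\<^esub> inv\<^bsub>G\<^esub> \<rho>) = \<one>\<^bsub>homology_group 1 C\<^esub>"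
proof -
  let ?\<kappa> = "\<phi> i [^]\<^bsub>G\<^esub> k"
  show Q: "?\<kappa> \<in> DQ" using \<phi>_DP[OF i] pow_DP mon_pow[OF \<phi>_DP[OF i]] by (simp add: DQ_iff)
  have P: "?\<kappa> \<in> DP" using Q DQ_DP by blast
  obtain \<sigma> T e where \<sigma>: "0 \<le> \<sigma>" "\<sigma> < 1" and T: "T \<subseteq> U" "path_connected T" and e: "e > 0" "p ` T \<subseteq> ball (r i) e"
    "ball (r i) e \<inter> R \<subseteq> {r i}" and bT: "\<And>s. \<sigma> \<le> s \<Longrightarrow> s < 1 \<Longrightarrow> b i s \<in> T" and \<phi>T: "\<And>x. x \<in> T \<Longrightarrow> \<phi> i x \<in> T"
    using arc_disc[of i "\<beta> i" "\<phi> i" "b i"] arcs decks lifts \<phi>_DP i by metis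
  let ?v = "b i \<sigma>"
  have v: "?v \<in> T" "?v \<in> U" using bT[of \<sigma>] \<sigma> T by auto
  have "(\<phi> i [^]\<^bsub>G\<^esub> (m::nat)) ?v \<in> T" for m
  proof (induction m)
    case 0
    then show ?case using v by (simp add: deck_one)
  next
    case (Suc m)
    have "\<phi> i [^]\<^bsub>G\<^esub> Suc m = \<phi> i \<otimes>\<^bsub>G\<^esub> (\<phi> i [^]\<^bsub>G\<^esub> m)"
      using monoid.nat_pow_Suc2[OF group.is_monoid[OF G_group]] \<phi>_DP[OF i] by simp
    then show ?case using deck_mult[OF \<phi>_DP[OF i] pow_DP[OF \<phi>_DP[OF i]] v(2)] \<phi>T[OF Suc] by simp
  qed
  then have \<kappa>v: "?\<kappa> ?v \<in> T" .
  obtain c where c: "upath c u ?v" using upath_exists[OF u v(2)] by blast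
  obtain d where d: "path d" "path_image d \<subseteq> T" "pathstart d = ?v" "pathfinish d = ?\<kappa> ?v"
    using T(2) v(1) \<kappa>v unfolding path_connected_def by blast
  have du: "upath d ?v (?\<kappa> ?v)" using d T(1) by auto
  have cr: "upath (reversepath (?\<kappa> \<circ> c)) (?\<kappa> ?v) (?\<kappa> u)" by (rule qchain_reverse(2)[OF upath_deck[OF c P]])
  have full: "upath ((c +++ d) +++ reversepath (?\<kappa> \<circ> c)) u (?\<kappa> u)"
    by (rule qchain_join(2)[OF qchain_join(2)[OF c du] cr])
  have eq: "\<rho> \<circ> ((c +++ d) +++ reversepath (?\<kappa> \<circ> c)) = ((\<rho> \<circ> c) +++ (\<rho> \<circ> d)) +++ reversepath (\<rho> \<circ> (?\<kappa> \<circ> c))"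
    by (simp add: path_compose_join path_compose_reversepath)
  have \<rho>c: "upath (\<rho> \<circ> c) (\<rho> u) (\<rho> ?v)" and \<rho>d: "upath (\<rho> \<circ> d) (\<rho> ?v) (\<rho> (?\<kappa> ?v))"
    and \<rho>\<kappa>c: "upath (\<rho> \<circ> (?\<kappa> \<circ> c)) (\<rho> (?\<kappa> u)) (\<rho> (?\<kappa> ?v))"
    using upath_deck[OF c \<rho>] upath_deck[OF du \<rho>] upath_deck[OF upath_deck[OF c P] \<rho>] by blast+
  have "simplex_of_path (q \<circ> (\<rho> \<circ> (?\<kappa> \<circ> c))) = simplex_of_path (q \<circ> (\<rho> \<circ> c))"
  proof (rule simplex_of_path_cong)
    fix t :: real assume "t \<in> {0..1}"
    then have "c t \<in> U" using c by (auto simp: path_image_def)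
    then show "(q \<circ> (\<rho> \<circ> (?\<kappa> \<circ> c))) t = (q \<circ> (\<rho> \<circ> c)) t" using q_comm[OF Q \<rho>] by simp
  qed
  then have same: "qchain (\<rho> \<circ> (?\<kappa> \<circ> c)) = qchain (\<rho> \<circ> c)" by simp
  have null: "homologous_rel 1 C {} (qchain (\<rho> \<circ> d)) 0"
  proof (rule qchain_disc_null[OF i e(1,3), of "\<rho> ` T"])
    show "connected (\<rho> ` T)"
      by (intro connected_continuous_image path_connected_imp_connected T continuous_on_subset[OF deck_setD(2)[OF \<rho>]])
    show "\<rho> ` T \<subseteq> U" using T deck_setD(3)[OF \<rho>] by blast
    show "p ` \<rho> ` T \<subseteq> ball (r i) e" using T e(2) deck_setD(4)[OF \<rho>] by force
    show "path_image (\<rho> \<circ> d) \<subseteq> \<rho> ` T" using d(2) by (auto simp: path_image_def)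
    show "q (pathfinish (\<rho> \<circ> d)) = q (pathstart (\<rho> \<circ> d))"
      using q_comm[OF Q \<rho> v(2)] d by (simp add: pathfinish_def pathstart_def)
  qed (use \<rho>d in auto)
  have h1: "homologous_rel 1 C {} (qchain (((\<rho> \<circ> c) +++ (\<rho> \<circ> d)) +++ reversepath (\<rho> \<circ> (?\<kappa> \<circ> c))))
      (qchain ((\<rho> \<circ> c) +++ (\<rho> \<circ> d)) + qchain (reversepath (\<rho> \<circ> (?\<kappa> \<circ> c))))"
    by (rule qchain_join(1)[OF qchain_join(2)[OF \<rho>c \<rho>d] qchain_reverse(2)[OF \<rho>\<kappa>c]])
  have h2: "homologous_rel 1 C {} (qchain ((\<rho> \<circ> c) +++ (\<rho> \<circ> d)) + qchain (reversepath (\<rho> \<circ> (?\<kappa> \<circ> c))))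
      ((qchain (\<rho> \<circ> c) + qchain (\<rho> \<circ> d)) + (- qchain (\<rho> \<circ> (?\<kappa> \<circ> c))))"
    by (intro homologous_rel_add qchain_join(1)[OF \<rho>c \<rho>d] qchain_reverse(1)[OF \<rho>\<kappa>c])
  have h3: "homologous_rel 1 C {} ((qchain (\<rho> \<circ> c) + qchain (\<rho> \<circ> d)) + (- qchain (\<rho> \<circ> (?\<kappa> \<circ> c))))
      ((qchain (\<rho> \<circ> c) + 0) + (- qchain (\<rho> \<circ> c)))"
    unfolding same by (intro homologous_rel_add null homologous_rel_refl)
  have "homologous_rel 1 C {} (qchain (((\<rho> \<circ> c) +++ (\<rho> \<circ> d)) +++ reversepath (\<rho> \<circ> (?\<kappa> \<circ> c)))) 0"
    using homologous_rel_trans[OF h3 homologous_rel_trans[OF h2 h1]] by simp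
  then show "deck_class C U q u (\<rho> \<otimes>\<^bsub>G\<^esub> ?\<kappa> \<otimes>\<^bsub>G\<^esub> inv\<^bsub>G\<^esub> \<rho>) = \<one>\<^bsub>homology_group 1 C\<^esub>"
    unfolding deck_class_conj[of \<rho> ?\<kappa> "(c +++ d) +++ reversepath (?\<kappa> \<circ> c)", OF \<rho> Q full] eq one_homology_1
      homologous_rel_set_eq .
qed

text \<open>A point missed by \<open>q\<close> has a vanishing coordinate and is therefore the
  centre of its chart. The second parameter \<open>s\<close> marks a nearby point that
  \<open>q\<close> does reach, from which the centre is approached.\<close>

lemma chart_or_q:
  assumes "P \<in> topspace C" "P \<notin> q ` U"
  shows "\<exists>j m D \<rho> s. chart j m D \<rho> \<and> 0 \<in> D \<and> P = cpt \<rho> 0 \<and> s \<in> D \<and> s \<noteq> 0"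
proof -
  obtain j m D \<rho> where ch: "chart j m D \<rho>" "P \<in> cpt \<rho> ` D" using chart_exists[OF assms(1)] .
  then obtain s where s: "s \<in> D" "P = cpt \<rho> s" by blast
  have "s = 0" using chart_q[OF ch(1) s(1)] s(2) assms(2) by blast
  moreover have "open D" using ch by (simp add: chart_def)
  then obtain e where e: "e > 0" "ball s e \<subseteq> D" using s(1) unfolding open_contains_ball by blast
  then have "of_real (e/2) \<in> D" using \<open>s = 0\<close> by (auto simp: dist_norm)
  ultimately show ?thesis using ch s e(1) by (intro exI[of _ j] exI[of _ m] exI[of _ D] exI[of _ \<rho>] exI[of _ "of_real (e/2)"]) auto
qed

text \<open>Around a point without vanishing coordinate the chart parameter can be kept away from
  0.\<close>

lemma q_image_nbhd:
  assumes "P \<in> q ` U"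
  obtains V where "openin C V" "P \<in> V" "V \<subseteq> q ` U"
proof -
  have "P \<in> topspace C" using q_cont assms by (auto simp: continuous_map_def)
  then obtain j m D \<rho> where ch: "chart j m D \<rho>" "P \<in> cpt \<rho> ` D" using chart_exists by blast
  then obtain s where s: "s \<in> D" "P = cpt \<rho> s" by blast
  have rho: "\<rho> m s = s" using ch s by (auto simp: chart_def)
  have "s \<noteq> 0"
  proof
    assume "s = 0"
    have jm: "j \<in> {0..n}" "m \<in> {0..n}" using chart_index[OF ch(1)] by auto
    obtain w where "w \<in> U" "P = q w" using assms by blast
    then have "hratio m j P \<noteq> 0" using jm by (auto simp: curve_map_def hratio_proj_point)
    then show False using chart_coord(1)[OF ch(1) s(1)] s(2) \<open>s = 0\<close> by simp
  qed
  then have "s \<in> D - {0}" using s by simp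
  moreover have "open (D - {0})" using ch by (auto simp: chart_def)
  ultimately obtain e where e: "e > 0" "ball s e \<subseteq> D - {0}" unfolding open_contains_ball by blast
  have "openin C (cpt \<rho> ` ball s e)" by (rule chart_open[OF chart_subset[OF ch(1)]]) (use e in auto)
  moreover have "cpt \<rho> ` ball s e \<subseteq> q ` U" using chart_q[OF ch(1)] e(2) by blast
  moreover have "P \<in> cpt \<rho> ` ball s e" using s e by auto
  ultimately show ?thesis using that by blast
qed

text \<open>Membership in \<open>H\<close> becomes a predicate on cycles that is stable under
  homology, so that the next proof can compute with chains.\<close>

lemma subgroup_hclass:
  assumes H: "subgroup H (homology_group 1 C)"
  defines "P \<equiv> \<lambda>c. singular_relcycle 1 C {} c \<and> hclass C c \<in> H"
  shows "P 0" "P a \<Longrightarrow> P a' \<Longrightarrow> P (a + a')" "P a \<Longrightarrow> P (- a)"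
    "homologous_rel 1 C {} a a' \<Longrightarrow> P a \<Longrightarrow> P a'"
proof -
  show "P 0" unfolding P_def using subgroup.one_closed[OF H] one_homology_1[of C] by simp
  show "P a \<Longrightarrow> P a' \<Longrightarrow> P (a + a')"
    unfolding P_def using subgroup.m_closed[OF H, of "hclass C a" "hclass C a'"] mult_homology_1[of C a a'] singular_relcycle_add by metis
  show "P a \<Longrightarrow> P (- a)"
    unfolding P_def using subgroup.m_inv_closed[OF H, of "hclass C a"] inv_homology_1[of C a] singular_relcycle_minus by metis
  show "homologous_rel 1 C {} a a' \<Longrightarrow> P a \<Longrightarrow> P a'"
    unfolding P_def using homologous_rel_singular_relcycle homologous_rel_set_eq by metis
qed

text \<open>The chain \<open>\<Lambda> \<gamma>\<close> is \<open>\<gamma>\<close> closed up through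
  the base point. It satisfies \<open>P\<close> for paths in the image of \<open>q\<close> and for
  paths in a chart about a missed point; bisection reduces every path to such pieces, and
  \<open>cycle_induct\<close> concludes.\<close>

lemma homology_subset_of_deck_classes:
  assumes H: "subgroup H (homology_group 1 C)" and DQ: "\<And>\<kappa>. \<kappa> \<in> DQ \<Longrightarrow> deck_class C U q u \<kappa> \<in> H"
  shows "carrier (homology_group 1 C) \<subseteq> H"
proof -
  define P where "P = (\<lambda>c. singular_relcycle 1 C {} c \<and> hclass C c \<in> H)"
  have PH: "P 0" "\<And>a a'. P a \<Longrightarrow> P a' \<Longrightarrow> P (a + a')" "\<And>a. P a \<Longrightarrow> P (- a)"
    "\<And>a a'. homologous_rel 1 C {} a a' \<Longrightarrow> P a \<Longrightarrow> P a'"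
    unfolding P_def by (rule subgroup_hclass[OF H]; assumption)+
  have Pdiff: "P (a - a')" if "P a" "P a'" for a a' using PH(2)[OF that(1) PH(3)[OF that(2)]] by simp
  obtain J M D RR SS where ch: "\<And>x. x \<in> topspace C - q ` U \<Longrightarrow> chart (J x) (M x) (D x) (RR x) \<and> 0 \<in> D x \<and>
      x = cpt (RR x) 0 \<and> SS x \<in> D x \<and> SS x \<noteq> 0"
    using chart_or_q by (metis DiffD1 DiffD2)
  define lf where "lf x = (SOME v. v \<in> U \<and> q v = x)" for x
  have lf: "lf x \<in> U \<and> q (lf x) = x" if "x \<in> q ` U" for x
    unfolding lf_def by (rule someI_ex) (use that in blast)
  define pth where "pth x = (SOME c. upath c u (lf x))" for x
  have pth: "upath (pth x) u (lf x)" if "x \<in> q ` U" for x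
  proof -
    have "\<exists>c. upath c u (lf x)" by (rule upath_exists[OF u]) (use lf[OF that] in simp)
    then show ?thesis unfolding pth_def by (rule someI_ex[of "\<lambda>c. upath c u (lf x)"])
  qed
  \<comment> \<open>A missed point is approached by a path to the marked nearby point of its chart,
    followed by a segment to the centre.\<close>
  define \<delta> where "\<delta> x = (if x \<in> q ` U then qchain (pth x) else
     qchain (pth (cpt (RR x) (SS x))) + frag_of (simplex_of_path (cpt (RR x) \<circ> linepath (SS x) 0)))" for x
  define \<Lambda> where "\<Lambda> \<gamma> = \<delta> (\<gamma> 0) + frag_of (simplex_of_path \<gamma>) - \<delta> (\<gamma> 1)" for \<gamma> :: "real \<Rightarrow> _"
  \<comment> \<open>The lift of the path ends at a point that differs from the chosen preimage of
    \<open>\<gamma> 1\<close> by an element \<open>\<kappa>\<close> of Deck(q); closing up with the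
    \<open>\<kappa>\<close>-translate gives a path from \<open>u\<close> to
    \<open>\<kappa> u\<close>.\<close>
  have L1: "P (\<Lambda> \<gamma>)" if \<gamma>: "continuous_map (top_of_set {0..1}) C \<gamma>" "\<gamma> ` {0..1} \<subseteq> q ` U" for \<gamma>
  proof -
    have g01: "\<gamma> 0 \<in> q ` U" "\<gamma> 1 \<in> q ` U" using \<gamma>(2) by auto
    obtain h where h: "path h" "path_image h \<subseteq> U" "h 0 = lf (\<gamma> 0)" "\<And>t. t \<in> {0..1} \<Longrightarrow> q (h t) = \<gamma> t"
      by (rule lift_C[OF \<gamma>, of "lf (\<gamma> 0)"]) (use lf[OF g01(1)] in auto)
    have h1: "h 1 \<in> U" "q (h 1) = \<gamma> 1" using h(2) h(4)[of 1] by (auto simp: path_image_def)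
    obtain \<kappa> where \<kappa>: "\<kappa> \<in> DQ" "\<kappa> (lf (\<gamma> 1)) = h 1"
      using deck_q_exists[of "lf (\<gamma> 1)" "h 1"] lf[OF g01(2)] h1 by metis
    have c: "upath (pth (\<gamma> 0)) u (h 0)" using pth[OF g01(1)] h(3) by simp
    have hu: "upath h (h 0) (h 1)" using h by (simp add: pathstart_def pathfinish_def)
    have d: "upath (\<kappa> \<circ> pth (\<gamma> 1)) (\<kappa> u) (h 1)" using upath_deck[OF pth[OF g01(2)] DQ_DP[OF \<kappa>(1)]] \<kappa>(2) by simp
    note j = qchain_join[OF c hu]
    note rv = qchain_reverse[OF d]
    note j2 = qchain_join[OF j(2) rv(2)]
    have "homologous_rel 1 C {} (qchain (pth (\<gamma> 0) +++ h) + qchain (reversepath (\<kappa> \<circ> pth (\<gamma> 1))))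
       ((qchain (pth (\<gamma> 0)) + qchain h) + - qchain (\<kappa> \<circ> pth (\<gamma> 1)))"
      by (rule homologous_rel_add[OF j(1) rv(1)])
    then have hom: "homologous_rel 1 C {} (qchain ((pth (\<gamma> 0) +++ h) +++ reversepath (\<kappa> \<circ> pth (\<gamma> 1))))
       ((qchain (pth (\<gamma> 0)) + qchain h) + - qchain (\<kappa> \<circ> pth (\<gamma> 1)))"
      using j2(1) by (rule homologous_rel_trans)
    have "simplex_of_path (q \<circ> h) = simplex_of_path \<gamma>" by (rule simplex_of_path_cong) (use h(4) in simp)
    then have "(qchain (pth (\<gamma> 0)) + qchain h) + - qchain (\<kappa> \<circ> pth (\<gamma> 1)) = \<Lambda> \<gamma>"
      using qchain_DQ[OF pth[OF g01(2)] \<kappa>(1)] g01 by (simp add: \<Lambda>_def \<delta>_def)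
    then have hom': "homologous_rel 1 C {} (qchain ((pth (\<gamma> 0) +++ h) +++ reversepath (\<kappa> \<circ> pth (\<gamma> 1)))) (\<Lambda> \<gamma>)"
      using hom by simp
    have "P (qchain ((pth (\<gamma> 0) +++ h) +++ reversepath (\<kappa> \<circ> pth (\<gamma> 1))))"
      unfolding P_def using DQ_cycle[of \<kappa>, OF \<kappa>(1) j2(2)] DQ[OF \<kappa>(1)] deck_class_eq[of _ \<kappa>, OF j2(2)] by simp
    then show ?thesis using PH(4)[OF hom'] by blast
  qed
  \<comment> \<open>In the convex parameter domain only the end points matter. The claim reduces to
    segments between nonzero parameters and, by the triangle relation, to segments with an end at
    the centre.\<close>
  have L2: "P (\<Lambda> (cpt (RR x) \<circ> c))" if x: "x \<in> topspace C - q ` U" and c: "path c" "path_image c \<subseteq> D x" for x c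
  proof -
    let ?f = "cpt (RR x)"
    have chx: "chart (J x) (M x) (D x) (RR x)" and D0: "0 \<in> D x" "x = ?f 0" "SS x \<in> D x" "SS x \<noteq> 0"
      using ch[OF x] by auto
    have f: "continuous_map (top_of_set (D x)) C ?f" by (rule chart_continuous[OF chx])
    have Dx: "open (D x)" "convex (D x)" using chx by (auto simp: chart_def)
    have sD: "simply_connected (D x)" using Dx by (simp add: convex_imp_simply_connected)
    define E where "E s t = \<Lambda> (?f \<circ> linepath s t)" for s t
    have E: "E s t = \<delta> (?f s) + frag_of (simplex_of_path (?f \<circ> linepath s t)) - \<delta> (?f t)" for s t
      by (simp add: E_def \<Lambda>_def linepath_def)
    have path: "P (\<Lambda> (?f \<circ> d)) \<longleftrightarrow> P (\<Lambda> (?f \<circ> d'))"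
      if d: "path d" "path_image d \<subseteq> D x" "path d'" "path_image d' \<subseteq> D x" "d' 0 = d 0" "d' 1 = d 1" for d d'
    proof -
      have "homologous_rel 1 C {} (frag_of (simplex_of_path (?f \<circ> d))) (frag_of (simplex_of_path (?f \<circ> d')))"
        by (rule homologous_simply_connected[OF f sD]) (use d in \<open>auto simp: pathstart_def pathfinish_def\<close>)
      then have "homologous_rel 1 C {} (\<Lambda> (?f \<circ> d)) (\<Lambda> (?f \<circ> d'))"
        unfolding \<Lambda>_def using d(5,6) by (intro homologous_rel_diff homologous_rel_add) auto
      then show ?thesis using PH(4) homologous_rel_sym by metis
    qed
    have tri: "homologous_rel 1 C {} (E s t + E t w) (E s w)" if "s \<in> D x" "t \<in> D x" "w \<in> D x" for s t w
    proof -
      have "E s t + E t w = \<delta> (?f s) + (frag_of (simplex_of_path (?f \<circ> linepath s t)) + frag_of (simplex_of_path (?f \<circ> linepath t w))) - \<delta> (?f w)"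
        unfolding E by simp
      then show ?thesis
        unfolding E[of s w] by (simp only:)
          (intro homologous_rel_diff homologous_rel_add homologous_rel_refl homologous_triangle[OF f Dx(2)] that)
    qed
    have E1: "P (E s t)" if s: "s \<in> D x" "t \<in> D x" "s \<noteq> 0" "t \<noteq> 0" for s t
    proof -
      \<comment> \<open>A segment between nonzero parameters may pass through 0; it is replaced by a
        path in the punctured domain, whose image stays in the image of \<open>q\<close>.\<close>
      have "path_connected (D x - {0})"
        by (rule path_connected_open_delete) (use Dx convex_connected in auto)
      then obtain d where d: "path d" "path_image d \<subseteq> D x - {0}" "pathstart d = s" "pathfinish d = t"
        using s unfolding path_connected_def by blast
      have "P (\<Lambda> (?f \<circ> d))"
      proof (rule L1)
        show "continuous_map (top_of_set {0..1}) C (?f \<circ> d)"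
          by (rule continuous_map_path_compose[OF f d(1)]) (use d in auto)
        show "(?f \<circ> d) ` {0..1} \<subseteq> q ` U"
          using d(2) chart_q[OF chx] by (fastforce simp: path_image_def)
      qed
      moreover have li: "path_image (linepath s t) \<subseteq> D x" using s Dx(2) by (simp add: closed_segment_subset)
      have di: "path_image d \<subseteq> D x" using d(2) by blast
      have "linepath s t 0 = d 0" "linepath s t 1 = d 1"
        using d(3,4) by (simp_all add: pathstart_def pathfinish_def linepath_def)
      ultimately show ?thesis
        unfolding E_def using path[OF d(1) di path_linepath li] by blast
    qed
    have xs: "?f (SS x) \<in> q ` U" using chart_q[OF chx D0(3,4)] .
    have "\<delta> x = \<delta> (?f (SS x)) + frag_of (simplex_of_path (?f \<circ> linepath (SS x) 0))"
      using x xs by (simp add: \<delta>_def)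
    \<comment> \<open>This is the definition of \<open>\<delta>\<close> at a missed point: the
      closed-up segment to the centre is the zero chain.\<close>
    then have "E (SS x) 0 = 0" unfolding E D0(2)[symmetric] by simp
    then have ESS: "P (E (SS x) 0)" using PH(1) by simp
    have Es0: "P (E s 0)" if s: "s \<in> D x" "s \<noteq> 0" for s
      using PH(4)[OF tri[OF s(1) D0(3) D0(1)]] PH(2)[OF E1[OF s(1) D0(3) s(2) D0(4)] ESS] by blast
    have E00: "P (E 0 0)"
    proof -
      \<comment> \<open>The triangle relation for a constant triangle makes \<open>E 0 0\<close>
        homologous to its double.\<close>
      have "homologous_rel 1 C {} (E 0 0 - (E 0 0 + E 0 0)) (E 0 0 - E 0 0)"
        by (intro homologous_rel_diff homologous_rel_refl tri D0)
      then have "homologous_rel 1 C {} (- E 0 0) 0" by simp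
      then have "P (- E 0 0)" using PH(1,4) homologous_rel_sym by metis
      then show ?thesis using PH(3) by fastforce
    qed
    have E0t: "P (E 0 t)" if t: "t \<in> D x" "t \<noteq> 0" for t
    proof -
      have "P (E 0 t + E t 0)" using PH(4) E00 tri[OF D0(1) t(1) D0(1)] homologous_rel_sym by metis
      then have "P ((E 0 t + E t 0) - E t 0)" using Pdiff Es0[OF t] by blast
      then show ?thesis by simp
    qed
    have PE: "P (E s t)" if "s \<in> D x" "t \<in> D x" for s t
      using that E1 Es0 E0t E00 by (cases "s = 0"; cases "t = 0") auto
    have c01: "c 0 \<in> D x" "c 1 \<in> D x" using c(2) by (auto simp: path_image_def)
    have li: "path_image (linepath (c 0) (c 1)) \<subseteq> D x" using c01 Dx(2) by (simp add: closed_segment_subset)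
    have "c 0 = linepath (c 0) (c 1) 0" "c 1 = linepath (c 0) (c 1) 1" by (simp_all add: linepath_def)
    then show ?thesis
      using path[OF path_linepath li c] PE[OF c01] unfolding E_def by blast
  qed
  have L3: "P (\<Lambda> \<gamma>)" if \<gamma>: "continuous_map (top_of_set {0..1}) C \<gamma>" for \<gamma>
  proof -
    define E where "E s t = \<Lambda> (\<gamma> \<circ> linepath s t)" for s t
    have E: "E s t = \<delta> (\<gamma> s) + frag_of (simplex_of_path (\<gamma> \<circ> linepath s t)) - \<delta> (\<gamma> t)" for s t
      by (simp add: E_def \<Lambda>_def linepath_def)
    have lp: "continuous_map (top_of_set {0..1}) C (\<gamma> \<circ> linepath s t)"
      "(\<gamma> \<circ> linepath s t) ` {0..1} = \<gamma> ` {s..t}" if "0 \<le> s" "s \<le> t" "t \<le> 1" for s t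
    proof -
      have "linepath s t ` {0..1} = {s..t}"
        using path_image_linepath[of s t] that by (simp add: path_image_def closed_segment_eq_real_ivl)
      then show "(\<gamma> \<circ> linepath s t) ` {0..1} = \<gamma> ` {s..t}" by (metis image_comp)
      have "path_image (linepath s t) \<subseteq> {0..1}" using that by (auto simp: closed_segment_eq_real_ivl)
      then show "continuous_map (top_of_set {0..1}) C (\<gamma> \<circ> linepath s t)"
        by (intro continuous_map_path_compose[OF \<gamma>]) auto
    qed
    have "0 \<le> (0::real) \<and> (1::real) \<le> 1 \<longrightarrow> P (E 0 1)"
    proof (rule Bolzano[where P = "\<lambda>s t. 0 \<le> s \<and> t \<le> 1 \<longrightarrow> P (E s t)"])
      fix s t w :: real assume st: "0 \<le> s \<and> t \<le> 1 \<longrightarrow> P (E s t)" "0 \<le> t \<and> w \<le> 1 \<longrightarrow> P (E t w)" "s \<le> t" "t \<le> w"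
      show "0 \<le> s \<and> w \<le> 1 \<longrightarrow> P (E s w)"
      proof
        assume sw: "0 \<le> s \<and> w \<le> 1"
        have "E s t + E t w = \<delta> (\<gamma> s) + (frag_of (simplex_of_path (\<gamma> \<circ> linepath s t)) + frag_of (simplex_of_path (\<gamma> \<circ> linepath t w))) - \<delta> (\<gamma> w)"
          unfolding E by simp
        moreover have "homologous_rel 1 C {} (\<delta> (\<gamma> s) + (frag_of (simplex_of_path (\<gamma> \<circ> linepath s t)) + frag_of (simplex_of_path (\<gamma> \<circ> linepath t w))) - \<delta> (\<gamma> w)) (E s w)"
          unfolding E[of s w]
          by (intro homologous_rel_diff homologous_rel_add homologous_rel_refl homologous_triangle[OF \<gamma>])
            (use sw st in auto)
        ultimately have "homologous_rel 1 C {} (E s t + E t w) (E s w)" by simp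
        moreover have "P (E s t + E t w)" using st sw by (intro PH(2)) auto
        ultimately show "P (E s w)" by (rule PH(4))
      qed
    next
      fix x :: real assume x01: "0 \<le> x" "x \<le> 1"
      then have x: "x \<in> {0..1}" by simp
      then have gx: "\<gamma> x \<in> topspace C" using \<gamma> by (auto simp: continuous_map_def)
      \<comment> \<open>Near each parameter the path stays in the image of \<open>q\<close>, where
        \<open>L1\<close> applies, or in the chart about a missed point, where \<open>L2\<close>
        applies.\<close>
      have "\<exists>V. openin C V \<and> \<gamma> x \<in> V \<and> (\<forall>s t. 0 \<le> s \<and> s \<le> t \<and> t \<le> 1 \<and> \<gamma> ` {s..t} \<subseteq> V \<longrightarrow> P (E s t))"
      proof (cases "\<gamma> x \<in> q ` U")
        case True
        then obtain V where V: "openin C V" "\<gamma> x \<in> V" "V \<subseteq> q ` U" using q_image_nbhd by blast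
        have "P (E s t)" if st: "0 \<le> s" "s \<le> t" "t \<le> 1" "\<gamma> ` {s..t} \<subseteq> V" for s t
          unfolding E_def
        proof (rule L1)
          show "continuous_map (top_of_set {0..1}) C (\<gamma> \<circ> linepath s t)" by (rule lp(1)[OF st(1-3)])
          show "(\<gamma> \<circ> linepath s t) ` {0..1} \<subseteq> q ` U" using lp(2)[OF st(1-3)] st(4) V(3) by simp
        qed
        then show ?thesis using V by blast
      next
        case False
        then have xC: "\<gamma> x \<in> topspace C - q ` U" using gx by simp
        let ?x = "\<gamma> x"
        let ?f = "cpt (RR ?x)"
        have chx: "chart (J ?x) (M ?x) (D ?x) (RR ?x)" "0 \<in> D ?x" "?x = ?f 0" using ch[OF xC] by auto
        have "P (E s t)" if st: "0 \<le> s" "s \<le> t" "t \<le> 1" "\<gamma> ` {s..t} \<subseteq> ?f ` D ?x" for s t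
        proof -
          let ?c = "hratio (M ?x) (J ?x) \<circ> (\<gamma> \<circ> linepath s t)"
          have im: "(\<gamma> \<circ> linepath s t) ` {0..1} \<subseteq> ?f ` D ?x" using lp(2)[OF st(1-3)] st(4) by simp
          have "continuous_on {0..1} ?c"
            by (rule continuous_chart_coord[OF chx(1) lp(1)[OF st(1-3)] im])
          moreover have c: "?c l \<in> D ?x \<and> ?f (?c l) = (\<gamma> \<circ> linepath s t) l" if l: "l \<in> {0..1}" for l
          proof -
            have "(\<gamma> \<circ> linepath s t) l \<in> ?f ` D ?x" by (rule subsetD[OF im imageI[OF l]])
            then obtain w where w: "w \<in> D ?x" "(\<gamma> \<circ> linepath s t) l = ?f w" by blast
            then show ?thesis using chart_coord(1)[OF chx(1) w(1)] by simp
          qed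
          ultimately have pc: "path ?c" by (simp only: path_def)
          have "path_image ?c \<subseteq> D ?x"
            unfolding path_image_def by (rule image_subsetI) (rule conjunct1[OF c])
          then have "P (\<Lambda> (?f \<circ> ?c))" by (rule L2[OF xC pc])
          moreover have "\<Lambda> (?f \<circ> ?c) = E s t"
          proof -
            have "simplex_of_path (?f \<circ> ?c) = simplex_of_path (\<gamma> \<circ> linepath s t)"
              by (rule simplex_of_path_cong) (use c in auto)
            then show ?thesis unfolding E_def \<Lambda>_def using c[of 0] c[of 1] by simp
          qed
          ultimately show ?thesis by simp
        qed
        then have "\<forall>s t. 0 \<le> s \<and> s \<le> t \<and> t \<le> 1 \<and> \<gamma> ` {s..t} \<subseteq> ?f ` D ?x \<longrightarrow> P (E s t)"
          by blast
        moreover have "?x \<in> ?f ` D ?x" using chx(3,2) by (rule image_eqI)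
        ultimately show ?thesis using chart_open[OF chx(1)] by (intro exI[of _ "?f ` D ?x"] conjI)
      qed
      then obtain V where V: "openin C V" "\<gamma> x \<in> V"
        "\<forall>s t. 0 \<le> s \<and> s \<le> t \<and> t \<le> 1 \<and> \<gamma> ` {s..t} \<subseteq> V \<longrightarrow> P (E s t)" by (elim exE conjE)
      have "openin (top_of_set {0..1}) {y \<in> {0..1}. \<gamma> y \<in> V}"
        using openin_continuous_map_preimage[OF \<gamma> V(1)] by simp
      then obtain e where e: "e > 0" "\<And>y. y \<in> {0..1} \<Longrightarrow> dist y x < e \<Longrightarrow> \<gamma> y \<in> V"
        unfolding openin_euclidean_subtopology_iff using x V(2) by blast
      have "P (E s t)" if "s \<le> x" "x \<le> t" "t - s < e" "0 \<le> s" "t \<le> 1" for s t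
      proof (rule V(3)[rule_format], intro conjI)
        show "\<gamma> ` {s..t} \<subseteq> V"
        proof
          fix z assume "z \<in> \<gamma> ` {s..t}"
          then obtain y where y: "s \<le> y" "y \<le> t" "z = \<gamma> y" by auto
          then have "dist y x < e" using that by (auto simp: dist_real_def)
          then show "z \<in> V" using e(2)[of y] y that by simp
        qed
      qed (use that in auto)
      then show "\<exists>d>0. \<forall>s t. s \<le> x \<and> x \<le> t \<and> t - s < d \<longrightarrow> 0 \<le> s \<and> t \<le> 1 \<longrightarrow> P (E s t)"
        using e(1) by blast
    qed simp
    then have "P (E 0 1)" by simp
    moreover have "E 0 1 = \<Lambda> \<gamma>"
    proof -
      have "simplex_of_path (\<gamma> \<circ> linepath 0 1) = simplex_of_path \<gamma>"
        by (rule simplex_of_path_cong) (simp add: linepath_def)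
      then show ?thesis unfolding E \<Lambda>_def by simp
    qed
    ultimately show ?thesis by simp
  qed
  show ?thesis
  proof
    fix A assume "A \<in> carrier (homology_group 1 C)"
    then obtain c where c: "singular_relcycle 1 C {} c" "A = hclass C c" unfolding carrier_homology_1 by blast
    have "P c"
      by (rule cycle_induct[OF c(1), of P \<delta>]) (use PH L3 in \<open>auto simp: \<Lambda>_def\<close>)
    then show "A \<in> H" using c(2) by (simp add: P_def)
  qed
qed

end

section \<open>Generators of the homology group\<close>

text \<open>Commuting with a fixed element passes from generators to the group they generate. This
  is applied first to a generator and then to an arbitrary element.\<close>

lemma (in group) comm_group_of_generators:
  assumes S: "S \<subseteq> carrier G" "generate G S = carrier G"
    and comm: "\<And>a b. a \<in> S \<Longrightarrow> b \<in> S \<Longrightarrow> a \<otimes> b = b \<otimes> a"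
  shows "comm_group G"
proof -
  have step: "x \<otimes> y = y \<otimes> x"
    if y: "y \<in> carrier G" "\<And>a. a \<in> S \<Longrightarrow> a \<otimes> y = y \<otimes> a" and x: "x \<in> generate G S" for x y
    using x
  proof (induction x rule: generate.induct)
    case one
    then show ?case using y by simp
  next
    case (incl h)
    then show ?case using y by blast
  next
    case (inv h)
    then have h: "h \<in> carrier G" "h \<otimes> y = y \<otimes> h" using S y by auto
    have "inv h \<otimes> (h \<otimes> y) \<otimes> inv h = inv h \<otimes> (y \<otimes> h) \<otimes> inv h" by (simp only: h(2))
    moreover have "inv h \<otimes> (h \<otimes> y) \<otimes> inv h = y \<otimes> inv h" using h(1) y(1) by (simp add: m_assoc[symmetric])
    moreover have "inv h \<otimes> (y \<otimes> h) \<otimes> inv h = inv h \<otimes> y" using h(1) y(1) by (simp add: m_assoc)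
    ultimately show ?case by simp
  next
    case (eng a b)
    then have "a \<in> carrier G" "b \<in> carrier G" using S by auto
    then show ?case using eng y(1) by (metis m_assoc)
  qed
  have "x \<otimes> y = y \<otimes> x" if x: "x \<in> carrier G" and y: "y \<in> carrier G" for x y
  proof (rule step[OF y])
    show "a \<otimes> y = y \<otimes> a" if a: "a \<in> S" for a
      using step[of a y] comm a S y by (metis subsetD)
  qed (use x S in simp)
  then show ?thesis by (rule group_comm_groupI)
qed

lemma (in comm_group) foldr_pow:
  assumes s: "\<And>d. d \<in> set xs \<Longrightarrow> s d \<in> carrier G"
  shows "foldr (\<lambda>d x. (s d [^] (g d :: nat)) \<otimes> x) xs \<one> \<in> carrier G"
    "foldr (\<lambda>d x. (s d [^] (g d + h d :: nat)) \<otimes> x) xs \<one> =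
      foldr (\<lambda>d x. (s d [^] g d) \<otimes> x) xs \<one> \<otimes> foldr (\<lambda>d x. (s d [^] h d) \<otimes> x) xs \<one>"
proof -
  have cl: "foldr (\<lambda>d x. (s d [^] (g d :: nat)) \<otimes> x) xs \<one> \<in> carrier G" for g
    using s by (induction xs) auto
  then show "foldr (\<lambda>d x. (s d [^] (g d :: nat)) \<otimes> x) xs \<one> \<in> carrier G" .
  show "foldr (\<lambda>d x. (s d [^] (g d + h d :: nat)) \<otimes> x) xs \<one> =
      foldr (\<lambda>d x. (s d [^] g d) \<otimes> x) xs \<one> \<otimes> foldr (\<lambda>d x. (s d [^] h d) \<otimes> x) xs \<one>"
    using s
  proof (induction xs)
    case (Cons d xs)
    have c: "foldr (\<lambda>d x. (s d [^] (g d :: nat)) \<otimes> x) xs \<one> \<in> carrier G" for g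
      using Cons(2) by (induction xs) auto
    show ?case using Cons c by (simp add: nat_pow_mult[symmetric] m_ac)
  qed simp
qed

lemma (in comm_group) foldr_pow_single:
  assumes "\<And>d. d \<in> set xs \<Longrightarrow> s d \<in> carrier G" "distinct xs"
  shows "foldr (\<lambda>d x. (s d [^] (if d = i then a else 0 :: nat)) \<otimes> x) xs \<one> = (if i \<in> set xs then s i [^] a else \<one>)"
  using assms by (induction xs) auto

text \<open>Commutativity collects equal generators, and exponents may be reduced modulo
  \<open>k\<close>; in particular the inverse of a generator is its power with exponent
  \<open>k - 1\<close>.\<close>

lemma (in comm_group) generated_power_product:
  assumes s: "\<And>i. i \<in> {1..n} \<Longrightarrow> s i \<in> carrier G" "\<And>i. i \<in> {1..n} \<Longrightarrow> s i [^] k = \<one>"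
    and gen: "generate G (s ` {1..n}) = carrier G" and k: "k \<ge> (1::nat)" and x: "x \<in> carrier G"
  shows "\<exists>g. (\<forall>d. g d < k) \<and> x = ordered_power_product G n s g"
proof -
  have set: "set [1..<Suc n] = {1..n}" "distinct [1..<Suc n]" by auto
  have sx: "s d \<in> carrier G" if "d \<in> set [1..<Suc n]" for d using s(1) that unfolding set(1) .
  have red: "s d [^] (m mod k) = s d [^] m" if "d \<in> {1..n}" for d and m :: nat
  proof -
    have "s d [^] m = s d [^] (k * (m div k) + m mod k)" by simp
    also have "\<dots> = (s d [^] k) [^] (m div k) \<otimes> s d [^] (m mod k)"
      using s(1)[OF that] by (simp only: nat_pow_mult nat_pow_pow)
    also have "\<dots> = s d [^] (m mod k)" using s[OF that] by simp
    finally show ?thesis by simp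
  qed
  have reduce: "ordered_power_product G n s (\<lambda>d. g d mod k) = ordered_power_product G n s g" for g
  proof -
    have "foldr (\<lambda>d x. (s d [^] (g d mod k)) \<otimes> x) xs \<one> = foldr (\<lambda>d x. (s d [^] g d) \<otimes> x) xs \<one>" if "set xs \<subseteq> {1..n}" for xs
      using that red by (induction xs) auto
    then show ?thesis unfolding ordered_power_product_def using set by blast
  qed
  have single: "\<exists>g. s i [^] (a::nat) = ordered_power_product G n s g" if "i \<in> {1..n}" for i a
  proof -
    have "foldr (\<lambda>d x. (s d [^] (if d = i then a else 0)) \<otimes> x) [1..<Suc n] \<one> =
        (if i \<in> set [1..<Suc n] then s i [^] a else \<one>)"
      by (rule foldr_pow_single[OF _ set(2)]) (rule sx)
    moreover have "i \<in> set [1..<Suc n]" using that unfolding set(1) .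
    ultimately show ?thesis unfolding ordered_power_product_def by (metis (no_types))
  qed
  have "\<exists>g. x = ordered_power_product G n s g"
    using x unfolding gen[symmetric]
  proof (induction x rule: generate.induct)
    case one
    have "foldr (\<lambda>d x. (s d [^] (0::nat)) \<otimes> x) xs \<one> = \<one>" for xs by (induction xs) auto
    then show ?case unfolding ordered_power_product_def by (intro exI[of _ "\<lambda>_. 0"]) simp
  next
    case (incl h)
    then obtain i where "i \<in> {1..n}" "h = s i" by blast
    then show ?case using single[of i 1] s(1) by simp
  next
    case (inv h)
    then obtain i where i: "i \<in> {1..n}" "h = s i" by blast
    have "s i [^] (k - 1) \<otimes> s i = \<one>"
      using s[OF i(1)] k nat_pow_Suc[of "s i" "k - 1"] by simp
    then have "inv h = s i [^] (k - 1)" using i s(1) inv_equality by simp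
    then show ?case using single[OF i(1)] by metis
  next
    case (eng a b)
    then obtain g h where "a = ordered_power_product G n s g" "b = ordered_power_product G n s h" by blast
    then have "a \<otimes> b = ordered_power_product G n s (\<lambda>d. g d + h d)"
      unfolding ordered_power_product_def using foldr_pow(2)[of "[1..<Suc n]" s g h, OF sx] by (simp only:)
    then show ?case by blast
  qed
  then obtain g where "x = ordered_power_product G n s g" by blast
  then have "x = ordered_power_product G n s (\<lambda>d. g d mod k)" using reduce by simp
  then show ?thesis using k by (intro exI[of _ "\<lambda>d. g d mod k"]) auto
qed

lemma hom_foldr_pow:
  assumes h: "h \<in> hom G H" and G: "group G" "group H" and s: "\<And>d. d \<in> set xs \<Longrightarrow> s d \<in> carrier G"
  shows "h (foldr (\<lambda>d x. (s d [^]\<^bsub>G\<^esub> (g d :: nat)) \<otimes>\<^bsub>G\<^esub> x) xs \<one>\<^bsub>G\<^esub>) =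
    foldr (\<lambda>d x. (h (s d) [^]\<^bsub>H\<^esub> g d) \<otimes>\<^bsub>H\<^esub> x) xs \<one>\<^bsub>H\<^esub>"
proof -
  interpret group_hom G H h using h G by (simp add: group_hom_def group_hom_axioms_def)
  have cl: "foldr (\<lambda>d x. (s d [^]\<^bsub>G\<^esub> (g d :: nat)) \<otimes>\<^bsub>G\<^esub> x) ys \<one>\<^bsub>G\<^esub> \<in> carrier G"
    if "set ys \<subseteq> set xs" for ys using that s by (induction ys) auto
  have "h (foldr (\<lambda>d x. (s d [^]\<^bsub>G\<^esub> (g d :: nat)) \<otimes>\<^bsub>G\<^esub> x) ys \<one>\<^bsub>G\<^esub>) =
    foldr (\<lambda>d x. (h (s d) [^]\<^bsub>H\<^esub> g d) \<otimes>\<^bsub>H\<^esub> x) ys \<one>\<^bsub>H\<^esub>" if "set ys \<subseteq> set xs" for ys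
    using that
  proof (induction ys)
    case (Cons d ys)
    then have "set ys \<subseteq> set xs" "d \<in> set xs" by auto
    then show ?case using cl[of ys] s Cons by (simp add: hom_nat_pow)
  qed simp
  then show ?thesis by blast
qed

section \<open>Reduction of the homology to conjugated commutators\<close>

context fermat_loops
begin

abbreviation H1 where "H1 \<equiv> homology_group 1 C"
abbreviation dc where "dc \<equiv> deck_class C U q u"
abbreviation cc where "cc \<equiv> conj_commutator G n \<phi>"

lemma cc_eq: "cc (j, l, g) = opp g \<otimes>\<^bsub>G\<^esub> (\<phi> j \<otimes>\<^bsub>G\<^esub> \<phi> l \<otimes>\<^bsub>G\<^esub> inv\<^bsub>G\<^esub> (\<phi> j) \<otimes>\<^bsub>G\<^esub> inv\<^bsub>G\<^esub> (\<phi> l)) \<otimes>\<^bsub>G\<^esub> inv\<^bsub>G\<^esub> (opp g)"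
  by (simp add: conj_commutator_def)

lemma commutator_DQ:
  assumes "x \<in> DP" "y \<in> DP"
  shows "x \<otimes>\<^bsub>G\<^esub> y \<otimes>\<^bsub>G\<^esub> inv\<^bsub>G\<^esub> x \<otimes>\<^bsub>G\<^esub> inv\<^bsub>G\<^esub> y \<in> DQ"
  unfolding DQ_iff using assms by (simp add: G_mult G_inv mon_mult mon_inv)

lemma cc_DQ: "a \<in> gen_index k n \<Longrightarrow> cc a \<in> DQ"
  by (cases a) (auto simp: gen_index_def cc_eq intro!: DQ_conj commutator_DQ \<phi>_DP opp_DP)

lemma dc_one: "dc \<one>\<^bsub>G\<^esub> = \<one>\<^bsub>H1\<^esub>"
proof -
  interpret H1: comm_group H1 by (rule comm_group_homology_1)
  have 1: "\<one>\<^bsub>G\<^esub> \<in> DQ" by (simp add: DQ_iff G_one mon_one)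
  have "\<one>\<^bsub>G\<^esub> \<otimes>\<^bsub>G\<^esub> \<one>\<^bsub>G\<^esub> = \<one>\<^bsub>G\<^esub>"
    by (rule monoid.l_one[OF group.is_monoid[OF G_group]]) (simp add: G_one)
  then have "dc \<one>\<^bsub>G\<^esub> \<otimes>\<^bsub>H1\<^esub> dc \<one>\<^bsub>G\<^esub> = dc \<one>\<^bsub>G\<^esub>" using deck_class_mult[OF 1 1] by simp
  then show ?thesis using deck_class_carrier[OF 1] H1.r_cancel_one' by simp
qed

lemma dc_inv: "x \<in> DQ \<Longrightarrow> dc (inv\<^bsub>G\<^esub> x) = inv\<^bsub>H1\<^esub> (dc x)"
proof -
  assume x: "x \<in> DQ"
  interpret H1: comm_group H1 by (rule comm_group_homology_1)
  have "inv\<^bsub>G\<^esub> x \<otimes>\<^bsub>G\<^esub> x = \<one>\<^bsub>G\<^esub>" using group.l_inv[OF G_group] DQ_DP[OF x] by simp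
  then have "dc (inv\<^bsub>G\<^esub> x) \<otimes>\<^bsub>H1\<^esub> dc x = \<one>\<^bsub>H1\<^esub>" using deck_class_mult[OF DQ_inv[OF x] x] dc_one by simp
  then show ?thesis using H1.inv_equality deck_class_carrier[OF x] deck_class_carrier[OF DQ_inv[OF x]] by simp
qed

lemma deck_class_in_subgroup:
  assumes H: "subgroup H H1" and cc: "dc ` cc ` gen_index k n \<subseteq> H" and \<kappa>: "\<kappa> \<in> DQ"
  shows "dc \<kappa> \<in> H"
proof -
  interpret G: group G by (rule G_group)
  interpret H1: comm_group H1 by (rule comm_group_homology_1)
  have DP: "DP = carrier G" by simp
  have canc: "inv\<^bsub>G\<^esub> a \<otimes>\<^bsub>G\<^esub> (a \<otimes>\<^bsub>G\<^esub> z) = z" "a \<otimes>\<^bsub>G\<^esub> (inv\<^bsub>G\<^esub> a \<otimes>\<^bsub>G\<^esub> z) = z"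
    if "a \<in> carrier G" "z \<in> carrier G" for a z
    using that by (simp_all only: G.m_assoc[symmetric] G.inv_closed G.l_inv G.r_inv G.l_one)
  note gsimps = G.m_assoc G.inv_mult_group G.inv_inv G.l_inv G.r_inv G.l_one G.r_one canc G.m_closed G.inv_closed
  define conj where "conj \<rho> x = \<rho> \<otimes>\<^bsub>G\<^esub> x \<otimes>\<^bsub>G\<^esub> inv\<^bsub>G\<^esub> \<rho>" for \<rho> x
  \<comment> \<open>Requiring all conjugates under Deck(p), not only under Deck(q), makes
    \<open>N\<close> normal in Deck(p).\<close>
  define N where "N = {x \<in> DQ. \<forall>\<rho>\<in>carrier G. dc (conj \<rho> x) \<in> H}"
  have QC: "x \<in> carrier G" if "x \<in> DQ" for x using DQ_DP[OF that] by simp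
  have conjQ: "conj \<rho> x \<in> DQ" if "x \<in> DQ" "\<rho> \<in> carrier G" for \<rho> x
    unfolding conj_def using DQ_conj that by simp
  have N: "subgroup N G"
  proof (rule G.subgroupI)
    show "N \<subseteq> carrier G" using QC by (auto simp: N_def)
    have "conj \<rho> \<one>\<^bsub>G\<^esub> = \<one>\<^bsub>G\<^esub>" if "\<rho> \<in> carrier G" for \<rho>
      unfolding conj_def using that by (simp only: gsimps G.one_closed)
    then have "\<one>\<^bsub>G\<^esub> \<in> N"
      using subgroup.one_closed[OF H] by (simp add: N_def dc_one DQ_iff G_one mon_one)
    then show "N \<noteq> {}" by blast
    fix x assume x: "x \<in> N"
    then have xQ: "x \<in> DQ" by (simp add: N_def)
    have "conj \<rho> (inv\<^bsub>G\<^esub> x) = inv\<^bsub>G\<^esub> (conj \<rho> x)" if "\<rho> \<in> carrier G" for \<rho>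
      unfolding conj_def using that QC[OF xQ] by (simp only: gsimps)
    then show "inv\<^bsub>G\<^esub> x \<in> N"
      using x dc_inv[OF conjQ[OF xQ]] subgroup.m_inv_closed[OF H] DQ_inv[OF xQ] by (simp add: N_def)
    fix y assume y: "y \<in> N"
    then have yQ: "y \<in> DQ" by (simp add: N_def)
    have "conj \<rho> (x \<otimes>\<^bsub>G\<^esub> y) = conj \<rho> x \<otimes>\<^bsub>G\<^esub> conj \<rho> y" if "\<rho> \<in> carrier G" for \<rho>
      unfolding conj_def using that QC[OF xQ] QC[OF yQ] by (simp only: gsimps)
    then show "x \<otimes>\<^bsub>G\<^esub> y \<in> N"
      using x y deck_class_mult[OF conjQ[OF xQ] conjQ[OF yQ]] subgroup.m_closed[OF H] DQ_mult[OF xQ yQ]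
      by (simp add: N_def)
  qed
  have nN: "N \<lhd> G"
    unfolding G.normal_inv_iff
  proof (intro conjI ballI N)
    fix \<tau> x assume \<tau>: "\<tau> \<in> carrier G" and x: "x \<in> N"
    then have xQ: "x \<in> DQ" by (simp add: N_def)
    have "conj \<rho> (conj \<tau> x) = conj (\<rho> \<otimes>\<^bsub>G\<^esub> \<tau>) x" if "\<rho> \<in> carrier G" for \<rho>
      unfolding conj_def using that QC[OF xQ] \<tau> by (simp only: gsimps)
    then have "conj \<tau> x \<in> N" using x conjQ[OF xQ \<tau>] \<tau> by (simp add: N_def G_mult)
    then show "\<tau> \<otimes>\<^bsub>G\<^esub> x \<otimes>\<^bsub>G\<^esub> inv\<^bsub>G\<^esub> \<tau> \<in> N" by (simp add: conj_def)
  qed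
  have \<phi>C: "\<phi> i \<in> carrier G" if "i \<in> {1..n}" for i using \<phi>_DP[OF that] by simp
  let ?com = "\<lambda>x y. x \<otimes>\<^bsub>G\<^esub> y \<otimes>\<^bsub>G\<^esub> inv\<^bsub>G\<^esub> x \<otimes>\<^bsub>G\<^esub> inv\<^bsub>G\<^esub> y"
  have com_less: "?com (\<phi> j) (\<phi> l) \<in> N" if jl: "1 \<le> j" "j < l" "l \<le> n" for j l
  proof -
    have jn: "j \<in> {1..n}" "l \<in> {1..n}" using jl by auto
    let ?x = "?com (\<phi> j) (\<phi> l)"
    have xQ: "?x \<in> DQ" by (rule commutator_DQ) (use jn \<phi>_DP in auto)
    have "dc (conj \<rho> ?x) \<in> H" if \<rho>: "\<rho> \<in> carrier G" for \<rho>
    proof -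
      \<comment> \<open>The exponents are the monodromy of \<open>\<rho>\<close> modulo
        \<open>k\<close>, so \<open>\<rho>\<close> and \<open>opp g\<close> differ by
        \<open>\<kappa>\<close> in Deck(q). Conjugation by \<open>\<kappa>\<close> does not change a
        class, because the homology group is abelian.\<close>
      define g where "g d = nat (mon \<rho> d mod int k)" for d
      have g: "int (g d) = mon \<rho> d mod int k" for d using k by (simp add: g_def)
      have "g d < k" for d
      proof -
        have "int (g d) < int k" unfolding g using k by simp
        then show ?thesis by simp
      qed
      then have "\<forall>d\<in>{1..n}. g d \<le> k - 1" using Suc_leI by (metis Suc_diff_1 Suc_le_mono gr_zeroI not_less_zero)
      then have idx: "(j, l, g) \<in> gen_index k n" using jl by (simp add: gen_index_def)
      define \<kappa> where "\<kappa> = \<rho> \<otimes>\<^bsub>G\<^esub> inv\<^bsub>G\<^esub> (opp g)"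
      have oC: "opp g \<in> carrier G" using opp_DP by simp
      have \<kappa>Q: "\<kappa> \<in> DQ"
        unfolding DQ_iff \<kappa>_def using \<rho> opp_DP
        by (auto simp: G_mult G_inv mon_mult mon_inv opp_mon g minus_mod_eq_mult_div)
      have "conj \<rho> ?x = \<kappa> \<otimes>\<^bsub>G\<^esub> conj (opp g) ?x \<otimes>\<^bsub>G\<^esub> inv\<^bsub>G\<^esub> \<kappa>"
        unfolding conj_def \<kappa>_def using \<rho> oC QC[OF xQ] by (simp only: gsimps)
      moreover have "conj (opp g) ?x = cc (j, l, g)" by (simp add: conj_def cc_eq)
      ultimately have "dc (conj \<rho> ?x) = dc \<kappa> \<otimes>\<^bsub>H1\<^esub> dc (cc (j, l, g)) \<otimes>\<^bsub>H1\<^esub> inv\<^bsub>H1\<^esub> dc \<kappa>"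
        using deck_class_mult[OF DQ_mult[OF \<kappa>Q cc_DQ[OF idx]] DQ_inv[OF \<kappa>Q]] deck_class_mult[OF \<kappa>Q cc_DQ[OF idx]]
          dc_inv[OF \<kappa>Q] by simp
      also have "\<dots> = dc (cc (j, l, g))"
        using deck_class_carrier[OF \<kappa>Q] deck_class_carrier[OF cc_DQ[OF idx]]
        by (simp add: H1.m_comm[of "dc \<kappa>" "dc (cc (j, l, g))"] H1.m_assoc)
      finally show ?thesis using cc idx by auto
    qed
    then show ?thesis using xQ by (simp add: N_def)
  qed
  have com: "?com (\<phi> j) (\<phi> l) \<in> N" if jl: "j \<in> {1..n}" "l \<in> {1..n}" for j l
  proof -
    consider "j < l" | "j = l" | "l < j" by linarith
    then show ?thesis
    proof cases
      case 1
      then show ?thesis using com_less jl by simp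
    next
      case 2
      have "?com (\<phi> j) (\<phi> j) = \<one>\<^bsub>G\<^esub>" using \<phi>C[OF jl(1)] by (simp only: gsimps)
      then show ?thesis using 2 subgroup.one_closed[OF N] by simp
    next
      case 3
      have "?com (\<phi> j) (\<phi> l) = inv\<^bsub>G\<^esub> (?com (\<phi> l) (\<phi> j))"
        using \<phi>C[OF jl(1)] \<phi>C[OF jl(2)] by (simp only: gsimps)
      moreover have "?com (\<phi> l) (\<phi> j) \<in> N" using 3 com_less jl by simp
      ultimately show ?thesis using subgroup.m_inv_closed[OF N] by simp
    qed
  qed
  have pow: "\<phi> i [^]\<^bsub>G\<^esub> k \<in> N" if i: "i \<in> {1..n}" for i
    unfolding N_def conj_def using null_power[OF i] subgroup.one_closed[OF H] G_one by auto
  define h where "h a = N #>\<^bsub>G\<^esub> a" for a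
  let ?Q = "G Mod N"
  have hh: "h \<in> hom G ?Q" unfolding h_def by (rule normal.r_coset_hom_Mod[OF nN])
  interpret Q: group ?Q by (rule normal.factorgroup_is_group[OF nN])
  interpret hom: group_hom G ?Q h by (simp add: group_hom_def group_hom_axioms_def hh G_group Q.is_group)
  have h1: "h a = \<one>\<^bsub>?Q\<^esub> \<longleftrightarrow> a \<in> N" if "a \<in> carrier G" for a
  proof -
    have "h a = N \<longleftrightarrow> a \<in> N" unfolding h_def
      using G.coset_join1[OF _ that N] G.coset_join2[OF that N] by blast
    then show ?thesis by (simp add: FactGroup_def)
  qed
  have surj: "h ` carrier G = carrier ?Q"
    by (auto simp: h_def FactGroup_def RCOSETS_def)
  have genQ: "generate ?Q ((\<lambda>i. h (\<phi> i)) ` {1..n}) = carrier ?Q"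
  proof -
    have "\<phi> ` {1..n} \<subseteq> carrier G" using \<phi>C by blast
    from hom.generate_img[OF this] show ?thesis using surj unfolding image_image generate_\<phi> by simp
  qed
  have "comm_group ?Q"
  proof (rule Q.comm_group_of_generators[OF _ genQ])
    show "(\<lambda>i. h (\<phi> i)) ` {1..n} \<subseteq> carrier ?Q" using \<phi>C hom.hom_closed by blast
    fix a b' assume "a \<in> (\<lambda>i. h (\<phi> i)) ` {1..n}" "b' \<in> (\<lambda>i. h (\<phi> i)) ` {1..n}"
    then obtain j l where jl: "j \<in> {1..n}" "l \<in> {1..n}" "a = h (\<phi> j)" "b' = h (\<phi> l)" by blast
    have C: "\<phi> j \<in> carrier G" "\<phi> l \<in> carrier G" using \<phi>C jl by auto
    have "?com (\<phi> j) (\<phi> l) \<otimes>\<^bsub>G\<^esub> (\<phi> l \<otimes>\<^bsub>G\<^esub> \<phi> j) = \<phi> j \<otimes>\<^bsub>G\<^esub> \<phi> l" using C by (simp only: gsimps)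
    moreover have cc: "?com (\<phi> j) (\<phi> l) \<in> carrier G" "\<phi> l \<otimes>\<^bsub>G\<^esub> \<phi> j \<in> carrier G" using C by (simp_all only: gsimps)
    moreover have "h (?com (\<phi> j) (\<phi> l)) = \<one>\<^bsub>?Q\<^esub>"
      using h1 com[OF jl(1,2)] C by (simp only: gsimps)
    then have "h (?com (\<phi> j) (\<phi> l) \<otimes>\<^bsub>G\<^esub> (\<phi> l \<otimes>\<^bsub>G\<^esub> \<phi> j)) = h (\<phi> l \<otimes>\<^bsub>G\<^esub> \<phi> j)"
      using hom.hom_mult[OF cc(1,2)] hom.hom_closed[OF cc(2)] Q.l_one by (simp only:)
    ultimately have "h (\<phi> j \<otimes>\<^bsub>G\<^esub> \<phi> l) = h (\<phi> l \<otimes>\<^bsub>G\<^esub> \<phi> j)" by simp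
    then show "a \<otimes>\<^bsub>?Q\<^esub> b' = b' \<otimes>\<^bsub>?Q\<^esub> a" using C jl by (simp only: hom.hom_mult)
  qed
  then interpret Q: comm_group ?Q .
  have "\<exists>g. (\<forall>d. g d < k) \<and> h \<kappa> = ordered_power_product ?Q n (\<lambda>i. h (\<phi> i)) g"
  proof (rule Q.generated_power_product[OF _ _ genQ])
    show "h (\<phi> i) [^]\<^bsub>?Q\<^esub> k = \<one>\<^bsub>?Q\<^esub>" if "i \<in> {1..n}" for i
      using hom.hom_nat_pow[OF \<phi>C[OF that], of k] h1[of "\<phi> i [^]\<^bsub>G\<^esub> k"] pow[OF that] G.nat_pow_closed[OF \<phi>C[OF that]] by simp
  qed (use \<phi>C hom.hom_closed QC[OF \<kappa>] k in auto)
  then obtain g where g: "\<And>d. g d < k" "h \<kappa> = ordered_power_product ?Q n (\<lambda>i. h (\<phi> i)) g" by blast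
  have "h (opp g) = ordered_power_product ?Q n (\<lambda>i. h (\<phi> i)) g"
    unfolding ordered_power_product_def
    by (rule hom_foldr_pow[OF hh G_group Q.is_group]) (use \<phi>C in auto)
  then have "h \<kappa> = h (opp g)" using g by simp
  moreover have oC: "opp g \<in> carrier G" using opp_DP by simp
  ultimately have "h (\<kappa> \<otimes>\<^bsub>G\<^esub> inv\<^bsub>G\<^esub> (opp g)) = \<one>\<^bsub>?Q\<^esub>"
    using QC[OF \<kappa>] by (simp only: hom.hom_mult hom.hom_inv G.inv_closed Q.r_inv hom.hom_closed)
  then have kN: "\<kappa> \<otimes>\<^bsub>G\<^esub> inv\<^bsub>G\<^esub> (opp g) \<in> N"
    using h1[OF G.m_closed[OF QC[OF \<kappa>] G.inv_closed[OF oC]]] by blast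
  have "g d = 0" if d: "d \<in> {1..n}" for d
  proof -
    have "\<kappa> \<otimes>\<^bsub>G\<^esub> inv\<^bsub>G\<^esub> (opp g) \<in> DQ" using kN by (simp add: N_def)
    then have "int k dvd mon \<kappa> d - int (g d)"
      using d DQ_DP[OF \<kappa>] opp_DP by (auto simp: DQ_iff mon_mult mon_inv G_inv opp_mon)
    moreover have "int k dvd mon \<kappa> d" using \<kappa> d by (simp add: DQ_iff)
    ultimately have "int k dvd int (g d)" using dvd_diff[of "int k" "mon \<kappa> d" "mon \<kappa> d - int (g d)"] by simp
    then show ?thesis using g(1)[of d] by (metis dvd_imp_le int_dvd_int_iff not_gr_zero not_le)
  qed
  then have "foldr (\<lambda>d x. (\<phi> d [^]\<^bsub>G\<^esub> g d) \<otimes>\<^bsub>G\<^esub> x) xs \<one>\<^bsub>G\<^esub> = \<one>\<^bsub>G\<^esub>" if "set xs \<subseteq> {1..n}" for xs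
    using that G.l_one[OF G.one_closed] by (induction xs) auto
  moreover have "set [1..<Suc n] \<subseteq> {1..n}" by auto
  ultimately have "opp g = \<one>\<^bsub>G\<^esub>" unfolding ordered_power_product_def by blast
  then have "\<kappa> \<in> N" using kN QC[OF \<kappa>] by simp
  then have "dc (conj \<one>\<^bsub>G\<^esub> \<kappa>) \<in> H" by (simp add: N_def G_one)
  moreover have "conj \<one>\<^bsub>G\<^esub> \<kappa> = \<kappa>" unfolding conj_def using QC[OF \<kappa>] by simp
  ultimately show ?thesis by simp
qed

lemma homology_generators: "generate H1 ((\<lambda>a. dc (cc a)) ` gen_index k n) = carrier H1"
proof -
  interpret H1: comm_group H1 by (rule comm_group_homology_1)
  have sub: "(\<lambda>a. dc (cc a)) ` gen_index k n \<subseteq> carrier H1" using deck_class_carrier cc_DQ by blast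
  have H: "subgroup (generate H1 ((\<lambda>a. dc (cc a)) ` gen_index k n)) H1"
    by (rule H1.generate_is_subgroup[OF sub])
  have "dc ` cc ` gen_index k n \<subseteq> generate H1 ((\<lambda>a. dc (cc a)) ` gen_index k n)"
    by (auto intro!: generate.incl)
  then have "carrier H1 \<subseteq> generate H1 ((\<lambda>a. dc (cc a)) ` gen_index k n)"
    using homology_subset_of_deck_classes[OF H] deck_class_in_subgroup[OF H] by blast
  then show ?thesis using subgroup.subset[OF H] by blast
qed

end

section \<open>Periods\<close>

text \<open>Near \<open>z\<close> the difference \<open>l w - l z\<close> has norm below 1, so its
  imaginary part lies where \<open>Ln\<close> inverts \<open>exp\<close>. Hence \<open>l\<close> is
  locally a constant plus \<open>Ln\<close> of a quotient near 1.\<close>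

lemma continuous_log_derivative:
  fixes l :: "complex \<Rightarrow> complex"
  assumes S: "open S" "continuous_on S l" "z \<in> S"
    and e: "\<And>w. w \<in> S \<Longrightarrow> exp (l w) = c * (w - a)"
  shows "(l has_field_derivative 1 / (z - a)) (at z)"
proof -
  have nz: "c \<noteq> 0" "z \<noteq> a" using e[OF S(3)] exp_not_eq_zero[of "l z"] by auto
  have "isCont l z" using S continuous_on_eq_continuous_at by blast
  then have "(l \<longlongrightarrow> l z) (at z)" by (simp add: isCont_def)
  then have "\<forall>\<^sub>F w in at z. dist (l w) (l z) < 1" by (rule tendstoD) simp
  then have "\<forall>\<^sub>F w in nhds z. dist (l w) (l z) < 1" by (simp add: eventually_nhds_conv_at)
  moreover have "\<forall>\<^sub>F w in nhds z. w \<in> S" using S by (rule_tac eventually_nhds_in_open)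
  ultimately have ev: "\<forall>\<^sub>F w in nhds z. l w = l z + Ln ((w - a) / (z - a))"
  proof eventually_elim
    case (elim w)
    have "\<bar>Im (l w - l z)\<bar> \<le> norm (l w - l z)" by (rule abs_Im_le_cmod)
    also have "\<dots> < 1" using elim(1) by (simp add: dist_norm)
    finally have "- pi < Im (l w - l z)" "Im (l w - l z) \<le> pi" using pi_gt3 by linarith+
    then have "l w - l z = Ln (exp (l w - l z))" by (rule Ln_exp[symmetric])
    also have "exp (l w - l z) = (w - a) / (z - a)"
      using e[OF elim(2)] e[OF S(3)] nz by (simp add: exp_diff)
    finally show ?case by (simp add: algebra_simps)
  qed
  have "((\<lambda>w. l z + Ln ((w - a) / (z - a))) has_field_derivative 1 / (z - a)) (at z)"
    using nz by (auto intro!: derivative_eq_intros simp: complex_nonpos_Reals_iff)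
  then show ?thesis using DERIV_cong_ev[OF refl ev refl] by blast
qed

locale fermat_period = fermat_loops k n r U p L u \<phi> \<beta> b + fermat_form k n r \<alpha>
  for k n r and U :: "'u::real_normed_vector set" and p L u \<phi> \<beta> b \<alpha>
begin

abbreviation W where "W \<equiv> W_fun k n L \<alpha>"

definition \<Gamma> :: "'u \<Rightarrow> complex" where
  "\<Gamma> = (SOME g. prim U q g)"

lemma prim_\<Gamma>: "prim U q \<Gamma>"
  unfolding \<Gamma>_def by (rule someI_ex[OF prim_exists_simply_connected[OF q_cont sc lpc]])

lemma class_integral_deck:
  assumes "\<kappa> \<in> DQ"
  shows "class_integral n C (theta n \<alpha>) (dc \<kappa>) = \<Gamma> (\<kappa> u) - \<Gamma> u"
proof -
  obtain c where c: "upath c u (\<kappa> u)" using upath_exists[OF u] deck_setD(3)[OF assms u] by blast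
  have cc: "continuous_on {0..1} c" "c ` {0..1} \<subseteq> U" using c by (auto simp: path_def path_image_def)
  have "chain_integral n C (theta n \<alpha>) (qchain c) = (\<Gamma> \<circ> c) 1 - (\<Gamma> \<circ> c) 0"
    by (rule chain_integral_path[OF continuous_map_path_compose[OF q_cont] prim_compose[OF prim_\<Gamma> cc]]) (use c in auto)
  then show ?thesis
    using c unfolding deck_class_eq[of c \<kappa>, OF c] class_integral_eq by (simp add: pathstart_def pathfinish_def)
qed

lemma W_alt:
  "W v = xh 1 v powi (\<alpha> 1 + 1 - int k) * (\<Prod>t=2..n. xh t v powi (- \<alpha> t))"
  by (simp add: W_fun_def)

text \<open>No coordinate vanishes on the image of \<open>q\<close>, so the chart whose parameter is
  the first coordinate is available there. Along the section that parameter is the exponential of a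
  logarithm divided by \<open>k\<close>, and \<open>continuous_log_derivative\<close> differentiates
  the logarithm.\<close>

lemma \<Gamma>_section:
  assumes S: "open S" "continuous_on S \<sigma>" "\<And>z. z \<in> S \<Longrightarrow> \<sigma> z \<in> U \<and> p (\<sigma> z) = z" and z: "z \<in> S"
  shows "((\<lambda>z. \<Gamma> (\<sigma> z)) has_field_derivative - (W (\<sigma> z)) / of_nat k) (at z)"
proof -
  let ?v = "\<sigma> z"
  have v: "?v \<in> U" "p ?v = z" using S(3)[OF z] by auto
  have one: "1 \<in> {1..n}" using n by simp
  obtain D \<rho> where ch: "chart 0 1 D \<rho>" "xh 1 ?v \<in> D" and eq: "cpt \<rho> (xh 1 ?v) = q ?v"
  proof (rule chart_at[OF one, of "\<lambda>i. xh i ?v" z])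
    show "xh i ?v ^ k = eps i * (z - r i)" if "i \<in> {1..n}" for i using xh_power[OF that v(1)] v(2) by simp
  qed (auto simp: curve_map_def)
  let ?s = "xh 1 ?v"
  have D: "open D" and rho: "\<And>s. s \<in> D \<Longrightarrow> \<rho> 0 s = 1 \<and> \<rho> 1 s = s" and hol: "\<And>i. i \<in> {0..n} \<Longrightarrow> \<rho> i holomorphic_on D"
    using ch by (auto simp: chart_def)
  have rx: "\<rho> i ?s = xh i ?v" if "i \<in> {1..n}" for i
    using chart_coord(3)[OF ch, of i] that hratio_q[OF that] eq by simp
  obtain \<Phi> where \<Phi>: "LP (cpt \<rho> ` D) (\<Phi> \<circ> hratio 1 0)"
    "\<And>s. s \<in> D \<Longrightarrow> (\<Phi> has_field_derivative theta n \<alpha> \<rho> s) (at s)"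
    using LP_chart[OF ch(1)] by blast
  have "(q \<circ> \<sigma>) z \<in> cpt \<rho> ` D" using eq ch(2) by (simp add: image_iff) metis
  moreover have "\<sigma> ` S \<subseteq> U" using S(3) by blast
  moreover have "continuous_map (top_of_set S) C (q \<circ> \<sigma>)"
    by (rule continuous_map_compose[OF _ q_cont]) (use S in auto)
  ultimately have "\<forall>\<^sub>F w in at z within S. (\<Gamma> \<circ> \<sigma>) w - (\<Phi> \<circ> hratio 1 0) ((q \<circ> \<sigma>) w) = (\<Gamma> \<circ> \<sigma>) z - (\<Phi> \<circ> hratio 1 0) ((q \<circ> \<sigma>) z)"
    using prim_any[OF _ prim_compose[OF prim_\<Gamma> S(2)] z \<Phi>(1)] by blast
  then have ev: "\<forall>\<^sub>F w in nhds z. \<Gamma> (\<sigma> w) = \<Phi> (xh 1 (\<sigma> w)) + (\<Gamma> (\<sigma> z) - \<Phi> (xh 1 (\<sigma> z)))"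
    unfolding at_within_open[OF z S(1)] eventually_nhds_conv_at using hratio_q[OF one] by (simp add: algebra_simps)
  have "((\<lambda>w. \<Phi> (xh 1 (\<sigma> w)) + (\<Gamma> (\<sigma> z) - \<Phi> (xh 1 (\<sigma> z)))) has_field_derivative - (W (\<sigma> z)) / of_nat k) (at z)"
  proof -
    have z0: "z \<noteq> 0" using p_R[OF v(1)] v(2) one r1 by (metis imageI)
    have "((\<lambda>w. L 1 (\<sigma> w)) has_field_derivative 1 / (z - 0)) (at z)"
    proof (rule continuous_log_derivative[OF S(1) _ z])
      show "continuous_on S (\<lambda>w. L 1 (\<sigma> w))"
        by (rule continuous_on_compose2[OF L_cont[OF one] S(2)]) (use S(3) in blast)
      show "exp (L 1 (\<sigma> w)) = - 1 * (w - 0)" if "w \<in> S" for w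
        using exp_L[OF one] S(3)[OF that] r1 by (simp add: eps_def)
    qed
    then have x: "((\<lambda>w. xh 1 (\<sigma> w)) has_field_derivative ?s * (1 / z / of_nat k)) (at z)"
      unfolding root_coord_def using k by (auto intro!: derivative_eq_intros)
    have d: "deriv (\<lambda>w. \<rho> 1 w / \<rho> 0 w) ?s = 1"
    proof (rule DERIV_imp_deriv)
      show "((\<lambda>w. \<rho> 1 w / \<rho> 0 w) has_field_derivative 1) (at ?s)"
        by (rule has_field_derivative_transform_within_open[OF DERIV_ident D ch(2)]) (use rho in auto)
    qed
    have nz: "\<rho> i ?s \<noteq> 0" if "i \<in> {0..n}" for i
      using rx[of i] rho[OF ch(2)] that by (cases "i = 0") auto
    have "theta n \<alpha> \<rho> ?s = form_expr n \<alpha> \<rho> ?s"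
      by (rule theta_eq_form_expr[OF D hol ch(2) nz]) (use n in auto)
    also have "\<dots> = ?s powi \<alpha> 1 / (\<Prod>j=2..n. xh j ?v powi \<alpha> j)"
      unfolding form_expr_def d using rho[OF ch(2)] rx by simp
    finally have th: "theta n \<alpha> \<rho> ?s = ?s powi \<alpha> 1 / (\<Prod>j=2..n. xh j ?v powi \<alpha> j)" .
    have zz: "z = - (?s ^ k)" using xh_power[OF one v(1)] v(2) r1 by (simp add: eps_def)
    have "theta n \<alpha> \<rho> ?s * (?s * (1 / z / of_nat k)) = - (W ?v) / of_nat k"
    proof -
      have "?s powi (\<alpha> 1 + 1 - int k) = ?s powi \<alpha> 1 * ?s / ?s ^ k"
        by (simp add: power_int_diff power_int_add)
      moreover have "(\<Prod>t=2..n. xh t ?v powi (- \<alpha> t)) = 1 / (\<Prod>t=2..n. xh t ?v powi \<alpha> t)"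
        by (simp add: power_int_minus inverse_eq_divide prod_dividef)
      moreover have "1 / z = - (1 / ?s ^ k)"
        using arg_cong[OF zz, of "\<lambda>x. 1 / x"] by (simp only: divide_minus_right)
      ultimately show ?thesis unfolding W_alt th by (simp only:) (simp add: field_simps)
    qed
    moreover have "((\<lambda>w. \<Phi> (xh 1 (\<sigma> w))) has_field_derivative theta n \<alpha> \<rho> ?s * (?s * (1 / z / of_nat k))) (at z)"
      by (rule DERIV_chain2[OF \<Phi>(2)[OF ch(2)] x])
    ultimately show ?thesis by (auto intro!: derivative_eq_intros)
  qed
  then show ?thesis by (simp only: DERIV_cong_ev[OF refl ev refl])
qed

text \<open>Derivatives on \<open>U\<close> are taken along sections over discs. The set
  \<open>T\<close> is open in \<open>U\<close>, and on it the section inverts \<open>p\<close>, so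
  constancy along the section means local constancy on \<open>U\<close>.\<close>

lemma section_exists:
  assumes v: "v \<in> U"
  obtains T S \<sigma> where "openin (top_of_set U) T" "v \<in> T" "open S" "p ` T \<subseteq> S" "continuous_on S \<sigma>"
    "\<And>z. z \<in> S \<Longrightarrow> \<sigma> z \<in> U \<and> p (\<sigma> z) = z" "\<And>w. w \<in> T \<Longrightarrow> \<sigma> (p w) = w" "connected S"
proof -
  obtain T S \<sigma> where 1: "v \<in> T" "openin (top_of_set U) T" "p v \<in> S" "openin (top_of_set (- R)) S" "homeomorphism T S p \<sigma>"
    using covering_space_local_homeomorphism[OF cov v] by metis
  have "open S" using 1(4) open_R openin_open_trans by blast
  then obtain e where e: "e > 0" "ball (p v) e \<subseteq> S" using 1(3) unfolding open_contains_ball by blast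
  have TU: "T \<subseteq> U" using 1(2) by (rule openin_imp_subset)
  define T' where "T' = {w \<in> T. p w \<in> ball (p v) e}"
  have "continuous_on T p" by (rule continuous_on_subset[OF p_cont TU])
  then have "openin (top_of_set T) (T \<inter> p -` ball (p v) e)"
    by (rule continuous_openin_preimage_gen) simp
  moreover have "T \<inter> p -` ball (p v) e = T'" unfolding T'_def by blast
  ultimately have "openin (top_of_set U) T'" using openin_trans[OF _ 1(2)] by simp
  moreover have "continuous_on (ball (p v) e) \<sigma>"
    using 1(5) e(2) by (auto simp: homeomorphism_def intro: continuous_on_subset)
  moreover have "\<sigma> z \<in> U \<and> p (\<sigma> z) = z" if "z \<in> ball (p v) e" for z
  proof -
    have "z \<in> S" using e(2) that by blast
    then show ?thesis
      using homeomorphism_image2[OF 1(5)] homeomorphism_apply2[OF 1(5)] TU by blast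
  qed
  moreover have "\<sigma> (p w) = w" if "w \<in> T'" for w using 1(5) that by (auto simp: homeomorphism_def T'_def)
  ultimately show ?thesis
    using 1(1) e(1) by (intro that[of T' "ball (p v) e" \<sigma>]) (auto simp: T'_def)
qed

section \<open>Multipliers, and periods as a crossed homomorphism\<close>

definition \<omega> :: "('u \<Rightarrow> 'u) \<Rightarrow> complex" where
  "\<omega> \<psi> = zeta_root k powi (\<Sum>d=1..n. mon \<psi> d * M_exp \<alpha> d)"

lemma W_deck:
  assumes \<psi>: "\<psi> \<in> DP" and v: "v \<in> U"
  shows "W (\<psi> v) = \<omega> \<psi> * W v"
proof -
  let ?z = "zeta_root k"
  have x: "xh i (\<psi> v) powi e = ?z powi (mon \<psi> i * e) * xh i v powi e" if "i \<in> {1..n}" for i e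
    using xh_mon[OF \<psi> that v] by (simp add: power_int_mult_distrib power_int_mult)
  have 1: "xh 1 (\<psi> v) powi (\<alpha> 1 + 1 - int k) = ?z powi (mon \<psi> 1 * M_exp \<alpha> 1) * xh 1 v powi (\<alpha> 1 + 1 - int k)"
  proof -
    \<comment> \<open>The exponent of the first root coordinate in \<open>W\<close> is
      \<open>M_exp \<alpha> 1 - k\<close>, and the shift by \<open>k\<close> is invisible to k-th
      roots of unity.\<close>
    have "mon \<psi> 1 * (\<alpha> 1 + 1 - int k) = mon \<psi> 1 * M_exp \<alpha> 1 + - mon \<psi> 1 * int k"
      by (simp add: M_exp_def algebra_simps)
    then have "?z powi (mon \<psi> 1 * (\<alpha> 1 + 1 - int k)) = ?z powi (mon \<psi> 1 * M_exp \<alpha> 1) * ?z powi (- mon \<psi> 1 * int k)"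
      by (simp only: power_int_add[OF disjI1[OF zeta_nonzero]])
    moreover have "?z powi (- mon \<psi> 1 * int k) = 1" using zeta_powi_eq_1[of k "- mon \<psi> 1 * int k"] k by simp
    ultimately show ?thesis using x[of 1] n by simp
  qed
  have 2: "(\<Prod>t=2..n. xh t (\<psi> v) powi (- \<alpha> t)) = ?z powi (\<Sum>t=2..n. mon \<psi> t * M_exp \<alpha> t) * (\<Prod>t=2..n. xh t v powi (- \<alpha> t))"
  proof -
    have "(\<Prod>t=2..n. xh t (\<psi> v) powi (- \<alpha> t)) = (\<Prod>t=2..n. ?z powi (mon \<psi> t * M_exp \<alpha> t) * xh t v powi (- \<alpha> t))"
      by (rule prod.cong) (use x in \<open>auto simp: M_exp_def\<close>)
    then show ?thesis by (simp add: prod.distrib prod_power_int_same)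
  qed
  have "(\<Sum>d=1..n. mon \<psi> d * M_exp \<alpha> d) = mon \<psi> 1 * M_exp \<alpha> 1 + (\<Sum>t=2..n. mon \<psi> t * M_exp \<alpha> t)"
    using n by (simp add: sum.atLeast_Suc_atMost numeral_2_eq_2)
  then show ?thesis unfolding W_alt 1 2 \<omega>_def by (simp add: power_int_add)
qed

text \<open>The function \<Gamma> \<circ> \<psi> - \<omega> \<psi> * \<Gamma> has derivative 0 along
  every section, because \<open>W\<close> is multiplied by \<omega> \<psi>; it is thus locally
  constant on the connected set \<open>U\<close>.\<close>

lemma \<Gamma>_deck:
  assumes \<psi>: "\<psi> \<in> DP" and v: "v \<in> U" "w \<in> U"
  shows "\<Gamma> (\<psi> v) - \<Gamma> (\<psi> w) = \<omega> \<psi> * (\<Gamma> v - \<Gamma> w)"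
proof -
  define f where "f v = \<Gamma> (\<psi> v) - \<omega> \<psi> * \<Gamma> v" for v
  have "\<forall>\<^sub>F y in at x within U. f x = f y" if x: "x \<in> U" for x
  proof -
    obtain T S \<sigma> where T: "openin (top_of_set U) T" "x \<in> T" and S: "open S" "p ` T \<subseteq> S" "continuous_on S \<sigma>"
      "\<And>z. z \<in> S \<Longrightarrow> \<sigma> z \<in> U \<and> p (\<sigma> z) = z" "\<And>w. w \<in> T \<Longrightarrow> \<sigma> (p w) = w" "connected S"
      using section_exists[OF x] by blast
    have "((\<lambda>z. f (\<sigma> z)) has_field_derivative 0) (at z)" if z: "z \<in> S" for z
    proof -
      have "((\<lambda>z. \<Gamma> (\<psi> (\<sigma> z))) has_field_derivative - (W (\<psi> (\<sigma> z))) / of_nat k) (at z)"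
      proof (rule \<Gamma>_section[OF S(1) _ _ z, of "\<lambda>z. \<psi> (\<sigma> z)"])
        show "continuous_on S (\<lambda>z. \<psi> (\<sigma> z))"
          by (rule continuous_on_compose2[OF deck_setD(2)[OF \<psi>] S(3)]) (use S(4) in blast)
        show "\<psi> (\<sigma> z) \<in> U \<and> p (\<psi> (\<sigma> z)) = z" if "z \<in> S" for z
          using S(4)[OF that] deck_setD(3,4)[OF \<psi>] by simp
      qed
      moreover have "((\<lambda>z. \<Gamma> (\<sigma> z)) has_field_derivative - (W (\<sigma> z)) / of_nat k) (at z)"
        by (rule \<Gamma>_section[OF S(1,3,4) z])
      ultimately have "((\<lambda>z. f (\<sigma> z)) has_field_derivative - (W (\<psi> (\<sigma> z))) / of_nat k - \<omega> \<psi> * (- (W (\<sigma> z)) / of_nat k)) (at z)"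
        unfolding f_def by (intro DERIV_diff DERIV_cmult)
      then show ?thesis using W_deck[OF \<psi>] S(4)[OF z] by simp
    qed
    then have "(\<lambda>z. f (\<sigma> z)) constant_on S" using S(1,6) by (intro has_field_derivative_0_imp_constant_on)
    then obtain a where a: "\<And>z. z \<in> S \<Longrightarrow> f (\<sigma> z) = a" by (auto simp: constant_on_def)
    have "f y = a" if "y \<in> T" for y using a[of "p y"] S(2,5) that by force
    moreover have "\<forall>\<^sub>F y in at x within U. y \<in> T"
      using T unfolding openin_open eventually_at_topological by blast
    ultimately show ?thesis using T(2) by (auto elim: eventually_mono)
  qed
  then have "f v = f w" using connected_local_const[OF con v, of f] by blast
  then show ?thesis by (simp add: f_def algebra_simps)
qed

lemma \<omega>_mult: "\<psi> \<in> DP \<Longrightarrow> \<psi>' \<in> DP \<Longrightarrow> \<omega> (\<psi> \<otimes>\<^bsub>G\<^esub> \<psi>') = \<omega> \<psi> * \<omega> \<psi>'"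
  by (simp add: \<omega>_def mon_mult distrib_right sum.distrib power_int_add)

lemma \<omega>_inv: "\<psi> \<in> DP \<Longrightarrow> \<omega> (inv\<^bsub>G\<^esub> \<psi>) = inverse (\<omega> \<psi>)"
  by (simp add: \<omega>_def mon_inv sum_negf power_int_minus)

lemma \<omega>_nz: "\<omega> \<psi> \<noteq> 0"
  by (simp add: \<omega>_def)

lemma \<omega>_\<phi>: "i \<in> {1..n} \<Longrightarrow> \<omega> (\<phi> i) = zeta_root k powi M_exp \<alpha> i"
proof -
  assume i: "i \<in> {1..n}"
  have "(\<Sum>d=1..n. mon (\<phi> i) d * M_exp \<alpha> d) = (\<Sum>d=1..n. if d = i then M_exp \<alpha> d else 0)"
    by (rule sum.cong) (use mon_\<phi>[OF i] in auto)
  then show ?thesis using i by (simp add: \<omega>_def)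
qed

definition per :: "('u \<Rightarrow> 'u) \<Rightarrow> complex" where
  "per \<psi> = \<Gamma> (\<psi> u) - \<Gamma> u"

text \<open>Passing from \<psi> u to \<psi> (\<psi>' u) is the \<psi>-translate of passing from u to
  \<psi>' u, and \<open>\<Gamma>_deck\<close> scales that increment by the multiplier of
  \<psi>.\<close>

lemma per_mult: "\<psi> \<in> DP \<Longrightarrow> \<psi>' \<in> DP \<Longrightarrow> per (\<psi> \<otimes>\<^bsub>G\<^esub> \<psi>') = per \<psi> + \<omega> \<psi> * per \<psi>'"
  using \<Gamma>_deck[of \<psi> "\<psi>' u" u] deck_setD(3)[of \<psi>' U p u] u by (simp add: per_def deck_mult algebra_simps)

lemma per_inv: "\<psi> \<in> DP \<Longrightarrow> per (inv\<^bsub>G\<^esub> \<psi>) = - per \<psi> / \<omega> \<psi>"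
proof -
  assume \<psi>: "\<psi> \<in> DP"
  have "\<psi> \<otimes>\<^bsub>G\<^esub> inv\<^bsub>G\<^esub> \<psi> = \<one>\<^bsub>G\<^esub>" using group.r_inv[OF G_group] \<psi> by simp
  then have "per \<psi> + \<omega> \<psi> * per (inv\<^bsub>G\<^esub> \<psi>) = 0"
    using per_mult[OF \<psi> G_inv[OF \<psi>]] deck_one[OF u, of p] by (simp add: per_def)
  then show ?thesis using \<omega>_nz[of \<psi>] by (simp add: field_simps add_eq_0_iff)
qed

text \<open>Each factor contributes its period times the multiplier of everything to its left.
  Multipliers commute, so the inverse of \<open>x\<close> contributes - \<omega> y * per x and that
  of \<open>y\<close> contributes - per y.\<close>

lemma per_commutator:
  assumes "x \<in> DP" "y \<in> DP"
  shows "per (x \<otimes>\<^bsub>G\<^esub> y \<otimes>\<^bsub>G\<^esub> inv\<^bsub>G\<^esub> x \<otimes>\<^bsub>G\<^esub> inv\<^bsub>G\<^esub> y) = (1 - \<omega> y) * per x - (1 - \<omega> x) * per y"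
  using assms \<omega>_nz[of x] \<omega>_nz[of y]
  by (simp add: per_mult G_mult G_inv \<omega>_mult \<omega>_inv per_inv field_simps)

text \<open>The contributions of \<open>\<rho>\<close> and its inverse cancel because the multiplier
  of \<open>x\<close> is 1.\<close>

lemma per_conj:
  assumes "x \<in> DP" "\<rho> \<in> DP" "\<omega> x = 1"
  shows "per (\<rho> \<otimes>\<^bsub>G\<^esub> x \<otimes>\<^bsub>G\<^esub> inv\<^bsub>G\<^esub> \<rho>) = \<omega> \<rho> * per x"
  using assms \<omega>_nz[of \<rho>] by (simp add: per_mult G_mult G_inv \<omega>_mult per_inv field_simps)

lemma \<Gamma>_cont: "continuous_on U \<Gamma>"
  unfolding continuous_on_def
proof
  fix x assume x: "x \<in> U"
  obtain T S \<sigma> where T: "openin (top_of_set U) T" "x \<in> T" and S: "open S" "p ` T \<subseteq> S" "continuous_on S \<sigma>"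
    "\<And>z. z \<in> S \<Longrightarrow> \<sigma> z \<in> U \<and> p (\<sigma> z) = z" "\<And>w. w \<in> T \<Longrightarrow> \<sigma> (p w) = w" "connected S"
    using section_exists[OF x] by blast
  have "p x \<in> S" using S(2) T(2) by blast
  then have "isCont (\<lambda>z. \<Gamma> (\<sigma> z)) (p x)" using \<Gamma>_section[OF S(1,3,4)] DERIV_isCont by blast
  moreover have "(p \<longlongrightarrow> p x) (at x within U)" using p_cont x by (simp add: continuous_on_def)
  ultimately have "((\<lambda>y. \<Gamma> (\<sigma> (p y))) \<longlongrightarrow> \<Gamma> (\<sigma> (p x))) (at x within U)"
    by (rule isCont_tendsto_compose)
  moreover have "\<forall>\<^sub>F y in at x within U. \<Gamma> (\<sigma> (p y)) = \<Gamma> y"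
  proof -
    have "\<forall>\<^sub>F y in at x within U. y \<in> T"
      using T unfolding openin_open eventually_at_topological by blast
    then show ?thesis by eventually_elim (simp add: S(5))
  qed
  ultimately show "(\<Gamma> \<longlongrightarrow> \<Gamma> x) (at x within U)"
    using S(5)[OF T(2)] Lim_transform_eventually by fastforce
qed

section \<open>Integrals along the arcs to the branch points\<close>

lemma arc_facts:
  assumes i: "i \<in> {1..n}"
  shows "continuous_on {0..<1} (b i)" "\<And>t. t \<in> {0..<1} \<Longrightarrow> b i t \<in> U" "b i 0 = u"
    "\<And>t. t \<in> {0..<1} \<Longrightarrow> p (b i t) = \<beta> i t" "continuous_on {0..1} (\<beta> i)" "\<beta> i 1 = r i"
    "\<beta> i piecewise_C1_differentiable_on {0..1}"
proof -
  have l: "arc_lift U p u (\<beta> i) (b i)" and a: "branch_arc R (p u) (r i) (\<beta> i)" using lifts arcs i by auto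
  show "continuous_on {0..<1} (b i)" "\<And>t. t \<in> {0..<1} \<Longrightarrow> b i t \<in> U" "b i 0 = u"
    "\<And>t. t \<in> {0..<1} \<Longrightarrow> p (b i t) = \<beta> i t"
    using l unfolding arc_lift_def by (simp_all add: image_subset_iff)
  have v: "valid_path (\<beta> i)" using a by (simp add: branch_arc_def)
  show "continuous_on {0..1} (\<beta> i)" using valid_path_imp_path[OF v] by (simp add: path_def)
  show "\<beta> i piecewise_C1_differentiable_on {0..1}" using v by (simp add: valid_path_def)
  show "\<beta> i 1 = r i" using a by (simp add: branch_arc_def pathfinish_def)
qed

text \<open>The lift is only given on [0,1), so the fundamental theorem is applied on
  \<open>{0..s}\<close>; the finitely many parameters where the arc is not differentiable are exempt
  from it.\<close>

lemma \<Gamma>_arc: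
  assumes i: "i \<in> {1..n}" and s: "0 \<le> s" "s < 1"
  shows "integral {0..s} (\<lambda>t. W (b i t) * vector_derivative (\<beta> i) (at t)) = - of_nat k * (\<Gamma> (b i s) - \<Gamma> u)"
proof -
  note b = arc_facts[OF i]
  obtain E where E: "finite E" "\<And>t. t \<in> {0..1} - E \<Longrightarrow> \<beta> i differentiable (at t)"
    using b(7) unfolding piecewise_C1_differentiable_on_def C1_differentiable_on_eq by blast
  have der: "((\<lambda>t. \<Gamma> (b i t)) has_vector_derivative (vector_derivative (\<beta> i) (at t) * (- (W (b i t)) / of_nat k))) (at t)"
    if t: "t \<in> {0<..<s} - E" for t
  proof -
    have t1: "t \<in> {0..<1}" "t \<in> {0<..<1}" using t s by auto
    have btU: "b i t \<in> U" by (rule b(2)[OF t1(1)])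
    obtain T S \<sigma> where T: "openin (top_of_set U) T" "b i t \<in> T" and S: "open S" "p ` T \<subseteq> S" "continuous_on S \<sigma>"
      "\<And>z. z \<in> S \<Longrightarrow> \<sigma> z \<in> U \<and> p (\<sigma> z) = z" "\<And>w. w \<in> T \<Longrightarrow> \<sigma> (p w) = w" "connected S"
      using section_exists[OF btU] by blast
    have bt: "\<beta> i t \<in> S" "\<sigma> (\<beta> i t) = b i t" using S(2,5) T(2) b(4)[OF t1(1)] by force+
    have "(\<beta> i has_vector_derivative vector_derivative (\<beta> i) (at t)) (at t)"
      using E(2)[of t] t s by (simp add: vector_derivative_works[symmetric])
    moreover have "((\<lambda>z. \<Gamma> (\<sigma> z)) has_field_derivative - (W (\<sigma> (\<beta> i t))) / of_nat k) (at (\<beta> i t))"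
      by (rule \<Gamma>_section[OF S(1,3,4) bt(1)])
    ultimately have "((\<lambda>z. \<Gamma> (\<sigma> z)) \<circ> \<beta> i has_vector_derivative vector_derivative (\<beta> i) (at t) * (- (W (\<sigma> (\<beta> i t))) / of_nat k)) (at t)"
      by (rule field_vector_diff_chain_at)
    then have "((\<lambda>z. \<Gamma> (\<sigma> z)) \<circ> \<beta> i has_vector_derivative vector_derivative (\<beta> i) (at t) * (- (W (b i t)) / of_nat k)) (at t)"
      unfolding bt(2) .
    \<comment> \<open>Nearby points of the lift stay in \<open>T\<close>, where the section recovers
      the lift from the arc.\<close>
    moreover have "\<exists>e>0. \<forall>t'. dist t' t < e \<longrightarrow> t' \<in> {0<..<1} \<and> b i t' \<in> T"
    proof -
      obtain V where V: "open V" "T = U \<inter> V" using T(1) by (auto simp: openin_open)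
      have "continuous_on {0<..<1} (b i)" by (rule continuous_on_subset[OF b(1)]) auto
      then have "open ({0<..<1} \<inter> b i -` V)" using V(1) by (intro continuous_open_preimage) auto
      moreover have "t \<in> {0<..<1} \<inter> b i -` V" using t1 T(2) V by auto
      ultimately obtain e where "e > 0" "ball t e \<subseteq> {0<..<1} \<inter> b i -` V" unfolding open_contains_ball by blast
      moreover have "b i t' \<in> U" if "t' \<in> {0<..<1}" for t' using b(2) that by simp
      ultimately show ?thesis using V(2) by (intro exI[of _ e]) (auto simp: subset_iff dist_commute)
    qed
    then obtain e where e: "e > 0" "\<And>t'. dist t' t < e \<Longrightarrow> t' \<in> {0<..<1} \<and> b i t' \<in> T" by blast
    ultimately show ?thesis
    proof (elim has_vector_derivative_transform_within[OF _ e(1)], goal_cases)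
      case (2 t')
      then have "t' \<in> {0<..<1}" "b i t' \<in> T" using e(2)[of t'] by auto
      then show ?case using S(5)[of "b i t'"] b(4)[of t'] by simp
    qed auto
  qed
  have "((\<lambda>t. vector_derivative (\<beta> i) (at t) * (- (W (b i t)) / of_nat k)) has_integral \<Gamma> (b i s) - \<Gamma> (b i 0)) {0..s}"
  proof (rule fundamental_theorem_of_calculus_interior_strong[OF E(1) s(1)])
    show "continuous_on {0..s} (\<lambda>t. \<Gamma> (b i t))"
      by (rule continuous_on_compose2[OF \<Gamma>_cont continuous_on_subset[OF b(1)]]) (use s b(2) in auto)
  qed (use der in auto)
  then have "((\<lambda>t. - of_nat k * (vector_derivative (\<beta> i) (at t) * (- (W (b i t)) / of_nat k))) has_integral - of_nat k * (\<Gamma> (b i s) - \<Gamma> u)) {0..s}"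
    unfolding b(3) by (rule has_integral_mult_right)
  moreover have "- of_nat k * (vector_derivative (\<beta> i) (at t) * (- (W (b i t)) / of_nat k)) = W (b i t) * vector_derivative (\<beta> i) (at t)" for t
    using k by simp
  ultimately have "((\<lambda>t. W (b i t) * vector_derivative (\<beta> i) (at t)) has_integral - of_nat k * (\<Gamma> (b i s) - \<Gamma> u)) {0..s}"
    by (simp only:)
  then show ?thesis by (rule integral_unique)
qed

text \<open>Near the end of the arc its lift and the translate of the lift stay in the connected set
  \<open>T\<close>, on which \<Gamma> is a chart primitive of the root coordinate plus one constant.
  That coordinate tends to 0 along both, which gives the common limit.\<close>

lemma \<Gamma>_arc_limit:
  assumes i: "i \<in> {1..n}"
  obtains l where "((\<lambda>s. \<Gamma> (b i s)) \<longlongrightarrow> l) (at_left 1)" "((\<lambda>s. \<Gamma> (\<phi> i (b i s))) \<longlongrightarrow> l) (at_left 1)"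
proof -
  note b = arc_facts[OF i]
  have \<phi>i: "\<phi> i \<in> DP" by (rule \<phi>_DP[OF i])
  obtain \<sigma> T e where \<sigma>: "0 \<le> \<sigma>" "\<sigma> < 1" and T: "T \<subseteq> U" "path_connected T" and e: "e > 0" "p ` T \<subseteq> ball (r i) e"
    "ball (r i) e \<inter> R \<subseteq> {r i}" and bT: "\<And>s. \<sigma> \<le> s \<Longrightarrow> s < 1 \<Longrightarrow> b i s \<in> T" and \<phi>T: "\<And>x. x \<in> T \<Longrightarrow> \<phi> i x \<in> T"
    using arc_disc[of i "\<beta> i" "\<phi> i" "b i"] arcs decks lifts \<phi>i i by metis
  have cT: "connected T" using T(2) by (rule path_connected_imp_connected)
  have w0: "b i \<sigma> \<in> T" using bT \<sigma> by simp
  then obtain D \<rho> where ch: "chart 0 i D \<rho>" "0 \<in> D" and \<rho>: "\<And>v. v \<in> T \<Longrightarrow> xh i v \<in> D \<and> q v = cpt \<rho> (xh i v)"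
    using disc_chart[OF i e(1,3) cT T(1) e(2)] by blast
  obtain \<Phi> where \<Phi>: "LP (cpt \<rho> ` D) (\<Phi> \<circ> hratio i 0)"
    "\<And>s. s \<in> D \<Longrightarrow> (\<Phi> has_field_derivative theta n \<alpha> \<rho> s) (at s)"
    using LP_chart[OF ch(1)] by blast
  define a where "a = \<Gamma> (b i \<sigma>) - \<Phi> (xh i (b i \<sigma>))"
  have qT: "continuous_map (top_of_set T) C q" using q_cont T(1) by (meson continuous_map_from_subtopology_mono)
  have pT: "prim T q ((\<Phi> \<circ> hratio i 0) \<circ> q)" by (rule prim_in_chart[OF \<Phi>(1)]) (use \<rho> in auto)
  have G: "\<Gamma> v = \<Phi> (xh i v) + a" if "v \<in> T" for v
    using prim_unique[OF qT pT prim_subset[OF prim_\<Gamma> T(1)] cT w0 that] hratio_q[OF i]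
    by (simp add: a_def algebra_simps)
  have contPhi: "isCont \<Phi> 0" using \<Phi>(2)[OF ch(2)] by (rule DERIV_isCont)
  have ev: "\<forall>\<^sub>F s in at_left 1. \<sigma> \<le> s \<and> s < 1"
    using eventually_at_left_real[OF \<sigma>(2)] by eventually_elim auto
  \<comment> \<open>The k-th power of the absolute value is the distance of the arc to
    \<open>r i\<close>, and \<open>root k\<close> is continuous at 0.\<close>
  have x0: "((\<lambda>s. xh i (b i s)) \<longlongrightarrow> 0) (at_left 1)"
  proof -
    have "(\<beta> i \<longlongrightarrow> \<beta> i 1) (at 1 within {0..1})" using b(5) by (simp add: continuous_on_def)
    then have "(\<beta> i \<longlongrightarrow> r i) (at_left 1)"
      unfolding b(6) using at_within_Icc_at_left[of 0 "1::real"] by simp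
    then have "((\<lambda>s. norm (eps i * (\<beta> i s - r i))) \<longlongrightarrow> 0) (at_left 1)"
      by (auto intro!: tendsto_eq_intros simp: tendsto_norm_zero_iff)
    then have "((\<lambda>s. root k (norm (eps i * (\<beta> i s - r i)))) \<longlongrightarrow> root k 0) (at_left 1)"
      by (rule tendsto_real_root)
    moreover have "\<forall>\<^sub>F s in at_left 1. root k (norm (eps i * (\<beta> i s - r i))) = norm (xh i (b i s))"
      using ev
    proof eventually_elim
      case (elim s)
      then have "xh i (b i s) ^ k = eps i * (\<beta> i s - r i)"
        using xh_power[OF i b(2)] b(4) \<sigma>(1) by simp
      then show ?case using k by (metis norm_ge_zero norm_power not_numeral_le_zero real_root_power_cancel zero_less_iff_neq_zero)
    qed
    ultimately have "((\<lambda>s. norm (xh i (b i s))) \<longlongrightarrow> 0) (at_left 1)"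
      using Lim_transform_eventually by fastforce
    then show ?thesis by (simp add: tendsto_norm_zero_iff)
  qed
  have y0: "((\<lambda>s. xh i (\<phi> i (b i s))) \<longlongrightarrow> 0) (at_left 1)"
  proof -
    have "((\<lambda>s. zeta_root k powi mon (\<phi> i) i * xh i (b i s)) \<longlongrightarrow> zeta_root k powi mon (\<phi> i) i * 0) (at_left 1)"
      by (intro tendsto_mult tendsto_const x0)
    moreover have "\<forall>\<^sub>F s in at_left 1. zeta_root k powi mon (\<phi> i) i * xh i (b i s) = xh i (\<phi> i (b i s))"
      using ev by eventually_elim (use xh_mon[OF \<phi>i i b(2)] \<sigma>(1) in auto)
    ultimately show ?thesis using Lim_transform_eventually by fastforce
  qed
  show ?thesis
  proof (rule that[of "\<Phi> 0 + a"])
    have "((\<lambda>s. \<Phi> (xh i (b i s)) + a) \<longlongrightarrow> \<Phi> 0 + a) (at_left 1)"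
      by (intro tendsto_add tendsto_const isCont_tendsto_compose[OF contPhi x0])
    moreover have "\<forall>\<^sub>F s in at_left 1. \<Phi> (xh i (b i s)) + a = \<Gamma> (b i s)"
      using ev by eventually_elim (use G bT in auto)
    ultimately show "((\<lambda>s. \<Gamma> (b i s)) \<longlongrightarrow> \<Phi> 0 + a) (at_left 1)" by (rule Lim_transform_eventually)
    have "((\<lambda>s. \<Phi> (xh i (\<phi> i (b i s))) + a) \<longlongrightarrow> \<Phi> 0 + a) (at_left 1)"
      by (intro tendsto_add tendsto_const isCont_tendsto_compose[OF contPhi y0])
    moreover have "\<forall>\<^sub>F s in at_left 1. \<Phi> (xh i (\<phi> i (b i s))) + a = \<Gamma> (\<phi> i (b i s))"
      using ev by eventually_elim (use G bT \<phi>T in auto)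
    ultimately show "((\<lambda>s. \<Gamma> (\<phi> i (b i s))) \<longlongrightarrow> \<Phi> 0 + a) (at_left 1)" by (rule Lim_transform_eventually)
  qed
qed

abbreviation J where "J i \<equiv> W_integral k n L (\<beta> i) (b i) \<alpha>"

text \<open>With \<open>l\<close> the common limit, \<open>\<Gamma>_deck\<close> along the arc gives
  l = \<Gamma> (\<phi> i u) + \<omega> (\<phi> i) * (l - \<Gamma> u) in the limit, while
  \<open>\<Gamma>_arc\<close> identifies J i with - k * (l - \<Gamma> u).\<close>

lemma per_\<phi>:
  assumes i: "i \<in> {1..n}"
  shows "per (\<phi> i) = - (1 - \<omega> (\<phi> i)) * J i / of_nat k"
proof -
  note b = arc_facts[OF i]
  obtain l where l: "((\<lambda>s. \<Gamma> (b i s)) \<longlongrightarrow> l) (at_left 1)" "((\<lambda>s. \<Gamma> (\<phi> i (b i s))) \<longlongrightarrow> l) (at_left 1)"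
    using \<Gamma>_arc_limit[OF i] by blast
  have ev: "\<forall>\<^sub>F s in at_left 1. 0 < s \<and> s < (1::real)"
    using eventually_at_left_real[of 0 "1::real", OF zero_less_one] by eventually_elim auto
  have "((\<lambda>s. - of_nat k * (\<Gamma> (b i s) - \<Gamma> u)) \<longlongrightarrow> - of_nat k * (l - \<Gamma> u)) (at_left 1)"
    by (intro tendsto_mult tendsto_diff tendsto_const l)
  moreover have "\<forall>\<^sub>F s in at_left 1. - of_nat k * (\<Gamma> (b i s) - \<Gamma> u) = integral {0..s} (\<lambda>t. W (b i t) * vector_derivative (\<beta> i) (at t))"
    using ev by eventually_elim (simp add: \<Gamma>_arc[OF i])
  ultimately have "((\<lambda>s. integral {0..s} (\<lambda>t. W (b i t) * vector_derivative (\<beta> i) (at t))) \<longlongrightarrow> - of_nat k * (l - \<Gamma> u)) (at_left 1)"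
    by (rule Lim_transform_eventually)
  then have J: "J i = - of_nat k * (l - \<Gamma> u)"
    unfolding W_integral_def by (intro tendsto_Lim) auto
  have "((\<lambda>s. \<Gamma> (\<phi> i u) + \<omega> (\<phi> i) * (\<Gamma> (b i s) - \<Gamma> u)) \<longlongrightarrow> \<Gamma> (\<phi> i u) + \<omega> (\<phi> i) * (l - \<Gamma> u)) (at_left 1)"
    by (intro tendsto_add tendsto_mult tendsto_diff tendsto_const l)
  moreover have "\<forall>\<^sub>F s in at_left 1. \<Gamma> (\<phi> i u) + \<omega> (\<phi> i) * (\<Gamma> (b i s) - \<Gamma> u) = \<Gamma> (\<phi> i (b i s))"
    using ev
  proof eventually_elim
    case (elim s)
    then show ?case using \<Gamma>_deck[OF \<phi>_DP[OF i] b(2)[of s] u] by (simp add: algebra_simps)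
  qed
  ultimately have "((\<lambda>s. \<Gamma> (\<phi> i (b i s))) \<longlongrightarrow> \<Gamma> (\<phi> i u) + \<omega> (\<phi> i) * (l - \<Gamma> u)) (at_left 1)"
    by (rule Lim_transform_eventually)
  then have "l = \<Gamma> (\<phi> i u) + \<omega> (\<phi> i) * (l - \<Gamma> u)"
    by (rule tendsto_unique[OF trivial_limit_at_left_real l(2)])
  then have "\<Gamma> (\<phi> i u) = l - \<omega> (\<phi> i) * (l - \<Gamma> u)" by (rule eq_diff_eq[THEN iffD2, OF sym])
  then have "per (\<phi> i) = (1 - \<omega> (\<phi> i)) * (l - \<Gamma> u)" by (simp add: per_def algebra_simps)
  moreover have "(of_nat k :: complex) \<noteq> 0" using k by simp
  then have "- (1 - \<omega> (\<phi> i)) * J i / of_nat k = (1 - \<omega> (\<phi> i)) * (l - \<Gamma> u)"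
    unfolding J by (simp only: minus_mult_minus mult.left_commute[of _ "of_nat k"] mult_minus_left minus_minus mult_minus_right)
      simp
  ultimately show ?thesis by simp
qed

lemma period_formula:
  assumes jl: "1 \<le> j" "j < l" "l \<le> n"
  shows "class_integral n C (theta n \<alpha>) (dc (cc (j, l, g))) =
     zeta_root k powi (\<Sum>d=1..n. int (g d) * M_exp \<alpha> d) *
     ((1 - zeta_root k powi M_exp \<alpha> j) * (1 - zeta_root k powi M_exp \<alpha> l) / of_nat k) * (J l - J j)"
proof -
  have i: "j \<in> {1..n}" "l \<in> {1..n}" using jl by auto
  let ?x = "\<phi> j \<otimes>\<^bsub>G\<^esub> \<phi> l \<otimes>\<^bsub>G\<^esub> inv\<^bsub>G\<^esub> (\<phi> j) \<otimes>\<^bsub>G\<^esub> inv\<^bsub>G\<^esub> (\<phi> l)"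
  have xQ: "?x \<in> DQ" by (rule commutator_DQ) (use i \<phi>_DP in auto)
  have \<omega>x: "\<omega> ?x = 1"
    using i \<phi>_DP \<omega>_nz by (simp add: \<omega>_mult \<omega>_inv G_mult G_inv field_simps)
  have ccQ: "cc (j, l, g) \<in> DQ" unfolding cc_eq by (rule DQ_conj[OF xQ opp_DP])
  have "\<omega> (opp g) = zeta_root k powi (\<Sum>d=1..n. int (g d) * M_exp \<alpha> d)"
    unfolding \<omega>_def by (rule arg_cong[of _ _ "\<lambda>e. zeta_root k powi e"], rule sum.cong) (auto simp: opp_mon)
  \<comment> \<open>The minus sign in \<open>per_\<phi>\<close> is what orders the difference as
    \<open>J l - J j\<close>.\<close>
  moreover have "per ?x = (1 - \<omega> (\<phi> j)) * (1 - \<omega> (\<phi> l)) / of_nat k * (J l - J j)"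
    unfolding per_commutator[OF \<phi>_DP[OF i(1)] \<phi>_DP[OF i(2)]] per_\<phi>[OF i(1)] per_\<phi>[OF i(2)]
    using k by (simp add: field_simps)
  moreover have "class_integral n C (theta n \<alpha>) (dc (cc (j, l, g))) = \<omega> (opp g) * per ?x"
    unfolding class_integral_deck[OF ccQ] per_def[symmetric] unfolding cc_eq
    by (rule per_conj[OF DQ_DP[OF xQ] opp_DP \<omega>x])
  ultimately show ?thesis by (simp add: \<omega>_\<phi>[OF i(1)] \<omega>_\<phi>[OF i(2)])
qed

end

section \<open>The period lattice as an image of the homology group\<close>

lemma group_complex_add: "group complex_add_group"
  by (rule groupI) (auto simp: complex_add_group_def intro: exI[of _ "- x" for x] add.left_inverse)

context fermat
begin

lemma period_vector_hom: "period_vector k n C \<in> hom (homology_group 1 C) (period_space k n)"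
proof (rule homI)
  show "period_vector k n C A \<in> carrier (period_space k n)" for A
    by (simp add: period_vector_def period_space_def complex_add_group_def)
  fix A B assume "A \<in> carrier (homology_group 1 C)" "B \<in> carrier (homology_group 1 C)"
  then obtain a b where ab: "A = hclass C a" "B = hclass C b" unfolding carrier_homology_1 by blast
  have "class_integral n C (theta n \<alpha>) (hclass C (a + b)) =
      class_integral n C (theta n \<alpha>) (hclass C a) + class_integral n C (theta n \<alpha>) (hclass C b)"
    if "\<alpha> \<in> form_index k n" for \<alpha>
  proof -
    interpret fermat_form k n r \<alpha> by unfold_locales (rule that)
    show ?thesis by (simp only: class_integral_eq chain_integral_add)
  qed
  then show "period_vector k n C (A \<otimes>\<^bsub>homology_group 1 C\<^esub> B) = period_vector k n C A \<otimes>\<^bsub>period_space k n\<^esub> period_vector k n C B"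
    unfolding ab mult_homology_1
    by (auto simp: period_vector_def period_space_def complex_add_group_def fun_eq_iff)
qed

end

context fermat_loops
begin

lemma period_lattice_generators:
  "cc ` gen_index k n \<subseteq> carrier (deck_group U q)"
  "generate H1 ((\<lambda>a. dc (cc a)) ` gen_index k n) = carrier H1"
  "a \<in> gen_index k n \<Longrightarrow> period_vector k n C (dc (cc a)) = explicit_period k n (\<lambda>i. W_integral k n L (\<beta> i) (b i)) a"
  "period_lattice k n C = generate (period_space k n) (explicit_period k n (\<lambda>i. W_integral k n L (\<beta> i) (b i)) ` gen_index k n)"
proof -
  show 1: "cc ` gen_index k n \<subseteq> carrier (deck_group U q)" using cc_DQ by auto
  show 2: "generate H1 ((\<lambda>a. dc (cc a)) ` gen_index k n) = carrier H1" by (rule homology_generators)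
  show 3: "period_vector k n C (dc (cc a)) = explicit_period k n (\<lambda>i. W_integral k n L (\<beta> i) (b i)) a"
    if a: "a \<in> gen_index k n" for a
  proof -
    obtain j l g where jlg: "a = (j, l, g)" "1 \<le> j" "j < l" "l \<le> n" using a by (auto simp: gen_index_def)
    have "class_integral n C (theta n \<alpha>) (dc (cc (j, l, g))) =
       zeta_root k powi (\<Sum>d=1..n. int (g d) * M_exp \<alpha> d) *
       ((1 - zeta_root k powi M_exp \<alpha> j) * (1 - zeta_root k powi M_exp \<alpha> l) / of_nat k) *
       (W_integral k n L (\<beta> l) (b l) \<alpha> - W_integral k n L (\<beta> j) (b j) \<alpha>)"
      if "\<alpha> \<in> form_index k n" for \<alpha>
    proof -
      \<comment> \<open>The index \<open>\<alpha>\<close> is fixed only here, since the deck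
        transformations and their homology classes do not depend on it.\<close>
      interpret fermat_period k n r U p L u \<phi> \<beta> b \<alpha> by unfold_locales (rule that)
      show ?thesis by (rule period_formula[OF jlg(2-4)])
    qed
    then show ?thesis unfolding jlg(1) period_vector_def explicit_period_def prod.case by (rule restrict_ext)
  qed
  interpret H1: comm_group H1 by (rule comm_group_homology_1)
  have PS: "group (period_space k n)"
    unfolding period_space_def by (rule product_group) (rule group_complex_add)
  interpret ph: group_hom H1 "period_space k n" "period_vector k n C"
    by (simp add: group_hom_def group_hom_axioms_def period_vector_hom PS H1.is_group)
  have sub: "(\<lambda>a. dc (cc a)) ` gen_index k n \<subseteq> carrier H1" using deck_class_carrier cc_DQ by blast
  \<comment> \<open>A homomorphism maps a generated subgroup to the subgroup generated by the images
    of the generators.\<close>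
  have "period_lattice k n C = period_vector k n C ` generate H1 ((\<lambda>a. dc (cc a)) ` gen_index k n)"
    unfolding period_lattice_def 2 ..
  also have "\<dots> = generate (period_space k n) (period_vector k n C ` (\<lambda>a. dc (cc a)) ` gen_index k n)"
    by (rule ph.generate_img[OF sub, symmetric])
  also have "period_vector k n C ` (\<lambda>a. dc (cc a)) ` gen_index k n = explicit_period k n (\<lambda>i. W_integral k n L (\<beta> i) (b i)) ` gen_index k n"
    unfolding image_image by (rule image_cong[OF refl 3])
  finally show "period_lattice k n C = generate (period_space k n) (explicit_period k n (\<lambda>i. W_integral k n L (\<beta> i) (b i)) ` gen_index k n)" .
qed

end

theorem theorem4:
  fixes k n :: nat
    and lam r :: "nat \<Rightarrow> complex"
    and R :: "complex set"
    and C :: "(nat \<Rightarrow> complex) set topology"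
    and U :: "'u::real_normed_vector set"
    and p :: "'u \<Rightarrow> complex"
    and L :: "nat \<Rightarrow> 'u \<Rightarrow> complex"
    and q :: "'u \<Rightarrow> (nat \<Rightarrow> complex) set"
    and u :: 'u
    and \<phi> :: "nat \<Rightarrow> 'u \<Rightarrow> 'u"
    and \<beta> :: "nat \<Rightarrow> real \<Rightarrow> complex"
    and b :: "nat \<Rightarrow> real \<Rightarrow> 'u"
  assumes "k \<ge> 2" and "n \<ge> 2"
    and "inj_on lam {1..n-2}" and "\<forall>i\<in>{1..n-2}. lam i \<noteq> 0 \<and> lam i \<noteq> 1"
  defines "r \<equiv> branch_pt lam"
    and "R \<equiv> r ` {1..n}"
    and "C \<equiv> fermat_curve k n r"
  assumes "universal_covering U p (- R)"
    and "\<forall>i\<in>{1..n}. continuous_on U (L i) \<and> (\<forall>v\<in>U. exp (L i v) = shifted r p i v)"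
  defines "q \<equiv> curve_map k n L"
  assumes "u \<in> U"
    and "free_generators (deck_group U p) {1..n} \<phi>"
    and "\<forall>i\<in>{1..n}. branch_arc R (p u) (r i) (\<beta> i)"
    and "\<forall>i\<in>{1..n}. deck_of_arc R U p u (\<beta> i) (\<phi> i)"
    and "\<forall>i\<in>{1..n}. arc_lift U p u (\<beta> i) (b i)"
  shows "(conj_commutator (deck_group U p) n \<phi> ` gen_index k n \<subseteq> carrier (deck_group U q)) \<and>
         (generate (homology_group 1 C)
           ((\<lambda>a. deck_class C U q u (conj_commutator (deck_group U p) n \<phi> a)) ` gen_index k n)
         = carrier (homology_group 1 C)) \<and>
         (\<forall>a\<in>gen_index k n.
           period_vector k n C (deck_class C U q u (conj_commutator (deck_group U p) n \<phi> a))
           = explicit_period k n (\<lambda>i. W_integral k n L (\<beta> i) (b i)) a) \<and>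
         (period_lattice k n C
         = generate (period_space k n)
             (explicit_period k n (\<lambda>i. W_integral k n L (\<beta> i) (b i)) ` gen_index k n))"
proof -
  \<comment> \<open>The values 0 and 1 belong to the indices 1 and 2, and \<open>lam\<close> avoids
    them; the remaining indices are shifted by 2 into the set on which \<open>lam\<close> is
    injective.\<close>
  have "inj_on (branch_pt lam) {1..n}"
  proof (rule inj_onI)
    fix i j assume ij: "i \<in> {1..n}" "j \<in> {1..n}" "branch_pt lam i = branch_pt lam j"
    have lam: "branch_pt lam m = lam (m - 2) \<and> m - 2 \<in> {1..n-2}" if "m \<in> {1..n}" "m \<noteq> 1" "m \<noteq> 2" for m
      using that by (auto simp: branch_pt_def)
    have b12: "branch_pt lam 1 = 0" "branch_pt lam 2 = 1" by (auto simp: branch_pt_def)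
    have ne: "branch_pt lam m \<noteq> 0 \<and> branch_pt lam m \<noteq> 1" if "m \<in> {1..n}" "m \<noteq> 1" "m \<noteq> 2" for m
      using lam[OF that] assms(4) by simp
    show "i = j"
    proof (cases "i \<in> {1,2} \<or> j \<in> {1,2}")
      case True
      then show ?thesis using ne[OF ij(1)] ne[OF ij(2)] ij(3) b12 by (metis empty_iff insert_iff zero_neq_one)
    next
      case False
      then have "lam (i - 2) = lam (j - 2)" "i - 2 \<in> {1..n-2}" "j - 2 \<in> {1..n-2}"
        using lam[OF ij(1)] lam[OF ij(2)] ij(3) by auto
      then have "i - 2 = j - 2" using assms(3) by (auto dest: inj_onD)
      then show ?thesis using False ij by auto
    qed
  qed
  then have F: "fermat k n r"
    unfolding r_def by unfold_locales (use assms(1,2) in \<open>auto simp: branch_pt_def\<close>)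
  have C: "C = fermat.C k n r" unfolding C_def fermat.C_def[OF F] ..
  interpret loops: fermat_loops k n r U p L u \<phi> \<beta> b
    by (intro fermat_loops.intro fermat_cover.intro F fermat_cover_axioms.intro fermat_loops_axioms.intro
        assms(8,9,11-15)[unfolded R_def])
  show ?thesis unfolding C q_def by (intro conjI ballI loops.period_lattice_generators)
qed

end
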